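(* Every \'ez field is algebraically bounded.
   Context: $K$ is large if every $K$-curve with a smooth $K$-point has infinitely many $K$-points. The \'etale open topology on $V(K)$, for a $K$-variety $V$ (separated reduced $K$-scheme of finite type), has as basis the images of $X(K)\to V(K)$ for \'etale morphisms $X\to V$ of $K$-varieties. Definable means first-order definable in the language of rings with parameters from $K$. An \'ez subset of $K^m$ is a finite union of definable sets each of which is an \'etale open subset of a Zariski closed subset $V'(K)$ of $K^m$ (with the \'etale open topology of $V'(K)$, $V'$ a closed subvariety of $\mathbb{A}^m$). $K$ is an \'ez field if $K$ is large and every definable subset of every $K^m$ is \'ez. $K$ is algebraically bounded if for every definable $X\subseteq K^m\times K$ there are polynomials $f_1,\ldots,f_k\in K[x_1,\ldots,x_m,t]$ such that for every $a\in K^m$ with $X_a=\{b\in K:(a,b)\in X\}$ finite, there is $i$ with $f_i(a,t)$ not the zero polynomial and $X_a\subseteq\{b\in K: f_i(a,b)=0\}$. *)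

theory Defs
  imports
    "HOL-Analysis.Abstract_Topology"
    "HOL-Library.Poly_Mapping"
    "HOL-Library.Extended_Nat"
    "HOL-Computational_Algebra.Polynomial"
    "HOL-Algebra.QuotRing"
    "Jordan_Normal_Form.Determinant"
begin

section \<open>Polynomials in several variables\<close>

text \<open>Multivariate polynomials are finitely supported maps from exponent vectors to coefficients;
  the polynomial ring in the variables numbered by \<open>0, \<dots>, n - 1\<close> is a carrier set in this type.\<close>

type_synonym 'k mp = "(nat \<Rightarrow>\<^sub>0 nat) \<Rightarrow>\<^sub>0 'k"

definition ring_on :: "'a::comm_ring_1 set \<Rightarrow> 'a ring" where
  "ring_on S = \<lparr>carrier = S, monoid.mult = (*), one = 1, zero = 0, add = (+)\<rparr>"

definition poly_ring :: "nat \<Rightarrow> 'k::field mp ring" where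
  "poly_ring n = ring_on {p. \<forall>\<mu>\<in>Poly_Mapping.keys p. Poly_Mapping.keys \<mu> \<subseteq> {..<n}}"

definition const :: "'k::field \<Rightarrow> 'k mp" where
  "const c = Poly_Mapping.single 0 c"

definition mp_eval :: "(nat \<Rightarrow> 'k::field) \<Rightarrow> 'k mp \<Rightarrow> 'k" where
  "mp_eval a p = (\<Sum>\<mu>\<in>Poly_Mapping.keys p.
     Poly_Mapping.lookup p \<mu> * (\<Prod>i\<in>Poly_Mapping.keys \<mu>. a i ^ Poly_Mapping.lookup \<mu> i))"

definition pdiff :: "nat \<Rightarrow> 'k::field mp \<Rightarrow> 'k mp" where
  "pdiff i p = (\<Sum>\<mu>\<in>Poly_Mapping.keys p.
     Poly_Mapping.single (\<mu> - Poly_Mapping.single i 1)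
       (of_nat (Poly_Mapping.lookup \<mu> i) * Poly_Mapping.lookup p \<mu>))"

definition radical_ideal :: "'a set \<Rightarrow> ('a, 'b) ring_scheme \<Rightarrow> bool" where
  "radical_ideal I R \<longleftrightarrow> ideal I R \<and> (\<forall>a\<in>carrier R. \<forall>k::nat. a [^]\<^bsub>R\<^esub> k \<in> I \<longrightarrow> a \<in> I)"

section \<open>Locally ringed spaces over a field\<close>

text \<open>A sheaf of \<open>K\<close>-algebras is represented by its stalks together with, for every open set \<open>U\<close>,
  the set of those families of germs \<open>(s x)\<^sub>x\<^sub>\<in>\<^sub>U\<close> that are sections over \<open>U\<close> (a section of a sheaf
  is determined by its germs).  The field \<open>scal\<close> is the \<open>K\<close>-algebra structure of the stalks;
  giving it is the same as giving a morphism to \<open>Spec K\<close>.\<close>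

record ('k, 'p, 'r) kspace =
  tp :: "'p topology"
  stk :: "'p \<Rightarrow> 'r ring"
  sec :: "'p set \<Rightarrow> ('p \<Rightarrow> 'r) set"
  scal :: "'p \<Rightarrow> 'k \<Rightarrow> 'r"

abbreviation pts :: "('k, 'p, 'r) kspace \<Rightarrow> 'p set" where
  "pts X \<equiv> topspace (tp X)"

definition locally_ringed :: "('k::field, 'p, 'r) kspace \<Rightarrow> bool" where
  "locally_ringed X \<longleftrightarrow>
     (\<forall>x\<in>pts X. cring (stk X x) \<and> (\<exists>!M. maximalideal M (stk X x))
        \<and> scal X x \<in> Ring.ring_hom (ring_on UNIV) (stk X x)) \<and>
     (\<forall>U. openin (tp X) U \<longrightarrow>
        sec X U \<subseteq> (\<Pi>\<^sub>E x\<in>U. carrier (stk X x)) \<and>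
        (\<forall>c. (\<lambda>x\<in>U. scal X x c) \<in> sec X U) \<and>
        (\<forall>s\<in>sec X U. \<forall>t\<in>sec X U.
           (\<lambda>x\<in>U. s x \<oplus>\<^bsub>stk X x\<^esub> t x) \<in> sec X U \<and> (\<lambda>x\<in>U. s x \<otimes>\<^bsub>stk X x\<^esub> t x) \<in> sec X U) \<and>
        (\<forall>s\<in>sec X U. \<forall>W. openin (tp X) W \<and> W \<subseteq> U \<longrightarrow> restrict s W \<in> sec X W) \<and>
        (\<forall>s\<in>(\<Pi>\<^sub>E x\<in>U. carrier (stk X x)).
           (\<forall>x\<in>U. \<exists>W. openin (tp X) W \<and> x \<in> W \<and> W \<subseteq> U \<and> restrict s W \<in> sec X W)
           \<longrightarrow> s \<in> sec X U) \<and>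
        (\<forall>s\<in>sec X U. \<forall>t\<in>sec X U. \<forall>x\<in>U. s x = t x \<longrightarrow>
           (\<exists>W. openin (tp X) W \<and> x \<in> W \<and> W \<subseteq> U \<and> (\<forall>y\<in>W. s y = t y)))) \<and>
     (\<forall>x\<in>pts X. \<forall>a\<in>carrier (stk X x).
        \<exists>U s. openin (tp X) U \<and> x \<in> U \<and> s \<in> sec X U \<and> s x = a)"

definition open_sub :: "('k, 'p, 'r) kspace \<Rightarrow> 'p set \<Rightarrow> ('k, 'p, 'r) kspace" where
  "open_sub X U = X\<lparr>tp := subtopology (tp X) U\<rparr>"

record ('p, 'r, 'q, 's) kmap =
  pmap :: "'p \<Rightarrow> 'q"
  smap :: "'p \<Rightarrow> 's \<Rightarrow> 'r"

definition kmor ::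
  "('k::field, 'p, 'r) kspace \<Rightarrow> ('k, 'q, 's) kspace \<Rightarrow> ('p, 'r, 'q, 's) kmap \<Rightarrow> bool" where
  "kmor X Y f \<longleftrightarrow>
     continuous_map (tp X) (tp Y) (pmap f) \<and>
     (\<forall>x\<in>pts X.
        smap f x \<in> Ring.ring_hom (stk Y (pmap f x)) (stk X x) \<and>
        (\<forall>a\<in>carrier (stk Y (pmap f x)).
           smap f x a \<in> Units (stk X x) \<longrightarrow> a \<in> Units (stk Y (pmap f x))) \<and>
        (\<forall>c. smap f x (scal Y (pmap f x) c) = scal X x c)) \<and>
     (\<forall>W s. openin (tp Y) W \<and> s \<in> sec Y W \<longrightarrow>
        (\<lambda>x\<in>{x \<in> pts X. pmap f x \<in> W}. smap f x (s (pmap f x)))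
          \<in> sec X {x \<in> pts X. pmap f x \<in> W})"

definition kmap_eq ::
  "('k, 'p, 'r) kspace \<Rightarrow> ('k, 'q, 's) kspace \<Rightarrow> ('p, 'r, 'q, 's) kmap
     \<Rightarrow> ('p, 'r, 'q, 's) kmap \<Rightarrow> bool" where
  "kmap_eq X Y f g \<longleftrightarrow> (\<forall>x\<in>pts X. pmap f x = pmap g x \<and>
     (\<forall>a\<in>carrier (stk Y (pmap f x)). smap f x a = smap g x a))"

definition kid :: "('p, 'r, 'p, 'r) kmap" where
  "kid = \<lparr>pmap = (\<lambda>x. x), smap = (\<lambda>x a. a)\<rparr>"

definition kcomp ::
  "('q, 's, 'u, 'v) kmap \<Rightarrow> ('p, 'r, 'q, 's) kmap \<Rightarrow> ('p, 'r, 'u, 'v) kmap" where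
  "kcomp g f = \<lparr>pmap = (\<lambda>x. pmap g (pmap f x)), smap = (\<lambda>x a. smap f x (smap g (pmap f x) a))\<rparr>"

definition open_immersion ::
  "('k::field, 'p, 'r) kspace \<Rightarrow> ('k, 'q, 's) kspace \<Rightarrow> ('p, 'r, 'q, 's) kmap \<Rightarrow> bool" where
  "open_immersion X Y f \<longleftrightarrow> kmor X Y f \<and> openin (tp Y) (pmap f ` pts X) \<and>
     homeomorphic_map (tp X) (subtopology (tp Y) (pmap f ` pts X)) (pmap f) \<and>
     (\<forall>x\<in>pts X. bij_betw (smap f x) (carrier (stk Y (pmap f x))) (carrier (stk X x)))"

definition kiso ::
  "('k::field, 'p, 'r) kspace \<Rightarrow> ('k, 'q, 's) kspace \<Rightarrow> ('p, 'r, 'q, 's) kmap \<Rightarrow> bool" where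
  "kiso X Y f \<longleftrightarrow> open_immersion X Y f \<and> pmap f ` pts X = pts Y"

section \<open>Affine schemes\<close>

definition frac :: "('a, 'b) ring_scheme \<Rightarrow> 'a set \<Rightarrow> 'a \<Rightarrow> 'a \<Rightarrow> ('a \<times> 'a) set" where
  "frac A P a s = {(b, t). b \<in> carrier A \<and> t \<in> carrier A - P \<and>
     (\<exists>u\<in>carrier A - P. u \<otimes>\<^bsub>A\<^esub> (a \<otimes>\<^bsub>A\<^esub> t \<ominus>\<^bsub>A\<^esub> b \<otimes>\<^bsub>A\<^esub> s) = \<zero>\<^bsub>A\<^esub>)}"

text \<open>The localization of \<open>A\<close> at a prime ideal \<open>P\<close>.\<close>

definition loc :: "('a, 'b) ring_scheme \<Rightarrow> 'a set \<Rightarrow> ('a \<times> 'a) set ring" where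
  "loc A P = \<lparr>
     carrier = {frac A P a s | a s. a \<in> carrier A \<and> s \<in> carrier A - P},
     monoid.mult = (\<lambda>X Y. \<Union>(a, s)\<in>X. \<Union>(b, t)\<in>Y. frac A P (a \<otimes>\<^bsub>A\<^esub> b) (s \<otimes>\<^bsub>A\<^esub> t)),
     one = frac A P \<one>\<^bsub>A\<^esub> \<one>\<^bsub>A\<^esub>,
     zero = frac A P \<zero>\<^bsub>A\<^esub> \<one>\<^bsub>A\<^esub>,
     add = (\<lambda>X Y. \<Union>(a, s)\<in>X. \<Union>(b, t)\<in>Y.
              frac A P (a \<otimes>\<^bsub>A\<^esub> t \<oplus>\<^bsub>A\<^esub> b \<otimes>\<^bsub>A\<^esub> s) (s \<otimes>\<^bsub>A\<^esub> t))\<rparr>"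

definition zariski :: "('a, 'b) ring_scheme \<Rightarrow> 'a set topology" where
  "zariski A = topology (\<lambda>S. \<exists>E\<subseteq>carrier A. S = {P. primeideal P A \<and> \<not> E \<subseteq> P})"

definition Spec ::
  "('a, 'b) ring_scheme \<Rightarrow> ('k::field \<Rightarrow> 'a) \<Rightarrow> ('k, 'a set, ('a \<times> 'a) set) kspace" where
  "Spec A \<iota> = \<lparr>
     tp = zariski A,
     stk = loc A,
     sec = (\<lambda>U. {s \<in> (\<Pi>\<^sub>E P\<in>U. carrier (loc A P)).
        \<forall>P\<in>U. \<exists>W a f. openin (zariski A) W \<and> P \<in> W \<and> W \<subseteq> U \<and> a \<in> carrier A \<and> f \<in> carrier A \<and>
          (\<forall>Q\<in>W. f \<notin> Q \<and> s Q = frac A Q a f)}),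
     scal = (\<lambda>P c. frac A P (\<iota> c) \<one>\<^bsub>A\<^esub>)\<rparr>"

definition Spec_map ::
  "('a, 'b) ring_scheme \<Rightarrow> ('c, 'd) ring_scheme \<Rightarrow> ('a \<Rightarrow> 'c)
     \<Rightarrow> ('c set, ('c \<times> 'c) set, 'a set, ('a \<times> 'a) set) kmap" where
  "Spec_map A B h = \<lparr>
     pmap = (\<lambda>Q. {a \<in> carrier A. h a \<in> Q}),
     smap = (\<lambda>Q z. \<Union>(a, s)\<in>z. frac B Q (h a) (h s))\<rparr>"

text \<open>Schemes of finite type over \<open>K\<close> are taken with points and stalks in the types in which the
  spectra of the quotients of polynomial rings live.  These types have cardinality greater than
  \<open>max \<bar>K\<bar> \<aleph>\<^sub>0\<close>, which bounds the number of points and the size of the stalks of a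
  \<open>K\<close>-scheme of finite type, so every such scheme has an isomorphic copy in these types.\<close>

type_synonym 'k alg = "'k mp set"
type_synonym 'k sch = "('k, 'k alg set, ('k alg \<times> 'k alg) set) kspace"
type_synonym 'k smor =
  "('k alg set, ('k alg \<times> 'k alg) set, 'k alg set, ('k alg \<times> 'k alg) set) kmap"

text \<open>\<open>quot n I\<close> is \<open>K[x\<^sub>0, \<dots>, x\<^sub>n\<^sub>-\<^sub>1] / I\<close>; up to isomorphism these are the finitely generated
  \<open>K\<close>-algebras.\<close>

definition quot :: "nat \<Rightarrow> 'k::field mp set \<Rightarrow> 'k alg ring" where
  "quot n I = poly_ring n Quot I"

definition aff :: "nat \<Rightarrow> 'k::field mp set \<Rightarrow> 'k sch" where
  "aff n I = Spec (quot n I) (\<lambda>c. I +>\<^bsub>poly_ring n\<^esub> const c)"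

definition Spec_K :: "'k::field sch" where
  "Spec_K = aff 0 {0}"

text \<open>For \<open>I \<subseteq> J\<close> and \<open>m \<le> n\<close>, the morphism induced by \<open>K[x\<^sub>0, \<dots>, x\<^sub>m\<^sub>-\<^sub>1] / I \<rightarrow> K[x\<^sub>0, \<dots>, x\<^sub>n\<^sub>-\<^sub>1] / J\<close>.\<close>

definition proj :: "nat \<Rightarrow> 'k::field mp set \<Rightarrow> nat \<Rightarrow> 'k mp set \<Rightarrow> 'k smor" where
  "proj m I n J = Spec_map (quot m I) (quot n J) (\<lambda>z. \<Union>g\<in>z. J +>\<^bsub>poly_ring n\<^esub> g)"

section \<open>Varieties, smooth and etale morphisms\<close>

definition finite_type :: "'k::field sch \<Rightarrow> bool" where
  "finite_type X \<longleftrightarrow> locally_ringed X \<and>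
     (\<exists>\<U>. finite \<U> \<and> \<Union>\<U> = pts X \<and>
       (\<forall>U\<in>\<U>. openin (tp X) U \<and>
         (\<exists>n I f. ideal I (poly_ring n) \<and> kiso (open_sub X U) (aff n I) f)))"

text \<open>A fibre product over \<open>K\<close>.  The fibre product of schemes has the universal property with
  respect to all locally ringed spaces.\<close>

definition fibre_product :: "'k::field sch \<Rightarrow> 'k sch \<Rightarrow> 'k sch \<Rightarrow> 'k smor \<Rightarrow> 'k smor \<Rightarrow> bool" where
  "fibre_product X Y P p q \<longleftrightarrow> locally_ringed P \<and> kmor P X p \<and> kmor P Y q \<and>
     (\<forall>(Z :: 'k sch) f g. locally_ringed Z \<and> kmor Z X f \<and> kmor Z Y g \<longrightarrow>
       (\<exists>h. kmor Z P h \<and> kmap_eq Z X (kcomp p h) f \<and> kmap_eq Z Y (kcomp q h) g \<and>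
         (\<forall>h'. kmor Z P h' \<and> kmap_eq Z X (kcomp p h') f \<and> kmap_eq Z Y (kcomp q h') g
            \<longrightarrow> kmap_eq Z P h' h)))"

text \<open>The image of the diagonal in \<open>X \<times>\<^sub>K X\<close> is closed.\<close>

definition separated :: "'k::field sch \<Rightarrow> bool" where
  "separated X \<longleftrightarrow> (\<forall>P p q d. fibre_product X X P p q \<and> kmor X P d \<and>
     kmap_eq X X (kcomp p d) kid \<and> kmap_eq X X (kcomp q d) kid
       \<longrightarrow> closedin (tp P) (pmap d ` pts X))"

definition reduced :: "'k::field sch \<Rightarrow> bool" where
  "reduced X \<longleftrightarrow> (\<forall>x\<in>pts X. \<forall>a\<in>carrier (stk X x). \<forall>n::nat.
     a [^]\<^bsub>stk X x\<^esub> n = \<zero>\<^bsub>stk X x\<^esub> \<longrightarrow> a = \<zero>\<^bsub>stk X x\<^esub>)"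

definition variety :: "'k::field sch \<Rightarrow> bool" where
  "variety X \<longleftrightarrow> finite_type X \<and> separated X \<and> reduced X"

text \<open>Smoothness of relative dimension \<open>d\<close> at a point, by the Jacobian condition: near \<open>x\<close> and
  \<open>\<phi>(x)\<close> the morphism is isomorphic to the restriction to an open subscheme of
  \<open>Spec B[T\<^sub>1, \<dots>, T\<^sub>n] / (f\<^sub>1, \<dots>, f\<^sub>r) \<rightarrow> Spec B\<close> with \<open>n = r + d\<close>, where some \<open>r \<times> r\<close> minor of the
  Jacobian matrix \<open>(\<partial>f\<^sub>i/\<partial>T\<^sub>j)\<close> does not vanish at \<open>x\<close>.  Here \<open>B\<close> is \<open>K[x\<^sub>0, \<dots>, x\<^sub>m\<^sub>-\<^sub>1] / I\<close>, and the
  \<open>T\<^sub>j\<close> are the variables numbered by \<open>m, \<dots>, m + n - 1\<close>.\<close>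

definition smooth_at :: "nat \<Rightarrow> 'k::field sch \<Rightarrow> 'k sch \<Rightarrow> 'k smor \<Rightarrow> 'k alg set \<Rightarrow> bool" where
  "smooth_at d X Y \<phi> x \<longleftrightarrow>
     (\<exists>U W m n I fs J \<sigma> \<alpha> \<beta>.
        openin (tp X) U \<and> x \<in> U \<and> openin (tp Y) W \<and> pmap \<phi> ` U \<subseteq> W \<and>
        ideal I (poly_ring m) \<and> set fs \<subseteq> carrier (poly_ring (m + n)) \<and>
        n = length fs + d \<and> J = genideal (poly_ring (m + n)) (I \<union> set fs) \<and>
        kiso (open_sub Y W) (aff m I) \<alpha> \<and>
        open_immersion (open_sub X U) (aff (m + n) J) \<beta> \<and>
        kmap_eq (open_sub X U) (aff m I) (kcomp \<alpha> \<phi>) (kcomp (proj m I (m + n) J) \<beta>) \<and>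
        \<sigma> ` {..<length fs} \<subseteq> {m..<m + n} \<and>
        J +>\<^bsub>poly_ring (m + n)\<^esub>
            Determinant.det (mat (length fs) (length fs) (\<lambda>(i, j). pdiff (\<sigma> j) (fs ! i)))
          \<notin> pmap \<beta> x)"

definition etale :: "'k::field sch \<Rightarrow> 'k sch \<Rightarrow> 'k smor \<Rightarrow> bool" where
  "etale X Y \<phi> \<longleftrightarrow> kmor X Y \<phi> \<and> (\<forall>x\<in>pts X. smooth_at 0 X Y \<phi> x)"

definition smooth_point :: "'k::field sch \<Rightarrow> 'k alg set \<Rightarrow> bool" where
  "smooth_point X x \<longleftrightarrow> x \<in> pts X \<and> (\<exists>\<phi> d. kmor X Spec_K \<phi> \<and> smooth_at d X Spec_K \<phi> x)"

text \<open>The set \<open>X(K)\<close>, as the set of points whose residue field is \<open>K\<close>: every element of the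
  stalk is congruent to a scalar modulo the maximal ideal, that is, modulo the non-units.\<close>

definition rat_points :: "'k::field sch \<Rightarrow> 'k alg set set" where
  "rat_points X = {x \<in> pts X. \<forall>a\<in>carrier (stk X x). \<exists>c. a \<ominus>\<^bsub>stk X x\<^esub> scal X x c \<notin> Units (stk X x)}"

section \<open>Large fields\<close>

definition irreducible_in :: "'p topology \<Rightarrow> 'p set \<Rightarrow> bool" where
  "irreducible_in T Z \<longleftrightarrow> Z \<subseteq> topspace T \<and> Z \<noteq> {} \<and>
     (\<forall>C D. closedin T C \<and> closedin T D \<and> Z \<subseteq> C \<union> D \<longrightarrow> Z \<subseteq> C \<or> Z \<subseteq> D)"

definition krull_dim :: "'p topology \<Rightarrow> enat" where
  "krull_dim T = Sup {enat n | n. \<exists>Z :: nat \<Rightarrow> 'p set.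
     (\<forall>i\<le>n. closedin T (Z i) \<and> irreducible_in T (Z i)) \<and> (\<forall>i<n. Z i \<subset> Z (Suc i))}"

text \<open>Irreducibility matters: for disconnected \<open>X\<close> with an isolated \<open>K\<close>-point the condition on
  large fields below would fail for trivial reasons.\<close>

definition curve :: "'k::field sch \<Rightarrow> bool" where
  "curve X \<longleftrightarrow> variety X \<and> irreducible_in (tp X) (pts X) \<and> krull_dim (tp X) = 1"

definition large :: "'k::field itself \<Rightarrow> bool" where
  "large _ \<longleftrightarrow> (\<forall>X :: 'k sch. curve X \<and> (\<exists>x\<in>rat_points X. smooth_point X x)
     \<longrightarrow> infinite (rat_points X))"

section \<open>The etale open topology\<close>

definition etale_image :: "'k::field sch \<Rightarrow> 'k alg set set \<Rightarrow> bool" where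
  "etale_image V S \<longleftrightarrow> (\<exists>X \<phi>. variety X \<and> etale X V \<phi> \<and> S = pmap \<phi> ` rat_points X)"

definition etale_open :: "'k::field sch \<Rightarrow> 'k alg set set \<Rightarrow> bool" where
  "etale_open V = arbitrary union_of etale_image V"

text \<open>Elements of \<open>K\<^sup>m\<close> are lists of length \<open>m\<close>.  For a closed subvariety \<open>V\<close> of affine \<open>m\<close>-space
  with radical ideal \<open>I\<close>, \<open>zeros m I\<close> is \<open>V(K)\<close> as a subset of \<open>K\<^sup>m\<close>, and \<open>kpoint m I a\<close> is the
  corresponding \<open>K\<close>-point of the scheme \<open>V = aff m I\<close>.\<close>

definition zeros :: "nat \<Rightarrow> 'k::field mp set \<Rightarrow> 'k list set" where
  "zeros m I = {a. length a = m \<and> (\<forall>g\<in>I. mp_eval (\<lambda>i. a ! i) g = 0)}"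

definition kpoint :: "nat \<Rightarrow> 'k::field mp set \<Rightarrow> 'k list \<Rightarrow> 'k alg set" where
  "kpoint m I a = {I +>\<^bsub>poly_ring m\<^esub> g | g. g \<in> carrier (poly_ring m) \<and> mp_eval (\<lambda>i. a ! i) g = 0}"

definition etale_open_in :: "nat \<Rightarrow> 'k::field mp set \<Rightarrow> 'k list set \<Rightarrow> bool" where
  "etale_open_in m I S \<longleftrightarrow> S \<subseteq> zeros m I \<and> etale_open (aff m I) (kpoint m I ` S)"

section \<open>Definable sets\<close>

datatype 'k tm = Var nat | Param 'k | Add "'k tm" "'k tm" | Mul "'k tm" "'k tm" | Neg "'k tm"

datatype 'k fm = FEq "'k tm" "'k tm" | FNot "'k fm" | FAnd "'k fm" "'k fm" | FEx nat "'k fm"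

primrec tm_val :: "(nat \<Rightarrow> 'k::field) \<Rightarrow> 'k tm \<Rightarrow> 'k" where
  "tm_val e (Var i) = e i"
| "tm_val e (Param c) = c"
| "tm_val e (Add s t) = tm_val e s + tm_val e t"
| "tm_val e (Mul s t) = tm_val e s * tm_val e t"
| "tm_val e (Neg t) = - tm_val e t"

primrec sat :: "(nat \<Rightarrow> 'k::field) \<Rightarrow> 'k fm \<Rightarrow> bool" where
  "sat e (FEq s t) \<longleftrightarrow> tm_val e s = tm_val e t"
| "sat e (FNot \<phi>) \<longleftrightarrow> \<not> sat e \<phi>"
| "sat e (FAnd \<phi> \<psi>) \<longleftrightarrow> sat e \<phi> \<and> sat e \<psi>"
| "sat e (FEx i \<phi>) \<longleftrightarrow> (\<exists>c. sat (e(i := c)) \<phi>)"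

text \<open>Free variables beyond the first \<open>m\<close> act as the parameter \<open>0\<close>.\<close>

definition definable :: "nat \<Rightarrow> 'k::field list set \<Rightarrow> bool" where
  "definable m S \<longleftrightarrow>
     (\<exists>\<phi>. S = {a. length a = m \<and> sat (\<lambda>i. if i < m then a ! i else 0) \<phi>})"

section \<open>Ez fields and algebraic boundedness\<close>

definition ez_set :: "nat \<Rightarrow> 'k::field list set \<Rightarrow> bool" where
  "ez_set m S \<longleftrightarrow> (\<exists>\<S>. finite \<S> \<and> S = \<Union>\<S> \<and>
     (\<forall>U\<in>\<S>. definable m U \<and> (\<exists>I. radical_ideal I (poly_ring m) \<and> etale_open_in m I U)))"

definition ez_field :: "'k::field itself \<Rightarrow> bool" where
  "ez_field K \<longleftrightarrow> large K \<and> (\<forall>m. \<forall>S :: 'k list set. definable m S \<longrightarrow> ez_set m S)"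

text \<open>The polynomial \<open>f(a, t)\<close> in the single variable \<open>t\<close>, which is the variable with number \<open>m\<close>.\<close>

definition spec_poly :: "nat \<Rightarrow> 'k::field list \<Rightarrow> 'k mp \<Rightarrow> 'k poly" where
  "spec_poly m a f = (\<Sum>\<mu>\<in>Poly_Mapping.keys f. Polynomial.monom
     (Poly_Mapping.lookup f \<mu> * (\<Prod>i<m. (a ! i) ^ Poly_Mapping.lookup \<mu> i))
     (Poly_Mapping.lookup \<mu> m))"

definition algebraically_bounded :: "'k::field itself \<Rightarrow> bool" where
  "algebraically_bounded _ \<longleftrightarrow>
     (\<forall>m. \<forall>S :: 'k list set. definable (m + 1) S \<longrightarrow>
       (\<exists>F. finite F \<and> F \<subseteq> carrier (poly_ring (m + 1)) \<and>
         (\<forall>a. length a = m \<and> finite {b. a @ [b] \<in> S} \<longrightarrow>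
           (\<exists>f\<in>F. spec_poly m a f \<noteq> 0 \<and>
              {b. a @ [b] \<in> S} \<subseteq> {b. poly (spec_poly m a f) b = 0}))))"

end

theory Submission
  imports
    Defs
    "HOL-Algebra.Finite_Extensions"
    "HOL-Algebra.Algebraic_Closure_Type"
    "HOL-Computational_Algebra.Formal_Laurent_Series"
    "HOL-Computational_Algebra.Polynomial_Factorial"
begin

text \<open>Let \<open>S\<close> be an etale open subset of \<open>V(K)\<close>, where \<open>V\<close> is closed in affine \<open>(m+1)\<close>-space, and let
  \<open>a \<in> K\<^sup>m\<close>.  If some equation of \<open>V\<close> does not vanish identically on the line \<open>{a} \<times> K\<close>, it bounds the
  fibre \<open>S\<^sub>a\<close>.  Otherwise the line lies in \<open>V\<close>, and \<open>S\<^sub>a\<close> is empty or infinite: near a point \<open>b\<close> of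
  \<open>S\<^sub>a\<close> an etale neighbourhood is given by a square polynomial system with invertible Jacobian, whose
  solution along the line is, by Hensel's lemma, a tuple of power series in \<open>t - b\<close>.  These series are
  separably algebraic over \<open>K(t)\<close>, since derivations extend uniquely along the system, so the
  primitive element theorem turns them into the germ of a plane curve that can be arranged to be smooth
  at the origin.  As \<open>K\<close> is large, this curve has infinitely many \<open>K\<close>-points, and all but finitely
  many of them yield points of \<open>S\<^sub>a\<close>.

  By Hilbert's basis theorem finitely many equations of \<open>V\<close> suffice.  For a finite union of such sets
  \<open>S\<close>, one takes all products formed by choosing for each \<open>S\<close> either one of these equations or, to cover
  empty fibres, the constant \<open>1\<close>.\<close>

hide_const (open) Polynomials.degree up_ring.coeff up_ring.monom Polynomial_Divisibility.poly_ring
no_notation Polynomials.var (\<open>X\<index>\<close>)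

text \<open>Two obstacles shape the proof. The characteristic is arbitrary and \<open>K\<close> may
  be imperfect, so algebraicity over \<open>K(t)\<close> is not enough: the primitive element and
  the smooth point of the final curve need separability, which is extracted from the invertible
  Jacobian matrix. Moreover, largeness speaks about curves that are schemes, while a power series is
  only a germ. The germ \<open>u\<close> is therefore traded for the kernel of
  \<open>K[s][y] -> K[[s]]\<close>, \<open>y \<mapsto> u\<close>. This ideal is prime, so its zero
  scheme is integral, and it is principal with a generator whose \<open>y\<close>-derivative is a
  unit along \<open>u\<close>, so the origin is a smooth \<open>K\<close>-point. That the scheme is
  a curve, separatedness and dimension one included, is verified directly against the definitions.
  No fibre product with the line is formed: the equations of the etale neighbourhood are restricted
  to the line by substituting fractions of polynomials in \<open>t\<close> for the base coordinates.
  Infinitely many points suffice, because a function that is nonzero on the branch vanishes only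
  over finitely many parameters.\<close>

abbreviation lookup where "lookup \<equiv> Poly_Mapping.lookup"
abbreviation keys where "keys \<equiv> Poly_Mapping.keys"

subsection \<open>Evaluation of polynomials along a ring homomorphism\<close>

definition mon_eval :: "(nat \<Rightarrow> 'b::comm_ring_1) \<Rightarrow> (nat \<Rightarrow>\<^sub>0 nat) \<Rightarrow> 'b" where
  "mon_eval a \<mu> = (\<Prod>i\<in>keys \<mu>. a i ^ lookup \<mu> i)"

text \<open>The coefficients pass through \<open>\<phi>\<close>, so one development serves values in
  \<open>K\<close>, in power series, in Laurent series and in \<open>K[t]\<close>.\<close>

definition ev :: "('k::field \<Rightarrow> 'b::comm_ring_1) \<Rightarrow> (nat \<Rightarrow> 'b) \<Rightarrow> 'k mp \<Rightarrow> 'b" where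
  "ev \<phi> a p = (\<Sum>\<mu>\<in>keys p. \<phi> (lookup p \<mu>) * mon_eval a \<mu>)"

definition mvar :: "nat \<Rightarrow> 'k::field mp" where
  "mvar i = Poly_Mapping.single (Poly_Mapping.single i 1) 1"

lemma mp_eval_eq_ev: "mp_eval a p = ev (\<lambda>c. c) a p"
  by (simp add: mp_eval_def ev_def mon_eval_def)

lemma mon_eval_superset:
  assumes "finite S" "keys \<mu> \<subseteq> S"
  shows "mon_eval a \<mu> = (\<Prod>i\<in>S. a i ^ lookup \<mu> i)"
  unfolding mon_eval_def
  by (rule prod.mono_neutral_left) (use assms in \<open>auto simp: in_keys_iff\<close>)

lemma mon_eval_0 [simp]: "mon_eval a 0 = 1"
  by (simp add: mon_eval_def)

lemma mon_eval_single [simp]: "mon_eval a (Poly_Mapping.single i n) = a i ^ n"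
  by (subst mon_eval_superset[of "{i}"]) auto

lemma mon_eval_add: "mon_eval a (\<mu> + \<nu>) = mon_eval a \<mu> * mon_eval a \<nu>"
proof -
  let ?S = "keys \<mu> \<union> keys \<nu>"
  have "mon_eval a (\<mu> + \<nu>) = (\<Prod>i\<in>?S. a i ^ lookup (\<mu> + \<nu>) i)"
    by (rule mon_eval_superset) (use Poly_Mapping.keys_add[of \<mu> \<nu>] in auto)
  also have "\<dots> = (\<Prod>i\<in>?S. a i ^ lookup \<mu> i) * (\<Prod>i\<in>?S. a i ^ lookup \<nu> i)"
    by (simp add: lookup_add power_add prod.distrib)
  also have "\<dots> = mon_eval a \<mu> * mon_eval a \<nu>"
    by (subst (1 2) mon_eval_superset[of ?S]) auto
  finally show ?thesis .
qed

lemma mp_sum_singles: "p = (\<Sum>\<mu>\<in>keys p. Poly_Mapping.single \<mu> (lookup p \<mu>))"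
proof (rule poly_mapping_eqI)
  fix \<nu>
  have "lookup (\<Sum>\<mu>\<in>keys p. Poly_Mapping.single \<mu> (lookup p \<mu>)) \<nu>
      = (\<Sum>\<mu>\<in>keys p. lookup p \<mu> when \<mu> = \<nu>)"
    by (simp add: lookup_sum lookup_single)
  also have "\<dots> = lookup p \<nu>"
    by (cases "\<nu> \<in> keys p") (auto simp: when_def in_keys_iff)
  finally show "lookup p \<nu> = lookup (\<Sum>\<mu>\<in>keys p. Poly_Mapping.single \<mu> (lookup p \<mu>)) \<nu>" ..
qed

lemma mp_single_induct [case_names zero add]:
  fixes p :: "'k::field mp"
  assumes "P 0" "\<And>\<mu> c p. P p \<Longrightarrow> P (Poly_Mapping.single \<mu> c + p)"
  shows "P p"
proof -
  have "P (\<Sum>\<mu>\<in>A. Poly_Mapping.single \<mu> (lookup p \<mu>))" if "finite A" for A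
    using that by (induction A) (auto intro: assms)
  from this[OF finite_keys, of p] show ?thesis
    using mp_sum_singles[of p] by simp
qed

text \<open>Membership in the carrier of \<open>poly_ring n\<close>, kept as a predicate so that the
  type class operations can be used.\<close>

definition in_vars :: "nat \<Rightarrow> 'k::field mp \<Rightarrow> bool" where
  "in_vars n p \<longleftrightarrow> (\<forall>\<mu>\<in>keys p. keys \<mu> \<subseteq> {..<n})"

lemma in_vars_0 [simp]: "in_vars n 0"
  and in_vars_const [simp]: "in_vars n (const c)"
  and in_vars_mvar [simp]: "i < n \<Longrightarrow> in_vars n (mvar i)"
  by (auto simp: in_vars_def const_def mvar_def)

lemma const_0: "const 0 = 0" and const_1: "const 1 = 1"
  and const_add: "const (c + d) = const c + const d"
  and const_mult: "const (c * d) = const c * const d"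
  and const_uminus: "const (- c) = - const c"
  by (auto simp: const_def single_add mult_single single_uminus)

lemma in_vars_1 [simp]: "in_vars n 1"
  using in_vars_const[of n 1] by (simp add: const_1)

lemma in_vars_add: "in_vars n p \<Longrightarrow> in_vars n q \<Longrightarrow> in_vars n (p + q)"
  using Poly_Mapping.keys_add[of p q] by (fastforce simp: in_vars_def)

lemma in_vars_uminus: "in_vars n p \<Longrightarrow> in_vars n (- p)"
  by (simp add: in_vars_def)

lemma in_vars_diff: "in_vars n p \<Longrightarrow> in_vars n q \<Longrightarrow> in_vars n (p - q)"
  using in_vars_add[of n p "- q"] in_vars_uminus[of n q] by simp

lemma in_vars_mult: "in_vars n p \<Longrightarrow> in_vars n q \<Longrightarrow> in_vars n (p * q)"
proof -
  assume p: "in_vars n p" and q: "in_vars n q"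
  have "keys \<mu> \<subseteq> {..<n}" if "\<mu> \<in> keys (p * q)" for \<mu>
  proof -
    from that keys_mult[of p q] obtain a b where "\<mu> = a + b" "a \<in> keys p" "b \<in> keys q" by auto
    thus ?thesis using p q Poly_Mapping.keys_add[of a b] unfolding in_vars_def by blast
  qed
  thus ?thesis by (simp add: in_vars_def)
qed

lemma in_vars_sum: "(\<And>i. i \<in> A \<Longrightarrow> in_vars n (f i)) \<Longrightarrow> in_vars n (sum f A)"
  by (induction A rule: infinite_finite_induct) (auto intro: in_vars_add)

lemma in_vars_prod: "(\<And>i. i \<in> A \<Longrightarrow> in_vars n (f i)) \<Longrightarrow> in_vars n (prod f A)"
  by (induction A rule: infinite_finite_induct) (auto intro: in_vars_mult)

lemma in_vars_mono: "in_vars m p \<Longrightarrow> m \<le> n \<Longrightarrow> in_vars n p"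
  unfolding in_vars_def by (meson lessThan_subset_iff order_trans)

lemma ex_in_vars: "\<exists>n. in_vars n p"
proof -
  have "finite (\<Union>\<mu>\<in>keys p. keys \<mu>)" by simp
  then obtain n where "\<forall>i\<in>(\<Union>\<mu>\<in>keys p. keys \<mu>). i < n"
    using finite_nat_set_iff_bounded by blast
  thus ?thesis by (intro exI[of _ n]) (auto simp: in_vars_def)
qed

lemma mvar_power: "mvar i ^ k = Poly_Mapping.single (Poly_Mapping.single i k) 1"
proof (induction k)
  case (Suc k)
  have "Poly_Mapping.single i (1::nat) + Poly_Mapping.single i k = Poly_Mapping.single i (Suc k)"
    by (metis One_nat_def plus_1_eq_Suc single_add)
  then show ?case by (simp only: power_Suc Suc) (simp add: mvar_def mult_single)
qed auto

lemma single_eq_prod_mvar: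
  "Poly_Mapping.single \<mu> c = const c * (\<Prod>i\<in>keys \<mu>. mvar i ^ lookup \<mu> i)"
proof -
  have *: "(\<Prod>i\<in>A. mvar i ^ lookup \<mu> i :: 'a mp)
      = Poly_Mapping.single (\<Sum>i\<in>A. Poly_Mapping.single i (lookup \<mu> i)) 1" if "finite A" for A
    using that by (induction A) (auto simp: mvar_power mult_single)
  have "(\<Prod>i\<in>keys \<mu>. mvar i ^ lookup \<mu> i :: 'a mp) = Poly_Mapping.single \<mu> 1"
    using *[OF finite_keys, of \<mu>] mp_sum_singles[of \<mu>] by simp
  thus ?thesis by (simp add: const_def mult_single)
qed

lemma mp_induct [consumes 1, case_names const mvar add mult]:
  fixes p :: "'k::field mp"
  assumes "in_vars n p"
    and c: "\<And>c. P (const c)" and v: "\<And>i. i < n \<Longrightarrow> P (mvar i)"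
    and a: "\<And>p q. in_vars n p \<Longrightarrow> in_vars n q \<Longrightarrow> P p \<Longrightarrow> P q \<Longrightarrow> P (p + q)"
    and m: "\<And>p q. in_vars n p \<Longrightarrow> in_vars n q \<Longrightarrow> P p \<Longrightarrow> P q \<Longrightarrow> P (p * q)"
  shows "P p"
proof -
  have pw: "P (mvar i ^ k) \<and> in_vars n (mvar i ^ k :: 'k mp)" if "i < n" for i k
  proof (induction k)
    case 0
    then show ?case using c[of 1] by (simp add: const_1)
  next
    case (Suc k)
    then show ?case using that by (auto intro!: m v intro: in_vars_mult)
  qed
  have pr: "P (\<Prod>i\<in>A. mvar i ^ f i) \<and> in_vars n (\<Prod>i\<in>A. mvar i ^ f i :: 'k mp)"
    if "finite A" "A \<subseteq> {..<n}" for A f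
    using that
  proof (induction A)
    case empty
    then show ?case using c[of 1] by (simp add: const_1)
  next
    case (insert x A)
    then show ?case using pw[of x] by (auto intro!: m intro: in_vars_mult)
  qed
  have s: "P (Poly_Mapping.single \<mu> d) \<and> in_vars n (Poly_Mapping.single \<mu> d)" if "keys \<mu> \<subseteq> {..<n}" for \<mu> d
    unfolding single_eq_prod_mvar using pr[OF finite_keys that] by (auto intro!: m c in_vars_mult)
  have "P (\<Sum>\<mu>\<in>A. Poly_Mapping.single \<mu> (lookup p \<mu>))
      \<and> in_vars n (\<Sum>\<mu>\<in>A. Poly_Mapping.single \<mu> (lookup p \<mu>))" if "finite A" "A \<subseteq> keys p" for A
    using that
  proof (induction A)
    case empty
    then show ?case using c[of 0] by (simp add: const_0)
  next
    case (insert x A)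
    have "keys x \<subseteq> {..<n}" using insert.prems assms(1) by (auto simp: in_vars_def)
    with insert s[of x] show ?case by (auto intro!: a intro: in_vars_add)
  qed
  from this[OF finite_keys order_refl] show ?thesis
    using mp_sum_singles[of p] by simp
qed

locale kalg =
  fixes \<phi> :: "'k::field \<Rightarrow> 'b::comm_ring_1"
  assumes hom_add: "\<phi> (c + d) = \<phi> c + \<phi> d"
    and hom_mult: "\<phi> (c * d) = \<phi> c * \<phi> d"
    and hom_1: "\<phi> 1 = 1"
begin

lemma hom_0: "\<phi> 0 = 0"
  using hom_add[of 0 0] by simp

lemma ev_superset:
  assumes "finite S" "keys p \<subseteq> S"
  shows "ev \<phi> a p = (\<Sum>\<mu>\<in>S. \<phi> (lookup p \<mu>) * mon_eval a \<mu>)"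
  unfolding ev_def
  by (rule sum.mono_neutral_left) (use assms in \<open>auto simp: in_keys_iff hom_0\<close>)

lemma ev_0 [simp]: "ev \<phi> a 0 = 0"
  by (simp add: ev_def)

lemma ev_add: "ev \<phi> a (p + q) = ev \<phi> a p + ev \<phi> a q"
proof -
  let ?S = "keys p \<union> keys q"
  have "ev \<phi> a (p + q) = (\<Sum>\<mu>\<in>?S. \<phi> (lookup (p + q) \<mu>) * mon_eval a \<mu>)"
    by (rule ev_superset) (use Poly_Mapping.keys_add[of p q] in auto)
  also have "\<dots> = (\<Sum>\<mu>\<in>?S. \<phi> (lookup p \<mu>) * mon_eval a \<mu>) + (\<Sum>\<mu>\<in>?S. \<phi> (lookup q \<mu>) * mon_eval a \<mu>)"
    by (simp add: lookup_add hom_add distrib_right sum.distrib)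
  also have "\<dots> = ev \<phi> a p + ev \<phi> a q"
    by (subst (1 2) ev_superset[of ?S]) auto
  finally show ?thesis .
qed

lemma ev_single: "ev \<phi> a (Poly_Mapping.single \<mu> c) = \<phi> c * mon_eval a \<mu>"
  by (subst ev_superset[of "{\<mu>}"]) auto

lemma ev_const [simp]: "ev \<phi> a (const c) = \<phi> c"
  by (simp add: const_def ev_single hom_0)

lemma ev_1 [simp]: "ev \<phi> a 1 = 1"
  using ev_const[of a 1] by (simp add: const_1 hom_1)

lemma ev_mvar [simp]: "ev \<phi> a (mvar i) = a i"
  by (simp add: mvar_def ev_single hom_1)

lemma ev_mult: "ev \<phi> a (p * q) = ev \<phi> a p * ev \<phi> a q"
proof (induction p rule: mp_single_induct)
  case (add \<mu> c p)
  have "ev \<phi> a (Poly_Mapping.single \<mu> c * q) = \<phi> c * mon_eval a \<mu> * ev \<phi> a q"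
    by (induction q rule: mp_single_induct)
       (auto simp: distrib_left ev_add mult_single ev_single hom_mult mon_eval_add algebra_simps)
  with add show ?case by (simp add: distrib_right ev_add ev_single)
qed simp

lemma ev_uminus: "ev \<phi> a (- p) = - ev \<phi> a p"
  using ev_add[of a p "- p"] by (simp add: eq_neg_iff_add_eq_0 add.commute)

lemma ev_diff: "ev \<phi> a (p - q) = ev \<phi> a p - ev \<phi> a q"
  using ev_add[of a p "- q"] by (simp add: ev_uminus)

lemma ev_power: "ev \<phi> a (p ^ k) = ev \<phi> a p ^ k"
  by (induction k) (auto simp: ev_mult)

lemma ev_sum: "ev \<phi> a (sum f A) = (\<Sum>i\<in>A. ev \<phi> a (f i))"
  by (induction A rule: infinite_finite_induct) (auto simp: ev_add)

lemma ev_prod: "ev \<phi> a (prod f A) = (\<Prod>i\<in>A. ev \<phi> a (f i))"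
  by (induction A rule: infinite_finite_induct) (auto simp: ev_mult)

end

lemma ev_cong:
  assumes "in_vars n p" "\<And>i. i < n \<Longrightarrow> a i = b i"
  shows "ev \<phi> a p = ev \<phi> b p"
  unfolding ev_def mon_eval_def using assms
  by (intro sum.cong prod.cong refl arg_cong2[where f="(*)"]) (auto simp: in_vars_def subset_iff)

interpretation id_alg: kalg "\<lambda>c. c"
  by unfold_locales auto

lemmas mp_eval_simps =
  id_alg.ev_add[folded mp_eval_eq_ev] id_alg.ev_mult[folded mp_eval_eq_ev]
  id_alg.ev_const[folded mp_eval_eq_ev] id_alg.ev_mvar[folded mp_eval_eq_ev]
  id_alg.ev_0[folded mp_eval_eq_ev] id_alg.ev_1[folded mp_eval_eq_ev]
  id_alg.ev_uminus[folded mp_eval_eq_ev] id_alg.ev_diff[folded mp_eval_eq_ev]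
  id_alg.ev_power[folded mp_eval_eq_ev] id_alg.ev_sum[folded mp_eval_eq_ev]
  id_alg.ev_prod[folded mp_eval_eq_ev]

subsection \<open>Partial derivatives\<close>

lemma pdiff_superset:
  assumes "finite S" "keys p \<subseteq> S"
  shows "pdiff i p = (\<Sum>\<mu>\<in>S. Poly_Mapping.single (\<mu> - Poly_Mapping.single i 1)
       (of_nat (lookup \<mu> i) * lookup p \<mu>))"
  unfolding pdiff_def
  by (rule sum.mono_neutral_left) (use assms in \<open>auto simp: in_keys_iff\<close>)

lemma pdiff_0 [simp]: "pdiff i 0 = 0"
  by (simp add: pdiff_def)

lemma pdiff_add: "pdiff i (p + q) = pdiff i p + pdiff i q"
proof -
  let ?S = "keys p \<union> keys q"
  have "pdiff i (p + q) = (\<Sum>\<mu>\<in>?S. Poly_Mapping.single (\<mu> - Poly_Mapping.single i 1)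
       (of_nat (lookup \<mu> i) * lookup (p + q) \<mu>))"
    by (rule pdiff_superset) (use Poly_Mapping.keys_add[of p q] in auto)
  also have "\<dots> = (\<Sum>\<mu>\<in>?S. Poly_Mapping.single (\<mu> - Poly_Mapping.single i 1) (of_nat (lookup \<mu> i) * lookup p \<mu>))
     + (\<Sum>\<mu>\<in>?S. Poly_Mapping.single (\<mu> - Poly_Mapping.single i 1) (of_nat (lookup \<mu> i) * lookup q \<mu>))"
    by (simp add: lookup_add distrib_left sum.distrib single_add)
  also have "\<dots> = pdiff i p + pdiff i q"
    by (subst (1 2) pdiff_superset[of ?S]) auto
  finally show ?thesis .
qed

lemma pdiff_single: "pdiff i (Poly_Mapping.single \<mu> c)
    = Poly_Mapping.single (\<mu> - Poly_Mapping.single i 1) (of_nat (lookup \<mu> i) * c)"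
  by (subst pdiff_superset[of "{\<mu>}"]) auto

lemma pdiff_const [simp]: "pdiff i (const c) = 0"
  by (simp add: const_def pdiff_single)

lemma pdiff_mvar: "pdiff i (mvar j) = (if i = j then 1 else 0)"
  by (auto simp: mvar_def pdiff_single lookup_single)

lemma pdiff_mult: "pdiff i (p * q) = p * pdiff i q + pdiff i p * q"
proof (induction p rule: mp_single_induct)
  case (add \<mu> c p)
  have "pdiff i (Poly_Mapping.single \<mu> c * q)
      = Poly_Mapping.single \<mu> c * pdiff i q + pdiff i (Poly_Mapping.single \<mu> c) * q"
  proof (induction q rule: mp_single_induct)
    case (add \<nu> d q)
    let ?e = "Poly_Mapping.single i (1::nat)"
    \<comment> \<open>Subtraction of exponents is truncated, so the two exponents can differ when
      the variable \<open>i\<close> does not occur in \<open>\<nu>\<close>; the coefficient is then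
      zero.\<close>
    have 1: "Poly_Mapping.single (\<mu> + \<nu> - ?e) (of_nat (lookup \<nu> i) * (c * d))
       = Poly_Mapping.single (\<mu> + (\<nu> - ?e)) (of_nat (lookup \<nu> i) * (c * d))"
    proof (cases "lookup \<nu> i = 0")
      case False
      hence "\<mu> + \<nu> - ?e = \<mu> + (\<nu> - ?e)"
        by (intro poly_mapping_eqI) (auto simp: lookup_add lookup_minus lookup_single when_def)
      thus ?thesis by simp
    qed simp
    have 2: "Poly_Mapping.single (\<mu> + \<nu> - ?e) (of_nat (lookup \<mu> i) * (c * d))
       = Poly_Mapping.single (\<mu> - ?e + \<nu>) (of_nat (lookup \<mu> i) * (c * d))"
    proof (cases "lookup \<mu> i = 0")
      case False
      hence "\<mu> + \<nu> - ?e = \<mu> - ?e + \<nu>"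
        by (intro poly_mapping_eqI) (auto simp: lookup_add lookup_minus lookup_single when_def)
      thus ?thesis by simp
    qed simp
    have "pdiff i (Poly_Mapping.single \<mu> c * Poly_Mapping.single \<nu> d)
      = Poly_Mapping.single (\<mu> + \<nu> - ?e) (of_nat (lookup \<mu> i) * (c * d))
        + Poly_Mapping.single (\<mu> + \<nu> - ?e) (of_nat (lookup \<nu> i) * (c * d))"
      by (simp only: mult_single pdiff_single lookup_add of_nat_add distrib_right single_add)
    also have "\<dots> = Poly_Mapping.single \<mu> c * pdiff i (Poly_Mapping.single \<nu> d)
        + pdiff i (Poly_Mapping.single \<mu> c) * Poly_Mapping.single \<nu> d"
      unfolding 1 2 by (simp add: pdiff_single mult_single algebra_simps)
    finally show ?case using add by (simp add: distrib_left pdiff_add)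
  qed simp
  with add show ?case by (simp add: distrib_right pdiff_add)
qed simp

lemma in_vars_pdiff: "in_vars n p \<Longrightarrow> in_vars n (pdiff i p)"
  by (induction p rule: mp_induct) (auto simp: pdiff_mvar pdiff_add pdiff_mult intro!: in_vars_add in_vars_mult)

subsection \<open>Subrings and Hilbert's basis theorem\<close>

text \<open>Subrings as plain subsets of a ring type: the towers of adjunctions below grow inside
  one fixed ambient ring.\<close>

definition subr :: "'a::comm_ring_1 set \<Rightarrow> bool" where
  "subr R \<longleftrightarrow> 1 \<in> R \<and> (\<forall>x\<in>R. \<forall>y\<in>R. x + y \<in> R \<and> x * y \<in> R) \<and> (\<forall>x\<in>R. - x \<in> R)"

definition pol_over :: "'a::comm_ring_1 set \<Rightarrow> 'a poly \<Rightarrow> bool" where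
  "pol_over R p \<longleftrightarrow> (\<forall>i. poly.coeff p i \<in> R)"

definition adjoin :: "'a::comm_ring_1 set \<Rightarrow> 'a \<Rightarrow> 'a set" where
  "adjoin R x = {poly p x | p. pol_over R p}"

context
  fixes R :: "'a::comm_ring_1 set"
  assumes R: "subr R"
begin

lemma subr_1: "1 \<in> R" and subr_add: "x \<in> R \<Longrightarrow> y \<in> R \<Longrightarrow> x + y \<in> R"
  and subr_mult: "x \<in> R \<Longrightarrow> y \<in> R \<Longrightarrow> x * y \<in> R" and subr_uminus: "x \<in> R \<Longrightarrow> - x \<in> R"
  using R by (auto simp: subr_def)

lemma subr_0: "0 \<in> R"
  using subr_add[OF subr_1 subr_uminus[OF subr_1]] by simp

lemma subr_diff: "x \<in> R \<Longrightarrow> y \<in> R \<Longrightarrow> x - y \<in> R"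
  using subr_add[of x "- y"] subr_uminus[of y] by simp

lemma subr_power: "x \<in> R \<Longrightarrow> x ^ n \<in> R"
  by (induction n) (auto intro: subr_1 subr_mult)

lemma subr_sum: "(\<And>i. i \<in> A \<Longrightarrow> f i \<in> R) \<Longrightarrow> sum f A \<in> R"
  by (induction A rule: infinite_finite_induct) (auto intro: subr_0 subr_add)

lemma pol_over_0: "pol_over R 0"
  and pol_over_add: "pol_over R p \<Longrightarrow> pol_over R q \<Longrightarrow> pol_over R (p + q)"
  and pol_over_diff: "pol_over R p \<Longrightarrow> pol_over R q \<Longrightarrow> pol_over R (p - q)"
  and pol_over_uminus: "pol_over R p \<Longrightarrow> pol_over R (- p)"
  and pol_over_smult: "c \<in> R \<Longrightarrow> pol_over R p \<Longrightarrow> pol_over R (smult c p)"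
  and pol_over_mult: "pol_over R p \<Longrightarrow> pol_over R q \<Longrightarrow> pol_over R (p * q)"
  and pol_over_monom: "c \<in> R \<Longrightarrow> pol_over R (Polynomial.monom c n)"
  by (auto simp: pol_over_def coeff_mult
      intro: subr_0 subr_add subr_diff subr_uminus subr_mult subr_sum)

lemma pol_over_pCons_iff: "pol_over R (pCons c p) \<longleftrightarrow> c \<in> R \<and> pol_over R p"
  unfolding pol_over_def coeff_pCons by (metis nat.case not0_implies_Suc)

lemma pol_over_poly: "pol_over R p \<Longrightarrow> x \<in> R \<Longrightarrow> poly p x \<in> R"
  by (induction p) (auto simp: pol_over_pCons_iff intro: subr_0 subr_add subr_mult)

lemma adjoin_incl: "R \<subseteq> adjoin R x"
proof
  fix c assume "c \<in> R"
  hence "pol_over R [:c:]" by (simp add: pol_over_pCons_iff pol_over_0)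
  moreover have "c = poly [:c:] x" by simp
  ultimately show "c \<in> adjoin R x" unfolding adjoin_def by blast
qed

lemma adjoin_self: "x \<in> adjoin R x"
proof -
  have "pol_over R [:0,1:]" by (simp add: pol_over_pCons_iff pol_over_0 subr_0 subr_1)
  moreover have "x = poly [:0,1:] x" by simp
  ultimately show ?thesis unfolding adjoin_def by blast
qed

lemma subr_adjoin: "subr (adjoin R x)"
  unfolding subr_def
proof (intro conjI ballI)
  show "1 \<in> adjoin R x" using adjoin_incl subr_1 by blast
next
  fix y z assume "y \<in> adjoin R x" "z \<in> adjoin R x"
  then obtain p q where pq: "pol_over R p" "pol_over R q" "y = poly p x" "z = poly q x"
    by (auto simp: adjoin_def)
  have "y + z = poly (p + q) x" "y * z = poly (p * q) x" using pq by auto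
  thus "y + z \<in> adjoin R x" "y * z \<in> adjoin R x"
    using pol_over_add[OF pq(1,2)] pol_over_mult[OF pq(1,2)] unfolding adjoin_def by blast+
next
  fix y assume "y \<in> adjoin R x"
  then obtain p where "pol_over R p" "y = poly p x" by (auto simp: adjoin_def)
  hence "- y = poly (- p) x" "pol_over R (- p)" using pol_over_uminus by auto
  thus "- y \<in> adjoin R x" unfolding adjoin_def by blast
qed

end

lemma adjoin_least:
  assumes "subr S" "R \<subseteq> S" "x \<in> S"
  shows "adjoin R x \<subseteq> S"
  using pol_over_poly[OF assms(1)] assms(2,3) by (auto simp: adjoin_def pol_over_def)

section \<open>Ideals of subrings and their generators\<close>

inductive_set lspan :: "'a::comm_ring_1 set \<Rightarrow> 'a set \<Rightarrow> 'a set" for R G where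
  lspan_0: "0 \<in> lspan R G"
| lspan_step: "r \<in> R \<Longrightarrow> g \<in> G \<Longrightarrow> y \<in> lspan R G \<Longrightarrow> r * g + y \<in> lspan R G"

definition ideal_in :: "'a::comm_ring_1 set \<Rightarrow> 'a set \<Rightarrow> bool" where
  "ideal_in I R \<longleftrightarrow> I \<subseteq> R \<and> 0 \<in> I \<and> (\<forall>x\<in>I. \<forall>y\<in>I. x + y \<in> I) \<and> (\<forall>r\<in>R. \<forall>x\<in>I. r * x \<in> I)"

definition noeth :: "'a::comm_ring_1 set \<Rightarrow> bool" where
  "noeth R \<longleftrightarrow> subr R \<and> (\<forall>I. ideal_in I R \<longrightarrow> (\<exists>G. finite G \<and> G \<subseteq> I \<and> I \<subseteq> lspan R G))"

lemma lspan_add: "x \<in> lspan R G \<Longrightarrow> y \<in> lspan R G \<Longrightarrow> x + y \<in> lspan R G"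
  by (induction x rule: lspan.induct) (auto simp: add.assoc intro: lspan_step)

lemma lspan_mult:
  assumes "subr R" "c \<in> R" "x \<in> lspan R G"
  shows "c * x \<in> lspan R G"
  using assms(3)
proof (induction x rule: lspan.induct)
  case (lspan_step r g y)
  have "(c * r) * g + c * y \<in> lspan R G"
    using lspan_step assms by (intro lspan.lspan_step) (auto intro: subr_mult)
  thus ?case by (simp add: algebra_simps)
qed (auto intro: lspan_0)

lemma lspan_ideal: "ideal_in I R \<Longrightarrow> G \<subseteq> I \<Longrightarrow> lspan R G \<subseteq> I"
proof
  fix x assume I: "ideal_in I R" "G \<subseteq> I" and "x \<in> lspan R G"
  from this(3) show "x \<in> I"
    by (induction x rule: lspan.induct) (use I in \<open>auto simp: ideal_in_def\<close>)
qed

text \<open>The argument with ideals \<open>L d\<close> of leading coefficients. Since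
  \<open>x\<close> need not be transcendental, it runs on the preimage \<open>I'\<close> of the
  ideal under \<open>p \<mapsto> p(x)\<close>, and the conclusions are evaluated at
  \<open>x\<close>.\<close>

theorem hilbert_basis:
  fixes x :: "'a::comm_ring_1"
  assumes N: "noeth R"
  shows "noeth (adjoin R x)"
  unfolding noeth_def
proof (intro conjI allI impI)
  have R: "subr R" using N by (simp add: noeth_def)
  show S: "subr (adjoin R x)" by (rule subr_adjoin[OF R])
  fix I assume I: "ideal_in I (adjoin R x)"
  define I' where "I' = {p. pol_over R p \<and> poly p x \<in> I}"
  define L where "L d = {c. \<exists>p\<in>I'. (\<forall>i>d. poly.coeff p i = 0) \<and> poly.coeff p d = c}" for d
  have I'_add: "p + q \<in> I'" if "p \<in> I'" "q \<in> I'" for p q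
    using that I pol_over_add[OF R] by (auto simp: I'_def ideal_in_def)
  have I'_mult: "r * p \<in> I'" if "pol_over R r" "p \<in> I'" for r p
    using that I pol_over_mult[OF R] by (auto simp: I'_def ideal_in_def adjoin_def)
  have I'_0: "0 \<in> I'" using I pol_over_0[OF R] by (auto simp: I'_def ideal_in_def)
  have I'_smult: "smult r p \<in> I'" if "r \<in> R" "p \<in> I'" for r p
    using I'_mult[of "[:r:]" p] that by (simp add: pol_over_pCons_iff[OF R] pol_over_0[OF R])
  have I'_diff: "p - q \<in> I'" if "p \<in> I'" "q \<in> I'" for p q
    using I'_add[OF that(1) I'_smult[OF _ that(2), of "-1"]] subr_uminus[OF R subr_1[OF R]] by simp
  have I'_monom: "Polynomial.monom 1 k * p \<in> I'" if "p \<in> I'" for p k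
    using that I'_mult pol_over_monom[OF R] subr_1[OF R] by blast
  have L_ideal: "ideal_in (L d) R" for d
    unfolding ideal_in_def
  proof (intro conjI ballI)
    show "L d \<subseteq> R" by (auto simp: L_def I'_def pol_over_def)
    show "0 \<in> L d" unfolding L_def using I'_0 by (auto intro!: bexI[of _ 0])
  next
    fix a b assume "a \<in> L d" "b \<in> L d"
    then obtain p q where "p \<in> I'" "q \<in> I'" "\<forall>i>d. poly.coeff p i = 0" "\<forall>i>d. poly.coeff q i = 0"
      "poly.coeff p d = a" "poly.coeff q d = b" by (auto simp: L_def)
    thus "a + b \<in> L d" unfolding L_def using I'_add by (auto intro!: bexI[of _ "p + q"])
  next
    fix r a assume "r \<in> R" "a \<in> L d"
    then obtain p where "p \<in> I'" "\<forall>i>d. poly.coeff p i = 0" "poly.coeff p d = a"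
      by (auto simp: L_def)
    thus "r * a \<in> L d" unfolding L_def using I'_smult \<open>r \<in> R\<close> by (auto intro!: bexI[of _ "smult r p"])
  qed
  have L_Suc: "L d \<subseteq> L (Suc d)" for d
  proof
    fix a assume "a \<in> L d"
    then obtain p where "p \<in> I'" "\<forall>i>d. poly.coeff p i = 0" "poly.coeff p d = a"
      by (auto simp: L_def)
    moreover from this have "Polynomial.monom 1 1 * p \<in> I'" using I'_monom by blast
    moreover have "Polynomial.monom 1 1 * p = pCons 0 p" by (simp add: monom_Suc)
    ultimately show "a \<in> L (Suc d)" unfolding L_def
      by (auto intro!: bexI[of _ "pCons 0 p"] simp: coeff_pCons split: nat.splits)
  qed
  hence L_mono: "L d \<subseteq> L e" if "d \<le> e" for d e using that by (rule lift_Suc_mono_le)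
  \<comment> \<open>The union of the increasing chain is itself an ideal; finitely many generators
    of it lie in one \<open>L M\<close>, so the chain is constant from \<open>M\<close> on.\<close>
  have "ideal_in (\<Union>d. L d) R"
    unfolding ideal_in_def
  proof (intro conjI ballI)
    show "(\<Union>d. L d) \<subseteq> R" "0 \<in> (\<Union>d. L d)"
      using L_ideal unfolding ideal_in_def by blast+
  next
    fix a b assume "a \<in> (\<Union>d. L d)" "b \<in> (\<Union>d. L d)"
    then obtain d e where "a \<in> L d" "b \<in> L e" by blast
    hence "a \<in> L (max d e)" "b \<in> L (max d e)" using L_mono[of d "max d e"] L_mono[of e "max d e"] by auto
    thus "a + b \<in> (\<Union>d. L d)" using L_ideal[of "max d e"] by (auto simp: ideal_in_def)
  next
    fix r a assume "r \<in> R" "a \<in> (\<Union>d. L d)"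
    thus "r * a \<in> (\<Union>d. L d)" using L_ideal unfolding ideal_in_def by blast
  qed
  then obtain G where G: "finite G" "G \<subseteq> (\<Union>d. L d)" "(\<Union>d. L d) \<subseteq> lspan R G"
    using N unfolding noeth_def by blast
  then obtain f where f: "\<And>g. g \<in> G \<Longrightarrow> g \<in> L (f g)"
    by (metis UN_E subset_iff)
  define M where "M = Max (insert 0 (f ` G))"
  have "G \<subseteq> L M"
  proof
    fix g assume "g \<in> G"
    hence "f g \<le> M" unfolding M_def using G(1) by auto
    thus "g \<in> L M" using f[OF \<open>g \<in> G\<close>] L_mono by blast
  qed
  hence L_top: "L d \<subseteq> L M" for d
    using lspan_ideal[OF L_ideal] G(3) by blast
  have "\<forall>d. \<exists>H. finite H \<and> H \<subseteq> L d \<and> L d \<subseteq> lspan R H"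
    using N L_ideal unfolding noeth_def by blast
  then obtain H where H: "\<And>d. finite (H d)" "\<And>d. H d \<subseteq> L d" "\<And>d. L d \<subseteq> lspan R (H d)"
    by metis
  have "\<forall>d. \<forall>c\<in>H d. \<exists>p. p \<in> I' \<and> (\<forall>i>d. poly.coeff p i = 0) \<and> poly.coeff p d = c"
    using H(2) by (auto simp: L_def)
  then obtain P where P: "\<And>d c. c \<in> H d \<Longrightarrow> P d c \<in> I'"
    "\<And>d c i. c \<in> H d \<Longrightarrow> i > d \<Longrightarrow> poly.coeff (P d c) i = 0"
    "\<And>d c. c \<in> H d \<Longrightarrow> poly.coeff (P d c) d = c"
    by metis
  \<comment> \<open>Only degrees up to \<open>M\<close> contribute: leading coefficients of higher
    degree already lie in \<open>L M\<close>.\<close>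
  define K where "K = (\<Union>d\<le>M. (\<lambda>c. poly (P d c) x) ` H d)"
  have K: "finite K" "K \<subseteq> I" using H(1) P(1) by (auto simp: K_def I'_def)
  let ?S = "lspan (adjoin R x) K"
  have lead: "\<exists>q\<in>I'. (\<forall>i>d. poly.coeff q i = 0) \<and> poly.coeff q d = c \<and> poly q x \<in> ?S"
    if "d \<le> M" "c \<in> lspan R (H d)" for d c
    using that(2)
  proof (induction c rule: lspan.induct)
    case lspan_0
    show ?case using I'_0 by (auto intro!: bexI[of _ 0] lspan.lspan_0)
  next
    case (lspan_step r g y)
    then obtain q where q: "q \<in> I'" "\<forall>i>d. poly.coeff q i = 0" "poly.coeff q d = y" "poly q x \<in> ?S"
      by blast
    have "smult r (P d g) + q \<in> I'" using lspan_step P(1) q(1) by (intro I'_add I'_smult) auto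
    moreover have "r * poly (P d g) x + poly q x \<in> ?S"
      using lspan_step q(4) adjoin_incl[OF R] that(1)
      by (intro lspan.lspan_step) (auto simp: K_def)
    ultimately show ?case using lspan_step P q
      by (intro bexI[of _ "smult r (P d g) + q"]) auto
  qed
  have main: "poly p x \<in> ?S" if "p \<in> I'" "\<forall>i\<ge>n. poly.coeff p i = 0" for n p
    using that
  proof (induction n arbitrary: p)
    case 0
    hence "p = 0" by (intro poly_eqI) auto
    thus ?case by (simp add: lspan.lspan_0)
  next
    case (Suc n)
    \<comment> \<open>Beyond degree \<open>M\<close> the generators of degree \<open>M\<close> are
      used, shifted up by the power \<open>x ^ (n - e)\<close>.\<close>
    define e where "e = min n M"
    have "poly.coeff p n \<in> L n" unfolding L_def using Suc.prems by (auto intro!: bexI[of _ p])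
    hence "poly.coeff p n \<in> L e" using L_top[of n] unfolding e_def by (auto simp: min_def)
    hence "poly.coeff p n \<in> lspan R (H e)" using H(3) by blast
    then obtain q where q: "q \<in> I'" "\<forall>i>e. poly.coeff q i = 0" "poly.coeff q e = poly.coeff p n" "poly q x \<in> ?S"
      using lead[of e] by (auto simp: e_def)
    define p' where "p' = p - Polynomial.monom 1 (n - e) * q"
    have "p' \<in> I'" unfolding p'_def using Suc.prems q I'_diff I'_monom by blast
    moreover have "\<forall>i\<ge>n. poly.coeff p' i = 0"
    proof (intro allI impI)
      fix i assume i: "i \<ge> n"
      have "e \<le> n" by (simp add: e_def)
      show "poly.coeff p' i = 0"
        using i Suc.prems(2) q(2,3) \<open>e \<le> n\<close>
        by (cases "i = n") (auto simp: p'_def coeff_monom_mult)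
    qed
    ultimately have "poly p' x \<in> ?S" by (rule Suc.IH)
    moreover have "x ^ (n - e) * poly q x \<in> ?S"
      by (intro lspan_mult[OF S] q(4) subr_power[OF S] adjoin_self[OF R])
    moreover have "poly p x = poly p' x + x ^ (n - e) * poly q x"
      by (simp add: p'_def poly_monom)
    ultimately show ?case by (simp add: lspan_add)
  qed
  have "I \<subseteq> ?S"
  proof
    fix y assume y: "y \<in> I"
    then obtain p where p: "pol_over R p" "y = poly p x" using I by (auto simp: ideal_in_def adjoin_def)
    hence "p \<in> I'" using y by (simp add: I'_def)
    from main[OF this, of "Suc (Polynomial.degree p)"] show "y \<in> ?S"
      using p by (auto simp: coeff_eq_0)
  qed
  with K show "\<exists>G. finite G \<and> G \<subseteq> I \<and> I \<subseteq> lspan (adjoin R x) G" by blast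
qed

lemma subr_in_vars: "subr {p. in_vars n p}"
  by (auto simp: subr_def intro: in_vars_add in_vars_mult in_vars_uminus)

lemma in_vars_0_iff: "in_vars 0 p \<longleftrightarrow> p \<in> range const"
proof
  assume "in_vars 0 p"
  thus "p \<in> range const"
    by (induction rule: mp_induct) (auto simp flip: const_add const_mult)
qed auto

lemma in_vars_Suc: "{p. in_vars (Suc n) p} = adjoin {p. in_vars n p} (mvar n)"
proof
  let ?A = "adjoin {p. in_vars n p} (mvar n) :: 'a mp set"
  have incl: "{p. in_vars n p} \<subseteq> ?A" by (rule adjoin_incl[OF subr_in_vars])
  have A: "subr ?A" by (rule subr_adjoin[OF subr_in_vars])
  show "{p. in_vars (Suc n) p} \<subseteq> ?A"
  proof safe
    fix p :: "'a mp"
    assume "in_vars (Suc n) p"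
    thus "p \<in> ?A"
    proof (induction rule: mp_induct)
      case (mvar i)
      then show ?case using incl adjoin_self[OF subr_in_vars, of "mvar n" n]
        by (cases "i = n") auto
    qed (use incl subr_add[OF A] subr_mult[OF A] in auto)
  qed
  show "?A \<subseteq> {p. in_vars (Suc n) p}"
    by (rule adjoin_least[OF subr_in_vars]) (auto intro: in_vars_mono)
qed

text \<open>Adjoins one variable at a time. The base case is the field of constants, where a nonzero
  ideal contains a unit.\<close>

lemma noeth_in_vars: "noeth {p :: 'k::field mp. in_vars n p}"
proof (induction n)
  case 0
  have "\<exists>G. finite G \<and> G \<subseteq> I \<and> I \<subseteq> lspan {p. in_vars 0 p} G"
    if I: "ideal_in I {p :: 'k mp. in_vars 0 p}" for I
  proof (cases "I \<subseteq> {0}")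
    case True
    thus ?thesis by (intro exI[of _ "{}"]) (auto intro: lspan_0)
  next
    case False
    then obtain x where x: "x \<in> I" "x \<noteq> 0" by blast
    moreover have "x \<in> range const" using x(1) I by (auto simp: ideal_in_def in_vars_0_iff)
    ultimately obtain c where c: "const c \<in> I" "c \<noteq> 0" using const_0 by blast
    have "y \<in> lspan {p. in_vars 0 p} {const c}" if "y \<in> I" for y
    proof -
      have "y \<in> range const" using that I by (auto simp: ideal_in_def in_vars_0_iff)
      then obtain d where "y = const d" by blast
      hence "y = const (d / c) * const c + 0" using c by (simp flip: const_mult)
      thus ?thesis by (metis in_vars_const lspan.simps mem_Collect_eq singletonI)
    qed
    thus ?thesis using c by (intro exI[of _ "{const c}"]) auto
  qed
  thus ?case by (simp add: noeth_def subr_in_vars)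
next
  case (Suc n)
  thus ?case unfolding in_vars_Suc by (rule hilbert_basis)
qed

subsection \<open>Hensel's lemma for systems of polynomials\<close>

interpretation fps_alg: kalg "fps_const :: 'k::field \<Rightarrow> 'k fps"
  by unfold_locales auto

text \<open>Congruence modulo \<open>X ^ k\<close>.\<close>

definition fps_agree :: "nat \<Rightarrow> 'k::field fps \<Rightarrow> 'k fps \<Rightarrow> bool" where
  "fps_agree k f g \<longleftrightarrow> (\<forall>l<k. fps_nth f l = fps_nth g l)"

lemma fps_agree_ev:
  assumes "\<And>v. fps_agree k (a v) (b v)"
  shows "fps_agree k (ev fps_const a p) (ev fps_const b p)"
proof -
  obtain n where "in_vars n p" using ex_in_vars by blast
  thus ?thesis
  proof (induction rule: mp_induct)
    case (mult p q)
    then show ?case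
      by (auto simp: fps_alg.ev_mult fps_agree_def fps_mult_nth intro!: sum.cong)
  qed (use assms in \<open>auto simp: fps_agree_def fps_alg.ev_add\<close>)
qed

lemma fps_ev_nth_0: "fps_nth (ev fps_const a p) 0 = mp_eval (\<lambda>v. fps_nth (a v) 0) p"
proof -
  obtain n where "in_vars n p" using ex_in_vars by blast
  thus ?thesis
    by (induction rule: mp_induct) (auto simp: mp_eval_simps fps_alg.ev_add fps_alg.ev_mult)
qed

text \<open>First-order Taylor expansion: the second-order terms of the increment
  \<open>X ^ (k + 1) d\<close> carry \<open>X ^ (2 k + 2)\<close> and so vanish modulo
  \<open>X ^ (k + 2)\<close>.\<close>

lemma fps_ev_taylor:
  fixes p :: "'k::field mp"
  assumes "in_vars n p"
  shows "\<exists>r. ev fps_const (\<lambda>v. a v + fps_X ^ Suc k * fps_const (d v)) p = ev fps_const a p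
     + fps_X ^ Suc k * (\<Sum>v<n. fps_const (d v) * ev fps_const a (pdiff v p)) + fps_X ^ Suc (Suc k) * r"
  using assms
proof (induction rule: mp_induct)
  case (const c)
  show ?case by (intro exI[of _ 0]) simp
next
  case (mvar i)
  have "(\<Sum>v<n. fps_const (d v) * ev fps_const a (pdiff v (mvar i))) = (\<Sum>v<n. if v = i then fps_const (d v) else 0)"
    by (intro sum.cong) (auto simp: pdiff_mvar)
  also have "\<dots> = fps_const (d i)" using mvar by simp
  finally show ?case by (intro exI[of _ 0]) simp
next
  case (add p q)
  then obtain r s where "ev fps_const (\<lambda>v. a v + fps_X ^ Suc k * fps_const (d v)) p = ev fps_const a p
     + fps_X ^ Suc k * (\<Sum>v<n. fps_const (d v) * ev fps_const a (pdiff v p)) + fps_X ^ Suc (Suc k) * r"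
    "ev fps_const (\<lambda>v. a v + fps_X ^ Suc k * fps_const (d v)) q = ev fps_const a q
     + fps_X ^ Suc k * (\<Sum>v<n. fps_const (d v) * ev fps_const a (pdiff v q)) + fps_X ^ Suc (Suc k) * s"
    by blast
  then show ?case
    by (intro exI[of _ "r + s"]) (simp add: fps_alg.ev_add pdiff_add sum.distrib algebra_simps del: power_Suc)
next
  case (mult p q)
  let ?b = "\<lambda>v. a v + fps_X ^ Suc k * fps_const (d v)"
  let ?D = "\<lambda>p. \<Sum>v<n. fps_const (d v) * ev fps_const a (pdiff v p)"
  from mult obtain r s where
    r: "ev fps_const ?b p = ev fps_const a p + fps_X ^ Suc k * ?D p + fps_X ^ Suc (Suc k) * r" and
    s: "ev fps_const ?b q = ev fps_const a q + fps_X ^ Suc k * ?D q + fps_X ^ Suc (Suc k) * s"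
    by blast
  have D: "?D (p * q) = ev fps_const a p * ?D q + ev fps_const a q * ?D p"
    by (simp add: pdiff_mult fps_alg.ev_add fps_alg.ev_mult sum.distrib sum_distrib_left algebra_simps)
  have "ev fps_const ?b (p * q) = ev fps_const ?b p * ev fps_const ?b q"
    by (simp only: fps_alg.ev_mult)
  also have "\<dots> = ev fps_const a p * ev fps_const a q
      + fps_X ^ Suc k * (ev fps_const a p * ?D q + ev fps_const a q * ?D p)
      + fps_X ^ Suc (Suc k) * (r * (ev fps_const a q + fps_X ^ Suc k * ?D q + fps_X ^ Suc (Suc k) * s)
        + ev fps_const a p * s + fps_X ^ k * ?D p * ?D q + fps_X ^ Suc k * ?D p * s)"
    unfolding r s
    by (simp add: algebra_simps)
  finally show ?case unfolding D fps_alg.ev_mult by blast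
qed

lemma solve_linear:
  fixes M :: "'k::field mat"
  assumes "M \<in> carrier_mat n n" "Determinant.det M \<noteq> 0"
  obtains w where "\<And>i. i < n \<Longrightarrow> (\<Sum>j<n. M $$ (i, j) * w j) = c i"
proof -
  from det_non_zero_imp_unit[OF assms]
  obtain B where B: "B \<in> carrier_mat n n" "M * B = 1\<^sub>m n"
    by (auto simp: Units_def ring_mat_def)
  define x where "x = B *\<^sub>v vec n c"
  have x: "x \<in> carrier_vec n" unfolding x_def using B(1) by simp
  have "M *\<^sub>v x = (M * B) *\<^sub>v vec n c"
    unfolding x_def using assms(1) B(1) by (simp add: assoc_mult_mat_vec[of _ n n _ n])
  also have "\<dots> = vec n c" using B(2) by simp
  finally have *: "M *\<^sub>v x = vec n c" .
  show thesis
  proof (rule that[of "\<lambda>j. x $ j"])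
    fix i assume i: "i < n"
    have "c i = (M *\<^sub>v x) $ i" using i * by simp
    also have "\<dots> = (\<Sum>j<n. M $$ (i, j) * x $ j)"
      using i assms(1) x by (simp add: scalar_prod_def lessThan_atLeast0)
    finally show "(\<Sum>j<n. M $$ (i, j) * x $ j) = c i" ..
  qed
qed

text \<open>\<open>smooth_at\<close> does not ask for the chosen variables \<open>\<sigma> j\<close>
  to be distinct; a repetition would give two equal columns and determinant zero.\<close>

lemma det_nonzero_inj:
  fixes g :: "nat \<Rightarrow> nat \<Rightarrow> 'k::comm_ring_1"
  assumes "Determinant.det (mat n n (\<lambda>(i, j). g (\<sigma> j) i)) \<noteq> 0"
  shows "inj_on \<sigma> {..<n}"
proof (rule inj_onI)
  fix i j assume ij: "i \<in> {..<n}" "j \<in> {..<n}" "\<sigma> i = \<sigma> j"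
  show "i = j"
  proof (rule ccontr)
    assume "i \<noteq> j"
    have "Determinant.det (mat n n (\<lambda>(i, j). g (\<sigma> j) i)) = 0"
      by (rule det_identical_columns[of _ n i j]) (use ij \<open>i \<noteq> j\<close> in \<open>auto intro!: eq_vecI\<close>)
    with assms show False by simp
  qed
qed

text \<open>Newton iteration that gains one coefficient per step. The matrix of the linear system is
  always the Jacobian at the constant terms, and the variables outside the image of
  \<open>\<sigma>\<close> act as parameters that never change.\<close>

theorem hensel_system:
  fixes a0 :: "nat \<Rightarrow> 'k::field fps" and fs :: "'k mp list"
  defines "n \<equiv> length fs"
  assumes zero: "\<And>i. i < n \<Longrightarrow> fps_nth (ev fps_const a0 (fs ! i)) 0 = 0"
    and det: "Determinant.det (mat n n (\<lambda>(i, j). fps_nth (ev fps_const a0 (pdiff (\<sigma> j) (fs ! i))) 0)) \<noteq> 0"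
  obtains a where "\<And>v. fps_nth (a v) 0 = fps_nth (a0 v) 0" "\<And>v. v \<notin> \<sigma> ` {..<n} \<Longrightarrow> a v = a0 v"
    "\<And>i. i < n \<Longrightarrow> ev fps_const a (fs ! i) = 0"
proof -
  have inj: "inj_on \<sigma> {..<n}"
    by (rule det_nonzero_inj[of n "\<lambda>v i. fps_nth (ev fps_const a0 (pdiff v (fs ! i))) 0"]) (rule det)
  define M where "M = mat n n (\<lambda>(i, j). fps_nth (ev fps_const a0 (pdiff (\<sigma> j) (fs ! i))) 0)"
  define h where "h i = (SOME n. in_vars n (fs ! i))" for i
  have h: "in_vars (h i) (fs ! i)" for i unfolding h_def by (rule someI_ex[OF ex_in_vars])
  define N where "N = Max (insert 0 (h ` {..<n} \<union> (\<lambda>j. Suc (\<sigma> j)) ` {..<n}))"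
  have N: "in_vars N (fs ! i)" "\<sigma> i < N" if "i < n" for i
  proof -
    have "h i \<le> N" "Suc (\<sigma> i) \<le> N" unfolding N_def using that by auto
    thus "in_vars N (fs ! i)" "\<sigma> i < N" using in_vars_mono[OF h] by auto
  qed
  define P where "P k a \<longleftrightarrow> (\<forall>v. fps_nth (a v) 0 = fps_nth (a0 v) 0) \<and> (\<forall>v. v \<notin> \<sigma> ` {..<n} \<longrightarrow> a v = a0 v)
     \<and> (\<forall>i<n. fps_agree (Suc k) (ev fps_const a (fs ! i)) 0)" for k a
  have step: "\<exists>b. P (Suc k) b \<and> (\<forall>v. fps_agree (Suc k) (a v) (b v))" if P: "P k a" for k a
  proof -
    \<comment> \<open>By the Taylor formula the correction \<open>X ^ (k + 1) d\<close> changes the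
      coefficient of index \<open>k + 1\<close> by \<open>M w\<close>, so the negative of that
      coefficient is prescribed.\<close>
    obtain w where w: "\<And>i. i < n \<Longrightarrow> (\<Sum>j<n. M $$ (i, j) * w j) = - fps_nth (ev fps_const a (fs ! i)) (Suc k)"
      using solve_linear[of M n "\<lambda>i. - fps_nth (ev fps_const a (fs ! i)) (Suc k)"] det by (auto simp: M_def)
    define d where "d v = (if v \<in> \<sigma> ` {..<n} then w (the_inv_into {..<n} \<sigma> v) else 0)" for v
    have d: "d (\<sigma> j) = w j" if "j < n" for j
      using that inj by (simp add: d_def the_inv_into_f_f)
    define b where "b v = a v + fps_X ^ Suc k * fps_const (d v)" for v
    have b_agree: "fps_agree (Suc k) (a v) (b v)" for v
      by (simp add: b_def fps_agree_def fps_X_power_mult_nth del: power_Suc)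
    have "fps_agree (Suc (Suc k)) (ev fps_const b (fs ! i)) 0" if i: "i < n" for i
      unfolding fps_agree_def
    proof (intro allI impI)
      fix l assume l: "l < Suc (Suc k)"
      let ?D = "\<Sum>v<N. fps_const (d v) * ev fps_const a (pdiff v (fs ! i))"
      obtain r where r: "ev fps_const b (fs ! i) = ev fps_const a (fs ! i) + fps_X ^ Suc k * ?D + fps_X ^ Suc (Suc k) * r"
        using fps_ev_taylor[OF N(1)[OF i], of a k d] unfolding b_def by blast
      have eq: "fps_nth (ev fps_const b (fs ! i)) l = fps_nth (ev fps_const a (fs ! i)) l
          + (if l = Suc k then fps_nth ?D 0 else 0)"
        using l unfolding r by (auto simp: fps_X_power_mult_nth simp del: power_Suc)
      have "fps_nth ?D 0 = (\<Sum>v<N. d v * fps_nth (ev fps_const a (pdiff v (fs ! i))) 0)"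
        by (simp add: fps_sum_nth)
      also have "\<dots> = (\<Sum>v<N. d v * fps_nth (ev fps_const a0 (pdiff v (fs ! i))) 0)"
        using P by (simp add: fps_ev_nth_0 P_def)
      also have "\<dots> = (\<Sum>v\<in>\<sigma> ` {..<n}. d v * fps_nth (ev fps_const a0 (pdiff v (fs ! i))) 0)"
        by (rule sum.mono_neutral_right) (use N(2) in \<open>auto simp: d_def\<close>)
      also have "\<dots> = (\<Sum>j<n. M $$ (i, j) * w j)"
        using i by (subst sum.reindex[OF inj]) (auto simp: M_def d mult.commute intro!: sum.cong)
      also have "\<dots> = - fps_nth (ev fps_const a (fs ! i)) (Suc k)" by (rule w[OF i])
      finally show "fps_nth (ev fps_const b (fs ! i)) l = fps_nth 0 l"
        using eq P i l by (auto simp: P_def fps_agree_def less_Suc_eq)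
    qed
    moreover have "fps_nth (b v) 0 = fps_nth (a0 v) 0" for v
      using P by (simp add: b_def P_def)
    moreover have "b v = a0 v" if "v \<notin> \<sigma> ` {..<n}" for v
      using P that by (simp add: b_def P_def d_def)
    ultimately have "P (Suc k) b" by (simp add: P_def)
    with b_agree show ?thesis by blast
  qed
  have "P 0 a0" using zero by (auto simp: P_def fps_agree_def)
  hence "\<exists>A. \<forall>k. P k (A k) \<and> (\<forall>v. fps_agree (Suc k) (A k v) (A (Suc k) v))"
    using dependent_nat_choice[of P "\<lambda>k a b. \<forall>v. fps_agree (Suc k) (a v) (b v)"] step by blast
  then obtain A where A: "\<And>k. P k (A k)" "\<And>k v. fps_agree (Suc k) (A k v) (A (Suc k) v)" by blast
  have A_mono: "fps_nth (A (l + j) v) l = fps_nth (A l v) l" for l j v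
  proof (induction j)
    case (Suc j)
    show ?case using A(2)[of "l + j" v] Suc by (auto simp: fps_agree_def)
  qed simp
  \<comment> \<open>Stage \<open>l\<close> already has the final coefficient of index
    \<open>l\<close>, so the diagonal is the limit of the sequence.\<close>
  define a where "a v = Abs_fps (\<lambda>l. fps_nth (A l v) l)" for v
  have agree: "fps_agree (Suc k) (a v) (A k v)" for k v
    unfolding fps_agree_def a_def
  proof (intro allI impI)
    fix l assume "l < Suc k"
    thus "fps_nth (Abs_fps (\<lambda>l. fps_nth (A l v) l)) l = fps_nth (A k v) l"
      using A_mono[of l "k - l" v] by simp
  qed
  show thesis
  proof
    fix v show "fps_nth (a v) 0 = fps_nth (a0 v) 0"
      using A(1)[of 0] by (simp add: a_def P_def)
  next
    fix v assume "v \<notin> \<sigma> ` {..<n}"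
    hence "A k v = a0 v" for k using A(1)[of k] by (simp add: P_def)
    thus "a v = a0 v" by (intro fps_ext) (simp add: a_def)
  next
    fix i assume "i < n"
    show "ev fps_const a (fs ! i) = 0"
    proof (rule fps_ext)
      fix k
      have "fps_nth (ev fps_const a (fs ! i)) k = fps_nth (ev fps_const (A k) (fs ! i)) k"
        using fps_agree_ev[of "Suc k" a "A k" "fs ! i"] agree by (auto simp: fps_agree_def)
      also have "\<dots> = 0" using A(1)[of k] \<open>i < n\<close> by (auto simp: P_def fps_agree_def)
      finally show "fps_nth (ev fps_const a (fs ! i)) k = fps_nth 0 k" by simp
    qed
  qed
qed

subsection \<open>Derivations and separability\<close>

text \<open>The values may lie anywhere in the ambient field and not only in \<open>R\<close>:
  extending a derivation to \<open>R[x]\<close> requires a division by \<open>p'(x)\<close>.\<close>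

definition der_on :: "'a::field set \<Rightarrow> ('a \<Rightarrow> 'a) \<Rightarrow> bool" where
  "der_on R D \<longleftrightarrow> (\<forall>x\<in>R. \<forall>y\<in>R. D (x + y) = D x + D y \<and> D (x * y) = x * D y + y * D x)"

text \<open>The form of separable algebraicity that can be handed down a tower of
  adjunctions.\<close>

definition noder :: "'a::field set \<Rightarrow> 'a set \<Rightarrow> bool" where
  "noder B R \<longleftrightarrow> (\<forall>D. der_on R D \<and> (\<forall>b\<in>B. D b = 0) \<longrightarrow> (\<forall>x\<in>R. D x = 0))"

definition sep_over :: "'a::field set \<Rightarrow> 'a \<Rightarrow> bool" where
  "sep_over R x \<longleftrightarrow> (\<exists>p. pol_over R p \<and> poly p x = 0 \<and> poly (pderiv p) x \<noteq> 0)"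

definition alg_over :: "'a::field set \<Rightarrow> 'a \<Rightarrow> bool" where
  "alg_over R x \<longleftrightarrow> (\<exists>p. pol_over R p \<and> p \<noteq> 0 \<and> poly p x = 0)"

lemma sep_over_imp_alg_over: "sep_over R x \<Longrightarrow> alg_over R x"
  by (auto simp: sep_over_def alg_over_def)

text \<open>If every relation of \<open>x\<close> over \<open>R\<close> is inseparable, then \<open>p(x) \<mapsto> p'(x)\<close> is a well-defined
  derivation.\<close>

lemma noder_imp_sep_over:
  assumes R: "subr R" and B: "B \<subseteq> R" and nd: "noder B (adjoin R x)"
  shows "sep_over R x"
proof (rule ccontr)
  assume ns: "\<not> sep_over R x"
  define c where "c y = (SOME p. pol_over R p \<and> poly p x = y)" for y
  define D where "D y = poly (pderiv (c y)) x" for y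
  have D: "D (poly p x) = poly (pderiv p) x" if p: "pol_over R p" for p
  proof -
    have "pol_over R (c (poly p x)) \<and> poly (c (poly p x)) x = poly p x"
      unfolding c_def by (rule someI[of _ p]) (use p in simp)
    hence "pol_over R (c (poly p x) - p)" "poly (c (poly p x) - p) x = 0"
      using p pol_over_diff[OF R] by auto
    hence "poly (pderiv (c (poly p x) - p)) x = 0" using ns by (auto simp: sep_over_def)
    thus ?thesis by (simp add: D_def pderiv_diff)
  qed
  have "der_on (adjoin R x) D"
    unfolding der_on_def
  proof (intro ballI)
    fix y z assume "y \<in> adjoin R x" "z \<in> adjoin R x"
    then obtain p q where pq: "pol_over R p" "pol_over R q" "y = poly p x" "z = poly q x"
      by (auto simp: adjoin_def)
    have "D (y + z) = poly (pderiv (p + q)) x"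
      using D[OF pol_over_add[OF R pq(1,2)]] pq by simp
    moreover have "D (y * z) = poly (pderiv (p * q)) x"
      using D[OF pol_over_mult[OF R pq(1,2)]] pq by simp
    ultimately show "D (y + z) = D y + D z \<and> D (y * z) = y * D z + z * D y"
      using D pq by (simp add: pderiv_add pderiv_mult)
  qed
  moreover have "D b = 0" if "b \<in> B" for b
  proof -
    have "pol_over R [:b:]" using that B by (auto simp: pol_over_pCons_iff[OF R] pol_over_0[OF R])
    from D[OF this] show ?thesis by (simp add: pderiv_pCons)
  qed
  ultimately have "D x = 0" using nd adjoin_self[OF R] unfolding noder_def by blast
  moreover have "pol_over R [:0, 1:]"
    by (simp add: pol_over_pCons_iff[OF R] pol_over_0[OF R] subr_0[OF R] subr_1[OF R])
  from D[OF this] have "D x = 1" by (simp add: pderiv_pCons)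
  ultimately show False by simp
qed

section \<open>Minimal relations over subrings\<close>

lemma pol_pseudo_div:
  fixes p f :: "'a::field poly"
  assumes R: "subr R" and p: "pol_over R p" "p \<noteq> 0" and f: "pol_over R f"
  shows "\<exists>k q r. pol_over R q \<and> pol_over R r \<and> smult (Polynomial.lead_coeff p ^ k) f = q * p + r
     \<and> (r = 0 \<or> Polynomial.degree r < Polynomial.degree p)"
  using f
proof (induction "Polynomial.degree f" arbitrary: f rule: less_induct)
  case less
  let ?l = "Polynomial.lead_coeff p"
  show ?case
  proof (cases "f = 0 \<or> Polynomial.degree f < Polynomial.degree p")
    case True
    thus ?thesis using less.prems pol_over_0[OF R]
      by (intro exI[of _ 0] exI[of _ 0] exI[of _ f]) auto
  next
    case False
    have l: "?l \<in> R" "?l \<noteq> 0" using p by (auto simp: pol_over_def)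
    have lf: "Polynomial.lead_coeff f \<in> R" using less.prems by (auto simp: pol_over_def)
    define m where "m = Polynomial.monom (Polynomial.lead_coeff f) (Polynomial.degree f - Polynomial.degree p)"
    have m: "pol_over R m" unfolding m_def using lf by (rule pol_over_monom[OF R])
    define g where "g = smult ?l f - m * p"
    have g: "pol_over R g" unfolding g_def
      using pol_over_diff[OF R pol_over_smult[OF R l(1) less.prems] pol_over_mult[OF R m p(1)]] .
    have deg_mp: "Polynomial.degree (m * p) = Polynomial.degree f"
      using False p(2) by (simp add: m_def degree_mult_eq degree_monom_eq monom_eq_0_iff)
    have "Polynomial.degree g \<le> Polynomial.degree f"
      unfolding g_def using deg_mp by (intro degree_diff_le) auto
    moreover have "poly.coeff g (Polynomial.degree f) = 0"
      unfolding g_def using False by (simp add: m_def coeff_monom_mult)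
    ultimately have "g = 0 \<or> Polynomial.degree g < Polynomial.degree f"
      by (metis leading_coeff_0_iff le_neq_implies_less)
    hence "\<exists>k q r. pol_over R q \<and> pol_over R r \<and> smult (?l ^ k) g = q * p + r
       \<and> (r = 0 \<or> Polynomial.degree r < Polynomial.degree p)"
    proof
      assume "g = 0"
      thus ?thesis using pol_over_0[OF R]
        by (intro exI[of _ 0] exI[of _ 0] exI[of _ 0]) auto
    qed (rule less.hyps[OF _ g])
    then obtain k q r where kqr: "pol_over R q" "pol_over R r" "smult (?l ^ k) g = q * p + r"
       "r = 0 \<or> Polynomial.degree r < Polynomial.degree p" by blast
    have "smult (?l ^ Suc k) f = smult (?l ^ k) (g + m * p)"
      by (simp add: g_def mult.commute)
    also have "\<dots> = (q + smult (?l ^ k) m) * p + r"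
      using kqr(3) by (simp add: smult_add_right algebra_simps)
    finally show ?thesis using kqr(2,4) pol_over_add[OF R kqr(1) pol_over_smult[OF R subr_power[OF R l(1)] m]]
      by blast
  qed
qed

text \<open>Since \<open>R\<close> is only a ring, a relation of least degree takes the place of the
  minimal polynomial: pseudo-division makes it divide every other relation up to a power of its
  leading coefficient.\<close>

lemma minimal_relation:
  fixes x :: "'a::field"
  assumes R: "subr R" and alg: "alg_over R x"
  obtains p where "pol_over R p" "p \<noteq> 0" "poly p x = 0"
    "\<And>f. pol_over R f \<Longrightarrow> poly f x = 0
      \<Longrightarrow> \<exists>k q. pol_over R q \<and> smult (Polynomial.lead_coeff p ^ k) f = q * p"
proof -
  define Q where "Q d \<longleftrightarrow> (\<exists>p. pol_over R p \<and> p \<noteq> 0 \<and> poly p x = 0 \<and> Polynomial.degree p = d)" for d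
  have "\<exists>d. Q d" using alg by (auto simp: Q_def alg_over_def)
  then obtain d where d: "Q d" "\<And>e. e < d \<Longrightarrow> \<not> Q e" using exists_least_iff[of Q] by blast
  then obtain p where p: "pol_over R p" "p \<noteq> 0" "poly p x = 0" "Polynomial.degree p = d"
    by (auto simp: Q_def)
  show thesis
  proof (rule that[OF p(1-3)])
    fix f assume f: "pol_over R f" "poly f x = 0"
    obtain k q r where kqr: "pol_over R q" "pol_over R r" "smult (Polynomial.lead_coeff p ^ k) f = q * p + r"
      "r = 0 \<or> Polynomial.degree r < Polynomial.degree p"
      using pol_pseudo_div[OF R p(1,2) f(1)] by blast
    from arg_cong[OF kqr(3), of "\<lambda>h. poly h x"] have "poly r x = 0" using f p by simp
    hence "r = 0" using d(2) kqr(2,4) p(4) unfolding Q_def by blast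
    thus "\<exists>k q. pol_over R q \<and> smult (Polynomial.lead_coeff p ^ k) f = q * p" using kqr by auto
  qed
qed

text \<open>Differentiating \<open>l^k g = q p\<close> at \<open>x\<close> leaves
  \<open>l^k g'(x) = q(x) p'(x)\<close>, and the left side is nonzero for a separable relation
  \<open>g\<close>.\<close>

lemma minimal_relation_pderiv:
  fixes x :: "'a::field"
  assumes sep: "sep_over R x" and p: "poly p x = 0"
    and min: "\<And>f. pol_over R f \<Longrightarrow> poly f x = 0
      \<Longrightarrow> \<exists>k q. pol_over R q \<and> smult (Polynomial.lead_coeff p ^ k) f = q * p" and "p \<noteq> 0"
  shows "poly (pderiv p) x \<noteq> 0"
proof
  assume 0: "poly (pderiv p) x = 0"
  obtain g where g: "pol_over R g" "poly g x = 0" "poly (pderiv g) x \<noteq> 0"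
    using sep by (auto simp: sep_over_def)
  from min[OF g(1,2)] obtain k q where "smult (Polynomial.lead_coeff p ^ k) g = q * p" by blast
  from arg_cong[OF this, of "\<lambda>h. poly (pderiv h) x"] show False
    using 0 p g \<open>p \<noteq> 0\<close> by (simp add: pderiv_mult pderiv_smult)
qed

text \<open>A derivation of \<open>R\<close> extends to \<open>R[x]\<close> when \<open>x\<close> is separable: its value at \<open>x\<close> is forced by
  the minimal relation.\<close>

lemma noder_adjoinD:
  fixes x :: "'a::field"
  assumes R: "subr R" and B: "B \<subseteq> R" and nd: "noder B (adjoin R x)"
  shows "noder B R"
  unfolding noder_def
proof (intro allI impI)
  fix D assume "der_on R D \<and> (\<forall>b\<in>B. D b = 0)"
  hence D: "der_on R D" and DB: "\<And>b. b \<in> B \<Longrightarrow> D b = 0" by auto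
  have D_add: "D (y + z) = D y + D z" and D_mult: "D (y * z) = y * D z + z * D y"
    if "y \<in> R" "z \<in> R" for y z using D that by (auto simp: der_on_def)
  have D_0: "D 0 = 0" using D_add[OF subr_0[OF R] subr_0[OF R]] by (metis add_0 add_right_cancel)
  have sep: "sep_over R x" by (rule noder_imp_sep_over[OF R B nd])
  obtain p where p: "pol_over R p" "p \<noteq> 0" "poly p x = 0"
    and p_min: "\<And>f. pol_over R f \<Longrightarrow> poly f x = 0
      \<Longrightarrow> \<exists>k q. pol_over R q \<and> smult (Polynomial.lead_coeff p ^ k) f = q * p"
    using minimal_relation[OF R sep_over_imp_alg_over[OF sep]] by blast
  have p': "poly (pderiv p) x \<noteq> 0" by (rule minimal_relation_pderiv[OF sep p(3) p_min p(2)])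
  \<comment> \<open>Applies \<open>D\<close> to the coefficients and evaluates at \<open>x\<close>.
    It is a function of the polynomial \<open>f\<close>, as the value \<open>f(x)\<close> alone does
    not determine it.\<close>
  define d where "d f = poly (map_poly D f) x" for f
  have d_pCons: "d (pCons c f) = D c + x * d f" for c f
    by (cases "pCons c f = 0") (auto simp: d_def map_poly_pCons D_0)
  have d_0: "d 0 = 0" by (simp add: d_def)
  have d_add: "d (f + g) = d f + d g" if "pol_over R f" "pol_over R g" for f g
    using that
  proof (induction f g rule: poly_induct2)
    case (pCons a f b g)
    thus ?case by (simp add: d_pCons pol_over_pCons_iff[OF R] D_add algebra_simps)
  qed (simp add: d_0)
  have d_smult: "d (smult c f) = c * d f + D c * poly f x" if "c \<in> R" "pol_over R f" for c f
    using that(2)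
  proof (induction f)
    case (pCons a f)
    thus ?case using that(1) by (simp add: d_pCons pol_over_pCons_iff[OF R] D_mult algebra_simps)
  qed (simp add: d_0)
  have d_mult: "d (f * g) = poly f x * d g + poly g x * d f" if "pol_over R f" "pol_over R g" for f g
    using that
  proof (induction f)
    case (pCons a f)
    hence af: "a \<in> R" "pol_over R f" by (auto simp: pol_over_pCons_iff[OF R])
    have "d (pCons a f * g) = d (smult a g + pCons 0 (f * g))" by simp
    also have "\<dots> = d (smult a g) + d (pCons 0 (f * g))"
      using af pCons.prems by (intro d_add pol_over_smult[OF R])
        (auto simp: pol_over_pCons_iff[OF R] subr_0[OF R] pol_over_mult[OF R])
    finally show ?case using af pCons by (simp add: d_pCons d_smult D_0 algebra_simps)
  qed (simp add: d_0)
  \<comment> \<open>Chosen so that \<open>\<delta> p = 0\<close>. Then \<open>\<delta>\<close> kills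
    every relation of \<open>x\<close>, which is a multiple of \<open>p\<close> up to a power of the
    leading coefficient, and so descends to \<open>R[x]\<close>.\<close>
  define t where "t = - d p / poly (pderiv p) x"
  define \<delta> where "\<delta> f = d f + poly (pderiv f) x * t" for f
  have \<delta>_p: "\<delta> p = 0" using p' by (simp add: \<delta>_def t_def)
  have \<delta>_add: "\<delta> (f + g) = \<delta> f + \<delta> g" if "pol_over R f" "pol_over R g" for f g
    using that by (simp add: \<delta>_def d_add pderiv_add algebra_simps)
  have \<delta>_mult: "\<delta> (f * g) = poly f x * \<delta> g + poly g x * \<delta> f" if "pol_over R f" "pol_over R g" for f g
    using that by (simp add: \<delta>_def d_mult pderiv_mult algebra_simps)
  have const: "pol_over R [:c:]" "\<delta> [:c:] = D c" if "c \<in> R" for c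
    using that by (auto simp: pol_over_pCons_iff[OF R] pol_over_0[OF R] \<delta>_def d_pCons d_0 pderiv_pCons)
  have \<delta>_0: "\<delta> f = 0" if f: "pol_over R f" "poly f x = 0" for f
  proof -
    let ?l = "Polynomial.lead_coeff p"
    from p_min[OF f] obtain k q where q: "pol_over R q" "smult (?l ^ k) f = q * p" by blast
    have l: "?l ^ k \<in> R" using p(1) subr_power[OF R] by (auto simp: pol_over_def)
    have "?l ^ k * \<delta> f = \<delta> ([:?l ^ k:] * f)"
      using \<delta>_mult[OF const(1)[OF l] f(1)] f(2) by simp
    also have "\<dots> = \<delta> (q * p)" using q(2) by simp
    also have "\<dots> = 0" using \<delta>_mult[OF q(1) p(1)] \<delta>_p p(3) by simp
    finally show ?thesis using p(2) by simp
  qed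
  define c where "c y = (SOME p. pol_over R p \<and> poly p x = y)" for y
  have E: "\<delta> (c (poly f x)) = \<delta> f" if f: "pol_over R f" for f
  proof -
    have cf: "pol_over R (c (poly f x)) \<and> poly (c (poly f x)) x = poly f x"
      unfolding c_def by (rule someI[of _ f]) (use f in simp)
    have "\<delta> (c (poly f x)) = \<delta> ((c (poly f x) - f) + f)" by simp
    also have "\<dots> = \<delta> (c (poly f x) - f) + \<delta> f"
      using cf f by (intro \<delta>_add pol_over_diff[OF R]) auto
    also have "\<delta> (c (poly f x) - f) = 0"
      using cf f by (intro \<delta>_0 pol_over_diff[OF R]) auto
    finally show ?thesis by simp
  qed
  have "der_on (adjoin R x) (\<lambda>y. \<delta> (c y))"
    unfolding der_on_def
  proof (intro ballI)
    fix y z assume "y \<in> adjoin R x" "z \<in> adjoin R x"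
    then obtain p q where pq: "pol_over R p" "pol_over R q" "y = poly p x" "z = poly q x"
      by (auto simp: adjoin_def)
    have "\<delta> (c (y + z)) = \<delta> (p + q)" "\<delta> (c (y * z)) = \<delta> (p * q)"
      using E[OF pol_over_add[OF R pq(1,2)]] E[OF pol_over_mult[OF R pq(1,2)]] pq by auto
    thus "\<delta> (c (y + z)) = \<delta> (c y) + \<delta> (c z) \<and> \<delta> (c (y * z)) = y * \<delta> (c z) + z * \<delta> (c y)"
      using E pq \<delta>_add \<delta>_mult by simp
  qed
  moreover have E_const: "\<delta> (c y) = D y" if "y \<in> R" for y
    using E[OF const(1)[OF that]] const(2)[OF that] by simp
  moreover have "\<forall>b\<in>B. \<delta> (c b) = 0" using E_const DB B by auto
  ultimately have "\<forall>y\<in>adjoin R x. \<delta> (c y) = 0" using nd unfolding noder_def by blast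
  thus "\<forall>y\<in>R. D y = 0" using E_const adjoin_incl[OF R, of x] by (metis subsetD)
qed

subsection \<open>Algebraic extensions inside a field and primitive elements\<close>

abbreviation Rg :: "'a::field ring" where "Rg \<equiv> ring_on UNIV"

lemma field_Rg: "field (Rg :: 'a::field ring)"
proof -
  have "cring (Rg :: 'a ring)"
  proof (rule cringI)
    show "abelian_group (Rg :: 'a ring)"
    proof (rule abelian_groupI)
      fix x :: 'a
      show "\<exists>y\<in>carrier Rg. y \<oplus>\<^bsub>Rg\<^esub> x = \<zero>\<^bsub>Rg\<^esub>"
        by (rule bexI[of _ "- x"]) (auto simp: ring_on_def)
    qed (auto simp: ring_on_def)
    show "comm_monoid (Rg :: 'a ring)"
      by (rule comm_monoidI) (auto simp: ring_on_def)
  qed (auto simp: ring_on_def algebra_simps)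
  moreover have "Units (Rg :: 'a ring) = carrier Rg - {\<zero>\<^bsub>Rg\<^esub>}"
  proof -
    have "x \<in> Units Rg" if "x \<noteq> 0" for x :: 'a
      unfolding Units_def using that by (auto simp: ring_on_def intro!: exI[of _ "inverse x"])
    moreover have "0 \<notin> Units (Rg :: 'a ring)" by (auto simp: Units_def ring_on_def)
    ultimately show ?thesis by (auto simp: ring_on_def)
  qed
  ultimately show ?thesis by (rule cring.cring_fieldI)
qed

interpretation Rg: domain "Rg :: 'a::field ring"
  using field_Rg by (rule field.axioms(1))

lemma Rg_simps: "carrier (Rg :: 'a::field ring) = UNIV" "monoid.mult (Rg :: 'a ring) = (*)"
  "add (Rg :: 'a ring) = (+)" "one (Rg :: 'a ring) = 1" "zero (Rg :: 'a ring) = 0"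
  by (auto simp: ring_on_def)

lemma Rg_uminus: "\<ominus>\<^bsub>Rg\<^esub> x = - x"
proof -
  have "- x \<oplus>\<^bsub>Rg\<^esub> x = \<zero>\<^bsub>Rg\<^esub>" by (simp add: Rg_simps)
  from Rg.minus_equality[OF this] show ?thesis by (simp add: Rg_simps)
qed

lemma Rg_inv: "x \<noteq> 0 \<Longrightarrow> inv\<^bsub>Rg\<^esub> x = inverse x"
  by (rule Rg.comm_inv_char) (auto simp: Rg_simps)

lemma Rg_pow: "x [^]\<^bsub>Rg\<^esub> (n::nat) = x ^ n"
  by (induction n) (auto simp: Rg_simps mult.commute)

definition subf :: "'a::field set \<Rightarrow> bool" where
  "subf E \<longleftrightarrow> subr E \<and> (\<forall>x\<in>E. inverse x \<in> E)"

lemma subf_imp_subr: "subf E \<Longrightarrow> subr E"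
  by (simp add: subf_def)

lemma subr_iff_subring: "subr E \<longleftrightarrow> subring E (Rg :: 'a::field ring)"
proof
  assume E: "subr E"
  show "subring E Rg"
    by (rule Rg.subringI)
       (auto simp: Rg_simps Rg_uminus intro: subr_1[OF E] subr_add[OF E] subr_mult[OF E] subr_uminus[OF E])
next
  assume E: "subring E Rg"
  show "subr E"
    using subringE[OF E] by (auto simp: subr_def Rg_simps Rg_uminus)
qed

lemma subf_iff_subfield: "subf E \<longleftrightarrow> subfield E (Rg :: 'a::field ring)"
proof
  assume E: "subf E"
  show "subfield E Rg"
  proof (rule field.subfieldI'[OF field_Rg])
    show "subring E Rg" using E by (simp add: subf_def subr_iff_subring)
    fix k assume "k \<in> E - {\<zero>\<^bsub>Rg\<^esub>}"
    thus "inv\<^bsub>Rg\<^esub> k \<in> E" using E by (auto simp: Rg_inv Rg_simps subf_def)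
  qed
next
  assume E: "subfield E Rg"
  have s: "subr E" using subfieldE(1)[OF E] by (simp add: subr_iff_subring)
  moreover have "inverse x \<in> E" if "x \<in> E" for x
  proof (cases "x = 0")
    case False
    thus ?thesis using Rg.subfield_m_inv(1)[OF E, of x] that by (simp add: Rg_inv Rg_simps)
  qed (use s subr_0 in auto)
  ultimately show "subf E" by (simp add: subf_def)
qed

lemma adjoin_eq_simple_extension:
  assumes E: "subr E"
  shows "adjoin E x = Rg.simple_extension E x"
proof
  show "adjoin E x \<subseteq> Rg.simple_extension E x"
  proof
    fix y assume "y \<in> adjoin E x"
    then obtain p where "pol_over E p" "y = poly p x" by (auto simp: adjoin_def)
    moreover have "poly p x \<in> Rg.simple_extension E x" if "pol_over E p" for p
      using that
    proof (induction p)
      case 0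
      show ?case using Rg.simple_extension.zero[of E x] by (simp add: Rg_simps)
    next
      case (pCons a p)
      thus ?case using Rg.simple_extension.lin[of "poly p x" E x a]
        by (simp add: pol_over_pCons_iff[OF E] Rg_simps algebra_simps)
    qed
    ultimately show "y \<in> Rg.simple_extension E x" by simp
  qed
  show "Rg.simple_extension E x \<subseteq> adjoin E x"
  proof
    fix y assume "y \<in> Rg.simple_extension E x"
    thus "y \<in> adjoin E x"
    proof (induction rule: Rg.simple_extension.induct)
      case zero
      show ?case using subr_0[OF subr_adjoin[OF E]] by (simp add: Rg_simps)
    next
      case (lin k1 k2)
      thus ?case using subr_adjoin[OF E] adjoin_incl[OF E, of x] adjoin_self[OF E, of x]
        by (auto simp: Rg_simps intro!: subr_add subr_mult)
    qed
  qed
qed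

text \<open>Coefficient lists for \<open>eval\<close> start with the leading coefficient, those for
  \<open>Poly\<close> with the constant one.\<close>

lemma Rg_eval: "Rg.eval cs x = poly (Poly (rev cs)) x"
  by (induction cs) (auto simp: Rg_simps Rg_pow Poly_append poly_monom algebra_simps)

lemma alg_over_iff_algebraic:
  assumes E: "subf E"
  shows "alg_over E x \<longleftrightarrow> (Rg.algebraic over E) x"
proof
  assume "alg_over E x"
  then obtain p where p: "pol_over E p" "p \<noteq> 0" "poly p x = 0" by (auto simp: alg_over_def)
  let ?l = "rev (coeffs p)"
  have "set (coeffs p) \<subseteq> E" using p(1) by (auto simp: pol_over_def coeffs_def)
  moreover have "hd ?l \<noteq> 0" "?l \<noteq> []"
    using p(2) by (auto simp: hd_rev last_coeffs_eq_coeff_degree)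
  ultimately have "?l \<in> carrier (univ_poly Rg E)"
    by (auto simp: univ_poly_def polynomial_def Rg_simps)
  moreover have "Rg.eval ?l x = \<zero>\<^bsub>Rg\<^esub>" using p(3) by (simp add: Rg_eval Rg_simps)
  ultimately show "(Rg.algebraic over E) x" using \<open>?l \<noteq> []\<close> by (intro Rg.algebraicI) auto
next
  assume "(Rg.algebraic over E) x"
  then obtain l where l: "l \<in> carrier (univ_poly Rg E)" "l \<noteq> []" "Rg.eval l x = \<zero>\<^bsub>Rg\<^esub>"
    using Rg.algebraicE[of E x] subfieldE(1) E by (auto simp: subf_iff_subfield Rg_simps)
  hence l': "hd l \<noteq> 0" "set l \<subseteq> E" by (auto simp: univ_poly_def polynomial_def Rg_simps)
  have "poly.coeff (Poly (rev l)) (length l - 1) = hd l"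
    using l(2) by (simp add: nth_default_def rev_nth hd_conv_nth)
  hence "Poly (rev l) \<noteq> 0" using l'(1) by (metis coeff_0)
  moreover have "pol_over E (Poly (rev l))"
    using l'(2) subr_0[OF subf_imp_subr[OF E]]
    by (auto simp: pol_over_def nth_default_def) (metis length_rev nth_mem set_rev subsetD)
  ultimately show "alg_over E x" using l(3) by (auto simp: alg_over_def Rg_eval Rg_simps)
qed

lemma subf_adjoin:
  assumes "subf E" "alg_over E x"
  shows "subf (adjoin E x)"
  using Rg.simple_extension_is_subfield[of E x] assms
  by (simp add: alg_over_iff_algebraic adjoin_eq_simple_extension subf_imp_subr subf_iff_subfield Rg_simps)

text \<open>Finite dimension is inherited in towers, so \<open>E[x][y]\<close> is finite over
  \<open>E\<close> and all its elements are algebraic.\<close>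

lemma alg_over_trans:
  assumes E: "subf E" and x: "alg_over E x" and y: "alg_over (adjoin E x) y"
    and z: "z \<in> adjoin (adjoin E x) y"
  shows "alg_over E z"
proof -
  let ?F = "adjoin E x" and ?L = "adjoin (adjoin E x) y"
  have F: "subf ?F" by (rule subf_adjoin[OF E x])
  have E': "subfield E Rg" and F': "subfield ?F Rg"
    using E F by (simp_all add: subf_iff_subfield)
  have "Rg.finite_dimension E ?F"
    using Rg.finite_dimension_simple_extension[OF E', of x] x E
    by (simp add: alg_over_iff_algebraic adjoin_eq_simple_extension[OF subf_imp_subr[OF E]] Rg_simps)
  moreover have "Rg.finite_dimension ?F ?L"
    using Rg.finite_dimension_simple_extension[OF F', of y] y F
    by (simp add: alg_over_iff_algebraic adjoin_eq_simple_extension[OF subf_imp_subr[OF F]] Rg_simps)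
  ultimately have "Rg.finite_dimension E ?L"
    by (rule Rg.telescopic_base_dim(1)[OF E' F'])
  moreover have "subring ?L Rg"
    using subr_adjoin[OF subf_imp_subr[OF F]] by (simp add: subr_iff_subring)
  ultimately have "(Rg.algebraic over E) z"
    using Rg.finite_dimension_imp_algebraic[OF E'] z by blast
  thus ?thesis by (simp add: alg_over_iff_algebraic[OF E])
qed

section \<open>Primitive elements by comparison of roots in an algebraic closure\<close>

lemma to_ac_map_poly_add: "map_poly to_ac (p + q) = map_poly to_ac p + map_poly to_ac q"
  by (intro poly_eqI) (simp add: coeff_map_poly)

lemma to_ac_map_poly_uminus: "map_poly to_ac (- p) = - map_poly to_ac p"
  by (intro poly_eqI) (simp add: coeff_map_poly)

lemma to_ac_map_poly_smult: "map_poly to_ac (smult c p) = smult (to_ac c) (map_poly to_ac p)"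
  by (intro poly_eqI) (simp add: coeff_map_poly)

lemma to_ac_map_poly_mult: "map_poly to_ac (p * q) = map_poly to_ac p * map_poly to_ac q"
  by (intro poly_eqI) (simp add: coeff_map_poly coeff_mult to_ac_sum)

lemmas to_ac_map_poly_simps = to_ac_map_poly_add to_ac_map_poly_uminus to_ac_map_poly_smult to_ac_map_poly_mult

lemma to_ac_poly: "poly (map_poly to_ac p) (to_ac x) = to_ac (poly p x)"
  by (induction p) (simp_all add: map_poly_pCons)

lemma to_ac_pderiv: "pderiv (map_poly to_ac p) = map_poly to_ac (pderiv p)"
  by (intro poly_eqI) (simp add: coeff_map_poly coeff_pderiv)

text \<open>The common roots of the minimal relation of \<open>y\<close> and of \<open>f(\<theta> - cX)\<close>, where \<open>f\<close> is a relation of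
  \<open>x\<close> and \<open>\<theta> = x + cy\<close>, reduce to \<open>y\<close> for all but finitely many \<open>c\<close>.\<close>

lemma primitive_element:
  fixes E C :: "'a::field set"
  assumes E: "subf E" and C: "C \<subseteq> E" "infinite C" and x: "alg_over E x" and y: "sep_over E y"
    and alg: "\<And>c. c \<in> C \<Longrightarrow> alg_over E (x + c * y)"
  obtains c where "c \<in> C" "y \<in> adjoin E (x + c * y)" "x \<in> adjoin E (x + c * y)"
proof -
  have E': "subr E" by (rule subf_imp_subr[OF E])
  obtain f where f: "pol_over E f" "f \<noteq> 0" "poly f x = 0" using x by (auto simp: alg_over_def)
  obtain g where g: "pol_over E g" "poly g y = 0" "poly (pderiv g) y \<noteq> 0" using y by (auto simp: sep_over_def)
  have g0: "g \<noteq> 0" using g(3) by auto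
  define cf where "cf = map_poly to_ac f"
  define cg where "cg = map_poly to_ac g"
  have cfg0: "cf \<noteq> 0" "cg \<noteq> 0" using f(2) g0 by (auto simp: cf_def cg_def map_poly_eq_0_iff)
  \<comment> \<open>These are the \<open>c\<close> with \<open>x + c y = u + c v\<close> for a root
    \<open>u\<close> of \<open>f\<close> and a root \<open>v\<close> of \<open>g\<close> other than
    \<open>y\<close>. Pairs with \<open>v = y\<close> contribute the value \<open>0\<close> of a
    division by zero, one more exclusion.\<close>
  define bad where "bad = (\<lambda>(u, v). (u - to_ac x) / (to_ac y - v)) ` ({u. poly cf u = 0} \<times> {v. poly cg v = 0})"
  have "finite bad" unfolding bad_def
    by (intro finite_imageI finite_cartesian_product poly_roots_finite cfg0)
  hence "finite (to_ac -` bad)" by (intro finite_vimageI inj_to_ac)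
  then obtain c where c: "c \<in> C" "to_ac c \<notin> bad"
    using C(2) by (metis finite_subset subsetI vimageI2)
  define \<theta> where "\<theta> = x + c * y"
  let ?F = "adjoin E \<theta>"
  have F: "subf ?F" using subf_adjoin[OF E alg[OF c(1)]] by (simp add: \<theta>_def)
  have F': "subr ?F" by (rule subf_imp_subr[OF F])
  have EF: "E \<subseteq> ?F" by (rule adjoin_incl[OF E'])
  have \<theta>: "\<theta> \<in> ?F" by (rule adjoin_self[OF E'])
  have cF: "c \<in> ?F" using c C EF by blast
  have mono: "pol_over ?F p" if "pol_over E p" for p using that EF by (auto simp: pol_over_def)
  have sepF: "sep_over ?F y" using g mono by (auto simp: sep_over_def)
  obtain p where p: "pol_over ?F p" "p \<noteq> 0" "poly p y = 0"
    and p_min: "\<And>f. pol_over ?F f \<Longrightarrow> poly f y = 0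
      \<Longrightarrow> \<exists>k q. pol_over ?F q \<and> smult (Polynomial.lead_coeff p ^ k) f = q * p"
    using minimal_relation[OF F' sep_over_imp_alg_over[OF sepF]] by blast
  have p': "poly (pderiv p) y \<noteq> 0" by (rule minimal_relation_pderiv[OF sepF p(3) p_min p(2)])
  define cp where "cp = map_poly to_ac p"
  have root: "poly (map_poly to_ac q) v = 0" if q: "pol_over ?F q" "poly q y = 0" and v: "poly cp v = 0" for q v
  proof -
    obtain k r where "smult (Polynomial.lead_coeff p ^ k) q = r * p" using p_min[OF q] by blast
    hence "map_poly to_ac (smult (Polynomial.lead_coeff p ^ k) q) = map_poly to_ac (r * p)" by simp
    hence "smult (to_ac (Polynomial.lead_coeff p ^ k)) (map_poly to_ac q) = map_poly to_ac r * cp"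
      unfolding cp_def by (simp add: to_ac_map_poly_simps)
    from arg_cong[OF this, of "\<lambda>h. poly h v"] show ?thesis using v p(2) by simp
  qed
  define h where "h = pcompose f [:\<theta>, - c:]"
  have h_over: "pol_over ?F h"
    unfolding h_def using f(1)
  proof (induction f)
    case (pCons a f)
    thus ?case using EF \<theta> cF
      by (auto simp: pcompose_pCons pol_over_pCons_iff[OF E'] pol_over_pCons_iff[OF F'] pol_over_0[OF F']
          intro!: pol_over_add[OF F'] pol_over_smult[OF F'] pol_over_uminus[OF F'] subr_0[OF F'])
  qed (simp add: pol_over_0[OF F'])
  have h_root: "poly h y = 0" using f(3) by (simp add: h_def poly_pcompose \<theta>_def algebra_simps)
  have only: "v = to_ac y" if v: "poly cp v = 0" for v
  proof (rule ccontr)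
    assume ne: "v \<noteq> to_ac y"
    have 1: "poly cg v = 0" using root[OF mono[OF g(1)] g(2) v] by (simp add: cg_def)
    have "poly (map_poly to_ac h) v = 0" by (rule root[OF h_over h_root v])
    also have "poly (map_poly to_ac h) v = poly cf (to_ac \<theta> - to_ac c * v)"
      unfolding h_def cf_def
      by (induction f) (simp_all add: pcompose_pCons map_poly_pCons to_ac_map_poly_simps algebra_simps)
    finally have "to_ac \<theta> - to_ac c * v \<in> {u. poly cf u = 0}" by simp
    moreover have "(to_ac \<theta> - to_ac c * v - to_ac x) / (to_ac y - v) = to_ac c"
      using ne by (simp add: \<theta>_def field_simps)
    ultimately have "to_ac c \<in> bad" unfolding bad_def using 1 by (force simp: image_iff)
    thus False using c(2) by simp
  qed
  have cp0: "cp \<noteq> 0" using p(2) by (simp add: cp_def map_poly_eq_0_iff)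
  have "poly cp (to_ac y) = to_ac (poly p y)" unfolding cp_def by (rule to_ac_poly)
  hence "poly cp (to_ac y) = 0" using p(3) by simp
  then obtain r where r: "cp = [:- to_ac y, 1:] * r" by (auto simp: poly_eq_0_iff_dvd)
  \<comment> \<open>A root of the cofactor \<open>r\<close> would again be \<open>y\<close> and
    hence a double root of \<open>p\<close>, against separability; over the algebraically closed
    field \<open>r\<close> is therefore constant.\<close>
  have "Polynomial.degree r = 0"
  proof (rule ccontr)
    assume "Polynomial.degree r \<noteq> 0"
    then obtain v where v: "poly r v = 0" using alg_closed_imp_poly_has_root[of r] by auto
    hence "poly cp v = 0" using r by simp
    hence "poly r (to_ac y) = 0" using only v by blast
    hence "poly (pderiv cp) (to_ac y) = 0" unfolding r by (simp add: pderiv_mult pderiv_pCons del: mult_pCons_left)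
    moreover have "poly (pderiv cp) (to_ac y) = to_ac (poly (pderiv p) y)"
      unfolding cp_def by (simp add: to_ac_pderiv to_ac_poly)
    ultimately show False using p' by simp
  qed
  hence "Polynomial.degree cp \<le> 1" using degree_mult_le[of "[:- to_ac y, 1:]" r] r by simp
  moreover have "Polynomial.degree cp = Polynomial.degree p" unfolding cp_def by (rule degree_map_poly) simp
  ultimately have deg: "Polynomial.degree p \<le> 1" by simp
  hence eq: "p = [:poly.coeff p 0, poly.coeff p 1:]"
    by (intro poly_eqI) (auto simp: coeff_pCons coeff_eq_0 split: nat.splits)
  have c1: "poly.coeff p 1 \<noteq> 0"
  proof
    assume "poly.coeff p 1 = 0"
    with eq have "p = [:poly.coeff p 0:]" by simp
    with p(3) have "p = 0" by (metis poly_pCons poly_0 mult_zero_right add_0_right pCons_0_0)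
    with p(2) show False by simp
  qed
  have "poly.coeff p 0 + y * poly.coeff p 1 = 0" using p(3) by (subst (asm) eq) simp
  hence "y = - poly.coeff p 0 * inverse (poly.coeff p 1)" using c1 by (simp add: field_simps eq_neg_iff_add_eq_0)
  moreover have "- poly.coeff p 0 * inverse (poly.coeff p 1) \<in> ?F"
    using p(1) F F' by (auto simp: pol_over_def subf_def intro!: subr_mult[OF F'] subr_uminus[OF F'])
  ultimately have y: "y \<in> ?F" by simp
  have "x = \<theta> - c * y" by (simp add: \<theta>_def)
  hence "x \<in> ?F" using subr_diff[OF F' \<theta> subr_mult[OF F' cF y]] by simp
  with y c(1) show thesis using that by (simp add: \<theta>_def)
qed

section \<open>Towers of simple adjunctions \<open>R k = E[T 0, ..., T (k - 1)]\<close>\<close>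

context
  fixes E :: "'a::field set" and R :: "nat \<Rightarrow> 'a set" and T :: "nat \<Rightarrow> 'a"
  assumes E: "subf E" and R0: "R 0 = E" and RSuc: "\<And>k. R (Suc k) = adjoin (R k) (T k)"
begin

lemma chain_subr: "subr (R k)"
  by (induction k) (auto simp: R0 RSuc intro: subr_adjoin subf_imp_subr[OF E])

lemma chain_mono: "k \<le> l \<Longrightarrow> R k \<subseteq> R l"
  by (rule lift_Suc_mono_le[of R]) (auto simp: RSuc intro: subsetD[OF adjoin_incl[OF chain_subr]])

lemma chain_base: "E \<subseteq> R k"
  using chain_mono[of 0 k] by (simp add: R0)

lemma chain_gen: "k < l \<Longrightarrow> T k \<in> R l"
  using chain_mono[of "Suc k" l] adjoin_self[OF chain_subr, of "T k" k] by (auto simp: RSuc)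

text \<open>Descends one generator at a time. The intermediate \<open>R k\<close> are treated as
  rings, because they are not yet known to be fields.\<close>

lemma chain_noder: "noder E (R n) \<Longrightarrow> k \<le> n \<Longrightarrow> noder E (R k)"
proof (induction n)
  case (Suc n)
  show ?case
  proof (cases "k = Suc n")
    case False
    have "noder E (R n)"
      using Suc.prems(1) by (auto simp: RSuc intro: noder_adjoinD[OF chain_subr chain_base])
    thus ?thesis using Suc False by simp
  qed (use Suc.prems in simp)
qed simp

lemma chain_der_zero:
  assumes "der_on (R n) D" "\<And>e. e \<in> E \<Longrightarrow> D e = 0" "\<And>k. k < n \<Longrightarrow> D (T k) = 0" "x \<in> R n"
  shows "D x = 0"
proof -
  have "\<forall>x\<in>R k. D x = 0" if "k \<le> n" for k
    using that
  proof (induction k)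
    case (Suc k)
    have add: "D (y + z) = D y + D z" and mult: "D (y * z) = y * D z + z * D y"
      if "y \<in> R (Suc k)" "z \<in> R (Suc k)" for y z
      using assms(1) chain_mono[OF Suc.prems] that unfolding der_on_def by blast+
    have S: "subr (R (Suc k))" by (rule chain_subr)
    have T: "T k \<in> R (Suc k)" by (rule chain_gen) simp
    have "poly p (T k) \<in> R (Suc k) \<and> D (poly p (T k)) = 0" if "pol_over (R k) p" for p
      using that
    proof (induction p)
      case 0
      show ?case using Suc subr_0[OF chain_subr] by simp
    next
      case (pCons a p)
      hence a: "a \<in> R k" "a \<in> R (Suc k)" "pol_over (R k) p"
        using chain_mono[of k "Suc k"] by (auto simp: pol_over_pCons_iff[OF chain_subr])
      have "T k * poly p (T k) \<in> R (Suc k)" using a pCons T by (intro subr_mult[OF S]) auto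
      thus ?case using a pCons T Suc assms(3)[of k] by (auto simp: add mult intro: subr_add[OF S])
    qed
    thus ?case by (auto simp: RSuc adjoin_def)
  qed (use assms(2) in \<open>simp add: R0\<close>)
  thus ?thesis using assms(4) by blast
qed

text \<open>\<open>V\<close> tracks an extra property of the primitive element. It is used with the
  power series among the Laurent series, so that the primitive element has no pole.\<close>

lemma primitive_element_chain:
  assumes C: "C \<subseteq> E" "infinite C" and nd: "noder E (R n)"
    and V: "0 \<in> V" "\<And>k x c. k < n \<Longrightarrow> x \<in> V \<Longrightarrow> c \<in> C \<Longrightarrow> T k + c * x \<in> V"
  obtains \<theta> where "\<theta> \<in> V" "sep_over E \<theta>" "R n = adjoin E \<theta>"
proof -
  have E': "subr E" by (rule subf_imp_subr[OF E])
  have sep: "sep_over E \<theta>" if "R k = adjoin E \<theta>" "k \<le> n" for k \<theta>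
    using noder_imp_sep_over[OF E' order_refl, of \<theta>] chain_noder[OF nd that(2)] that(1) by simp
  have "\<exists>\<theta>\<in>V. R k = adjoin E \<theta>" if "k \<le> n" for k
    using that
  proof (induction k)
    case 0
    have "adjoin E 0 = E"
      using adjoin_incl[OF E', of 0] adjoin_least[OF E' order_refl subr_0[OF E']] by blast
    thus ?case using V(1) R0 by auto
  next
    case (Suc k)
    then obtain \<beta> where \<beta>: "\<beta> \<in> V" "R k = adjoin E \<beta>" by auto
    have sep\<beta>: "sep_over E \<beta>" using sep[OF \<beta>(2)] Suc.prems by simp
    hence alg\<beta>: "alg_over E \<beta>" by (rule sep_over_imp_alg_over)
    have "noder E (adjoin (R k) (T k))" using chain_noder[OF nd Suc.prems] by (simp add: RSuc)
    hence algT: "alg_over (adjoin E \<beta>) (T k)"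
      using noder_imp_sep_over[OF chain_subr chain_base] \<beta>(2) sep_over_imp_alg_over by metis
    have alg: "alg_over E z" if "z \<in> R (Suc k)" for z
      using alg_over_trans[OF E alg\<beta> algT] that by (simp add: RSuc \<beta>(2))
    have in1: "T k \<in> R (Suc k)" by (rule chain_gen) simp
    have in2: "\<beta> \<in> R (Suc k)" using adjoin_self[OF E', of \<beta>] \<beta>(2) chain_mono[of k "Suc k"] by auto
    have in3: "T k + c * \<beta> \<in> R (Suc k)" if "c \<in> C" for c
      using that C(1) chain_base[of "Suc k"] in1 in2
      by (intro subr_add[OF chain_subr] subr_mult[OF chain_subr]) auto
    obtain c where c: "c \<in> C" "\<beta> \<in> adjoin E (T k + c * \<beta>)" "T k \<in> adjoin E (T k + c * \<beta>)"
      using primitive_element[OF E C alg[OF in1] sep\<beta>] alg in3 by blast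
    let ?F = "adjoin E (T k + c * \<beta>)"
    have F: "subr ?F" by (rule subr_adjoin[OF E'])
    have "R (Suc k) \<subseteq> ?F"
      unfolding RSuc \<beta>(2) by (intro adjoin_least F adjoin_incl[OF E'] c)
    moreover have "?F \<subseteq> R (Suc k)"
      by (intro adjoin_least chain_subr chain_base in3 c(1))
    ultimately show ?case using V(2)[of k \<beta> c] \<beta>(1) c(1) Suc.prems by (intro bexI[of _ "T k + c * \<beta>"]) auto
  qed
  from this[of n] obtain \<theta> where "\<theta> \<in> V" "R n = adjoin E \<theta>" by auto
  with sep[OF this(2)] show thesis using that by simp
qed

end

text \<open>Chain rule. Applied to the equations of a Jacobian system, it turns a derivation into a
  solution of a homogeneous linear system.\<close>

lemma (in kalg) der_ev:
  fixes D :: "'b \<Rightarrow> 'b"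
  assumes R: "subr R" and D: "\<And>x y. x \<in> R \<Longrightarrow> y \<in> R \<Longrightarrow> D (x + y) = D x + D y"
      "\<And>x y. x \<in> R \<Longrightarrow> y \<in> R \<Longrightarrow> D (x * y) = x * D y + y * D x"
    and const: "\<And>c. \<phi> c \<in> R" "\<And>c. D (\<phi> c) = 0"
    and a: "\<And>v. v < n \<Longrightarrow> a v \<in> R" and p: "in_vars n p"
  shows "ev \<phi> a p \<in> R \<and> D (ev \<phi> a p) = (\<Sum>v<n. ev \<phi> a (pdiff v p) * D (a v))"
  using p
proof (induction rule: mp_induct)
  case (mvar i)
  have "(\<Sum>v<n. ev \<phi> a (pdiff v (mvar i)) * D (a v)) = (\<Sum>v<n. if v = i then D (a v) else 0)"
    by (intro sum.cong) (auto simp: pdiff_mvar)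
  thus ?case using mvar a by simp
next
  case (add p q)
  thus ?case
    by (auto simp: ev_add D(1) pdiff_add distrib_right sum.distrib intro: subr_add[OF R])
next
  case (mult p q)
  thus ?case
    by (auto simp: ev_add ev_mult D(2) pdiff_mult distrib_right sum.distrib sum_distrib_left
        algebra_simps intro: subr_mult[OF R])
qed (auto simp: const)

subsection \<open>Plane curves parametrised by power series\<close>

text \<open>The value of \<open>P\<close> at \<open>s = X\<close>, \<open>y = u\<close>, that is,
  the restriction of \<open>P\<close> to the branch \<open>y = u(s)\<close>.\<close>

abbreviation ev2 :: "'k::field fps \<Rightarrow> 'k poly poly \<Rightarrow> 'k fps" where
  "ev2 u P \<equiv> poly (map_poly fps_of_poly P) u"

lemma ev2_pCons: "ev2 u (pCons a P) = fps_of_poly a + u * ev2 u P"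
  by (simp add: map_poly_pCons)

lemma map_fps_of_poly_add: "map_poly fps_of_poly (P + Q) = map_poly fps_of_poly P + map_poly fps_of_poly Q"
  by (intro poly_eqI) (simp add: coeff_map_poly fps_of_poly_add)

lemma ev2_add: "ev2 u (P + Q) = ev2 u P + ev2 u Q"
  by (simp add: map_fps_of_poly_add)

lemma ev2_smult: "ev2 u (smult a P) = fps_of_poly a * ev2 u P"
  by (induction P) (simp_all add: ev2_pCons fps_of_poly_mult algebra_simps)

lemma ev2_mult: "ev2 u (P * Q) = ev2 u P * ev2 u Q"
  by (induction P) (simp_all add: ev2_pCons ev2_add ev2_smult algebra_simps)

lemma ev2_uminus: "ev2 u (- P) = - ev2 u P"
  using ev2_add[where P=P and Q="- P" and u=u] by (simp add: eq_neg_iff_add_eq_0 add.commute)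

lemma ev2_diff: "ev2 u (P - Q) = ev2 u P - ev2 u Q"
  using ev2_add[where P=P and Q="- Q" and u=u] by (simp add: ev2_uminus)

lemma ev2_const: "ev2 u [:a:] = fps_of_poly a"
  by (simp add: ev2_pCons)

lemma ev2_pcompose: "ev2 u (pcompose G Q) = ev2 (ev2 u Q) G"
  by (induction G) (simp_all add: pcompose_pCons ev2_add ev2_mult ev2_pCons)

lemma ev2_nth_0: "fps_nth (ev2 u P) 0 = poly (poly P [:fps_nth u 0:]) 0"
  by (induction P) (simp_all add: ev2_pCons poly_0_coeff_0)

lemma fps_of_poly_eq_0_iff: "fps_of_poly p = 0 \<longleftrightarrow> p = 0"
  using fps_of_poly_eq_iff[of p 0] by simp

lemma prime_elem_const_poly:
  fixes p :: "'a::idom"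
  assumes "prime_elem p"
  shows "prime_elem [:p:]"
  using assms by (rule lift_prime_elem_poly)

text \<open>A non-constant divisor of least degree is irreducible.\<close>

lemma poly_prime_factor:
  fixes c :: "'k::field poly"
  assumes "Polynomial.degree c > 0"
  obtains p where "prime_elem p" "p dvd c" "Polynomial.degree p > 0"
proof -
  define P where "P d \<longleftrightarrow> (\<exists>p. p dvd c \<and> Polynomial.degree p = d \<and> d > 0)" for d
  have "P (Polynomial.degree c)" using assms by (auto simp: P_def intro: exI[of _ c])
  hence "\<exists>d. P d" by blast
  then obtain d where d: "P d" "\<And>e. e < d \<Longrightarrow> \<not> P e" using exists_least_iff[of P] by blast
  then obtain p where p: "p dvd c" "Polynomial.degree p = d" "d > 0" by (auto simp: P_def)
  have "Factorial_Ring.irreducible p"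
  proof (rule Factorial_Ring.irreducibleI)
    show "p \<noteq> 0" using p by auto
    thus "\<not> p dvd 1" using p by (simp add: is_unit_iff_degree)
    fix a b assume ab: "p = a * b"
    have ne: "a \<noteq> 0" "b \<noteq> 0" using ab p by auto
    hence deg: "Polynomial.degree a + Polynomial.degree b = d" using p ab by (simp add: degree_mult_eq)
    have "a dvd c" "b dvd c" using p(1) ab by (auto dest: dvd_mult_left dvd_mult_right)
    hence "Polynomial.degree a = 0 \<or> Polynomial.degree b = 0"
      using d(2)[of "Polynomial.degree a"] d(2)[of "Polynomial.degree b"] deg unfolding P_def by auto
    thus "a dvd 1 \<or> b dvd 1" using ne by (auto simp: is_unit_iff_degree)
  qed
  thus thesis using that field_poly_irreducible_imp_prime p by auto
qed

lemma poly_poly_pseudo_div: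
  fixes f g :: "'k::field poly poly"
  assumes "g \<noteq> 0"
  obtains c q r where "c \<noteq> 0" "smult c f = g * q + r" "r = 0 \<or> Polynomial.degree r < Polynomial.degree g"
proof -
  obtain q r where qr: "pseudo_divmod f g = (q, r)" by (cases "pseudo_divmod f g")
  show thesis
    by (rule that[OF _ pseudo_divmod[OF assms qr]]) (use assms in auto)
qed

text \<open>The kernel of \<open>K[s][y] \<rightarrow> K[[s]]\<close>, \<open>y \<mapsto> u\<close>, is generated by a primitive element of minimal
  degree; this is Gauss's lemma.\<close>

definition curve_eq :: "'k::field fps \<Rightarrow> 'k poly poly \<Rightarrow> bool" where
  "curve_eq u Q \<longleftrightarrow> Q \<noteq> 0 \<and> (\<forall>P. ev2 u P = 0 \<longleftrightarrow> Q dvd P)"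

lemma curve_eq_exists:
  assumes G: "ev2 u G = 0" "G \<noteq> 0"
  obtains Q where "curve_eq u Q"
proof -
  define A where "A d \<longleftrightarrow> (\<exists>P. P \<noteq> 0 \<and> ev2 u P = 0 \<and> Polynomial.degree P = d)" for d
  have "\<exists>d. A d" using G by (auto simp: A_def)
  then obtain d where d: "A d" "\<And>e. e < d \<Longrightarrow> \<not> A e" using exists_least_iff[of A] by blast
  \<comment> \<open>Among the relations of least degree in \<open>y\<close>, the degree of the
    leading coefficient is minimised as well. This makes \<open>Q\<close> primitive, since
    cancelling a factor from \<open>K[s]\<close> would lower it.\<close>
  define B where "B e \<longleftrightarrow> (\<exists>P. P \<noteq> 0 \<and> ev2 u P = 0 \<and> Polynomial.degree P = d
      \<and> Polynomial.degree (Polynomial.lead_coeff P) = e)" for e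
  have "\<exists>e. B e" using d(1) by (auto simp: A_def B_def)
  then obtain e where e: "B e" "\<And>f. f < e \<Longrightarrow> \<not> B f" using exists_least_iff[of B] by blast
  then obtain Q where Q: "Q \<noteq> 0" "ev2 u Q = 0" "Polynomial.degree Q = d"
    "Polynomial.degree (Polynomial.lead_coeff Q) = e" by (auto simp: B_def)
  have prim: "\<not> [:p:] dvd Q" if p: "Polynomial.degree p > 0" for p
  proof
    assume "[:p:] dvd Q"
    then obtain R where R: "Q = smult p R" by auto
    have ne: "p \<noteq> 0" "R \<noteq> 0" using R Q(1) by auto
    have "ev2 u R = 0" using Q(2) ne unfolding R by (simp add: ev2_smult fps_of_poly_eq_0_iff)
    moreover have "Polynomial.degree R = d" using Q(3) ne R by simp
    moreover have "Polynomial.degree (Polynomial.lead_coeff R) < e"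
    proof -
      have "Polynomial.lead_coeff Q = p * Polynomial.lead_coeff R" unfolding R using ne by simp
      hence "e = Polynomial.degree p + Polynomial.degree (Polynomial.lead_coeff R)"
        using Q(4) ne by (simp add: degree_mult_eq)
      thus ?thesis using p by simp
    qed
    ultimately show False using e(2) ne unfolding B_def by blast
  qed
  have "Q dvd P" if P: "ev2 u P = 0" for P
  proof -
    \<comment> \<open>Pseudo-division only shows that \<open>Q\<close> divides \<open>c P\<close>
      for some \<open>c\<close> in \<open>K[s]\<close>. If \<open>c\<close> of least degree had a
      prime factor, that factor, not dividing \<open>Q\<close>, would divide the cofactor and could
      be cancelled.\<close>
    define D where "D n \<longleftrightarrow> (\<exists>c. c \<noteq> 0 \<and> Q dvd smult c P \<and> Polynomial.degree c = n)" for n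
    obtain c q r where cqr: "c \<noteq> 0" "smult c P = Q * q + r" "r = 0 \<or> Polynomial.degree r < Polynomial.degree Q"
      using poly_poly_pseudo_div[OF Q(1)] by blast
    have "ev2 u (smult c P) = ev2 u (Q * q + r)" using cqr(2) by simp
    hence "ev2 u r = 0" using P Q(2) by (simp add: ev2_smult ev2_add ev2_mult)
    hence "r = 0" using cqr(3) d(2) Q(3) unfolding A_def by blast
    hence "\<exists>n. D n" using cqr unfolding D_def by auto
    then obtain n where n: "D n" "\<And>m. m < n \<Longrightarrow> \<not> D m" using exists_least_iff[of D] by blast
    then obtain c where c: "c \<noteq> 0" "Q dvd smult c P" "Polynomial.degree c = n" by (auto simp: D_def)
    have "n = 0"
    proof (rule ccontr)
      assume "n \<noteq> 0"
      hence "Polynomial.degree c > 0" using c(3) by simp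
      then obtain p where p: "prime_elem p" "p dvd c" "Polynomial.degree p > 0"
        by (rule poly_prime_factor)
      from p(2) obtain c' where c': "c = p * c'" by (rule dvdE)
      from c(2) obtain q where q: "smult c P = Q * q" by (rule dvdE)
      have pQ: "[:p:] * smult c' P = Q * q" by (subst q[symmetric]) (simp add: c' mult.commute)
      hence "[:p:] dvd Q * q" by (metis dvd_triv_left)
      hence "[:p:] dvd q" using prime_elem_const_poly[OF p(1)] prim[OF p(3)]
        by (simp add: prime_elem_dvd_mult_iff)
      then obtain q' where "q = smult p q'" by auto
      hence "[:p:] * smult c' P = [:p:] * (Q * q')" unfolding pQ by simp
      moreover have "[:p:] \<noteq> 0" using p(3) by auto
      ultimately have "smult c' P = Q * q'" by (metis mult_left_cancel)
      hence "Q dvd smult c' P" by (metis dvd_triv_left)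
      moreover have "c' \<noteq> 0" using c c' by auto
      moreover have "Polynomial.degree c' < n"
        using c(1,3) c' p(3) by (auto simp: degree_mult_eq)
      ultimately show False using n(2) unfolding D_def by blast
    qed
    with c obtain k where "c = [:k:]" "k \<noteq> 0" by (metis degree_eq_zeroE pCons_0_0)
    hence "smult [:inverse k:] (smult c P) = P" by (simp flip: one_pCons)
    thus "Q dvd P" using c(2) by (metis dvd_smult)
  qed
  moreover have "ev2 u P = 0" if "Q dvd P" for P
  proof -
    from that obtain k where "P = Q * k" by (rule dvdE)
    thus ?thesis using Q(2) by (simp only: ev2_mult mult_zero_left)
  qed
  ultimately have "curve_eq u Q" using Q(1) unfolding curve_eq_def by (intro conjI allI iffI)
  thus thesis by (rule that)
qed

text \<open>Replaces the resultant. An element \<open>W\<close> of least \<open>y\<close>-degree in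
  the ideal \<open>(Q, P)\<close> divides both generators up to factors from \<open>K[s]\<close>,
  and it does not vanish on the branch because \<open>P\<close> does not. From
  \<open>b Q = W r\<close> it follows that \<open>Q\<close> divides \<open>r\<close>; cancelling
  \<open>Q\<close> shows that \<open>W\<close> divides \<open>b\<close>, so \<open>W\<close> lies in
  \<open>K[s]\<close>.\<close>

lemma curve_eq_elimination:
  assumes Q: "curve_eq u Q" and P: "ev2 u P \<noteq> 0"
  obtains a B where "a \<noteq> 0" "Q dvd [:a:] - B * P"
proof -
  define I where "I = {W. \<exists>A B. W = A * Q + B * P}"
  define D where "D d \<longleftrightarrow> (\<exists>W\<in>I. W \<noteq> 0 \<and> Polynomial.degree W = d)" for d
  have "Q \<in> I" unfolding I_def by (rule CollectI, rule exI[of _ 1], rule exI[of _ 0]) simp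
  have PI: "P \<in> I" unfolding I_def by (rule CollectI, rule exI[of _ 0], rule exI[of _ 1]) simp
  have I_diff: "smult c W - V * q \<in> I" if W: "W \<in> I" and V: "V \<in> I" for c W V q
  proof -
    obtain A1 B1 where 1: "W = A1 * Q + B1 * P" using W by (auto simp: I_def)
    obtain A2 B2 where 2: "V = A2 * Q + B2 * P" using V by (auto simp: I_def)
    have "smult c W - V * q = (smult c A1 - A2 * q) * Q + (smult c B1 - B2 * q) * P"
      unfolding 1 2 by (simp add: algebra_simps smult_add_right)
    thus ?thesis unfolding I_def by blast
  qed
  have "\<exists>d. D d" using \<open>Q \<in> I\<close> Q by (auto simp: D_def curve_eq_def)
  then obtain d where d: "D d" "\<And>e. e < d \<Longrightarrow> \<not> D e" using exists_least_iff[of D] by blast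
  then obtain W where W: "W \<in> I" "W \<noteq> 0" "Polynomial.degree W = d" by (auto simp: D_def)
  have div: "\<exists>c q. c \<noteq> 0 \<and> smult c V = W * q" if V: "V \<in> I" for V
  proof -
    obtain c q r where cqr: "c \<noteq> 0" "smult c V = W * q + r" "r = 0 \<or> Polynomial.degree r < Polynomial.degree W"
      using poly_poly_pseudo_div[OF W(2)] by blast
    have "r = smult c V - W * q" using cqr(2) by simp
    hence "r \<in> I" using I_diff[OF V W(1)] by simp
    hence "r = 0" using cqr(3) d(2) W(3) unfolding D_def by blast
    thus ?thesis using cqr by auto
  qed
  obtain c q where cq: "c \<noteq> 0" "smult c P = W * q" using div[OF PI] by blast
  have "ev2 u (smult c P) \<noteq> 0" using cq(1) P by (simp add: ev2_smult fps_of_poly_eq_0_iff)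
  hence evW: "ev2 u W \<noteq> 0" using cq(2) by (auto simp: ev2_mult)
  obtain b r where br: "b \<noteq> 0" "smult b Q = W * r" using div[OF \<open>Q \<in> I\<close>] by blast
  have "ev2 u Q = 0" using Q by (auto simp: curve_eq_def)
  hence "ev2 u W * ev2 u r = 0" using arg_cong[OF br(2), of "ev2 u"] by (simp add: ev2_smult ev2_mult)
  hence "Q dvd r" using evW Q by (auto simp: curve_eq_def)
  then obtain r' where "r = Q * r'" by auto
  hence "Q * [:b:] = Q * (W * r')" using br(2) by (simp add: mult.left_commute)
  hence eq: "[:b:] = W * r'" using Q mult_left_cancel[of Q] unfolding curve_eq_def by blast
  hence "W * r' \<noteq> 0" "Polynomial.degree (W * r') = 0" using br(1) by (auto simp flip: eq)
  hence "Polynomial.degree W = 0" by (auto simp: degree_mult_eq)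
  then obtain a where a: "W = [:a:]" by (auto elim: degree_eq_zeroE)
  obtain A B where "W = A * Q + B * P" using W(1) by (auto simp: I_def)
  hence "[:a:] - B * P = Q * A" using a by (simp add: mult.commute)
  thus thesis using that[of a B] W(2) a by auto
qed

text \<open>The curve has no vertical component: \<open>p\<close> does not vanish on the branch, so
  the cofactor of \<open>p\<close> in \<open>Q\<close> would lie in the kernel, hence be a multiple
  of \<open>Q\<close>, and \<open>p\<close> would be a unit.\<close>

lemma curve_eq_not_dvd_vertical:
  assumes Q: "curve_eq u Q" and p: "Polynomial.degree p > 0"
  shows "\<not> [:p:] dvd Q"
proof
  assume "[:p:] dvd Q"
  then obtain R where R: "Q = smult p R" by auto
  have ne: "p \<noteq> 0" "R \<noteq> 0" using R Q by (auto simp: curve_eq_def)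
  have "ev2 u Q = 0" using Q by (auto simp: curve_eq_def)
  hence "ev2 u R = 0" using ne unfolding R by (simp add: ev2_smult fps_of_poly_eq_0_iff)
  hence "Q dvd R" using Q by (auto simp: curve_eq_def)
  then obtain S where "R = Q * S" by auto
  hence "R * 1 = R * ([:p:] * S)" using R by (simp add: mult.commute)
  hence "1 = [:p:] * S" using ne(2) by (metis mult_left_cancel)
  hence "[:p:] dvd 1" by (metis dvd_triv_left)
  hence "p dvd 1" by (simp add: is_unit_const_poly_iff)
  thus False using p ne by (simp add: is_unit_iff_degree)
qed

lemma poly_poly_swap: "poly (poly P [:c:]) t = poly (map_poly (\<lambda>q. poly q t) P) c"
  by (induction P) (simp_all add: map_poly_pCons)

text \<open>If \<open>Q\<close> vanished identically over \<open>t\<close>, then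
  \<open>s - t\<close> would divide all its coefficients and give a vertical component.\<close>

lemma curve_eq_finite_fibre:
  assumes Q: "curve_eq u Q"
  shows "finite {c. poly (poly Q [:c:]) t = 0}"
proof -
  have "map_poly (\<lambda>q. poly q t) Q \<noteq> 0"
  proof
    assume 0: "map_poly (\<lambda>q. poly q t) Q = 0"
    have "[:-t, 1:] dvd poly.coeff Q i" for i
    proof -
      have "poly (poly.coeff Q i) t = poly.coeff (map_poly (\<lambda>q. poly q t) Q) i" by (simp add: coeff_map_poly)
      thus ?thesis unfolding 0 by (simp add: poly_eq_0_iff_dvd)
    qed
    hence "[:[:-t, 1:]:] dvd Q" by (simp add: const_poly_dvd_iff)
    thus False using curve_eq_not_dvd_vertical[OF Q, of "[:-t, 1:]"] by simp
  qed
  thus ?thesis unfolding poly_poly_swap by (rule poly_roots_finite)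
qed

subsection \<open>Solutions of Jacobian systems in power series are algebraic\<close>

abbreviation kx :: "'k::field poly \<Rightarrow> 'k fls" where "kx p \<equiv> fps_to_fls (fps_of_poly p)"

text \<open>The field \<open>K(s)\<close> inside \<open>K((s))\<close>.\<close>

definition ratf :: "'k::field fls set" where
  "ratf = {kx p / kx q | p q. q \<noteq> 0}"

lemma kx_eq_0_iff: "kx p = 0 \<longleftrightarrow> p = 0"
  by (simp add: fps_of_poly_eq_0_iff)

lemma kx_simps: "kx (p + q) = kx p + kx q" "kx (p * q) = kx p * kx q" "kx (- p) = - kx p"
  "kx 0 = 0" "kx 1 = 1"
  by (simp_all add: fps_of_poly_add fps_of_poly_mult fps_of_poly_uminus fls_times_fps_to_fls)

lemma ratfI: "q \<noteq> 0 \<Longrightarrow> x * kx q = kx p \<Longrightarrow> x \<in> ratf"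
  unfolding ratf_def using nonzero_eq_divide_eq[of "kx q" x "kx p"] kx_eq_0_iff[of q] by blast

lemma ratfE:
  assumes "x \<in> ratf"
  obtains p q where "q \<noteq> 0" "x * kx q = kx p"
  using assms unfolding ratf_def by (auto simp: kx_eq_0_iff)

lemma kx_in_ratf: "kx p \<in> ratf"
  by (rule ratfI[of 1 _ p]) auto

lemma subf_ratf: "subf (ratf :: 'k::field fls set)"
  unfolding subf_def subr_def
proof (intro conjI ballI)
  show "1 \<in> (ratf :: 'k fls set)" using kx_in_ratf[of 1] by simp
next
  fix x y :: "'k fls" assume "x \<in> ratf" "y \<in> ratf"
  then obtain p q r s where q: "q \<noteq> 0" "x * kx q = kx p" and s: "s \<noteq> 0" "y * kx s = kx r"
    by (meson ratfE)
  show "x * y \<in> ratf"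
    by (rule ratfI[of "q * s" _ "p * r"]) (use q s in \<open>simp_all only: kx_simps flip: q(2) s(2)\<close>, auto)
  show "x + y \<in> ratf"
    by (rule ratfI[of "q * s" _ "p * s + r * q"])
       (use q s in \<open>simp_all only: kx_simps flip: q(2) s(2)\<close>, auto simp: algebra_simps)
next
  fix x :: "'k fls" assume "x \<in> ratf"
  then obtain p q where q: "q \<noteq> 0" "x * kx q = kx p" by (meson ratfE)
  show "- x \<in> ratf"
    by (rule ratfI[of q _ "- p"]) (use q in \<open>simp_all only: kx_simps flip: q(2)\<close>, auto)
  show "inverse x \<in> ratf"
  proof (cases "x = 0")
    case True
    thus ?thesis using kx_in_ratf[of 0] by simp
  next
    case False
    hence "p \<noteq> 0" using q kx_eq_0_iff[of p] kx_eq_0_iff[of q] by auto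
    moreover have "inverse x * kx p = kx q" using False by (simp add: field_simps flip: q(2))
    ultimately show ?thesis by (rule ratfI)
  qed
qed

lemma fls_const_in_ratf: "fls_const c \<in> ratf"
  using kx_in_ratf[of "[:c:]"] by (simp add: fps_of_poly_const)

lemma ratf_clear_denominators:
  assumes "pol_over ratf p"
  obtains d P where "d \<noteq> 0" "smult (kx d) p = map_poly kx P"
proof -
  have "\<exists>d P. d \<noteq> 0 \<and> smult (kx d) p = map_poly kx P"
    using assms
  proof (induction p)
    case 0
    show ?case by (intro exI[of _ 1] exI[of _ 0]) simp
  next
    case (pCons a p)
    then obtain d P where d: "d \<noteq> 0" "smult (kx d) p = map_poly kx P"
      by (auto simp: pol_over_pCons_iff[OF subf_imp_subr[OF subf_ratf]])
    have "a \<in> ratf" using pCons.prems by (auto simp: pol_over_pCons_iff[OF subf_imp_subr[OF subf_ratf]])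
    then obtain q r where q: "q \<noteq> 0" "a * kx q = kx r" by (rule ratfE)
    have "smult (kx (d * q)) (pCons a p) = pCons (kx d * (a * kx q)) (smult (kx q) (smult (kx d) p))"
      by (simp only: kx_simps) (simp add: ac_simps)
    also have "\<dots> = pCons (kx (d * r)) (map_poly kx (smult q P))"
      unfolding d q by (intro arg_cong2[where f=pCons] poly_eqI)
        (simp_all add: kx_simps coeff_map_poly fps_of_poly_mult fls_times_fps_to_fls)
    also have "\<dots> = map_poly kx (pCons (d * r) (smult q P))"
      by (simp add: map_poly_pCons)
    finally show ?case using d q by (intro exI[of _ "d * q"] exI[of _ "pCons (d * r) (smult q P)"]) auto
  qed
  thus thesis using that by blast
qed

lemma poly_map_kx: "poly (map_poly kx P) (fps_to_fls u) = fps_to_fls (ev2 u P)"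
  by (induction P) (simp_all add: map_poly_pCons fls_times_fps_to_fls)

lemma pderiv_map_kx: "pderiv (map_poly kx P) = map_poly kx (pderiv P)"
proof -
  have add: "map_poly kx (P + Q) = map_poly kx P + map_poly kx Q" for P Q :: "'a poly poly"
    by (intro poly_eqI) (simp add: coeff_map_poly fps_of_poly_add)
  show ?thesis by (induction P) (simp_all add: map_poly_pCons pderiv_pCons add)
qed

lemma adjoin_ratf_repr:
  assumes "fps_to_fls x \<in> adjoin ratf (fps_to_fls \<theta>)"
  obtains d r where "d \<noteq> 0" "fps_of_poly d * x = ev2 \<theta> r"
proof -
  obtain p where p: "pol_over ratf p" "fps_to_fls x = poly p (fps_to_fls \<theta>)"
    using assms by (auto simp: adjoin_def)
  obtain d P where d: "d \<noteq> 0" "smult (kx d) p = map_poly kx P"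
    using ratf_clear_denominators[OF p(1)] .
  have "fps_to_fls (fps_of_poly d * x) = poly (smult (kx d) p) (fps_to_fls \<theta>)"
    using p(2) by (simp add: fls_times_fps_to_fls)
  also have "\<dots> = fps_to_fls (ev2 \<theta> P)" unfolding d by (rule poly_map_kx)
  finally show thesis using that d(1) by simp
qed

lemma sep_over_ratf:
  assumes "sep_over ratf (fps_to_fls \<theta>)"
  obtains G where "ev2 \<theta> G = 0" "ev2 \<theta> (pderiv G) \<noteq> 0"
proof -
  obtain p where p: "pol_over ratf p" "poly p (fps_to_fls \<theta>) = 0" "poly (pderiv p) (fps_to_fls \<theta>) \<noteq> 0"
    using assms by (auto simp: sep_over_def)
  obtain d P where d: "d \<noteq> 0" "smult (kx d) p = map_poly kx P"
    using ratf_clear_denominators[OF p(1)] .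
  have "fps_to_fls (ev2 \<theta> P) = poly (smult (kx d) p) (fps_to_fls \<theta>)"
    unfolding d(2) by (rule poly_map_kx[symmetric])
  hence 1: "ev2 \<theta> P = 0" using p(2) by simp
  have "fps_to_fls (ev2 \<theta> (pderiv P)) = poly (pderiv (smult (kx d) p)) (fps_to_fls \<theta>)"
    unfolding d(2) by (simp only: pderiv_map_kx poly_map_kx)
  also have "\<dots> \<noteq> 0" using p(3) d(1) by (simp add: pderiv_smult fps_of_poly_eq_0_iff)
  finally show thesis using that 1 by simp
qed

interpretation fls_alg: kalg "fls_const :: 'k::field \<Rightarrow> 'k fls"
  by unfold_locales (auto intro: fls_eqI)

lemma fps_to_fls_ev: "fps_to_fls (ev fps_const a p) = ev fls_const (\<lambda>v. fps_to_fls (a v)) p"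
proof -
  obtain n where "in_vars n p" using ex_in_vars by blast
  thus ?thesis
    by (induction rule: mp_induct)
       (simp_all add: fps_alg.ev_add fps_alg.ev_mult fls_alg.ev_add fls_alg.ev_mult fls_times_fps_to_fls)
qed

text \<open>A derivation over \<open>K(s)\<close> kills the coordinates that are not solved for.
  Applied to the equations it gives \<open>M w = 0\<close> with \<open>M\<close> the Jacobian, so it
  kills the solved coordinates too; hence these generate a separable extension. Infinitely many
  constants are needed to choose a primitive element.\<close>

theorem jacobian_system_parametrization:
  fixes a :: "nat \<Rightarrow> 'k::field fps" and fs :: "'k mp list"
  defines "n \<equiv> length fs"
  assumes inf: "infinite (UNIV :: 'k set)"
    and zero: "\<And>i. i < n \<Longrightarrow> ev fps_const a (fs ! i) = 0"
    and det: "Determinant.det (mat n n (\<lambda>(i, j). fps_nth (ev fps_const a (pdiff (\<sigma> j) (fs ! i))) 0)) \<noteq> 0"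
    and base: "\<And>v. v \<notin> \<sigma> ` {..<n} \<Longrightarrow> fps_to_fls (a v) \<in> ratf"
  obtains \<theta> where "sep_over ratf (fps_to_fls \<theta>)" "\<And>v. fps_to_fls (a v) \<in> adjoin ratf (fps_to_fls \<theta>)"
proof -
  define b where "b v = fps_to_fls (a v)" for v
  define T where "T k = b (\<sigma> k)" for k
  define R where "R = rec_nat ratf (\<lambda>k S. adjoin S (T k))"
  have R0: "R 0 = ratf" and RSuc: "R (Suc k) = adjoin (R k) (T k)" for k by (simp_all add: R_def)
  note chain = subf_ratf R0 RSuc
  have R: "subr (R k)" for k by (rule chain_subr[OF chain])
  have bR: "b v \<in> R n" for v
  proof (cases "v \<in> \<sigma> ` {..<n}")
    case True
    thus ?thesis using chain_gen[OF chain, of _ n] by (auto simp: T_def)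
  next
    case False
    thus ?thesis using base[OF False] chain_base[OF chain, of n] by (auto simp: b_def)
  qed
  have inj: "inj_on \<sigma> {..<n}"
    by (rule det_nonzero_inj[of n "\<lambda>v i. fps_nth (ev fps_const a (pdiff v (fs ! i))) 0"]) (rule det)
  define A where "A = mat n n (\<lambda>(i, j). ev fps_const a (pdiff (\<sigma> j) (fs ! i)))"
  define M where "M = mat n n (\<lambda>(i, j). ev fls_const b (pdiff (\<sigma> j) (fs ! i)))"
  \<comment> \<open>The hypothesis concerns the constant terms only. Their determinant is the
    constant term of the determinant over power series, which is therefore nonzero and stays so in
    Laurent series.\<close>
  have "comm_ring_hom (\<lambda>f :: 'k fps. fps_nth f 0)" by unfold_locales (simp_all add: fps_mult_nth_0)
  from comm_ring_hom.hom_det[OF this, of A]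
  have "fps_nth (Determinant.det A) 0 = Determinant.det (map_mat (\<lambda>f. fps_nth f 0) A)" by simp
  also have "map_mat (\<lambda>f. fps_nth f 0) A = mat n n (\<lambda>(i, j). fps_nth (ev fps_const a (pdiff (\<sigma> j) (fs ! i))) 0)"
    by (rule eq_matI) (auto simp: A_def)
  finally have "Determinant.det A \<noteq> 0" using det by auto
  moreover have "comm_ring_hom (fps_to_fls :: 'k fps \<Rightarrow> 'k fls)"
    by unfold_locales (simp_all add: fls_times_fps_to_fls)
  from comm_ring_hom.hom_det[OF this, of A]
  have "fps_to_fls (Determinant.det A) = Determinant.det (map_mat fps_to_fls A)" by simp
  moreover have "map_mat fps_to_fls A = M"
    by (rule eq_matI) (auto simp: A_def M_def fps_to_fls_ev b_def[abs_def])
  ultimately have detM: "Determinant.det M \<noteq> 0" by auto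
  have nd: "noder ratf (R n)"
    unfolding noder_def
  proof (intro allI impI)
    fix D assume "der_on (R n) D \<and> (\<forall>x\<in>ratf. D x = 0)"
    hence D: "der_on (R n) D" and D0: "\<And>x. x \<in> ratf \<Longrightarrow> D x = 0" by auto
    have DT: "D (T k) = 0" if k: "k < n" for k
    proof -
      define w where "w = vec n (\<lambda>j. D (T j))"
      have "M *\<^sub>v w = 0\<^sub>v n"
      proof (rule eq_vecI)
        fix i assume "i < dim_vec (0\<^sub>v n)"
        hence i: "i < n" by simp
        obtain N' where N': "in_vars N' (fs ! i)" using ex_in_vars by blast
        define N where "N = Max (insert N' ((\<lambda>j. Suc (\<sigma> j)) ` {..<n}))"
        have "N' \<le> N" unfolding N_def by (intro Max_ge) auto
        hence N: "in_vars N (fs ! i)" using N' in_vars_mono by blast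
        have \<sigma>N: "\<sigma> j < N" if "j < n" for j
        proof -
          have "Suc (\<sigma> j) \<le> N" unfolding N_def using that by (intro Max_ge) auto
          thus ?thesis by simp
        qed
        have c: "fls_const c \<in> R n" "D (fls_const c) = 0" for c
          using chain_base[OF chain, of n] fls_const_in_ratf D0 by auto
        have "D (ev fls_const b (fs ! i)) = (\<Sum>v<N. ev fls_const b (pdiff v (fs ! i)) * D (b v))"
          by (rule conjunct2[OF fls_alg.der_ev[where R="R n" and D=D and a=b and n=N and p="fs ! i"]])
             (use D c bR N R in \<open>auto simp: der_on_def\<close>)
        also have "\<dots> = (\<Sum>v\<in>\<sigma> ` {..<n}. ev fls_const b (pdiff v (fs ! i)) * D (b v))"
          by (rule sum.mono_neutral_right) (use \<sigma>N D0 base in \<open>auto simp: b_def\<close>)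
        also have "\<dots> = (\<Sum>j<n. M $$ (i, j) * D (T j))"
          using i by (subst sum.reindex[OF inj]) (auto simp: M_def T_def intro!: sum.cong)
        also have "\<dots> = (M *\<^sub>v w) $ i"
          using i by (simp add: w_def M_def scalar_prod_def lessThan_atLeast0)
        finally have "(M *\<^sub>v w) $ i = D (ev fls_const b (fs ! i))" ..
        also have "ev fls_const b (fs ! i) = 0"
          using zero[OF i] fps_to_fls_ev[of a "fs ! i"] by (simp add: b_def[abs_def])
        also have "D 0 = 0" using D0[OF kx_in_ratf[of 0]] by simp
        finally show "(M *\<^sub>v w) $ i = 0\<^sub>v n $ i" using i by simp
      qed (simp add: M_def)
      moreover have "M \<in> carrier_mat n n" "w \<in> carrier_vec n" by (auto simp: M_def w_def)
      ultimately have "w = 0\<^sub>v n" using det_0_iff_vec_prod_zero[of M n] detM by auto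
      hence "w $ k = 0" using k by simp
      thus ?thesis using k by (simp add: w_def)
    qed
    show "\<forall>x\<in>R n. D x = 0" using chain_der_zero[OF chain D D0 DT] by blast
  qed
  have "inj (fls_const :: 'k \<Rightarrow> 'k fls)" by (rule injI) (metis fls_const_nth)
  hence "infinite (range fls_const :: 'k fls set)" using inf finite_imageD by blast
  moreover have "range fls_const \<subseteq> (ratf :: 'k fls set)" using fls_const_in_ratf by auto
  moreover have "T k + c * x \<in> range fps_to_fls" if x: "x \<in> range fps_to_fls" "c \<in> range fls_const" for k x c
  proof -
    obtain y d where "x = fps_to_fls y" "c = fls_const d" using x by auto
    hence "T k + c * x = fps_to_fls (a (\<sigma> k) + fps_const d * y)"
      by (simp add: T_def b_def fls_times_fps_to_fls)
    thus ?thesis by blast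
  qed
  moreover have "0 \<in> range fps_to_fls" by (rule image_eqI[of _ _ 0]) auto
  ultimately obtain z where z: "z \<in> range fps_to_fls" "sep_over ratf z" "R n = adjoin ratf z"
    using primitive_element_chain[OF chain, of "range fls_const" n "range fps_to_fls"] nd by metis
  then obtain \<theta> where "z = fps_to_fls \<theta>" by auto
  with z bR show thesis using that by (auto simp: b_def)
qed

text \<open>Newton's trick: replacing \<open>\<theta>\<close> by its tail \<open>u\<close> beyond a sufficiently high order turns a
  separable relation into one with a simple zero at the origin.\<close>

lemma simple_zero_shift:
  fixes \<theta> :: "'k::field fps"
  assumes G: "ev2 \<theta> G = 0" "ev2 \<theta> (pderiv G) \<noteq> 0"
  obtains u p N H where "fps_nth u 0 = 0" "\<theta> = fps_of_poly p + fps_X ^ N * u"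
    "ev2 u H = 0" "fps_nth (ev2 u (pderiv H)) 0 \<noteq> 0"
proof -
  define e where "e = subdegree (ev2 \<theta> (pderiv G))"
  \<comment> \<open>\<open>N > e\<close> gives \<open>2 N \<ge> N + e\<close>, so the terms of
    degree at least two in \<open>y\<close> will be divisible by \<open>s ^ (N + e)\<close>. Keeping
    the coefficients of \<open>\<theta>\<close> up to index \<open>N\<close>, and not only below
    \<open>N\<close>, gives the tail \<open>u\<close> constant term zero.\<close>
  define N where "N = Suc e"
  define p where "p = truncate_fps (Suc N) \<theta>"
  define u where "u = fps_shift N (\<theta> - fps_of_poly p)"
  have u0: "fps_nth u 0 = 0" by (simp add: u_def p_def fps_cutoff_nth)
  have \<theta>: "\<theta> = fps_of_poly p + fps_X ^ N * u"
  proof (rule fps_ext)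
    fix i show "fps_nth \<theta> i = fps_nth (fps_of_poly p + fps_X ^ N * u) i"
      by (simp add: u_def p_def fps_X_power_mult_nth)
  qed
  define S where "S = [:p, Polynomial.monom 1 N:]"
  define F where "F = pcompose G S"
  have evS: "ev2 u S = \<theta>" by (subst \<theta>) (simp add: S_def ev2_pCons fps_of_poly_monom' mult.commute)
  have evF: "ev2 u F = 0" unfolding F_def by (simp add: ev2_pcompose evS G)
  have evF': "ev2 u (pderiv F) = fps_X ^ N * ev2 \<theta> (pderiv G)"
    unfolding F_def by (simp add: pderiv_pcompose ev2_mult ev2_pcompose evS)
      (simp add: S_def pderiv_pCons ev2_const fps_of_poly_monom' mult.commute)
  \<comment> \<open>In the substitution \<open>p + s ^ N y\<close> each factor \<open>y\<close>
    comes with a factor \<open>s ^ N\<close>.\<close>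
  have dvd: "Polynomial.monom 1 (N * j) dvd poly.coeff F j" for j
    unfolding F_def S_def
  proof (induction G arbitrary: j)
    case (pCons b G)
    have "Polynomial.monom 1 (N * j) dvd poly.coeff (smult p (pcompose G [:p, Polynomial.monom 1 N:])) j"
      using pCons by simp
    moreover have "Polynomial.monom 1 (N * j) dvd poly.coeff (pCons 0 (smult (Polynomial.monom 1 N) (pcompose G [:p, Polynomial.monom 1 N:]))) j"
    proof (cases j)
      case (Suc i)
      have "(Polynomial.monom 1 (N * j) :: 'k poly) = Polynomial.monom 1 N * Polynomial.monom 1 (N * i)"
        by (simp add: mult_monom Suc)
      thus ?thesis using pCons(2)[of i] by (simp add: Suc mult_dvd_mono)
    qed simp
    moreover have "Polynomial.monom 1 (N * j) dvd poly.coeff [:b:] j"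
      by (cases j) (auto simp: monom_0 coeff_pCons one_pCons[symmetric])
    ultimately show ?case by (simp add: pcompose_pCons del: mult_pCons_left add: mult_pCons_left)
  qed simp
  obtain h0 h1 F2 where F: "F = pCons h0 (pCons h1 F2)" by (metis pCons_cases)
  let ?X = "fps_X ^ (N + e) :: 'k fps"
  have "Polynomial.monom 1 (N + e) dvd poly.coeff F2 i" for i
  proof -
    have "Polynomial.monom 1 (N + e) dvd (Polynomial.monom 1 (N * Suc (Suc i)) :: 'k poly)"
      by (auto simp: monom_1_dvd_iff' N_def)
    also have "\<dots> dvd poly.coeff F (Suc (Suc i))" by (rule dvd)
    also have "poly.coeff F (Suc (Suc i)) = poly.coeff F2 i" by (simp add: F)
    finally show ?thesis .
  qed
  hence "[:Polynomial.monom 1 (N + e):] dvd F2" by (simp add: const_poly_dvd_iff)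
  then obtain F3 where F3: "F2 = smult (Polynomial.monom 1 (N + e)) F3" by auto
  have X_dvd: "Polynomial.monom 1 (N + e) dvd h" if "?X dvd fps_of_poly h" for h
    unfolding monom_1_dvd_iff'
  proof (intro allI impI)
    fix k assume "k < N + e"
    from that obtain g where "fps_of_poly h = ?X * g" by (rule dvdE)
    hence "fps_nth (fps_of_poly h) k = fps_nth (?X * g) k" by simp
    thus "poly.coeff h k = 0" using \<open>k < N + e\<close> by (simp add: fps_X_power_mult_nth)
  qed
  \<comment> \<open>The unit part of the derivative of \<open>G\<close> at \<open>\<theta>\<close>;
    it becomes the derivative of \<open>H\<close> along \<open>u\<close>.\<close>
  define w where "w = fps_shift e (ev2 \<theta> (pderiv G))"
  have w0: "fps_nth w 0 \<noteq> 0" unfolding w_def e_def using G(2) by simp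
  have w: "ev2 u (pderiv F) = ?X * w"
    unfolding evF' w_def e_def by (subst (1) subdegree_decompose) (simp add: power_add mult_ac)
  \<comment> \<open>The relations \<open>F'(u) = s ^ (N + e) w\<close> and \<open>F(u) = 0\<close>,
    solved for the two lowest coefficients \<open>h1\<close> and \<open>h0\<close>, show that these
    are divisible by \<open>s ^ (N + e)\<close> too.\<close>
  have "pderiv F = pCons h1 (F2 + (F2 + pCons 0 (pderiv F2)))"
    unfolding F by (simp add: pderiv_pCons)
  hence "ev2 u (pderiv F) = fps_of_poly h1 + ?X * ((u + u) * ev2 u F3 + u * u * ev2 u (pderiv F3))"
    by (simp only: ev2_pCons ev2_add F3 ev2_smult pderiv_smult fps_of_poly_monom' fps_of_poly_0)
       (simp add: algebra_simps)
  hence h1: "fps_of_poly h1 = ?X * (w - ((u + u) * ev2 u F3 + u * u * ev2 u (pderiv F3)))"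
    unfolding w by (simp add: algebra_simps)
  then obtain k1 where k1: "h1 = Polynomial.monom 1 (N + e) * k1" using X_dvd by (metis dvdE dvd_triv_left)
  have "0 = fps_of_poly h0 + u * fps_of_poly h1 + u * u * ?X * ev2 u F3"
    using evF unfolding F F3 by (simp add: ev2_pCons ev2_smult fps_of_poly_monom' algebra_simps)
  hence "fps_of_poly h0 = ?X * (- u * fps_of_poly k1 - u * u * ev2 u F3)"
    unfolding k1 by (simp add: fps_of_poly_mult fps_of_poly_monom' algebra_simps eq_neg_iff_add_eq_0)
  then obtain k0 where k0: "h0 = Polynomial.monom 1 (N + e) * k0" using X_dvd by (metis dvdE dvd_triv_left)
  define H where "H = pCons k0 (pCons k1 F3)"
  have FH: "F = smult (Polynomial.monom 1 (N + e)) H" by (simp add: F H_def k0 k1 F3)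
  have "?X * ev2 u H = 0" using evF unfolding FH by (simp add: ev2_smult fps_of_poly_monom')
  hence "ev2 u H = 0" by simp
  moreover have "?X * ev2 u (pderiv H) = ?X * w"
    using w unfolding FH by (simp add: ev2_smult pderiv_smult fps_of_poly_monom')
  hence "ev2 u (pderiv H) = w" by simp
  ultimately show thesis using that[OF u0 \<theta>] w0 by simp
qed

subsection \<open>Solving Jacobian systems over a large field\<close>

text \<open>The scheme-free form in which largeness is used. The hypotheses say that
  \<open>y = u(s)\<close> is a branch of the plane curve \<open>Q = 0\<close> through the origin and
  that the curve is smooth there.\<close>

definition plane_large :: "'k::field itself \<Rightarrow> bool" where
  "plane_large _ \<longleftrightarrow> (\<forall>(u :: 'k fps) Q. fps_nth u 0 = 0 \<and> curve_eq u Q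
     \<and> fps_nth (ev2 u (pderiv Q)) 0 \<noteq> 0 \<longrightarrow> infinite {(t, c). poly (poly Q [:c:]) t = 0})"

abbreviation pt2 :: "'k::field poly poly \<Rightarrow> 'k \<Rightarrow> 'k \<Rightarrow> 'k" where
  "pt2 P t c \<equiv> poly (poly P [:c:]) t"

text \<open>Applied to the line \<open>y = 0\<close>, the curve of the zero series.\<close>

lemma plane_large_infinite:
  assumes "plane_large TYPE('k::field)"
  shows "infinite (UNIV :: 'k set)"
proof
  assume fin: "finite (UNIV :: 'k set)"
  have dvd: "ev2 (0 :: 'k fps) P = 0 \<longleftrightarrow> [:0, 1:] dvd P" for P
    using poly_eq_0_iff_dvd[of P 0] by (cases P) (simp add: ev2_pCons fps_of_poly_eq_0_iff)
  hence "curve_eq (0 :: 'k fps) [:0, 1:]" by (simp add: curve_eq_def)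
  moreover have "fps_nth (ev2 (0 :: 'k fps) (pderiv [:0, 1:])) 0 \<noteq> 0"
    by (simp add: pderiv_pCons ev2_pCons)
  ultimately have "infinite {(t :: 'k, c). pt2 [:0, 1:] t c = 0}"
    using assms unfolding plane_large_def by (metis fps_zero_nth)
  moreover have "finite (UNIV :: ('k \<times> 'k) set)" using fin by (rule finite_Prod_UNIV[OF _ fin])
  ultimately show False by (meson finite_subset subset_UNIV)
qed

text \<open>Infinitely many points over finitely many parameters would need an infinite
  fibre.\<close>

lemma infinite_curve_params:
  fixes u :: "'k::field fps"
  assumes large: "plane_large TYPE('k)" and u: "fps_nth u 0 = 0" "curve_eq u Q"
    "fps_nth (ev2 u (pderiv Q)) 0 \<noteq> 0"
  shows "infinite {t. \<exists>c. pt2 Q t c = 0}"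
proof
  assume fin: "finite {t. \<exists>c. pt2 Q t c = 0}"
  have "{(t, c). pt2 Q t c = 0} = Sigma {t. \<exists>c. pt2 Q t c = 0} (\<lambda>t. {c. pt2 Q t c = 0})"
    by auto
  moreover have "finite (Sigma {t. \<exists>c. pt2 Q t c = 0} (\<lambda>t. {c. pt2 Q t c = 0}))"
    using fin curve_eq_finite_fibre[OF u(2)] by (intro finite_SigmaI) auto
  moreover have "infinite {(t, c). pt2 Q t c = 0}"
    using large u unfolding plane_large_def by blast
  ultimately show False by metis
qed

lemma curve_eq_dvd_pt2:
  assumes "Q dvd P" "pt2 Q t c = 0"
  shows "pt2 P t c = 0"
  using assms by (elim dvdE) simp

text \<open>By elimination a nonzero \<open>a\<close> in \<open>K[s]\<close> is a multiple of
  \<open>P\<close> on the curve, so the zeros of \<open>P\<close> lie over roots of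
  \<open>a\<close>.\<close>

lemma curve_nonzero_off_finite:
  assumes Q: "curve_eq u Q" and P: "ev2 u P \<noteq> 0"
  obtains B where "finite B" "\<And>t c. pt2 Q t c = 0 \<Longrightarrow> t \<notin> B \<Longrightarrow> pt2 P t c \<noteq> 0"
proof -
  obtain a A where a: "a \<noteq> 0" "Q dvd [:a:] - A * P" using curve_eq_elimination[OF Q P] .
  show thesis
  proof (rule that[of "{t. poly a t = 0}"])
    show "finite {t. poly a t = 0}" by (rule poly_roots_finite[OF a(1)])
    fix t c assume tc: "pt2 Q t c = 0" "t \<notin> {t. poly a t = 0}"
    show "pt2 P t c \<noteq> 0" using curve_eq_dvd_pt2[OF a(2) tc(1)] tc(2) by auto
  qed
qed

text \<open>Coordinates \<open>a v = r v / d\<close> on the curve: a polynomial in them becomes, after clearing the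
  denominator, a polynomial on the curve with the corresponding values.\<close>

lemma ev_on_curve:
  fixes a :: "nat \<Rightarrow> 'k::field fps"
  assumes a: "\<And>v. v < n \<Longrightarrow> fps_of_poly d * a v = ev2 u (r v)" and p: "in_vars n p"
  shows "\<exists>N P. fps_of_poly d ^ N * ev fps_const a p = ev2 u P
    \<and> (\<forall>t c. poly d t \<noteq> 0 \<longrightarrow> poly d t ^ N * mp_eval (\<lambda>v. pt2 (r v) t c / poly d t) p = pt2 P t c)"
  using p
proof (induction rule: mp_induct)
  case (const k)
  show ?case
    by (intro exI[of _ 0] exI[of _ "[:[:k:]:]"]) (simp add: ev2_pCons fps_of_poly_const mp_eval_simps)
next
  case (mvar i)
  thus ?case using a by (intro exI[of _ 1] exI[of _ "r i"]) (simp add: mp_eval_simps)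
next
  case (add p q)
  then obtain N P M Q where
    P: "fps_of_poly d ^ N * ev fps_const a p = ev2 u P"
       "\<And>t c. poly d t \<noteq> 0 \<Longrightarrow> poly d t ^ N * mp_eval (\<lambda>v. pt2 (r v) t c / poly d t) p = pt2 P t c" and
    Q: "fps_of_poly d ^ M * ev fps_const a q = ev2 u Q"
       "\<And>t c. poly d t \<noteq> 0 \<Longrightarrow> poly d t ^ M * mp_eval (\<lambda>v. pt2 (r v) t c / poly d t) q = pt2 Q t c"
    by blast
  have "fps_of_poly d ^ (N + M) * ev fps_const a (p + q)
     = fps_of_poly d ^ M * (fps_of_poly d ^ N * ev fps_const a p) + fps_of_poly d ^ N * (fps_of_poly d ^ M * ev fps_const a q)"
    by (simp add: fps_alg.ev_add power_add algebra_simps)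
  also have "\<dots> = ev2 u (smult (d ^ M) P + smult (d ^ N) Q)"
    unfolding P(1) Q(1) by (simp add: ev2_add ev2_smult fps_of_poly_power)
  finally show ?case
  proof (intro exI[of _ "N + M"] exI[of _ "smult (d ^ M) P + smult (d ^ N) Q"] conjI allI impI)
    fix t c assume t: "poly d t \<noteq> 0"
    have "poly d t ^ (N + M) * mp_eval (\<lambda>v. pt2 (r v) t c / poly d t) (p + q)
      = poly d t ^ M * (poly d t ^ N * mp_eval (\<lambda>v. pt2 (r v) t c / poly d t) p)
        + poly d t ^ N * (poly d t ^ M * mp_eval (\<lambda>v. pt2 (r v) t c / poly d t) q)"
      by (simp add: mp_eval_simps power_add algebra_simps)
    thus "poly d t ^ (N + M) * mp_eval (\<lambda>v. pt2 (r v) t c / poly d t) (p + q)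
      = pt2 (smult (d ^ M) P + smult (d ^ N) Q) t c"
      unfolding P(2)[OF t] Q(2)[OF t] by simp
  qed
next
  case (mult p q)
  then obtain N P M Q where
    P: "fps_of_poly d ^ N * ev fps_const a p = ev2 u P"
       "\<And>t c. poly d t \<noteq> 0 \<Longrightarrow> poly d t ^ N * mp_eval (\<lambda>v. pt2 (r v) t c / poly d t) p = pt2 P t c" and
    Q: "fps_of_poly d ^ M * ev fps_const a q = ev2 u Q"
       "\<And>t c. poly d t \<noteq> 0 \<Longrightarrow> poly d t ^ M * mp_eval (\<lambda>v. pt2 (r v) t c / poly d t) q = pt2 Q t c"
    by blast
  have "fps_of_poly d ^ (N + M) * ev fps_const a (p * q)
     = (fps_of_poly d ^ N * ev fps_const a p) * (fps_of_poly d ^ M * ev fps_const a q)"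
    by (simp add: fps_alg.ev_mult power_add algebra_simps)
  also have "\<dots> = ev2 u (P * Q)" unfolding P(1) Q(1) by (simp add: ev2_mult)
  finally show ?case
  proof (intro exI[of _ "N + M"] exI[of _ "P * Q"] conjI allI impI)
    fix t c assume t: "poly d t \<noteq> 0"
    have "poly d t ^ (N + M) * mp_eval (\<lambda>v. pt2 (r v) t c / poly d t) (p * q)
      = (poly d t ^ N * mp_eval (\<lambda>v. pt2 (r v) t c / poly d t) p)
        * (poly d t ^ M * mp_eval (\<lambda>v. pt2 (r v) t c / poly d t) q)"
      by (simp add: mp_eval_simps power_add algebra_simps)
    thus "poly d t ^ (N + M) * mp_eval (\<lambda>v. pt2 (r v) t c / poly d t) (p * q) = pt2 (P * Q) t c"
      unfolding P(2)[OF t] Q(2)[OF t] by simp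
  qed
qed

text \<open>The arithmetic core. The first \<open>m\<close> coordinates are given rational functions
  of \<open>t\<close>, the others solve the square system \<open>fs\<close>, and \<open>h\<close> is
  an open condition. The power series solution through \<open>y0\<close> gives a branch, the branch
  gives a plane curve, and the points of that curve specialise back to solutions over
  \<open>K\<close>.\<close>

theorem large_jacobian_system:
  fixes fs :: "'k::field mp list" and p q :: "nat \<Rightarrow> 'k poly" and T0 :: "nat \<Rightarrow> 'k"
    and m :: nat
  defines "n \<equiv> length fs"
  defines "y0 \<equiv> \<lambda>v. if v < m then poly (p v) 0 / poly (q v) 0 else T0 v"
  assumes large: "plane_large TYPE('k)"
    and q0: "\<And>j. j < m \<Longrightarrow> poly (q j) 0 \<noteq> 0"
    and fs: "\<And>i. i < n \<Longrightarrow> in_vars (m + n) (fs ! i)"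
    and zero: "\<And>i. i < n \<Longrightarrow> mp_eval y0 (fs ! i) = 0"
    and \<sigma>: "\<sigma> ` {..<n} \<subseteq> {m..<m + n}"
    and det: "Determinant.det (mat n n (\<lambda>(i, j). mp_eval y0 (pdiff (\<sigma> j) (fs ! i)))) \<noteq> 0"
    and h: "in_vars (m + n) h" "mp_eval y0 h \<noteq> 0"
  shows "infinite {t. (\<forall>j<m. poly (q j) t \<noteq> 0) \<and> (\<exists>T.
    (\<forall>i<n. mp_eval (\<lambda>v. if v < m then poly (p v) t / poly (q v) t else T v) (fs ! i) = 0)
    \<and> mp_eval (\<lambda>v. if v < m then poly (p v) t / poly (q v) t else T v) h \<noteq> 0)}"
    (is "infinite ?S")
proof -
  \<comment> \<open>Starting values for Hensel's lemma: the expansions of \<open>p / q\<close> on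
    the base, constants for the unknowns, and the default \<open>0\<close> out of range, so that
    every coordinate not solved for is a rational function.\<close>
  define a0 where "a0 v = (if v < m then fps_of_poly (p v) / fps_of_poly (q v)
     else if v < m + n then fps_const (T0 v) else 0)" for v
  have qne: "q j \<noteq> 0" if "j < m" for j using q0[OF that] by auto
  have a0q: "fps_of_poly (q v) * a0 v = fps_of_poly (p v)" if "v < m" for v
  proof -
    have "fps_nth (fps_of_poly (q v)) 0 \<noteq> 0" using q0[OF that] by (simp add: poly_0_coeff_0)
    hence "fps_of_poly (q v) dvd 1" by (simp add: fps_is_unit_iff)
    hence "fps_of_poly (q v) dvd fps_of_poly (p v)" by (rule unit_imp_dvd)
    thus ?thesis using that by (simp add: a0_def)
  qed
  have a0_0: "fps_nth (a0 v) 0 = y0 v" if "v < m + n" for v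
  proof (cases "v < m")
    case True
    have "poly (q v) 0 * fps_nth (a0 v) 0 = poly (p v) 0"
      using arg_cong[OF a0q[OF True], of "\<lambda>f. fps_nth f 0"] by (simp add: poly_0_coeff_0)
    thus ?thesis using True q0[OF True] by (simp add: y0_def field_simps)
  qed (use that in \<open>simp add: a0_def y0_def\<close>)
  have ev0: "fps_nth (ev fps_const a p) 0 = mp_eval y0 p"
    if "\<And>v. fps_nth (a v) 0 = fps_nth (a0 v) 0" "in_vars (m + n) p" for p a
    unfolding fps_ev_nth_0 that(1) unfolding mp_eval_eq_ev
    by (rule ev_cong[OF that(2)]) (simp add: a0_0)
  have zero0: "fps_nth (ev fps_const a0 (fs ! i)) 0 = 0" if "i < length fs" for i
    using ev0[of a0 "fs ! i"] fs zero that by (simp add: n_def)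
  have mats: "mat n n (\<lambda>(i, j). fps_nth (ev fps_const a (pdiff (\<sigma> j) (fs ! i))) 0)
      = mat n n (\<lambda>(i, j). mp_eval y0 (pdiff (\<sigma> j) (fs ! i)))"
    if "\<And>v. fps_nth (a v) 0 = fps_nth (a0 v) 0" for a
    by (rule eq_matI) (auto simp: ev0[OF that] in_vars_pdiff fs)
  obtain a where a: "\<And>v. fps_nth (a v) 0 = fps_nth (a0 v) 0"
    "\<And>v. v \<notin> \<sigma> ` {..<n} \<Longrightarrow> a v = a0 v" "\<And>i. i < n \<Longrightarrow> ev fps_const a (fs ! i) = 0"
    using hensel_system[of fs a0 \<sigma>] zero0 mats[of a0] det unfolding n_def by metis
  have base: "fps_to_fls (a v) \<in> ratf" if "v \<notin> \<sigma> ` {..<n}" for v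
  proof -
    consider "v < m" | "v \<ge> m" "v < m + n" | "v \<ge> m + n" by linarith
    thus ?thesis
    proof cases
      case 1
      have "fps_to_fls (a v) * kx (q v) = kx (p v)"
        using arg_cong[OF a0q[OF 1], of fps_to_fls] a(2)[OF that] by (simp add: fls_times_fps_to_fls mult.commute)
      thus ?thesis using qne[OF 1] ratfI by blast
    next
      case 2
      thus ?thesis using a(2)[OF that] fls_const_in_ratf by (simp add: a0_def)
    next
      case 3
      thus ?thesis using a(2)[OF that] fls_const_in_ratf[of 0] by (simp add: a0_def)
    qed
  qed
  obtain \<theta> where \<theta>: "sep_over ratf (fps_to_fls \<theta>)" "\<And>v. fps_to_fls (a v) \<in> adjoin ratf (fps_to_fls \<theta>)"
    using jacobian_system_parametrization[of fs a \<sigma>] plane_large_infinite[OF large] a(3) base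
      mats[OF a(1)] det unfolding n_def by metis
  obtain G where G: "ev2 \<theta> G = 0" "ev2 \<theta> (pderiv G) \<noteq> 0" using sep_over_ratf[OF \<theta>(1)] .
  obtain u f N H where u: "fps_nth u 0 = 0" "\<theta> = fps_of_poly f + fps_X ^ N * u"
    "ev2 u H = 0" "fps_nth (ev2 u (pderiv H)) 0 \<noteq> 0"
    using simple_zero_shift[OF G] by blast
  have "H \<noteq> 0" using u(4) by auto
  then obtain Q where Q: "curve_eq u Q" using curve_eq_exists[OF u(3)] by blast
  have evQ: "ev2 u Q = 0" using Q by (simp add: curve_eq_def)
  \<comment> \<open>As \<open>Q(u) = 0\<close>, the derivative satisfies
    \<open>H'(u) = Q'(u) K(u)\<close>, so the simple zero passes from the multiple \<open>H\<close>
    to the generator \<open>Q\<close>.\<close>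
  obtain K where K: "H = Q * K" using u(3) Q unfolding curve_eq_def by (metis dvdE)
  have Q': "fps_nth (ev2 u (pderiv Q)) 0 \<noteq> 0"
    using u(4) evQ unfolding K by (auto simp: pderiv_mult ev2_add ev2_mult)
  have "\<exists>d r. d \<noteq> 0 \<and> fps_of_poly d * a v = ev2 u r" for v
  proof -
    obtain d r where dr: "d \<noteq> 0" "fps_of_poly d * a v = ev2 \<theta> r" using adjoin_ratf_repr[OF \<theta>(2)] .
    have "ev2 \<theta> r = ev2 u (pcompose r [:f, Polynomial.monom 1 N:])"
      unfolding ev2_pcompose by (subst u(2)) (simp add: ev2_pCons fps_of_poly_monom' mult.commute)
    with dr show ?thesis by auto
  qed
  then obtain d r where dr: "\<And>v. d v \<noteq> 0" "\<And>v. fps_of_poly (d v) * a v = ev2 u (r v)" by metis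
  \<comment> \<open>A common denominator: the point \<open>(t, c)\<close> of the curve gets the
    coordinates \<open>R v / D\<close>.\<close>
  define D where "D = (\<Prod>v<m + n. d v)"
  define R where "R v = smult (\<Prod>w\<in>{..<m + n} - {v}. d w) (r v)" for v
  have D0: "D \<noteq> 0" using dr(1) by (simp add: D_def)
  have DR: "fps_of_poly D * a v = ev2 u (R v)" if "v < m + n" for v
  proof -
    have "D = (\<Prod>w\<in>{..<m + n} - {v}. d w) * d v"
      unfolding D_def using that by (subst prod.remove[of _ v]) (auto simp: mult.commute)
    thus ?thesis by (simp add: R_def ev2_smult fps_of_poly_mult mult.assoc dr(2))
  qed
  let ?x = "\<lambda>t c v. pt2 (R v) t c / poly D t"
  have curve: "\<exists>N P. fps_of_poly D ^ N * ev fps_const a F = ev2 u P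
    \<and> (\<forall>t c. poly D t \<noteq> 0 \<longrightarrow> poly D t ^ N * mp_eval (?x t c) F = pt2 P t c)"
    if "in_vars (m + n) F" for F
    by (rule ev_on_curve[of "m + n", OF _ that]) (rule DR)
  have van: "mp_eval (?x t c) F = 0"
    if F: "in_vars (m + n) F" "ev fps_const a F = 0" "poly D t \<noteq> 0" "pt2 Q t c = 0" for F t c
  proof -
    obtain N P where P: "fps_of_poly D ^ N * ev fps_const a F = ev2 u P"
      "\<And>t c. poly D t \<noteq> 0 \<Longrightarrow> poly D t ^ N * mp_eval (?x t c) F = pt2 P t c"
      using curve[OF F(1)] by blast
    have "Q dvd P" using P(1) F(2) Q by (simp add: curve_eq_def)
    hence "pt2 P t c = 0" using F(4) by (rule curve_eq_dvd_pt2)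
    thus ?thesis using P(2)[OF F(3), of c] F(3) by simp
  qed
  \<comment> \<open>The identity \<open>q a = p\<close> holds on the branch; after clearing
    denominators it becomes a multiple of \<open>Q\<close> and so holds on the whole curve.\<close>
  have yv: "?x t c v = poly (p v) t / poly (q v) t"
    if v: "v < m" "poly (q v) t \<noteq> 0" "poly D t \<noteq> 0" "pt2 Q t c = 0" for t c v
  proof -
    have "v \<notin> \<sigma> ` {..<n}" using \<sigma> v(1) by auto
    hence av: "a v = a0 v" by (rule a(2))
    have "ev2 u (smult (q v) (R v) - [:D * p v:]) = 0"
      using DR[of v] v(1) a0q[OF v(1)] av
      by (simp add: ev2_diff ev2_smult ev2_const fps_of_poly_mult) (metis mult.left_commute)
    hence "Q dvd smult (q v) (R v) - [:D * p v:]" using Q by (simp add: curve_eq_def)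
    from curve_eq_dvd_pt2[OF this v(4)] show ?thesis using v by (simp add: field_simps)
  qed
  obtain N P where P: "fps_of_poly D ^ N * ev fps_const a h = ev2 u P"
      "\<And>t c. poly D t \<noteq> 0 \<Longrightarrow> poly D t ^ N * mp_eval (?x t c) h = pt2 P t c"
    using curve[OF h(1)] by blast
  have "ev fps_const a h \<noteq> 0" using ev0[OF a(1) h(1)] h(2) by auto
  hence "ev2 u P \<noteq> 0" using D0 by (simp add: fps_of_poly_eq_0_iff flip: P(1))
  then obtain B where B: "finite B" "\<And>t c. pt2 Q t c = 0 \<Longrightarrow> t \<notin> B \<Longrightarrow> pt2 P t c \<noteq> 0"
    using curve_nonzero_off_finite[OF Q] by blast
  \<comment> \<open>The parameters where a denominator vanishes or \<open>h\<close> might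
    vanish.\<close>
  define bad where "bad = B \<union> {t. poly D t = 0} \<union> (\<Union>j<m. {t. poly (q j) t = 0})"
  have "finite bad" unfolding bad_def using B(1) poly_roots_finite D0 qne by auto
  moreover have "infinite {t. \<exists>c. pt2 Q t c = 0}" by (rule infinite_curve_params[OF large u(1) Q Q'])
  ultimately have "infinite ({t. \<exists>c. pt2 Q t c = 0} - bad)" by simp
  moreover have "{t. \<exists>c. pt2 Q t c = 0} - bad \<subseteq> ?S"
  proof
    fix t assume t: "t \<in> {t. \<exists>c. pt2 Q t c = 0} - bad"
    then obtain c where c: "pt2 Q t c = 0" by auto
    have tD: "poly D t \<noteq> 0" and tq: "\<And>j. j < m \<Longrightarrow> poly (q j) t \<noteq> 0" and tB: "t \<notin> B"
      using t by (auto simp: bad_def)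
    let ?y = "\<lambda>v. if v < m then poly (p v) t / poly (q v) t else ?x t c v"
    have y: "?y = ?x t c" using yv tq tD c by auto
    have "mp_eval ?y (fs ! i) = 0" if "i < n" for i
      unfolding y by (rule van[OF fs[OF that] a(3)[OF that] tD c])
    moreover have "mp_eval ?y h \<noteq> 0"
      unfolding y using P(2)[OF tD, of c] B(2)[OF c tB] by auto
    ultimately show "t \<in> ?S" using tq
      by (intro CollectI conjI exI[of _ "?x t c"] allI impI) simp_all
  qed
  ultimately show ?thesis by (meson finite_subset)
qed

subsection \<open>Localization at a prime ideal\<close>

text \<open>The operations of \<open>loc\<close> are unions over all representatives; once the
  result is independent of the representatives, the union collapses to it.\<close>

lemma UN_pairs_const:
  assumes "\<And>a s b t. (a, s) \<in> S \<Longrightarrow> (b, t) \<in> T \<Longrightarrow> G a s b t = K" "(a0, s0) \<in> S" "(b0, t0) \<in> T"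
  shows "(\<Union>(a, s)\<in>S. \<Union>(b, t)\<in>T. G a s b t) = K"
proof -
  have "(\<Union>(b, t)\<in>T. G a s b t) = K" if "(a, s) \<in> S" for a s
  proof -
    have "(\<Union>(b, t)\<in>T. G a s b t) = (\<Union>q\<in>T. K)" using assms(1)[OF that] by (intro SUP_cong) auto
    also have "\<dots> = K" using assms(3) by auto
    finally show ?thesis .
  qed
  hence "(\<Union>(a, s)\<in>S. \<Union>(b, t)\<in>T. G a s b t) = (\<Union>q\<in>S. K)"
    by (intro SUP_cong refl) (simp add: split_beta)
  also have "\<dots> = K" using assms(2) by auto
  finally show ?thesis .
qed

context primeideal
begin

lemma prime_compl_mult: "s \<in> carrier R - I \<Longrightarrow> t \<in> carrier R - I \<Longrightarrow> s \<otimes> t \<in> carrier R - I"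
  using I_prime by auto

lemma one_in_compl: "\<one> \<in> carrier R - I"
  using one_imp_carrier I_notcarr by auto

lemma mult_minus_zero_iff:
  assumes "u \<in> carrier R" "x \<in> carrier R" "y \<in> carrier R"
  shows "u \<otimes> (x \<ominus> y) = \<zero> \<longleftrightarrow> u \<otimes> x = u \<otimes> y"
proof -
  have "u \<otimes> (x \<ominus> y) = u \<otimes> x \<ominus> u \<otimes> y" using assms by algebra
  thus ?thesis using assms by simp
qed

lemma frac_mem_iff:
  assumes "a \<in> carrier R" "s \<in> carrier R"
  shows "(b, t) \<in> frac R I a s \<longleftrightarrow> b \<in> carrier R \<and> t \<in> carrier R - I
     \<and> (\<exists>u\<in>carrier R - I. u \<otimes> (a \<otimes> t) = u \<otimes> (b \<otimes> s))"
  using assms by (auto simp: frac_def mult_minus_zero_iff)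

lemma frac_refl: "a \<in> carrier R \<Longrightarrow> s \<in> carrier R - I \<Longrightarrow> (a, s) \<in> frac R I a s"
  using one_in_compl by (subst frac_mem_iff) auto

text \<open>Zero divisors are allowed, so \<open>t\<close> cannot be cancelled; the witness
  \<open>u v t\<close> absorbs it.\<close>

lemma frac_trans:
  assumes "a \<in> carrier R" "s \<in> carrier R" "(b, t) \<in> frac R I a s" "(c, w) \<in> frac R I b t"
  shows "(c, w) \<in> frac R I a s"
proof -
  have bt: "b \<in> carrier R" "t \<in> carrier R - I" using assms frac_mem_iff by auto
  have cw: "c \<in> carrier R" "w \<in> carrier R - I" using assms(4) bt frac_mem_iff[of b t] by auto
  obtain u where u: "u \<in> carrier R - I" "u \<otimes> (a \<otimes> t) = u \<otimes> (b \<otimes> s)" using assms frac_mem_iff by auto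
  obtain v where v: "v \<in> carrier R - I" "v \<otimes> (b \<otimes> w) = v \<otimes> (c \<otimes> t)" using assms(4) bt frac_mem_iff[of b t] by auto
  have C: "a \<in> carrier R" "s \<in> carrier R" "b \<in> carrier R" "t \<in> carrier R" "c \<in> carrier R" "w \<in> carrier R"
    "u \<in> carrier R" "v \<in> carrier R" using assms bt cw u v by auto
  have "(u \<otimes> v \<otimes> t) \<otimes> (a \<otimes> w) = (u \<otimes> (a \<otimes> t)) \<otimes> (v \<otimes> w)" using C by algebra
  also have "\<dots> = (u \<otimes> s) \<otimes> (v \<otimes> (b \<otimes> w))" unfolding u(2) using C by algebra
  also have "\<dots> = (u \<otimes> v \<otimes> t) \<otimes> (c \<otimes> s)" unfolding v(2) using C by algebra
  finally show ?thesis
    using u v bt cw assms(1,2) prime_compl_mult by (subst frac_mem_iff) (auto intro!: bexI[of _ "u \<otimes> v \<otimes> t"])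
qed

lemma frac_sym:
  assumes "a \<in> carrier R" "s \<in> carrier R - I" "(b, t) \<in> frac R I a s"
  shows "(a, s) \<in> frac R I b t"
proof -
  have s: "s \<in> carrier R" using assms by simp
  obtain u where bt: "b \<in> carrier R" "t \<in> carrier R - I"
    and u: "u \<in> carrier R - I" "u \<otimes> (a \<otimes> t) = u \<otimes> (b \<otimes> s)"
    using assms(3) unfolding frac_mem_iff[OF assms(1) s] by blast
  have t: "t \<in> carrier R" using bt by simp
  show ?thesis unfolding frac_mem_iff[OF bt(1) t] using assms(1,2) u by metis
qed

lemma frac_eqI:
  assumes "a \<in> carrier R" "s \<in> carrier R - I" "(b, t) \<in> frac R I a s"
  shows "frac R I b t = frac R I a s"
proof -
  have bt: "b \<in> carrier R" "t \<in> carrier R - I" using assms frac_mem_iff[of a s] by auto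
  show ?thesis
  proof (intro equalityI subrelI)
    fix c w
    show "(c, w) \<in> frac R I b t \<Longrightarrow> (c, w) \<in> frac R I a s" using frac_trans[of a s b t c w] assms by auto
    show "(c, w) \<in> frac R I a s \<Longrightarrow> (c, w) \<in> frac R I b t"
      using frac_trans[of b t a s c w] frac_sym[OF assms] bt by auto
  qed
qed

lemma frac_eq_iff:
  assumes "a \<in> carrier R" "s \<in> carrier R - I" "b \<in> carrier R" "t \<in> carrier R - I"
  shows "frac R I a s = frac R I b t \<longleftrightarrow> (\<exists>u\<in>carrier R - I. u \<otimes> (a \<otimes> t) = u \<otimes> (b \<otimes> s))"
proof -
  have mem: "(b, t) \<in> frac R I a s
      \<longleftrightarrow> b \<in> carrier R \<and> t \<in> carrier R - I \<and> (\<exists>u\<in>carrier R - I. u \<otimes> (a \<otimes> t) = u \<otimes> (b \<otimes> s))"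
    by (rule frac_mem_iff) (use assms in auto)
  have "frac R I a s = frac R I b t \<longleftrightarrow> (b, t) \<in> frac R I a s"
    using frac_eqI[OF assms(1,2), of b t, symmetric] frac_refl[OF assms(3,4)] by (intro iffI) (simp_all only:)
  thus ?thesis unfolding mem using assms(3,4) by blast
qed

lemma frac_eqI':
  assumes "a \<in> carrier R" "s \<in> carrier R - I" "b \<in> carrier R" "t \<in> carrier R - I" "a \<otimes> t = b \<otimes> s"
  shows "frac R I a s = frac R I b t"
  using assms one_in_compl by (subst frac_eq_iff) auto

lemma loc_carrier: "x \<in> carrier (loc R I) \<longleftrightarrow> (\<exists>a\<in>carrier R. \<exists>s\<in>carrier R - I. x = frac R I a s)"
  by (auto simp: loc_def)

lemma frac_in_loc [intro]: "a \<in> carrier R \<Longrightarrow> s \<in> carrier R - I \<Longrightarrow> frac R I a s \<in> carrier (loc R I)"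
  by (auto simp: loc_carrier)

lemma loc_mult:
  assumes "a \<in> carrier R" "s \<in> carrier R - I" "b \<in> carrier R" "t \<in> carrier R - I"
  shows "frac R I a s \<otimes>\<^bsub>loc R I\<^esub> frac R I b t = frac R I (a \<otimes> b) (s \<otimes> t)"
proof -
  have "frac R I (a' \<otimes> b') (s' \<otimes> t') = frac R I (a \<otimes> b) (s \<otimes> t)"
    if x: "(a', s') \<in> frac R I a s" and y: "(b', t') \<in> frac R I b t" for a' s' b' t'
  proof (rule frac_eqI)
    obtain u where u: "u \<in> carrier R - I" "u \<otimes> (a \<otimes> s') = u \<otimes> (a' \<otimes> s)" using x assms frac_mem_iff by auto
    obtain v where v: "v \<in> carrier R - I" "v \<otimes> (b \<otimes> t') = v \<otimes> (b' \<otimes> t)" using y assms frac_mem_iff by auto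
    have m: "a' \<in> carrier R" "s' \<in> carrier R - I" "b' \<in> carrier R" "t' \<in> carrier R - I"
      using x y assms frac_mem_iff by auto
    have C: "a \<in> carrier R" "s \<in> carrier R" "b \<in> carrier R" "t \<in> carrier R" "u \<in> carrier R" "v \<in> carrier R"
      "a' \<in> carrier R" "s' \<in> carrier R" "b' \<in> carrier R" "t' \<in> carrier R" using assms u v m by auto
    have "(u \<otimes> v) \<otimes> (a \<otimes> b \<otimes> (s' \<otimes> t')) = (u \<otimes> (a \<otimes> s')) \<otimes> (v \<otimes> (b \<otimes> t'))" using C by algebra
    also have "\<dots> = (u \<otimes> v) \<otimes> (a' \<otimes> b' \<otimes> (s \<otimes> t))" unfolding u(2) v(2) using C by algebra
    finally show "(a' \<otimes> b', s' \<otimes> t') \<in> frac R I (a \<otimes> b) (s \<otimes> t)"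
      using u v m C prime_compl_mult by (subst frac_mem_iff) (auto intro!: bexI[of _ "u \<otimes> v"])
  qed (use assms prime_compl_mult in auto)
  moreover have "(a, s) \<in> frac R I a s" "(b, t) \<in> frac R I b t" using assms frac_refl by auto
  ultimately show ?thesis unfolding loc_def monoid.simps ring.simps by (rule UN_pairs_const)
qed

lemma loc_add:
  assumes "a \<in> carrier R" "s \<in> carrier R - I" "b \<in> carrier R" "t \<in> carrier R - I"
  shows "frac R I a s \<oplus>\<^bsub>loc R I\<^esub> frac R I b t = frac R I (a \<otimes> t \<oplus> b \<otimes> s) (s \<otimes> t)"
proof -
  have "frac R I (a' \<otimes> t' \<oplus> b' \<otimes> s') (s' \<otimes> t') = frac R I (a \<otimes> t \<oplus> b \<otimes> s) (s \<otimes> t)"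
    if x: "(a', s') \<in> frac R I a s" and y: "(b', t') \<in> frac R I b t" for a' s' b' t'
  proof (rule frac_eqI)
    obtain u where u: "u \<in> carrier R - I" "u \<otimes> (a \<otimes> s') = u \<otimes> (a' \<otimes> s)" using x assms frac_mem_iff by auto
    obtain v where v: "v \<in> carrier R - I" "v \<otimes> (b \<otimes> t') = v \<otimes> (b' \<otimes> t)" using y assms frac_mem_iff by auto
    have m: "a' \<in> carrier R" "s' \<in> carrier R - I" "b' \<in> carrier R" "t' \<in> carrier R - I"
      using x y assms frac_mem_iff by auto
    have C: "a \<in> carrier R" "s \<in> carrier R" "b \<in> carrier R" "t \<in> carrier R" "u \<in> carrier R" "v \<in> carrier R"
      "a' \<in> carrier R" "s' \<in> carrier R" "b' \<in> carrier R" "t' \<in> carrier R" using assms u v m by auto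
    have "(u \<otimes> v) \<otimes> ((a \<otimes> t \<oplus> b \<otimes> s) \<otimes> (s' \<otimes> t'))
        = (u \<otimes> (a \<otimes> s')) \<otimes> (v \<otimes> t \<otimes> t') \<oplus> (v \<otimes> (b \<otimes> t')) \<otimes> (u \<otimes> s \<otimes> s')" using C by algebra
    also have "\<dots> = (u \<otimes> v) \<otimes> ((a' \<otimes> t' \<oplus> b' \<otimes> s') \<otimes> (s \<otimes> t))" unfolding u(2) v(2) using C by algebra
    finally show "(a' \<otimes> t' \<oplus> b' \<otimes> s', s' \<otimes> t') \<in> frac R I (a \<otimes> t \<oplus> b \<otimes> s) (s \<otimes> t)"
      using u v m C prime_compl_mult by (subst frac_mem_iff) (auto intro!: bexI[of _ "u \<otimes> v"])
  qed (use assms prime_compl_mult in auto)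
  moreover have "(a, s) \<in> frac R I a s" "(b, t) \<in> frac R I b t" using assms frac_refl by auto
  ultimately show ?thesis unfolding loc_def monoid.simps ring.simps by (rule UN_pairs_const)
qed

lemma loc_one: "\<one>\<^bsub>loc R I\<^esub> = frac R I \<one> \<one>" and loc_zero: "\<zero>\<^bsub>loc R I\<^esub> = frac R I \<zero> \<one>"
  by (simp_all add: loc_def)

lemma locE:
  assumes "x \<in> carrier (loc R I)"
  obtains a s where "x = frac R I a s" "a \<in> carrier R" "s \<in> carrier R" "s \<in> carrier R - I"
  using assms by (auto simp: loc_carrier)

lemma loc_cring: "cring (loc R I)"
proof (rule cringI)
  note one = one_in_compl and mult = prime_compl_mult
  show "abelian_group (loc R I)"
  proof (rule abelian_groupI)
    fix x y assume "x \<in> carrier (loc R I)" "y \<in> carrier (loc R I)"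
    then obtain a s b t where xy: "x = frac R I a s" "y = frac R I b t"
      and C: "a \<in> carrier R" "s \<in> carrier R" "b \<in> carrier R" "t \<in> carrier R"
      and S: "s \<in> carrier R - I" "t \<in> carrier R - I" by (metis locE)
    show "x \<oplus>\<^bsub>loc R I\<^esub> y \<in> carrier (loc R I)"
      unfolding xy loc_add[OF C(1) S(1) C(3) S(2)] using C mult[OF S] by blast
    have "a \<otimes> t \<oplus> b \<otimes> s = b \<otimes> s \<oplus> a \<otimes> t" "s \<otimes> t = t \<otimes> s" using C by algebra+
    thus "x \<oplus>\<^bsub>loc R I\<^esub> y = y \<oplus>\<^bsub>loc R I\<^esub> x"
      unfolding xy loc_add[OF C(1) S(1) C(3) S(2)] loc_add[OF C(3) S(2) C(1) S(1)] by simp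
    have "\<zero> \<otimes> s \<oplus> a \<otimes> \<one> = a" "\<one> \<otimes> s = s" using C by algebra+
    thus "\<zero>\<^bsub>loc R I\<^esub> \<oplus>\<^bsub>loc R I\<^esub> x = x"
      unfolding xy loc_zero using C S one by (simp add: loc_add)
    show "\<exists>y\<in>carrier (loc R I). y \<oplus>\<^bsub>loc R I\<^esub> x = \<zero>\<^bsub>loc R I\<^esub>"
    proof (rule bexI[of _ "frac R I (\<ominus> a) s"])
      have "(\<ominus> a \<otimes> s \<oplus> a \<otimes> s) \<otimes> \<one> = \<zero> \<otimes> (s \<otimes> s)" using C by algebra
      hence "frac R I (\<ominus> a \<otimes> s \<oplus> a \<otimes> s) (s \<otimes> s) = frac R I \<zero> \<one>"
        using C mult[OF S(1) S(1)] one by (intro frac_eqI') auto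
      thus "frac R I (\<ominus> a) s \<oplus>\<^bsub>loc R I\<^esub> x = \<zero>\<^bsub>loc R I\<^esub>"
        unfolding loc_zero xy using C S by (simp add: loc_add)
    qed (use C S in blast)
  next
    fix x y z assume "x \<in> carrier (loc R I)" "y \<in> carrier (loc R I)" "z \<in> carrier (loc R I)"
    then obtain a s b t c w where xy: "x = frac R I a s" "y = frac R I b t" "z = frac R I c w"
      and C: "a \<in> carrier R" "s \<in> carrier R" "b \<in> carrier R" "t \<in> carrier R" "c \<in> carrier R" "w \<in> carrier R"
      and S: "s \<in> carrier R - I" "t \<in> carrier R - I" "w \<in> carrier R - I" by (metis locE)
    have "(a \<otimes> t \<oplus> b \<otimes> s) \<otimes> w \<oplus> c \<otimes> (s \<otimes> t) = a \<otimes> (t \<otimes> w) \<oplus> (b \<otimes> w \<oplus> c \<otimes> t) \<otimes> s"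
      "s \<otimes> t \<otimes> w = s \<otimes> (t \<otimes> w)" using C by algebra+
    thus "x \<oplus>\<^bsub>loc R I\<^esub> y \<oplus>\<^bsub>loc R I\<^esub> z = x \<oplus>\<^bsub>loc R I\<^esub> (y \<oplus>\<^bsub>loc R I\<^esub> z)"
      unfolding xy using C S mult[OF S(1,2)] mult[OF S(2,3)] by (simp add: loc_add)
  qed (use one in \<open>auto simp: loc_zero\<close>)
  show "comm_monoid (loc R I)"
  proof (rule comm_monoidI)
    fix x y assume "x \<in> carrier (loc R I)" "y \<in> carrier (loc R I)"
    then obtain a s b t where xy: "x = frac R I a s" "y = frac R I b t"
      and C: "a \<in> carrier R" "s \<in> carrier R" "b \<in> carrier R" "t \<in> carrier R"
      and S: "s \<in> carrier R - I" "t \<in> carrier R - I" by (metis locE)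
    show "x \<otimes>\<^bsub>loc R I\<^esub> y \<in> carrier (loc R I)"
      unfolding xy loc_mult[OF C(1) S(1) C(3) S(2)] using C mult[OF S] by blast
    show "x \<otimes>\<^bsub>loc R I\<^esub> y = y \<otimes>\<^bsub>loc R I\<^esub> x" unfolding xy using C S by (simp add: loc_mult m_comm)
    show "\<one>\<^bsub>loc R I\<^esub> \<otimes>\<^bsub>loc R I\<^esub> x = x" unfolding xy loc_one using C S one by (simp add: loc_mult)
  next
    fix x y z assume "x \<in> carrier (loc R I)" "y \<in> carrier (loc R I)" "z \<in> carrier (loc R I)"
    then obtain a s b t c w where xy: "x = frac R I a s" "y = frac R I b t" "z = frac R I c w"
      and C: "a \<in> carrier R" "s \<in> carrier R" "b \<in> carrier R" "t \<in> carrier R" "c \<in> carrier R" "w \<in> carrier R"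
      and S: "s \<in> carrier R - I" "t \<in> carrier R - I" "w \<in> carrier R - I" by (metis locE)
    show "x \<otimes>\<^bsub>loc R I\<^esub> y \<otimes>\<^bsub>loc R I\<^esub> z = x \<otimes>\<^bsub>loc R I\<^esub> (y \<otimes>\<^bsub>loc R I\<^esub> z)"
      unfolding xy using C S mult[OF S(1,2)] mult[OF S(2,3)] by (simp add: loc_mult m_assoc)
  qed (use one in \<open>auto simp: loc_one\<close>)
  fix x y z assume "x \<in> carrier (loc R I)" "y \<in> carrier (loc R I)" "z \<in> carrier (loc R I)"
  then obtain a s b t c w where xy: "x = frac R I a s" "y = frac R I b t" "z = frac R I c w"
    and C: "a \<in> carrier R" "s \<in> carrier R" "b \<in> carrier R" "t \<in> carrier R" "c \<in> carrier R" "w \<in> carrier R"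
    and S: "s \<in> carrier R - I" "t \<in> carrier R - I" "w \<in> carrier R - I" by (metis locE)
  have "(a \<otimes> t \<oplus> b \<otimes> s) \<otimes> c \<otimes> (s \<otimes> w \<otimes> (t \<otimes> w))
      = (a \<otimes> c \<otimes> (t \<otimes> w) \<oplus> b \<otimes> c \<otimes> (s \<otimes> w)) \<otimes> (s \<otimes> t \<otimes> w)" using C by algebra
  hence "frac R I ((a \<otimes> t \<oplus> b \<otimes> s) \<otimes> c) (s \<otimes> t \<otimes> w)
      = frac R I (a \<otimes> c \<otimes> (t \<otimes> w) \<oplus> b \<otimes> c \<otimes> (s \<otimes> w)) (s \<otimes> w \<otimes> (t \<otimes> w))"
    using C S by (intro frac_eqI' mult) auto
  thus "(x \<oplus>\<^bsub>loc R I\<^esub> y) \<otimes>\<^bsub>loc R I\<^esub> z = x \<otimes>\<^bsub>loc R I\<^esub> z \<oplus>\<^bsub>loc R I\<^esub> y \<otimes>\<^bsub>loc R I\<^esub> z"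
    unfolding xy using C S mult[OF S(1,2)] mult[OF S(1,3)] mult[OF S(2,3)] by (simp add: loc_add loc_mult)
qed

lemma frac_in_I_iff:
  assumes "a \<in> carrier R" "s \<in> carrier R - I" "b \<in> carrier R" "t \<in> carrier R - I" "frac R I a s = frac R I b t"
  shows "a \<in> I \<longleftrightarrow> b \<in> I"
proof -
  obtain u where u: "u \<in> carrier R - I" "u \<otimes> (a \<otimes> t) = u \<otimes> (b \<otimes> s)" using assms frac_eq_iff by auto
  have "a \<in> I \<longleftrightarrow> u \<otimes> (a \<otimes> t) \<in> I"
    using u(1) assms I_prime by (meson DiffE I_l_closed I_r_closed m_closed)
  also have "\<dots> \<longleftrightarrow> b \<in> I" unfolding u(2)
    using u(1) assms I_prime by (meson DiffE I_l_closed I_r_closed m_closed)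
  finally show ?thesis .
qed

text \<open>If \<open>a\<close> avoids the prime, \<open>s / a\<close> is an inverse; conversely the
  numerator of a fraction equal to \<open>1\<close> avoids the prime. This description of the units
  is what makes the localization local.\<close>

lemma loc_Units_iff:
  assumes "a \<in> carrier R" "s \<in> carrier R - I"
  shows "frac R I a s \<in> Units (loc R I) \<longleftrightarrow> a \<notin> I"
proof
  assume "frac R I a s \<in> Units (loc R I)"
  then obtain y where y: "y \<in> carrier (loc R I)" "frac R I a s \<otimes>\<^bsub>loc R I\<^esub> y = \<one>\<^bsub>loc R I\<^esub>"
    by (auto simp: Units_def)
  then obtain b t where bt: "y = frac R I b t" "b \<in> carrier R" "t \<in> carrier R - I" by (auto simp: loc_carrier)
  have "frac R I (a \<otimes> b) (s \<otimes> t) = frac R I \<one> \<one>" using y(2) assms bt by (simp add: loc_mult loc_one)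
  hence "a \<otimes> b \<notin> I"
    using frac_in_I_iff[of "a \<otimes> b" "s \<otimes> t" \<one> \<one>] assms bt prime_compl_mult one_in_compl by auto
  thus "a \<notin> I" using I_r_closed bt by auto
next
  assume a: "a \<notin> I"
  have "frac R I a s \<otimes>\<^bsub>loc R I\<^esub> frac R I s a = \<one>\<^bsub>loc R I\<^esub>"
    using assms a unfolding loc_one
    by (subst loc_mult; (simp; fail)?) (rule frac_eqI', auto simp: m_comm prime_compl_mult[simplified] one_in_compl[simplified])
  moreover from this have "frac R I s a \<otimes>\<^bsub>loc R I\<^esub> frac R I a s = \<one>\<^bsub>loc R I\<^esub>"
    using assms a cring.cring_simprules(14)[OF loc_cring] by (metis DiffI frac_in_loc DiffD1)
  ultimately show "frac R I a s \<in> Units (loc R I)"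
    using assms a unfolding Units_def by auto
qed

lemma loc_uminus:
  assumes "a \<in> carrier R" "s \<in> carrier R - I"
  shows "\<ominus>\<^bsub>loc R I\<^esub> frac R I a s = frac R I (\<ominus> a) s"
proof -
  interpret L: cring "loc R I" by (rule loc_cring)
  have "frac R I (\<ominus> a) s \<oplus>\<^bsub>loc R I\<^esub> frac R I a s = \<zero>\<^bsub>loc R I\<^esub>"
    unfolding loc_zero using assms
    by (subst loc_add; (simp; fail)?) (rule frac_eqI', auto simp: prime_compl_mult[simplified] one_in_compl[simplified] l_minus l_neg)
  thus ?thesis using assms by (intro L.minus_equality) auto
qed

lemma loc_minus:
  assumes "a \<in> carrier R" "s \<in> carrier R - I" "b \<in> carrier R" "t \<in> carrier R - I"
  shows "frac R I a s \<ominus>\<^bsub>loc R I\<^esub> frac R I b t = frac R I (a \<otimes> t \<ominus> b \<otimes> s) (s \<otimes> t)"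
  using assms by (simp add: a_minus_def loc_uminus loc_add l_minus)

lemma loc_hom: "(\<lambda>a. frac R I a \<one>) \<in> Ring.ring_hom R (loc R I)"
  using one_in_compl by (intro ring_hom_memI) (auto simp: loc_mult loc_add loc_one)

end

subsection \<open>The Zariski topology\<close>

context cring
begin

text \<open>By primality, an intersection belongs to the set of products of the two defining
  sets.\<close>

lemma istopology_zariski:
  "istopology (\<lambda>S. \<exists>E\<subseteq>carrier R. S = {P. primeideal P R \<and> \<not> E \<subseteq> P})"
  unfolding istopology_def
proof (intro conjI allI impI)
  fix S T
  assume "\<exists>E\<subseteq>carrier R. S = {P. primeideal P R \<and> \<not> E \<subseteq> P}"
    "\<exists>E\<subseteq>carrier R. T = {P. primeideal P R \<and> \<not> E \<subseteq> P}"
  then obtain E F where E: "E \<subseteq> carrier R" "S = {P. primeideal P R \<and> \<not> E \<subseteq> P}"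
    and F: "F \<subseteq> carrier R" "T = {P. primeideal P R \<and> \<not> F \<subseteq> P}" by blast
  let ?H = "{e \<otimes> f | e f. e \<in> E \<and> f \<in> F}"
  have "?H \<subseteq> P \<longleftrightarrow> E \<subseteq> P \<or> F \<subseteq> P" if P: "primeideal P R" for P
  proof -
    interpret P: primeideal P R by (rule P)
    have "x \<otimes> y \<in> P" if "x \<in> P" "y \<in> F" for x y using that F(1) P.I_r_closed by blast
    moreover have "x \<otimes> y \<in> P" if "x \<in> E" "y \<in> P" for x y using that E(1) P.I_l_closed by blast
    moreover have "E \<subseteq> P \<or> F \<subseteq> P" if H: "?H \<subseteq> P"
    proof (rule ccontr)
      assume "\<not> (E \<subseteq> P \<or> F \<subseteq> P)"
      then obtain e f where "e \<in> E" "e \<notin> P" "f \<in> F" "f \<notin> P" by blast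
      moreover from this have "e \<otimes> f \<in> P" using H by blast
      ultimately show False using P.I_prime[of e f] E(1) F(1) by blast
    qed
    ultimately show ?thesis by blast
  qed
  hence "S \<inter> T = {P. primeideal P R \<and> \<not> ?H \<subseteq> P}" unfolding E F by blast
  moreover have "?H \<subseteq> carrier R" using E(1) F(1) by auto
  ultimately show "\<exists>E\<subseteq>carrier R. S \<inter> T = {P. primeideal P R \<and> \<not> E \<subseteq> P}" by blast
next
  fix \<K> assume "\<forall>K\<in>\<K>. \<exists>E\<subseteq>carrier R. K = {P. primeideal P R \<and> \<not> E \<subseteq> P}"
  then obtain E where E: "\<And>K. K \<in> \<K> \<Longrightarrow> E K \<subseteq> carrier R \<and> K = {P. primeideal P R \<and> \<not> E K \<subseteq> P}"
    by metis
  have "\<Union>\<K> = {P. primeideal P R \<and> \<not> (\<Union>K\<in>\<K>. E K) \<subseteq> P}"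
  proof (intro equalityI subsetI)
    fix P assume "P \<in> \<Union>\<K>"
    then obtain K where "K \<in> \<K>" "P \<in> K" by blast
    thus "P \<in> {P. primeideal P R \<and> \<not> (\<Union>K\<in>\<K>. E K) \<subseteq> P}" using E[of K] by blast
  next
    fix P assume "P \<in> {P. primeideal P R \<and> \<not> (\<Union>K\<in>\<K>. E K) \<subseteq> P}"
    then obtain K where "K \<in> \<K>" "\<not> E K \<subseteq> P" "primeideal P R" by blast
    thus "P \<in> \<Union>\<K>" using E[of K] by blast
  qed
  moreover have "(\<Union>K\<in>\<K>. E K) \<subseteq> carrier R" using E by blast
  ultimately show "\<exists>E\<subseteq>carrier R. \<Union>\<K> = {P. primeideal P R \<and> \<not> E \<subseteq> P}" by blast
qed

lemma openin_zariski:
  "openin (zariski R) S \<longleftrightarrow> (\<exists>E\<subseteq>carrier R. S = {P. primeideal P R \<and> \<not> E \<subseteq> P})"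
  unfolding zariski_def topology_inverse'[OF istopology_zariski] ..

lemma topspace_zariski: "topspace (zariski R) = {P. primeideal P R}"
proof
  show "topspace (zariski R) \<subseteq> {P. primeideal P R}"
    unfolding topspace_def using openin_zariski by blast
  have "\<not> carrier R \<subseteq> P" if "primeideal P R" for P
    using primeideal.I_notcarr[OF that] ideal.Icarr[OF primeideal.axioms(1)[OF that]] by blast
  hence "{P. primeideal P R} = {P. primeideal P R \<and> \<not> carrier R \<subseteq> P}" by blast
  hence "openin (zariski R) {P. primeideal P R}" using openin_zariski by blast
  thus "{P. primeideal P R} \<subseteq> topspace (zariski R)" by (rule openin_subset)
qed

lemma openin_zariski_basic: "f \<in> carrier R \<Longrightarrow> openin (zariski R) {P. primeideal P R \<and> f \<notin> P}"
  unfolding openin_zariski by (rule exI[of _ "{f}"]) auto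

lemma zariski_basis:
  assumes "openin (zariski R) S" "P \<in> S"
  obtains f where "f \<in> carrier R" "f \<notin> P" "\<And>Q. primeideal Q R \<Longrightarrow> f \<notin> Q \<Longrightarrow> Q \<in> S"
  using assms unfolding openin_zariski by blast

lemma closedin_zariski:
  "closedin (zariski R) S \<longleftrightarrow> (\<exists>E\<subseteq>carrier R. S = {P. primeideal P R \<and> E \<subseteq> P})"
proof
  assume "closedin (zariski R) S"
  hence S: "S \<subseteq> {P. primeideal P R}" "openin (zariski R) ({P. primeideal P R} - S)"
    by (auto simp: closedin_def topspace_zariski)
  then obtain E where "E \<subseteq> carrier R" "{P. primeideal P R} - S = {P. primeideal P R \<and> \<not> E \<subseteq> P}"
    unfolding openin_zariski by blast
  thus "\<exists>E\<subseteq>carrier R. S = {P. primeideal P R \<and> E \<subseteq> P}" using S(1) by blast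
next
  assume "\<exists>E\<subseteq>carrier R. S = {P. primeideal P R \<and> E \<subseteq> P}"
  then obtain E where E: "E \<subseteq> carrier R" "S = {P. primeideal P R \<and> E \<subseteq> P}" by blast
  have "{P. primeideal P R} - S = {P. primeideal P R \<and> \<not> E \<subseteq> P}" unfolding E by blast
  hence "openin (zariski R) ({P. primeideal P R} - S)" unfolding openin_zariski using E(1) by blast
  thus "closedin (zariski R) S" by (auto simp: closedin_def topspace_zariski E)
qed

end

subsection \<open>Affine schemes are locally ringed spaces\<close>

text \<open>Zorn's lemma for the ideals that contain \<open>a\<close> but not
  \<open>1\<close>.\<close>

lemma exists_maximalideal:
  assumes "cring A" "a \<in> carrier A" "a \<notin> Units A"
  obtains M where "maximalideal M A" "a \<in> M"
proof -
  interpret A: cring A by fact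
  define S where "S = {J. ideal J A \<and> a \<in> J \<and> \<one>\<^bsub>A\<^esub> \<notin> J}"
  have "a \<in> PIdl\<^bsub>A\<^esub> a" by (rule A.cgenideal_self[OF assms(2)])
  moreover have "\<one>\<^bsub>A\<^esub> \<notin> PIdl\<^bsub>A\<^esub> a"
  proof
    assume "\<one>\<^bsub>A\<^esub> \<in> PIdl\<^bsub>A\<^esub> a"
    then obtain x where "x \<in> carrier A" "\<one>\<^bsub>A\<^esub> = x \<otimes>\<^bsub>A\<^esub> a" unfolding cgenideal_def by blast
    moreover from this have "a \<otimes>\<^bsub>A\<^esub> x = \<one>\<^bsub>A\<^esub>" using assms(2) A.m_comm by simp
    ultimately show False using assms(2,3) unfolding Units_def by auto
  qed
  ultimately have PS: "PIdl\<^bsub>A\<^esub> a \<in> S" unfolding S_def using A.cgenideal_ideal[OF assms(2)] by blast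
  have "\<exists>M\<in>S. \<forall>J\<in>S. M \<subseteq> J \<longrightarrow> J = M"
  proof (rule subset_Zorn)
    fix C assume C: "subset.chain S C"
    show "\<exists>U\<in>S. \<forall>J\<in>C. J \<subseteq> U"
    proof (cases "C = {}")
      case False
      have CS: "C \<subseteq> S" using C by (simp add: subset.chain_def)
      hence "subset.chain {I. ideal I A} C" using C unfolding subset.chain_def S_def by auto
      hence "ideal (\<Union>C) A" using A.chain_Union_is_ideal[of C] False by simp
      hence "\<Union>C \<in> S" using CS False unfolding S_def by blast
      thus ?thesis by blast
    qed (use PS in blast)
  qed
  then obtain M where M: "M \<in> S" "\<And>J. J \<in> S \<Longrightarrow> M \<subseteq> J \<Longrightarrow> J = M" by blast
  have "maximalideal M A"
  proof (rule maximalidealI)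
    show "ideal M A" using M(1) by (simp add: S_def)
    show "carrier A \<noteq> M" using M(1) A.one_closed by (auto simp: S_def)
    fix J assume J: "ideal J A" "M \<subseteq> J" "J \<subseteq> carrier A"
    show "J = M \<or> J = carrier A"
    proof (cases "\<one>\<^bsub>A\<^esub> \<in> J")
      case True
      thus ?thesis using ideal.one_imp_carrier[OF J(1)] by simp
    next
      case False
      hence "J \<in> S" using J M(1) unfolding S_def by blast
      thus ?thesis using M(2) J(2) by blast
    qed
  qed
  thus thesis using that M(1) by (simp add: S_def)
qed

lemma maximalideal_Units:
  assumes "cring A" "maximalideal M A" "a \<in> M"
  shows "a \<notin> Units A"
proof
  interpret A: cring A by fact
  interpret M: maximalideal M A by fact
  assume "a \<in> Units A"
  hence "\<one>\<^bsub>A\<^esub> \<in> M" using assms(3) M.I_l_closed[of a "inv\<^bsub>A\<^esub> a"] by simp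
  thus False using M.one_imp_carrier M.I_notcarr by auto
qed

lemma local_ring_maximalideal:
  assumes "cring A" "\<exists>!M. maximalideal M A" "maximalideal M A"
  shows "M = carrier A - Units A"
proof
  show "M \<subseteq> carrier A - Units A"
    using maximalideal_Units[OF assms(1,3)] ideal.Icarr[OF maximalideal.axioms(1)[OF assms(3)]] by blast
  show "carrier A - Units A \<subseteq> M"
    using exists_maximalideal[OF assms(1)] assms(2,3) by (metis Diff_iff subsetI)
qed

lemma (in primeideal) loc_maximalideal:
  "maximalideal {frac R I a s | a s. a \<in> I \<and> s \<in> carrier R - I} (loc R I)" (is "maximalideal ?M _")
proof -
  interpret L: cring "loc R I" by (rule loc_cring)
  have in_M: "frac R I a s \<in> ?M \<longleftrightarrow> a \<in> I" if "a \<in> carrier R" "s \<in> carrier R - I" for a s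
  proof
    assume "frac R I a s \<in> ?M"
    then obtain b t where "frac R I a s = frac R I b t" "b \<in> I" "t \<in> carrier R - I" by blast
    thus "a \<in> I" using frac_in_I_iff[OF that, of b t] Icarr by blast
  qed (use that in blast)
  have M_sub: "?M \<subseteq> carrier (loc R I)" using Icarr by blast
  have "ideal ?M (loc R I)"
  proof (rule idealI[OF L.ring_axioms])
    show "subgroup ?M (add_monoid (loc R I))"
    proof (rule group.subgroupI[OF L.add.is_group])
      show "?M \<subseteq> carrier (add_monoid (loc R I))" using M_sub by simp
      have "frac R I \<zero> \<one> \<in> ?M"
        unfolding in_M[OF zero_closed one_in_compl] by (rule additive_subgroup.zero_closed[OF is_additive_subgroup])
      thus "?M \<noteq> {}" by (metis empty_iff)
      fix x assume "x \<in> ?M"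
      then obtain a s where a: "x = frac R I a s" "a \<in> I" "s \<in> carrier R - I" by blast
      have "\<ominus>\<^bsub>loc R I\<^esub> x \<in> ?M" using a Icarr a_inv_closed by (auto simp: loc_uminus)
      thus "inv\<^bsub>add_monoid (loc R I)\<^esub> x \<in> ?M" by (simp add: a_inv_def)
      fix y assume "y \<in> ?M"
      then obtain b t where b: "y = frac R I b t" "b \<in> I" "t \<in> carrier R - I" by blast
      have "a \<otimes> t \<oplus> b \<otimes> s \<in> I" using a b I_r_closed a_closed by auto
      thus "x \<otimes>\<^bsub>add_monoid (loc R I)\<^esub> y \<in> ?M"
        using a b Icarr prime_compl_mult[OF a(3) b(3)] by (auto simp: loc_add)
    qed
  next
    fix x y assume "x \<in> ?M" "y \<in> carrier (loc R I)"
    then obtain a s b t where a: "x = frac R I a s" "a \<in> I" "s \<in> carrier R - I"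
      and b: "y = frac R I b t" "b \<in> carrier R" "t \<in> carrier R - I" by (auto simp: loc_carrier)
    have "b \<otimes> a \<in> I" "a \<otimes> b \<in> I" using a b I_l_closed I_r_closed by auto
    thus "y \<otimes>\<^bsub>loc R I\<^esub> x \<in> ?M" "x \<otimes>\<^bsub>loc R I\<^esub> y \<in> ?M"
      using a b Icarr prime_compl_mult[OF a(3) b(3)] prime_compl_mult[OF b(3) a(3)] by (auto simp: loc_mult)
  qed
  thus ?thesis
  proof (rule maximalidealI)
    show "carrier (loc R I) \<noteq> ?M"
      using in_M[OF one_closed one_in_compl] one_in_compl by blast
    fix J assume J: "ideal J (loc R I)" "?M \<subseteq> J" "J \<subseteq> carrier (loc R I)"
    show "J = ?M \<or> J = carrier (loc R I)"
    proof (cases "J \<subseteq> ?M")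
      case False
      then obtain x where x: "x \<in> J" "x \<notin> ?M" by blast
      then obtain a s where a: "x = frac R I a s" "a \<in> carrier R" "s \<in> carrier R" "s \<in> carrier R - I"
        using J(3) locE[of x] by blast
      have "a \<notin> I" using x(2) unfolding a(1) in_M[OF a(2,4)] .
      hence xU: "x \<in> Units (loc R I)" unfolding a(1) loc_Units_iff[OF a(2,4)] .
      have "inv\<^bsub>loc R I\<^esub> x \<otimes>\<^bsub>loc R I\<^esub> x \<in> J"
        by (rule ideal.I_l_closed[OF J(1) x(1) L.Units_inv_closed[OF xU]])
      hence "\<one>\<^bsub>loc R I\<^esub> \<in> J" unfolding L.Units_l_inv[OF xU] .
      thus ?thesis using ideal.one_imp_carrier[OF J(1)] by simp
    qed (use J in blast)
  qed
qed

lemma (in primeideal) loc_local: "\<exists>!M. maximalideal M (loc R I)"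
proof (rule ex1I)
  show "maximalideal {frac R I a s | a s. a \<in> I \<and> s \<in> carrier R - I} (loc R I)"
    by (rule loc_maximalideal)
  fix M assume M: "maximalideal M (loc R I)"
  interpret M: maximalideal M "loc R I" by fact
  have "M \<subseteq> {frac R I a s | a s. a \<in> I \<and> s \<in> carrier R - I}"
  proof
    fix x assume x: "x \<in> M"
    then obtain a s where a: "x = frac R I a s" "a \<in> carrier R" "s \<in> carrier R - I"
      using locE[OF M.Icarr[OF x]] by metis
    have "x \<notin> Units (loc R I)" by (rule maximalideal_Units[OF loc_cring M x])
    thus "x \<in> {frac R I a s | a s. a \<in> I \<and> s \<in> carrier R - I}" using a loc_Units_iff[OF a(2,3)] by blast
  qed
  thus "M = {frac R I a s | a s. a \<in> I \<and> s \<in> carrier R - I}"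
    using M.I_maximal[OF maximalideal.axioms(1)[OF loc_maximalideal]]
      maximalideal.I_notcarr[OF loc_maximalideal] Icarr by blast
qed

lemma ring_hom_Rg_const:
  assumes "cring A" "\<iota> \<in> Ring.ring_hom Rg A" "primeideal P A"
  shows "(\<lambda>c. frac A P (\<iota> c) \<one>\<^bsub>A\<^esub>) \<in> Ring.ring_hom (ring_on UNIV) (loc A P)"
proof -
  interpret P: primeideal P A by fact
  have "(\<lambda>a. frac A P a \<one>\<^bsub>A\<^esub>) \<circ> \<iota> \<in> Ring.ring_hom Rg (loc A P)"
    by (rule ring_hom_trans[OF assms(2) P.loc_hom])
  thus ?thesis by (simp add: comp_def)
qed

lemma Spec_simps [simp]:
  "tp (Spec A \<iota>) = zariski A" "stk (Spec A \<iota>) = loc A"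
  "scal (Spec A \<iota>) = (\<lambda>P c. frac A P (\<iota> c) \<one>\<^bsub>A\<^esub>)"
  by (simp_all add: Spec_def)

lemma mem_sec_Spec:
  "s \<in> sec (Spec A \<iota>) U \<longleftrightarrow> s \<in> (\<Pi>\<^sub>E P\<in>U. carrier (loc A P)) \<and>
     (\<forall>P\<in>U. \<exists>W a f. openin (zariski A) W \<and> P \<in> W \<and> W \<subseteq> U \<and> a \<in> carrier A \<and> f \<in> carrier A \<and>
          (\<forall>Q\<in>W. f \<notin> Q \<and> s Q = frac A Q a f))"
  by (simp add: Spec_def)

text \<open>Sections are locally fractions. Sums and products are formed on the intersection of two
  such neighbourhoods, and sections with equal germs at \<open>P\<close> agree on the open set where
  the witness \<open>u\<close> of that equality stays outside the prime.\<close>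

theorem locally_ringed_Spec:
  assumes A: "cring A" and \<iota>: "\<iota> \<in> Ring.ring_hom Rg A"
  shows "locally_ringed (Spec A \<iota>)"
proof -
  interpret A: cring A by (rule A)
  have pr: "primeideal P A" if "openin (zariski A) U" "P \<in> U" for P U
    using openin_subset[OF that(1)] that(2) by (auto simp: A.topspace_zariski)
  let ?X = "Spec A \<iota>"
  have frac_cond: "frac A Q a f \<in> carrier (loc A Q)"
    if "primeideal Q A" "a \<in> carrier A" "f \<in> carrier A" "f \<notin> Q" for Q a f
    using primeideal.frac_in_loc[OF that(1)] that by auto
  have secI: "s \<in> sec ?X U"
    if U: "openin (zariski A) U" and ext: "s \<in> extensional U"
      and rep: "\<And>P. P \<in> U \<Longrightarrow> \<exists>W a f. openin (zariski A) W \<and> P \<in> W \<and> W \<subseteq> U \<and> a \<in> carrier A \<and> f \<in> carrier A \<and>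
          (\<forall>Q\<in>W. f \<notin> Q \<and> s Q = frac A Q a f)" for s U
  proof -
    have "s P \<in> carrier (loc A P)" if "P \<in> U" for P
      using rep[OF that] frac_cond[OF pr[OF U that]] by metis
    thus ?thesis using ext rep unfolding mem_sec_Spec by (auto simp: PiE_iff)
  qed
  \<comment> \<open>Treats sum and product at once: \<open>k\<close> is the numerator of the result,
    and the denominator is the product \<open>f g\<close> in both cases.\<close>
  have combine: "(\<lambda>x\<in>U. h x (s x) (t x)) \<in> sec ?X U"
    if U: "openin (zariski A) U" and s: "s \<in> sec ?X U" and t: "t \<in> sec ?X U"
      and h: "\<And>Q a f b g. primeideal Q A \<Longrightarrow> a \<in> carrier A \<Longrightarrow> f \<in> carrier A - Q \<Longrightarrow> b \<in> carrier A \<Longrightarrow> g \<in> carrier A - Q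
         \<Longrightarrow> h Q (frac A Q a f) (frac A Q b g) = frac A Q (k a f b g) (f \<otimes>\<^bsub>A\<^esub> g)"
      and k: "\<And>a f b g. a \<in> carrier A \<Longrightarrow> f \<in> carrier A \<Longrightarrow> b \<in> carrier A \<Longrightarrow> g \<in> carrier A \<Longrightarrow> k a f b g \<in> carrier A"
    for U s t h k
  proof (rule secI[OF U])
    fix P assume P: "P \<in> U"
    obtain W1 a f where 1: "openin (zariski A) W1" "P \<in> W1" "W1 \<subseteq> U" "a \<in> carrier A" "f \<in> carrier A"
        "\<And>Q. Q \<in> W1 \<Longrightarrow> f \<notin> Q \<and> s Q = frac A Q a f" using s P unfolding mem_sec_Spec by metis
    obtain W2 b g where 2: "openin (zariski A) W2" "P \<in> W2" "W2 \<subseteq> U" "b \<in> carrier A" "g \<in> carrier A"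
        "\<And>Q. Q \<in> W2 \<Longrightarrow> g \<notin> Q \<and> t Q = frac A Q b g" using t P unfolding mem_sec_Spec by metis
    have "f \<otimes>\<^bsub>A\<^esub> g \<notin> Q \<and> (\<lambda>x\<in>U. h x (s x) (t x)) Q = frac A Q (k a f b g) (f \<otimes>\<^bsub>A\<^esub> g)"
      if Q: "Q \<in> W1 \<inter> W2" for Q
    proof -
      have pQ: "primeideal Q A" using pr[OF 1(1)] Q by blast
      have f: "f \<in> carrier A - Q" and g: "g \<in> carrier A - Q" using Q 1 2 by auto
      have "h Q (s Q) (t Q) = frac A Q (k a f b g) (f \<otimes>\<^bsub>A\<^esub> g)"
        using h[OF pQ 1(4) f 2(4) g] Q 1(6)[of Q] 2(6)[of Q] by simp
      moreover have "Q \<in> U" using Q 1(3) by blast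
      ultimately show ?thesis using primeideal.prime_compl_mult[OF pQ f g] by simp
    qed
    moreover have "openin (zariski A) (W1 \<inter> W2)" using 1(1) 2(1) by (rule openin_Int)
    moreover have "P \<in> W1 \<inter> W2" "W1 \<inter> W2 \<subseteq> U" using 1 2 by auto
    moreover have "k a f b g \<in> carrier A" "f \<otimes>\<^bsub>A\<^esub> g \<in> carrier A" using k 1 2 by auto
    ultimately show "\<exists>W a f. openin (zariski A) W \<and> P \<in> W \<and> W \<subseteq> U \<and> a \<in> carrier A \<and> f \<in> carrier A \<and>
          (\<forall>Q\<in>W. f \<notin> Q \<and> (\<lambda>x\<in>U. h x (s x) (t x)) Q = frac A Q a f)" by blast
  qed simp
  show ?thesis
    unfolding locally_ringed_def Spec_simps
  proof (intro conjI ballI allI impI)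
    fix P assume "P \<in> topspace (zariski A)"
    hence P: "primeideal P A" by (simp add: A.topspace_zariski)
    show "cring (loc A P)" by (rule primeideal.loc_cring[OF P])
    show "\<exists>!M. maximalideal M (loc A P)" by (rule primeideal.loc_local[OF P])
    show "(\<lambda>c. frac A P (\<iota> c) \<one>\<^bsub>A\<^esub>) \<in> Ring.ring_hom (ring_on UNIV) (loc A P)"
      by (rule ring_hom_Rg_const[OF A \<iota> P])
  next
    fix U assume U: "openin (zariski A) U"
    show "sec ?X U \<subseteq> (\<Pi>\<^sub>E x\<in>U. carrier (loc A x))" by (rule subsetI) (simp only: mem_sec_Spec)
  next
    fix U c assume U: "openin (zariski A) U"
    show "(\<lambda>x\<in>U. frac A x (\<iota> c) \<one>\<^bsub>A\<^esub>) \<in> sec ?X U"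
    proof (rule secI[OF U])
      fix P assume P: "P \<in> U"
      have "\<one>\<^bsub>A\<^esub> \<notin> Q" if "Q \<in> U" for Q using primeideal.one_in_compl[OF pr[OF U that]] by simp
      moreover have "\<iota> c \<in> carrier A" using ring_hom_closed[OF \<iota>, of c] by (simp add: Rg_simps)
      ultimately show "\<exists>W a f. openin (zariski A) W \<and> P \<in> W \<and> W \<subseteq> U \<and> a \<in> carrier A \<and> f \<in> carrier A \<and>
          (\<forall>Q\<in>W. f \<notin> Q \<and> (\<lambda>x\<in>U. frac A x (\<iota> c) \<one>\<^bsub>A\<^esub>) Q = frac A Q a f)"
        using U P by (intro exI[of _ U] exI[of _ "\<iota> c"] exI[of _ "\<one>\<^bsub>A\<^esub>"]) auto
    qed simp
  next
    fix U s t assume U: "openin (zariski A) U" and s: "s \<in> sec ?X U" and t: "t \<in> sec ?X U"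
    show "(\<lambda>x\<in>U. s x \<oplus>\<^bsub>loc A x\<^esub> t x) \<in> sec ?X U"
      by (rule combine[OF U s t, of _ "\<lambda>a f b g. a \<otimes>\<^bsub>A\<^esub> g \<oplus>\<^bsub>A\<^esub> b \<otimes>\<^bsub>A\<^esub> f"])
         (auto simp: primeideal.loc_add)
    show "(\<lambda>x\<in>U. s x \<otimes>\<^bsub>loc A x\<^esub> t x) \<in> sec ?X U"
      by (rule combine[OF U s t, of _ "\<lambda>a f b g. a \<otimes>\<^bsub>A\<^esub> b"])
         (auto simp: primeideal.loc_mult)
  next
    fix U s W assume U: "openin (zariski A) U" and s: "s \<in> sec ?X U"
      and W: "openin (zariski A) W \<and> W \<subseteq> U"
    show "restrict s W \<in> sec ?X W"
    proof (rule secI)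
      fix P assume P: "P \<in> W"
      hence "P \<in> U" using W by blast
      then obtain V a f where V: "openin (zariski A) V" "P \<in> V" "V \<subseteq> U" "a \<in> carrier A" "f \<in> carrier A"
        "\<And>Q. Q \<in> V \<Longrightarrow> f \<notin> Q \<and> s Q = frac A Q a f" using s unfolding mem_sec_Spec by metis
      have "openin (zariski A) (V \<inter> W)" "P \<in> V \<inter> W" "V \<inter> W \<subseteq> W" using V W P by auto
      moreover have "\<forall>Q\<in>V \<inter> W. f \<notin> Q \<and> restrict s W Q = frac A Q a f" using V(6) by auto
      ultimately show "\<exists>Wa a f. openin (zariski A) Wa \<and> P \<in> Wa \<and> Wa \<subseteq> W \<and> a \<in> carrier A \<and> f \<in> carrier A \<and>
          (\<forall>Q\<in>Wa. f \<notin> Q \<and> restrict s W Q = frac A Q a f)" using V(4,5) by blast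
    qed (use W in auto)
  next
    fix U s assume U: "openin (zariski A) U" and s: "s \<in> (\<Pi>\<^sub>E x\<in>U. carrier (loc A x))"
      and loc: "\<forall>x\<in>U. \<exists>W. openin (zariski A) W \<and> x \<in> W \<and> W \<subseteq> U \<and> restrict s W \<in> sec ?X W"
    show "s \<in> sec ?X U"
    proof (rule secI[OF U])
      fix P assume "P \<in> U"
      then obtain W where W: "openin (zariski A) W" "P \<in> W" "W \<subseteq> U" "restrict s W \<in> sec ?X W" using loc by blast
      then obtain V a f where V: "openin (zariski A) V" "P \<in> V" "V \<subseteq> W" "a \<in> carrier A" "f \<in> carrier A"
        "\<And>Q. Q \<in> V \<Longrightarrow> f \<notin> Q \<and> restrict s W Q = frac A Q a f" unfolding mem_sec_Spec by metis
      moreover have "\<forall>Q\<in>V. f \<notin> Q \<and> s Q = frac A Q a f" using V(3,6) by (metis restrict_apply' subsetD)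
      moreover have "V \<subseteq> U" using V(3) W(3) by blast
      ultimately show "\<exists>W a f. openin (zariski A) W \<and> P \<in> W \<and> W \<subseteq> U \<and> a \<in> carrier A \<and> f \<in> carrier A \<and>
          (\<forall>Q\<in>W. f \<notin> Q \<and> s Q = frac A Q a f)" by blast
    qed (use s in \<open>auto simp: PiE_iff\<close>)
  next
    fix U s t P assume U: "openin (zariski A) U" and s: "s \<in> sec ?X U" and t: "t \<in> sec ?X U"
      and P: "P \<in> U" and eq: "s P = t P"
    obtain W1 a f where 1: "openin (zariski A) W1" "P \<in> W1" "W1 \<subseteq> U" "a \<in> carrier A" "f \<in> carrier A"
        "\<And>Q. Q \<in> W1 \<Longrightarrow> f \<notin> Q \<and> s Q = frac A Q a f" using s P unfolding mem_sec_Spec by metis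
    obtain W2 b g where 2: "openin (zariski A) W2" "P \<in> W2" "W2 \<subseteq> U" "b \<in> carrier A" "g \<in> carrier A"
        "\<And>Q. Q \<in> W2 \<Longrightarrow> g \<notin> Q \<and> t Q = frac A Q b g" using t P unfolding mem_sec_Spec by metis
    interpret P: primeideal P A using pr[OF U P] .
    obtain u where u: "u \<in> carrier A - P" "u \<otimes>\<^bsub>A\<^esub> (a \<otimes>\<^bsub>A\<^esub> g) = u \<otimes>\<^bsub>A\<^esub> (b \<otimes>\<^bsub>A\<^esub> f)"
      using P.frac_eq_iff[of a f b g] eq 1 2 by auto
    define W where "W = W1 \<inter> W2 \<inter> {Q. primeideal Q A \<and> u \<notin> Q}"
    have "openin (zariski A) W" unfolding W_def
      using 1(1) 2(1) A.openin_zariski_basic u(1) by (intro openin_Int) auto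
    moreover have "P \<in> W" using 1(2) 2(2) u(1) P.primeideal_axioms by (simp add: W_def)
    moreover have "W \<subseteq> U" using 1(3) by (auto simp: W_def)
    moreover have "s Q = t Q" if "Q \<in> W" for Q
    proof -
      have Q: "primeideal Q A" "u \<in> carrier A - Q" "f \<in> carrier A - Q" "g \<in> carrier A - Q"
        using that u(1) 1 2 by (auto simp: W_def)
      have "frac A Q a f = frac A Q b g"
        using primeideal.frac_eq_iff[OF Q(1) 1(4) Q(3) 2(4) Q(4)] u(2) Q(2) by blast
      thus ?thesis using that 1(6) 2(6) by (auto simp: W_def)
    qed
    ultimately show "\<exists>W. openin (zariski A) W \<and> P \<in> W \<and> W \<subseteq> U \<and> (\<forall>y\<in>W. s y = t y)" by blast
  next
    fix P x assume "P \<in> topspace (zariski A)" and x: "x \<in> carrier (loc A P)"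
    hence P: "primeideal P A" by (simp add: A.topspace_zariski)
    obtain a f where a: "x = frac A P a f" "a \<in> carrier A" "f \<in> carrier A - P"
      using primeideal.locE[OF P x] by metis
    let ?U = "{Q. primeideal Q A \<and> f \<notin> Q}"
    have U: "openin (zariski A) ?U" using a(3) by (intro A.openin_zariski_basic) auto
    have "(\<lambda>Q\<in>?U. frac A Q a f) \<in> sec ?X ?U"
    proof (rule secI[OF U])
      fix Q assume "Q \<in> ?U"
      thus "\<exists>W b g. openin (zariski A) W \<and> Q \<in> W \<and> W \<subseteq> ?U \<and> b \<in> carrier A \<and> g \<in> carrier A \<and>
          (\<forall>Q\<in>W. g \<notin> Q \<and> (\<lambda>Q\<in>?U. frac A Q a f) Q = frac A Q b g)"
        using U a by (intro exI[of _ ?U] exI[of _ a] exI[of _ f]) auto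
    qed simp
    moreover have "P \<in> ?U" using P a(3) by simp
    ultimately show "\<exists>U s. openin (zariski A) U \<and> P \<in> U \<and> s \<in> sec ?X U \<and> s P = x"
      using U a(1) by (intro exI[of _ ?U] exI[of _ "\<lambda>Q\<in>?U. frac A Q a f"]) auto
  qed
qed

subsection \<open>Morphisms\<close>

lemma kmorD:
  assumes "kmor X Y f"
  shows "continuous_map (tp X) (tp Y) (pmap f)"
    and "x \<in> pts X \<Longrightarrow> smap f x \<in> Ring.ring_hom (stk Y (pmap f x)) (stk X x)"
    and "x \<in> pts X \<Longrightarrow> a \<in> carrier (stk Y (pmap f x)) \<Longrightarrow> smap f x a \<in> Units (stk X x)
      \<Longrightarrow> a \<in> Units (stk Y (pmap f x))"
    and "x \<in> pts X \<Longrightarrow> smap f x (scal Y (pmap f x) c) = scal X x c"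
    and "openin (tp Y) W \<Longrightarrow> s \<in> sec Y W \<Longrightarrow> (\<lambda>x\<in>{x \<in> pts X. pmap f x \<in> W}. smap f x (s (pmap f x)))
          \<in> sec X {x \<in> pts X. pmap f x \<in> W}"
    and "x \<in> pts X \<Longrightarrow> pmap f x \<in> pts Y"
  using assms unfolding kmor_def by (auto dest: continuous_map_image_subset_topspace)

lemma kmor_kid: "locally_ringed X \<Longrightarrow> kmor X X kid"
proof -
  assume X: "locally_ringed X"
  have "restrict s {x \<in> pts X. x \<in> W} \<in> sec X {x \<in> pts X. x \<in> W}" if "openin (tp X) W" "s \<in> sec X W" for W s
  proof -
    have "{x \<in> pts X. x \<in> W} = W" using openin_subset[OF that(1)] by blast
    thus ?thesis using X that unfolding locally_ringed_def by auto
  qed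
  thus ?thesis unfolding kmor_def kid_def by (auto intro!: ring_hom_memI)
qed

lemma kmor_kcomp:
  assumes f: "kmor X Y f" and g: "kmor Y Z g"
  shows "kmor X Z (kcomp g f)"
  unfolding kmor_def kcomp_def kmap.simps
proof (intro conjI ballI allI impI)
  show "continuous_map (tp X) (tp Z) (\<lambda>x. pmap g (pmap f x))"
    using continuous_map_compose[OF kmorD(1)[OF f] kmorD(1)[OF g]] by (simp add: comp_def)
next
  fix x assume x: "x \<in> pts X"
  have y: "pmap f x \<in> pts Y" by (rule kmorD(6)[OF f x])
  show "(\<lambda>a. smap f x (smap g (pmap f x) a)) \<in> Ring.ring_hom (stk Z (pmap g (pmap f x))) (stk X x)"
    using ring_hom_trans[OF kmorD(2)[OF g y] kmorD(2)[OF f x]] by (simp add: comp_def)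
  show "smap f x (smap g (pmap f x) (scal Z (pmap g (pmap f x)) c)) = scal X x c" for c
    using kmorD(4)[OF g y] kmorD(4)[OF f x] by simp
  fix a assume a: "a \<in> carrier (stk Z (pmap g (pmap f x)))" "smap f x (smap g (pmap f x) a) \<in> Units (stk X x)"
  have "smap g (pmap f x) a \<in> carrier (stk Y (pmap f x))" using ring_hom_closed[OF kmorD(2)[OF g y] a(1)] .
  thus "a \<in> Units (stk Z (pmap g (pmap f x)))" using kmorD(3)[OF g y a(1)] kmorD(3)[OF f x] a(2) by blast
next
  fix W s assume W: "openin (tp Z) W \<and> s \<in> sec Z W"
  let ?V = "{y \<in> pts Y. pmap g y \<in> W}"
  have V: "openin (tp Y) ?V" using kmorD(1)[OF g] W by (auto simp: continuous_map_def)
  have 1: "(\<lambda>y\<in>?V. smap g y (s (pmap g y))) \<in> sec Y ?V" using kmorD(5)[OF g] W by blast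
  have eq: "{x \<in> pts X. pmap f x \<in> ?V} = {x \<in> pts X. pmap g (pmap f x) \<in> W}"
    using kmorD(6)[OF f] by blast
  have "(\<lambda>x\<in>{x \<in> pts X. pmap f x \<in> ?V}. smap f x ((\<lambda>y\<in>?V. smap g y (s (pmap g y))) (pmap f x)))
      = (\<lambda>x\<in>{x \<in> pts X. pmap g (pmap f x) \<in> W}. smap f x (smap g (pmap f x) (s (pmap g (pmap f x)))))"
    unfolding eq using kmorD(6)[OF f] by (intro restrict_ext) auto
  thus "(\<lambda>x\<in>{x \<in> pts X. pmap g (pmap f x) \<in> W}. smap f x (smap g (pmap f x) (s (pmap g (pmap f x)))))
      \<in> sec X {x \<in> pts X. pmap g (pmap f x) \<in> W}"
    using kmorD(5)[OF f V 1] unfolding eq by simp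
qed

lemma open_sub_pts: "open_sub X (pts X) = X"
  by (simp add: open_sub_def)

lemma kiso_kid: "locally_ringed X \<Longrightarrow> kiso X X kid"
proof -
  assume X: "locally_ringed X"
  have "homeomorphic_map (tp X) (tp X) (\<lambda>x. x)"
    using homeomorphic_map_id[of "tp X" "tp X"] by (simp add: id_def)
  thus ?thesis using kmor_kid[OF X]
    by (simp add: kiso_def open_immersion_def kid_def bij_betw_def inj_on_def)
qed

lemma primeideal_vimage:
  assumes "cring A" "cring B" "h \<in> Ring.ring_hom A B" "primeideal Q B"
  shows "primeideal {a \<in> carrier A. h a \<in> Q} A"
proof -
  interpret A: cring A by fact
  interpret Q: primeideal Q B by fact
  interpret h: ring_hom_ring A B h
    using assms by (intro ring_hom_ring.intro ring_hom_ring_axioms.intro cring.axioms(1)) auto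
  have "ideal {a \<in> carrier A. h a \<in> Q} A"
  proof (rule idealI[OF A.ring_axioms])
    show "subgroup {a \<in> carrier A. h a \<in> Q} (add_monoid A)"
      by (rule group.subgroupI[OF A.add.is_group])
         (auto simp: additive_subgroup.zero_closed[OF Q.is_additive_subgroup] Q.a_closed
           additive_subgroup.a_inv_closed[OF Q.is_additive_subgroup] simp flip: a_inv_def intro!: exI[of _ "\<zero>\<^bsub>A\<^esub>"])
  qed (auto intro: Q.I_l_closed Q.I_r_closed)
  thus ?thesis
  proof (rule primeidealI[OF _ assms(1)])
    have "h \<one>\<^bsub>A\<^esub> \<notin> Q" using ring_hom_one[OF assms(3)] Q.one_in_compl by simp
    thus "carrier A \<noteq> {a \<in> carrier A. h a \<in> Q}" using A.one_closed by blast
    fix a b assume "a \<in> carrier A" "b \<in> carrier A" "a \<otimes>\<^bsub>A\<^esub> b \<in> {a \<in> carrier A. h a \<in> Q}"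
    thus "a \<in> {a \<in> carrier A. h a \<in> Q} \<or> b \<in> {a \<in> carrier A. h a \<in> Q}"
      using Q.I_prime[of "h a" "h b"] by auto
  qed
qed

text \<open>\<open>Spec_map\<close> takes a union over all representatives of a fraction; equal
  fractions have equal images, so the union has one term.\<close>

lemma Spec_map_stalk:
  assumes A: "cring A" and B: "cring B" and h: "h \<in> Ring.ring_hom A B" and Q: "primeideal Q B"
    and a: "a \<in> carrier A" "s \<in> carrier A" "h s \<notin> Q"
  shows "smap (Spec_map A B h) Q (frac A {a \<in> carrier A. h a \<in> Q} a s) = frac B Q (h a) (h s)"
proof -
  define P where "P = {a \<in> carrier A. h a \<in> Q}"
  have nP: "x \<in> carrier A - P \<longleftrightarrow> x \<in> carrier A \<and> h x \<notin> Q" for x unfolding P_def by blast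
  interpret P: primeideal P A unfolding P_def by (rule primeideal_vimage[OF A B h Q])
  interpret Q: primeideal Q B by fact
  have hc: "h x \<in> carrier B" if "x \<in> carrier A" for x using ring_hom_closed[OF h that] .
  have s: "s \<in> carrier A - P" unfolding nP using a(2,3) by (rule conjI)
  have *: "frac B Q (h b) (h t) = frac B Q (h a) (h s)" if bt: "(b, t) \<in> frac A P a s" for b t
  proof -
    have "b \<in> carrier A \<and> t \<in> carrier A - P
        \<and> (\<exists>u\<in>carrier A - P. u \<otimes>\<^bsub>A\<^esub> (a \<otimes>\<^bsub>A\<^esub> t) = u \<otimes>\<^bsub>A\<^esub> (b \<otimes>\<^bsub>A\<^esub> s))"
      using bt unfolding P.frac_mem_iff[OF a(1,2)] .
    then obtain u where bt: "b \<in> carrier A" "t \<in> carrier A - P" and u: "u \<in> carrier A - P"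
      "u \<otimes>\<^bsub>A\<^esub> (a \<otimes>\<^bsub>A\<^esub> t) = u \<otimes>\<^bsub>A\<^esub> (b \<otimes>\<^bsub>A\<^esub> s)" by (elim conjE bexE)
    have "h (u \<otimes>\<^bsub>A\<^esub> (a \<otimes>\<^bsub>A\<^esub> t)) = h (u \<otimes>\<^bsub>A\<^esub> (b \<otimes>\<^bsub>A\<^esub> s))" using u(2) by simp
    moreover have c: "t \<in> carrier A" "u \<in> carrier A" using bt(2) u(1) by blast+
    ultimately have eq: "h u \<otimes>\<^bsub>B\<^esub> (h a \<otimes>\<^bsub>B\<^esub> h t) = h u \<otimes>\<^bsub>B\<^esub> (h b \<otimes>\<^bsub>B\<^esub> h s)"
      using a(1,2) bt(1) by (simp add: ring_hom_mult[OF h])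
    have m: "h s \<in> carrier B - Q" "h t \<in> carrier B - Q" "h u \<in> carrier B - Q"
      using a(2,3) bt(2) u(1) hc unfolding nP by blast+
    show ?thesis
      unfolding Q.frac_eq_iff[OF hc[OF bt(1)] m(2) hc[OF a(1)] m(1)] using eq[symmetric] m(3) by blast
  qed
  have "(\<Union>(b, t)\<in>frac A P a s. frac B Q (h b) (h t)) = (\<Union>q\<in>frac A P a s. frac B Q (h a) (h s))"
    by (rule SUP_cong[OF refl]) (use * in \<open>simp only: split_paired_all case_prod_conv\<close>)
  also have "\<dots> = frac B Q (h a) (h s)" using P.frac_refl[OF a(1) s] by blast
  finally show ?thesis unfolding Spec_map_def P_def by simp
qed

theorem kmor_Spec_map:
  assumes A: "cring A" and B: "cring B" and h: "h \<in> Ring.ring_hom A B"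
    and \<iota>: "\<And>c. \<iota> c \<in> carrier A" "\<And>c. h (\<iota> c) = \<kappa> c"
  shows "kmor (Spec B \<kappa>) (Spec A \<iota>) (Spec_map A B h)"
proof -
  interpret A: cring A by fact
  interpret B: cring B by fact
  let ?f = "Spec_map A B h"
  have pm: "pmap ?f Q = {a \<in> carrier A. h a \<in> Q}" for Q by (simp add: Spec_map_def)
  have hc: "h x \<in> carrier B" if "x \<in> carrier A" for x using ring_hom_closed[OF h that] .
  note prime = primeideal_vimage[OF A B h]
  have cont: "continuous_map (zariski B) (zariski A) (pmap ?f)"
    unfolding continuous_map_def
  proof (intro conjI allI impI)
    show "pmap ?f \<in> topspace (zariski B) \<rightarrow> topspace (zariski A)"
      using prime by (auto simp: A.topspace_zariski B.topspace_zariski pm)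
    fix U assume "openin (zariski A) U"
    then obtain E where E: "E \<subseteq> carrier A" "U = {P. primeideal P A \<and> \<not> E \<subseteq> P}"
      unfolding A.openin_zariski by blast
    have "{x \<in> topspace (zariski B). pmap ?f x \<in> U} = {Q. primeideal Q B \<and> \<not> h ` E \<subseteq> Q}"
      using E(1) prime unfolding E(2) B.topspace_zariski pm by blast
    moreover have "h ` E \<subseteq> carrier B" using E(1) hc by blast
    ultimately show "openin (zariski B) {x \<in> topspace (zariski B). pmap ?f x \<in> U}"
      unfolding B.openin_zariski by blast
  qed
  show ?thesis
    unfolding kmor_def Spec_simps
  proof (intro conjI ballI allI impI)
    fix Q assume "Q \<in> topspace (zariski B)"
    hence Q: "primeideal Q B" by (simp add: B.topspace_zariski)
    interpret Q: primeideal Q B by fact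
    interpret P: primeideal "pmap ?f Q" A unfolding pm by (rule prime[OF Q])
    note st = Spec_map_stalk[OF A B h Q, folded pm]
    have rep: "\<exists>a s. x = frac A (pmap ?f Q) a s \<and> a \<in> carrier A \<and> s \<in> carrier A - pmap ?f Q \<and> h a \<in> carrier B
        \<and> h s \<in> carrier B - Q \<and> smap ?f Q x = frac B Q (h a) (h s)"
      if "x \<in> carrier (loc A (pmap ?f Q))" for x
    proof -
      from that obtain a s where as: "x = frac A (pmap ?f Q) a s" "a \<in> carrier A" "s \<in> carrier A"
        "s \<in> carrier A - pmap ?f Q" by (rule P.locE)
      have "h s \<notin> Q" using as(3,4) unfolding pm by blast
      thus ?thesis using as hc st[of a s] by blast
    qed
    show "smap ?f Q \<in> Ring.ring_hom (loc A (pmap ?f Q)) (loc B Q)"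
    proof (rule ring_hom_memI)
      fix x assume "x \<in> carrier (loc A (pmap ?f Q))"
      thus "smap ?f Q x \<in> carrier (loc B Q)" using rep by (metis Q.frac_in_loc)
    next
      fix x y assume "x \<in> carrier (loc A (pmap ?f Q))" "y \<in> carrier (loc A (pmap ?f Q))"
      from rep[OF this(1)] rep[OF this(2)] obtain a s b t where
        x: "x = frac A (pmap ?f Q) a s" "a \<in> carrier A" "s \<in> carrier A - pmap ?f Q" "h a \<in> carrier B"
           "h s \<in> carrier B - Q" "smap ?f Q x = frac B Q (h a) (h s)" and
        y: "y = frac A (pmap ?f Q) b t" "b \<in> carrier A" "t \<in> carrier A - pmap ?f Q" "h b \<in> carrier B"
           "h t \<in> carrier B - Q" "smap ?f Q y = frac B Q (h b) (h t)" by metis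
      have sA: "s \<in> carrier A" "t \<in> carrier A" using x(3) y(3) by auto
      have hst: "h (s \<otimes>\<^bsub>A\<^esub> t) \<notin> Q"
        using Q.prime_compl_mult[OF x(5) y(5)] sA by (simp add: ring_hom_mult[OF h])
      have "smap ?f Q (x \<otimes>\<^bsub>loc A (pmap ?f Q)\<^esub> y) = frac B Q (h (a \<otimes>\<^bsub>A\<^esub> b)) (h (s \<otimes>\<^bsub>A\<^esub> t))"
        unfolding x(1) y(1) P.loc_mult[OF x(2,3) y(2,3)]
        by (rule st) (use x y sA hst in auto)
      also have "\<dots> = smap ?f Q x \<otimes>\<^bsub>loc B Q\<^esub> smap ?f Q y"
        unfolding x(6) y(6) Q.loc_mult[OF x(4,5) y(4,5)] using x y sA by (simp add: ring_hom_mult[OF h])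
      finally show "smap ?f Q (x \<otimes>\<^bsub>loc A (pmap ?f Q)\<^esub> y) = smap ?f Q x \<otimes>\<^bsub>loc B Q\<^esub> smap ?f Q y" .
      have "smap ?f Q (x \<oplus>\<^bsub>loc A (pmap ?f Q)\<^esub> y)
          = frac B Q (h (a \<otimes>\<^bsub>A\<^esub> t \<oplus>\<^bsub>A\<^esub> b \<otimes>\<^bsub>A\<^esub> s)) (h (s \<otimes>\<^bsub>A\<^esub> t))"
        unfolding x(1) y(1) P.loc_add[OF x(2,3) y(2,3)]
        by (rule st) (use x y sA hst in auto)
      also have "\<dots> = smap ?f Q x \<oplus>\<^bsub>loc B Q\<^esub> smap ?f Q y"
        unfolding x(6) y(6) Q.loc_add[OF x(4,5) y(4,5)] using x y sA
        by (simp add: ring_hom_mult[OF h] ring_hom_add[OF h])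
      finally show "smap ?f Q (x \<oplus>\<^bsub>loc A (pmap ?f Q)\<^esub> y) = smap ?f Q x \<oplus>\<^bsub>loc B Q\<^esub> smap ?f Q y" .
    next
      show "smap ?f Q \<one>\<^bsub>loc A (pmap ?f Q)\<^esub> = \<one>\<^bsub>loc B Q\<^esub>"
        unfolding P.loc_one Q.loc_one using st[of "\<one>\<^bsub>A\<^esub>" "\<one>\<^bsub>A\<^esub>"] Q.one_in_compl ring_hom_one[OF h] by simp
    qed
    show "smap ?f Q (frac A (pmap ?f Q) (\<iota> c) \<one>\<^bsub>A\<^esub>) = frac B Q (\<kappa> c) \<one>\<^bsub>B\<^esub>" for c
      using st[of "\<iota> c" "\<one>\<^bsub>A\<^esub>"] \<iota> Q.one_in_compl ring_hom_one[OF h] by simp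
    fix x assume x: "x \<in> carrier (loc A (pmap ?f Q))" "smap ?f Q x \<in> Units (loc B Q)"
    from rep[OF x(1)] obtain a s where
      as: "x = frac A (pmap ?f Q) a s" "a \<in> carrier A" "s \<in> carrier A - pmap ?f Q" "h a \<in> carrier B"
         "h s \<in> carrier B - Q" "smap ?f Q x = frac B Q (h a) (h s)" by metis
    have "h a \<notin> Q" using x(2) unfolding as(6) Q.loc_Units_iff[OF as(4,5)] .
    hence "a \<notin> pmap ?f Q" unfolding pm by blast
    thus "x \<in> Units (loc A (pmap ?f Q))" unfolding as(1) P.loc_Units_iff[OF as(2,3)] .
  next
    show "continuous_map (zariski B) (zariski A) (pmap ?f)" by (rule cont)
  next
    fix W s assume "openin (zariski A) W \<and> s \<in> sec (Spec A \<iota>) W"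
    hence W: "openin (zariski A) W" and s: "s \<in> sec (Spec A \<iota>) W" by auto
    let ?V = "{x \<in> topspace (zariski B). pmap ?f x \<in> W}"
    let ?s = "\<lambda>x\<in>?V. smap ?f x (s (pmap ?f x))"
    have loc_rep: "\<exists>V a f. openin (zariski B) V \<and> Q \<in> V \<and> V \<subseteq> ?V \<and> a \<in> carrier B \<and> f \<in> carrier B \<and>
          (\<forall>P\<in>V. f \<notin> P \<and> ?s P = frac B P a f)" if Q: "Q \<in> ?V" for Q
    proof -
      have "pmap ?f Q \<in> W" using Q by simp
      then obtain U a f where U: "openin (zariski A) U" "pmap ?f Q \<in> U" "U \<subseteq> W" "a \<in> carrier A" "f \<in> carrier A"
        "\<And>P. P \<in> U \<Longrightarrow> f \<notin> P \<and> s P = frac A P a f" using s unfolding mem_sec_Spec by metis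
      let ?U = "{x \<in> topspace (zariski B). pmap ?f x \<in> U}"
      have "openin (zariski B) ?U" using cont U(1) by (auto simp: continuous_map_def)
      moreover have "Q \<in> ?U" "?U \<subseteq> ?V" using Q U(2,3) by auto
      moreover have "h f \<notin> P \<and> ?s P = frac B P (h a) (h f)" if P: "P \<in> ?U" for P
      proof -
        have PB: "primeideal P B" using P by (simp add: B.topspace_zariski)
        have fP: "f \<notin> pmap ?f P" "s (pmap ?f P) = frac A (pmap ?f P) a f" using U(6) P by auto
        have hf: "h f \<notin> P" using fP(1) U(5) by (simp add: pm)
        have "P \<in> ?V" using P U(3) by auto
        thus ?thesis using hf fP(2) Spec_map_stalk[OF A B h PB U(4,5) hf] by (simp add: pm)
      qed
      ultimately show ?thesis using U(4,5) hc by blast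
    qed
    have "?s P \<in> carrier (loc B P)" if P: "P \<in> ?V" for P
    proof -
      have PB: "primeideal P B" using P by (simp add: B.topspace_zariski)
      from loc_rep[OF P] obtain V a f where V: "P \<in> V" "a \<in> carrier B" "f \<in> carrier B"
        "\<forall>P\<in>V. f \<notin> P \<and> ?s P = frac B P a f" by (elim exE conjE)
      have "f \<notin> P \<and> ?s P = frac B P a f" using V(4) V(1) by (rule bspec)
      hence f: "f \<notin> P" "?s P = frac B P a f" by (rule conjunct1, rule conjunct2)
      show ?thesis unfolding f(2) using primeideal.frac_in_loc[OF PB V(2), of f] V(3) f(1) by blast
    qed
    hence "?s \<in> (\<Pi>\<^sub>E P\<in>?V. carrier (loc B P))" by (simp add: PiE_iff)
    thus "?s \<in> sec (Spec B \<kappa>) ?V" unfolding mem_sec_Spec using loc_rep by blast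
  qed
qed

subsection \<open>Affine schemes are separated and reduced\<close>

text \<open>The field lives on the type of \<open>A\<close> itself, through chosen coset
  representatives. The one-point space built on it must have type \<open>'k sch\<close>, because the
  universal property in \<open>fibre_product\<close> quantifies over that type.\<close>

lemma residue_field_exists:
  fixes A :: "'a ring"
  assumes "cring A" "maximalideal M A"
  obtains F :: "'a ring" and \<pi> where "field F" "\<pi> \<in> Ring.ring_hom A F" "\<pi> ` carrier A = carrier F"
    "\<And>a. a \<in> carrier A \<Longrightarrow> \<pi> a = \<zero>\<^bsub>F\<^esub> \<longleftrightarrow> a \<in> M"
proof -
  interpret A: cring A by fact
  interpret M: maximalideal M A by fact
  define r :: "'a set \<Rightarrow> 'a" where "r C = (SOME x. x \<in> C)" for C
  have Q: "field (A Quot M)" by (rule M.quotient_is_field[OF assms(1)])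
  have r: "r (M +>\<^bsub>A\<^esub> a) \<in> M +>\<^bsub>A\<^esub> a" if "a \<in> carrier A" for a
    unfolding r_def by (rule someI[of _ a]) (rule M.a_rcos_self[OF that])
  have eq: "M +>\<^bsub>A\<^esub> r (M +>\<^bsub>A\<^esub> a) = M +>\<^bsub>A\<^esub> a" if "a \<in> carrier A" for a
    using M.a_repr_independence'[OF r[OF that] that] by simp
  have inj: "inj_on r (carrier (A Quot M))"
  proof (rule inj_onI)
    have c: "M +>\<^bsub>A\<^esub> r C = C" if C: "C \<in> carrier (A Quot M)" for C
    proof -
      obtain a where a: "a \<in> carrier A" "C = M +>\<^bsub>A\<^esub> a"
        using C unfolding FactRing_def A_RCOSETS_def' by auto
      show ?thesis unfolding a(2) by (rule eq[OF a(1)])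
    qed
    fix C D assume "C \<in> carrier (A Quot M)" "D \<in> carrier (A Quot M)" "r C = r D"
    thus "C = D" using c by metis
  qed
  let ?F = "image_ring r (A Quot M)" and ?p = "\<lambda>a. r (M +>\<^bsub>A\<^esub> a)"
  have F: "field ?F" by (rule field.inj_imp_image_ring_is_field[OF Q inj])
  have iso: "r \<in> ring_iso (A Quot M) ?F" by (rule inj_imp_image_ring_iso[OF inj])
  hence rh: "r \<in> Ring.ring_hom (A Quot M) ?F" by (simp add: ring_iso_def)
  have ph: "?p \<in> Ring.ring_hom A ?F"
    using ring_hom_trans[OF M.rcos_ring_hom rh] by (simp add: comp_def)
  show thesis
  proof (rule that[OF F ph])
    show "?p ` carrier A = carrier ?F"
      unfolding image_ring_carrier FactRing_def A_RCOSETS_def' by auto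
    fix a assume a: "a \<in> carrier A"
    have "\<zero>\<^bsub>?F\<^esub> = r M" unfolding image_ring_zero FactRing_def by simp
    hence "?p a = \<zero>\<^bsub>?F\<^esub> \<longleftrightarrow> r (M +>\<^bsub>A\<^esub> a) = r (M +>\<^bsub>A\<^esub> \<zero>\<^bsub>A\<^esub>)"
      using M.a_rcos_const[OF additive_subgroup.zero_closed[OF M.is_additive_subgroup]] by simp
    also have "\<dots> \<longleftrightarrow> M +>\<^bsub>A\<^esub> a = M +>\<^bsub>A\<^esub> \<zero>\<^bsub>A\<^esub>" using eq[OF a] eq[OF A.zero_closed] by metis
    also have "\<dots> \<longleftrightarrow> a \<in> M" using A.quotient_eq_iff_same_a_r_cos[OF M.ideal_axioms a A.zero_closed] a
      by (simp add: a_minus_def)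
    finally show "?p a = \<zero>\<^bsub>?F\<^esub> \<longleftrightarrow> a \<in> M" .
  qed
qed

lemma locally_ringedD:
  assumes "locally_ringed X"
  shows "x \<in> pts X \<Longrightarrow> cring (stk X x)" and "x \<in> pts X \<Longrightarrow> \<exists>!M. maximalideal M (stk X x)"
    and "x \<in> pts X \<Longrightarrow> scal X x \<in> Ring.ring_hom (ring_on UNIV) (stk X x)"
    and "openin (tp X) U \<Longrightarrow> s \<in> sec X U \<Longrightarrow> s \<in> (\<Pi>\<^sub>E x\<in>U. carrier (stk X x))"
    and "openin (tp X) U \<Longrightarrow> (\<lambda>x\<in>U. scal X x c) \<in> sec X U"
    and "openin (tp X) U \<Longrightarrow> s \<in> sec X U \<Longrightarrow> t \<in> sec X U \<Longrightarrow> (\<lambda>x\<in>U. s x \<oplus>\<^bsub>stk X x\<^esub> t x) \<in> sec X U"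
    and "openin (tp X) U \<Longrightarrow> s \<in> sec X U \<Longrightarrow> t \<in> sec X U \<Longrightarrow> (\<lambda>x\<in>U. s x \<otimes>\<^bsub>stk X x\<^esub> t x) \<in> sec X U"
    and "openin (tp X) U \<Longrightarrow> s \<in> sec X U \<Longrightarrow> openin (tp X) W \<Longrightarrow> W \<subseteq> U \<Longrightarrow> restrict s W \<in> sec X W"
    and "openin (tp X) U \<Longrightarrow> s \<in> sec X U \<Longrightarrow> t \<in> sec X U \<Longrightarrow> x \<in> U \<Longrightarrow> s x = t x \<Longrightarrow>
           \<exists>W. openin (tp X) W \<and> x \<in> W \<and> W \<subseteq> U \<and> (\<forall>y\<in>W. s y = t y)"
    and "x \<in> pts X \<Longrightarrow> a \<in> carrier (stk X x) \<Longrightarrow> \<exists>U s. openin (tp X) U \<and> x \<in> U \<and> s \<in> sec X U \<and> s x = a"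
proof -
  note L = assms[unfolded locally_ringed_def]
  note L1 = conjunct1[OF L, THEN bspec] and L3 = conjunct2[OF conjunct2[OF L], THEN bspec, THEN bspec]
    and L2 = conjunct1[OF conjunct2[OF L], THEN spec, THEN mp]
  show "x \<in> pts X \<Longrightarrow> cring (stk X x)" "x \<in> pts X \<Longrightarrow> \<exists>!M. maximalideal M (stk X x)"
    "x \<in> pts X \<Longrightarrow> scal X x \<in> Ring.ring_hom (ring_on UNIV) (stk X x)"
    by (drule L1, elim conjE, assumption)+
  show "x \<in> pts X \<Longrightarrow> a \<in> carrier (stk X x) \<Longrightarrow> \<exists>U s. openin (tp X) U \<and> x \<in> U \<and> s \<in> sec X U \<and> s x = a"
    by (rule L3)
  show "openin (tp X) U \<Longrightarrow> s \<in> sec X U \<Longrightarrow> s \<in> (\<Pi>\<^sub>E x\<in>U. carrier (stk X x))"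
    by (drule L2, elim conjE, erule subsetD)
  show "openin (tp X) U \<Longrightarrow> (\<lambda>x\<in>U. scal X x c) \<in> sec X U"
    by (drule L2, elim conjE, erule spec)
  show "openin (tp X) U \<Longrightarrow> s \<in> sec X U \<Longrightarrow> t \<in> sec X U \<Longrightarrow> (\<lambda>x\<in>U. s x \<oplus>\<^bsub>stk X x\<^esub> t x) \<in> sec X U"
    "openin (tp X) U \<Longrightarrow> s \<in> sec X U \<Longrightarrow> t \<in> sec X U \<Longrightarrow> (\<lambda>x\<in>U. s x \<otimes>\<^bsub>stk X x\<^esub> t x) \<in> sec X U"
    by (drule L2, elim conjE, drule bspec, assumption, drule bspec, assumption, elim conjE, assumption)+
  show "openin (tp X) U \<Longrightarrow> s \<in> sec X U \<Longrightarrow> openin (tp X) W \<Longrightarrow> W \<subseteq> U \<Longrightarrow> restrict s W \<in> sec X W"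
    by (drule L2[of U]) simp
  show "openin (tp X) U \<Longrightarrow> s \<in> sec X U \<Longrightarrow> t \<in> sec X U \<Longrightarrow> x \<in> U \<Longrightarrow> s x = t x \<Longrightarrow>
           \<exists>W. openin (tp X) W \<and> x \<in> W \<and> W \<subseteq> U \<and> (\<forall>y\<in>W. s y = t y)"
    by (drule L2[of U]) simp
qed

lemma scal_one: "locally_ringed X \<Longrightarrow> x \<in> pts X \<Longrightarrow> scal X x 1 = \<one>\<^bsub>stk X x\<^esub>"
  using ring_hom_one[OF locally_ringedD(3)] by (fastforce simp: Rg_simps)

text \<open>The germ of an inverse extends to a section \<open>t\<close>, and \<open>s t = 1\<close>
  spreads from \<open>x\<close> to a neighbourhood.\<close>

lemma openin_section_unit:
  assumes X: "locally_ringed X" and U: "openin (tp X) U" and s: "s \<in> sec X U"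
  shows "openin (tp X) {x \<in> U. s x \<in> Units (stk X x)}"
proof (subst openin_subopen, intro ballI)
  fix x assume "x \<in> {x \<in> U. s x \<in> Units (stk X x)}"
  hence x: "x \<in> U" "s x \<in> Units (stk X x)" by auto
  have xX: "x \<in> pts X" using openin_subset[OF U] x(1) by blast
  obtain v where v: "v \<in> carrier (stk X x)" "s x \<otimes>\<^bsub>stk X x\<^esub> v = \<one>\<^bsub>stk X x\<^esub>"
    using x(2) by (auto simp: Units_def)
  obtain V t where V: "openin (tp X) V" "x \<in> V" "t \<in> sec X V" "t x = v"
    using locally_ringedD(10)[OF X xX v(1)] by blast
  let ?O = "U \<inter> V"
  have O: "openin (tp X) ?O" "x \<in> ?O" using U V x by auto
  have 1: "(\<lambda>y\<in>?O. restrict s ?O y \<otimes>\<^bsub>stk X y\<^esub> restrict t ?O y) \<in> sec X ?O"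
    by (rule locally_ringedD(7)[OF X O(1) locally_ringedD(8)[OF X U s O(1)] locally_ringedD(8)[OF X V(1,3) O(1)]]) auto
  have 2: "(\<lambda>y\<in>?O. scal X y 1) \<in> sec X ?O" by (rule locally_ringedD(5)[OF X O(1)])
  have "\<exists>W. openin (tp X) W \<and> x \<in> W \<and> W \<subseteq> ?O
      \<and> (\<forall>y\<in>W. (\<lambda>y\<in>?O. restrict s ?O y \<otimes>\<^bsub>stk X y\<^esub> restrict t ?O y) y = (\<lambda>y\<in>?O. scal X y 1) y)"
    by (rule locally_ringedD(9)[OF X O(1) 1 2 O(2)]) (use O(2) v V(4) scal_one[OF X xX] in simp)
  then obtain W where W: "openin (tp X) W" "x \<in> W" "W \<subseteq> ?O"
    "\<And>y. y \<in> W \<Longrightarrow> (\<lambda>y\<in>?O. restrict s ?O y \<otimes>\<^bsub>stk X y\<^esub> restrict t ?O y) y = (\<lambda>y\<in>?O. scal X y 1) y" by blast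
  have "W \<subseteq> {x \<in> U. s x \<in> Units (stk X x)}"
  proof
    fix y assume y: "y \<in> W"
    have yO: "y \<in> U" "y \<in> V" using y W(3) by auto
    have yX: "y \<in> pts X" using openin_subset[OF U] yO(1) by blast
    interpret R: cring "stk X y" by (rule locally_ringedD(1)[OF X yX])
    have c: "s y \<in> carrier (stk X y)" "t y \<in> carrier (stk X y)"
      using locally_ringedD(4)[OF X U s] locally_ringedD(4)[OF X V(1,3)] yO by auto
    have "s y \<otimes>\<^bsub>stk X y\<^esub> t y = \<one>\<^bsub>stk X y\<^esub>" using W(4)[OF y] yO scal_one[OF X yX] by simp
    hence "s y \<in> Units (stk X y)" using c R.m_comm[OF c] unfolding Units_def by auto
    thus "y \<in> {x \<in> U. s x \<in> Units (stk X x)}" using yO(1) by simp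
  qed
  thus "\<exists>T. openin (tp X) T \<and> x \<in> T \<and> T \<subseteq> {x \<in> U. s x \<in> Units (stk X x)}" using W(1,2) by blast
qed

lemma ring_hom_Units:
  assumes "h \<in> Ring.ring_hom A B" "a \<in> Units A"
  shows "h a \<in> Units B"
proof -
  obtain b where b: "a \<in> carrier A" "b \<in> carrier A" "a \<otimes>\<^bsub>A\<^esub> b = \<one>\<^bsub>A\<^esub>" "b \<otimes>\<^bsub>A\<^esub> a = \<one>\<^bsub>A\<^esub>"
    using assms(2) by (auto simp: Units_def)
  have "h a \<otimes>\<^bsub>B\<^esub> h b = \<one>\<^bsub>B\<^esub>" "h b \<otimes>\<^bsub>B\<^esub> h a = \<one>\<^bsub>B\<^esub>"
    using ring_hom_mult[OF assms(1) b(1,2)] ring_hom_mult[OF assms(1) b(2,1)] b ring_hom_one[OF assms(1)] by auto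
  thus ?thesis using b ring_hom_closed[OF assms(1)] unfolding Units_def by auto
qed

text \<open>The spectrum of a field, with an arbitrary label \<open>z\<close> for its point, so that
  the label can be the very point that is to be tested.\<close>

lemma locally_ringed_point:
  fixes F :: "'r ring" and \<iota> :: "'k::field \<Rightarrow> 'r" and z :: 'p
  assumes F: "field F" and \<iota>: "\<iota> \<in> Ring.ring_hom Rg F"
  shows "locally_ringed \<lparr>tp = discrete_topology {z}, stk = (\<lambda>_. F), sec = (\<lambda>U. \<Pi>\<^sub>E x\<in>U. carrier F), scal = (\<lambda>_. \<iota>)\<rparr>"
    (is "locally_ringed ?Z")
proof -
  interpret F: field F by fact
  have max: "\<exists>!M. maximalideal M F"
  proof (rule ex1I[where a="{\<zero>\<^bsub>F\<^esub>}"])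
    show "maximalideal {\<zero>\<^bsub>F\<^esub>} F" by (rule F.zeromaximalideal)
    fix M assume M: "maximalideal M F"
    hence "M \<in> {I. ideal I F}" using maximalideal.axioms(1) by blast
    hence "M = {\<zero>\<^bsub>F\<^esub>} \<or> M = carrier F" unfolding F.all_ideals by blast
    thus "M = {\<zero>\<^bsub>F\<^esub>}" using maximalideal.I_notcarr[OF M] by blast
  qed
  have \<iota>c: "\<iota> c \<in> carrier F" for c using ring_hom_closed[OF \<iota>, of c] by (simp add: Rg_simps)
  show ?thesis
    unfolding locally_ringed_def kspace.simps
  proof (intro conjI ballI allI impI)
    fix U s assume "openin (discrete_topology {z}) U" "s \<in> (\<Pi>\<^sub>E x\<in>U. carrier F)"
      "\<forall>x\<in>U. \<exists>W. openin (discrete_topology {z}) W \<and> x \<in> W \<and> W \<subseteq> U \<and> restrict s W \<in> (\<Pi>\<^sub>E x\<in>W. carrier F)"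
    show "s \<in> (\<Pi>\<^sub>E x\<in>U. carrier F)" by fact
  next
    fix U s t x
    assume U: "openin (discrete_topology {z}) U" "x \<in> U" "s x = t x"
    show "\<exists>W. openin (discrete_topology {z}) W \<and> x \<in> W \<and> W \<subseteq> U \<and> (\<forall>y\<in>W. s y = t y)"
      using U by (intro exI[of _ "{x}"]) auto
  next
    fix x a assume x: "x \<in> topspace (discrete_topology {z})" "a \<in> carrier F"
    show "\<exists>U s. openin (discrete_topology {z}) U \<and> x \<in> U \<and> s \<in> (\<Pi>\<^sub>E x\<in>U. carrier F) \<and> s x = a"
      using x by (intro exI[of _ "{z}"] exI[of _ "\<lambda>x\<in>{z}. a"]) auto
  qed (use max \<iota> \<iota>c F.is_cring in \<open>auto simp: PiE_iff\<close>)
qed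

lemma global_section_Spec:
  assumes A: "cring A" and a: "a \<in> carrier A"
  shows "(\<lambda>Q\<in>pts (Spec A \<iota>). frac A Q a \<one>\<^bsub>A\<^esub>) \<in> sec (Spec A \<iota>) (pts (Spec A \<iota>))"
  unfolding mem_sec_Spec
proof (intro conjI ballI)
  interpret A: cring A by fact
  let ?X = "Spec A \<iota>"
  have P: "primeideal Q A" if "Q \<in> pts ?X" for Q using that by (simp add: A.topspace_zariski)
  show "(\<lambda>Q\<in>pts ?X. frac A Q a \<one>\<^bsub>A\<^esub>) \<in> (\<Pi>\<^sub>E P\<in>pts ?X. carrier (loc A P))"
    using primeideal.frac_in_loc[OF P a primeideal.one_in_compl[OF P]] by (simp only: restrict_PiE_iff) blast
  fix Q assume Q: "Q \<in> pts ?X"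
  have "\<forall>Q\<in>pts ?X. \<one>\<^bsub>A\<^esub> \<notin> Q \<and> (\<lambda>Q\<in>pts ?X. frac A Q a \<one>\<^bsub>A\<^esub>) Q = frac A Q a \<one>\<^bsub>A\<^esub>"
  proof
    fix Q assume Q: "Q \<in> pts ?X"
    show "\<one>\<^bsub>A\<^esub> \<notin> Q \<and> (\<lambda>Q\<in>pts ?X. frac A Q a \<one>\<^bsub>A\<^esub>) Q = frac A Q a \<one>\<^bsub>A\<^esub>"
      unfolding restrict_apply'[OF Q] using primeideal.one_in_compl[OF P[OF Q]] by blast
  qed
  thus "\<exists>W b f. openin (zariski A) W \<and> Q \<in> W \<and> W \<subseteq> pts ?X \<and> b \<in> carrier A \<and> f \<in> carrier A \<and>
        (\<forall>Q\<in>W. f \<notin> Q \<and> (\<lambda>Q\<in>pts ?X. frac A Q a \<one>\<^bsub>A\<^esub>) Q = frac A Q b f)"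
    using Q a openin_topspace[of "zariski A"] by (intro exI[of _ "pts ?X"] exI[of _ a] exI[of _ "\<one>\<^bsub>A\<^esub>"]) simp
qed

text \<open>The diagonal is the set of points where, for every function \<open>a\<close>, the germ
  \<open>p\<^sup>* a - q\<^sup>* a\<close> is not a unit: restricted to the residue field of such a point, both projections
  agree, and the universal property identifies the point with its image under the diagonal.\<close>

theorem separated_Spec:
  fixes A :: "'k::field alg ring" and \<iota> :: "'k \<Rightarrow> 'k alg"
  assumes A: "cring A" and \<iota>: "\<iota> \<in> Ring.ring_hom Rg A"
  shows "separated (Spec A \<iota>)"
  unfolding separated_def
proof (intro allI impI)
  let ?X = "Spec A \<iota> :: 'k sch"
  fix P p q d
  assume asm: "fibre_product ?X ?X P p q \<and> kmor ?X P d \<and>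
     kmap_eq ?X ?X (kcomp p d) kid \<and> kmap_eq ?X ?X (kcomp q d) kid"
  hence FP: "fibre_product ?X ?X P p q" and d: "kmor ?X P d"
    and pd: "kmap_eq ?X ?X (kcomp p d) kid" and qd: "kmap_eq ?X ?X (kcomp q d) kid" by blast+
  interpret A: cring A by fact
  have P: "locally_ringed P" and p: "kmor P ?X p" and q: "kmor P ?X q"
    using FP unfolding fibre_product_def by blast+
  have UP: "\<exists>h. kmor Z P h \<and> kmap_eq Z ?X (kcomp p h) f \<and> kmap_eq Z ?X (kcomp q h) g \<and>
         (\<forall>h'. kmor Z P h' \<and> kmap_eq Z ?X (kcomp p h') f \<and> kmap_eq Z ?X (kcomp q h') g \<longrightarrow> kmap_eq Z P h' h)"
    if "locally_ringed Z" "kmor Z ?X f" "kmor Z ?X g" for Z :: "'k sch" and f g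
    using FP that unfolding fibre_product_def by blast
  have X: "locally_ringed ?X" by (rule locally_ringed_Spec[OF A \<iota>])
  have ptsX: "pts ?X = {Q. primeideal Q A}" by (simp add: A.topspace_zariski)
  define fr where "fr a Q = frac A Q a \<one>\<^bsub>A\<^esub>" for a Q
  have fr_in: "fr a Q \<in> carrier (stk ?X Q)" if "primeideal Q A" "a \<in> carrier A" for a Q
    using primeideal.frac_in_loc[OF that(1,2) primeideal.one_in_compl[OF that(1)]] by (simp add: fr_def)
  have fr_sec: "(\<lambda>Q\<in>pts ?X. fr a Q) \<in> sec ?X (pts ?X)" if a: "a \<in> carrier A" for a
    unfolding fr_def by (rule global_section_Spec[OF A a])
  \<comment> \<open>The difference of the two pullbacks of \<open>a\<close>, with the scalar
    \<open>-1\<close> in place of a minus sign: \<open>locally_ringed\<close> gives closure of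
    sections under sums, products and scalars.\<close>
  define w where "w a x = smap p x (fr a (pmap p x)) \<oplus>\<^bsub>stk P x\<^esub> scal P x (-1) \<otimes>\<^bsub>stk P x\<^esub> smap q x (fr a (pmap q x))" for a x
  have pP: "primeideal (pmap p x) A" "primeideal (pmap q x) A" if "x \<in> pts P" for x
    using kmorD(6)[OF p that] kmorD(6)[OF q that] by (simp_all add: A.topspace_zariski)
  have pull: "(\<lambda>x\<in>pts P. smap f x (fr a (pmap f x))) \<in> sec P (pts P)"
    if f: "kmor P ?X f" and a: "a \<in> carrier A" for f a
  proof -
    have eq: "{x \<in> pts P. pmap f x \<in> pts ?X} = pts P" using kmorD(6)[OF f] by blast
    have "(\<lambda>x\<in>{x \<in> pts P. pmap f x \<in> pts ?X}. smap f x ((\<lambda>Q\<in>pts ?X. fr a Q) (pmap f x)))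
        \<in> sec P {x \<in> pts P. pmap f x \<in> pts ?X}"
      by (rule kmorD(5)[OF f openin_topspace fr_sec[OF a]])
    moreover have "(\<lambda>x\<in>pts P. smap f x ((\<lambda>Q\<in>pts ?X. fr a Q) (pmap f x))) = (\<lambda>x\<in>pts P. smap f x (fr a (pmap f x)))"
      using kmorD(6)[OF f] by (intro restrict_ext) simp
    ultimately show ?thesis unfolding eq by simp
  qed
  have w_sec: "(\<lambda>x\<in>pts P. w a x) \<in> sec P (pts P)" if a: "a \<in> carrier A" for a
  proof -
    note O = openin_topspace[of "tp P"]
    have "(\<lambda>x\<in>pts P. (\<lambda>x\<in>pts P. scal P x (-1)) x \<otimes>\<^bsub>stk P x\<^esub> (\<lambda>x\<in>pts P. smap q x (fr a (pmap q x))) x) \<in> sec P (pts P)"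
      by (rule locally_ringedD(7)[OF P O locally_ringedD(5)[OF P O] pull[OF q a]])
    from locally_ringedD(6)[OF P O pull[OF p a] this] show ?thesis
      unfolding w_def by (simp cong: restrict_cong)
  qed
  define D where "D = {x \<in> pts P. \<forall>a\<in>carrier A. w a x \<notin> Units (stk P x)}"
  have "openin (tp P) (\<Union>a\<in>carrier A. {x \<in> pts P. w a x \<in> Units (stk P x)})"
  proof (intro openin_Union ballI)
    fix T assume "T \<in> (\<lambda>a. {x \<in> pts P. w a x \<in> Units (stk P x)}) ` carrier A"
    then obtain a where a: "a \<in> carrier A" "T = {x \<in> pts P. w a x \<in> Units (stk P x)}" by blast
    have "T = {x \<in> pts P. (\<lambda>x\<in>pts P. w a x) x \<in> Units (stk P x)}" unfolding a(2) by auto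
    thus "openin (tp P) T" using openin_section_unit[OF P openin_topspace w_sec[OF a(1)]] by simp
  qed
  moreover have "pts P - D = (\<Union>a\<in>carrier A. {x \<in> pts P. w a x \<in> Units (stk P x)})" by (auto simp: D_def)
  ultimately have "closedin (tp P) D" by (auto simp: closedin_def D_def)
  moreover have "pmap d ` pts ?X = D"
  proof
    show "pmap d ` pts ?X \<subseteq> D"
    proof safe
      fix x assume x: "x \<in> pts ?X"
      let ?z = "pmap d x"
      have z: "?z \<in> pts P" by (rule kmorD(6)[OF d x])
      have Px: "primeideal x A" using x by (simp add: A.topspace_zariski)
      interpret Lx: cring "stk ?X x" by (rule locally_ringedD(1)[OF X x])
      interpret Lz: cring "stk P ?z" by (rule locally_ringedD(1)[OF P z])
      have pz: "pmap p ?z = x" "pmap q ?z = x" using pd qd x by (auto simp: kmap_eq_def kcomp_def kid_def)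
      note dh = kmorD(2)[OF d x]
      have "w a ?z \<notin> Units (stk P ?z)" if a: "a \<in> carrier A" for a
      proof
        assume U: "w a ?z \<in> Units (stk P ?z)"
        have f: "fr a x \<in> carrier (stk ?X x)" by (rule fr_in[OF Px a])
        have pc: "smap p ?z (fr a x) \<in> carrier (stk P ?z)" "smap q ?z (fr a x) \<in> carrier (stk P ?z)"
          using ring_hom_closed[OF kmorD(2)[OF p z]] ring_hom_closed[OF kmorD(2)[OF q z]] f pz by auto
        have sc: "scal P ?z (-1) \<in> carrier (stk P ?z)"
          using ring_hom_closed[OF locally_ringedD(3)[OF P z], of "-1"] by (simp add: Rg_simps)
        have bk: "smap d x (smap p ?z (fr a x)) = fr a x" "smap d x (smap q ?z (fr a x)) = fr a x"
          using pd qd x f pz by (auto simp: kmap_eq_def kcomp_def kid_def)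
        have "scal ?X x (-1) \<oplus>\<^bsub>stk ?X x\<^esub> scal ?X x 1 = scal ?X x (-1 + 1)"
          using ring_hom_add[OF locally_ringedD(3)[OF X x], of "-1" 1] by (simp add: Rg_simps)
        also have "\<dots> = \<zero>\<^bsub>stk ?X x\<^esub>"
          using ring_hom_zero[OF locally_ringedD(3)[OF X x] _ Lx.ring_axioms] Rg.ring_axioms by (simp add: Rg_simps)
        finally have m1: "scal ?X x (-1) \<oplus>\<^bsub>stk ?X x\<^esub> \<one>\<^bsub>stk ?X x\<^esub> = \<zero>\<^bsub>stk ?X x\<^esub>"
          unfolding scal_one[OF X x] .
        have sX: "scal ?X x (-1) \<in> carrier (stk ?X x)"
          using ring_hom_closed[OF locally_ringedD(3)[OF X x], of "-1"] by (simp add: Rg_simps)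
        have "smap d x (w a ?z) = fr a x \<oplus>\<^bsub>stk ?X x\<^esub> scal ?X x (-1) \<otimes>\<^bsub>stk ?X x\<^esub> fr a x"
          unfolding w_def pz ring_hom_add[OF dh pc(1) Lz.m_closed[OF sc pc(2)]] ring_hom_mult[OF dh sc pc(2)]
            bk kmorD(4)[OF d x] ..
        also have "\<dots> = (scal ?X x (-1) \<oplus>\<^bsub>stk ?X x\<^esub> \<one>\<^bsub>stk ?X x\<^esub>) \<otimes>\<^bsub>stk ?X x\<^esub> fr a x"
          unfolding Lx.l_distr[OF sX Lx.one_closed f] Lx.l_one[OF f] by (rule Lx.a_comm[OF f Lx.m_closed[OF sX f]])
        also have "\<dots> = \<zero>\<^bsub>stk ?X x\<^esub>" unfolding m1 by (rule Lx.l_null[OF f])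
        finally have "\<zero>\<^bsub>stk ?X x\<^esub> \<in> Units (stk ?X x)" using ring_hom_Units[OF dh U] by simp
        moreover have "\<zero>\<^bsub>stk ?X x\<^esub> = frac A x \<zero>\<^bsub>A\<^esub> \<one>\<^bsub>A\<^esub>" using primeideal.loc_zero[OF Px] by simp
        ultimately show False
          using primeideal.loc_Units_iff[OF Px A.zero_closed primeideal.one_in_compl[OF Px]]
            additive_subgroup.zero_closed[OF ideal.axioms(1)[OF primeideal.axioms(1)[OF Px]]] by simp
      qed
      thus "?z \<in> D" using z by (simp add: D_def)
    qed
    show "D \<subseteq> pmap d ` pts ?X"
    proof
      fix z assume zD: "z \<in> D"
      hence z: "z \<in> pts P" by (simp add: D_def)
      interpret Lz: cring "stk P z" by (rule locally_ringedD(1)[OF P z])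
      obtain M where M: "maximalideal M (stk P z)" using locally_ringedD(2)[OF P z] by blast
      have M_eq: "M = carrier (stk P z) - Units (stk P z)"
        by (rule local_ring_maximalideal[OF locally_ringedD(1,2)[OF P z] M])
      obtain F :: "('k alg \<times> 'k alg) set ring" and \<pi> where F: "field F" and \<pi>: "\<pi> \<in> Ring.ring_hom (stk P z) F"
        and \<pi>0: "\<And>a. a \<in> carrier (stk P z) \<Longrightarrow> \<pi> a = \<zero>\<^bsub>F\<^esub> \<longleftrightarrow> a \<in> M"
        using residue_field_exists[OF locally_ringedD(1)[OF P z] M] by metis
      interpret F: field F by (rule F)
      have \<pi>s: "(\<lambda>c. \<pi> (scal P z c)) \<in> Ring.ring_hom Rg F"
        using ring_hom_trans[OF locally_ringedD(3)[OF P z] \<pi>] by (simp add: comp_def)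
      define Z :: "'k sch" where "Z = \<lparr>tp = discrete_topology {z}, stk = (\<lambda>_. F),
        sec = (\<lambda>U. \<Pi>\<^sub>E x\<in>U. carrier F), scal = (\<lambda>_ c. \<pi> (scal P z c))\<rparr>"
      have Zs: "tp Z = discrete_topology {z}" "stk Z = (\<lambda>_. F)" "sec Z = (\<lambda>U. \<Pi>\<^sub>E x\<in>U. carrier F)"
        "scal Z = (\<lambda>_ c. \<pi> (scal P z c))" by (simp_all add: Z_def)
      have Z: "locally_ringed Z" unfolding Z_def by (rule locally_ringed_point[OF F \<pi>s])
      define g :: "'k smor" where "g = \<lparr>pmap = (\<lambda>_. z), smap = (\<lambda>_. \<pi>)\<rparr>"
      have gs: "pmap g = (\<lambda>_. z)" "smap g = (\<lambda>_. \<pi>)" by (simp_all add: g_def)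
      have g: "kmor Z P g"
        unfolding kmor_def Zs gs
      proof (intro conjI ballI allI impI)
        show "continuous_map (discrete_topology {z}) (tp P) (\<lambda>_. z)" using z by simp
        fix a assume a: "a \<in> carrier (stk P z)" "\<pi> a \<in> Units F"
        have "\<pi> a \<noteq> \<zero>\<^bsub>F\<^esub>" using a(2) F.field_Units by blast
        thus "a \<in> Units (stk P z)" using \<pi>0[OF a(1)] a(1) M_eq by blast
      next
        fix W s assume "openin (tp P) W \<and> s \<in> sec P W"
        hence "s \<in> (\<Pi>\<^sub>E x\<in>W. carrier (stk P x))" using locally_ringedD(4)[OF P] by blast
        thus "(\<lambda>x\<in>{x \<in> topspace (discrete_topology {z}). z \<in> W}. \<pi> (s z))
            \<in> (\<Pi>\<^sub>E x\<in>{x \<in> topspace (discrete_topology {z}). z \<in> W}. carrier F)"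
          using ring_hom_closed[OF \<pi>] by auto
      qed (use \<pi> in auto)
      note pz = pP(1)[OF z] and qz = pP(2)[OF z]
      note ph = kmorD(2)[OF p z] and qh = kmorD(2)[OF q z]
      define P1 where "P1 b = \<pi> (smap p z b)" for b
      define Q1 where "Q1 b = \<pi> (smap q z b)" for b
      have P1h: "P1 \<in> Ring.ring_hom (loc A (pmap p z)) F" and Q1h: "Q1 \<in> Ring.ring_hom (loc A (pmap q z)) F"
        using ring_hom_trans[OF ph \<pi>] ring_hom_trans[OF qh \<pi>] by (simp_all add: comp_def P1_def[abs_def] Q1_def[abs_def])
      have agree: "P1 (fr a (pmap p z)) = Q1 (fr a (pmap q z))" if a: "a \<in> carrier A" for a
      proof -
        have f: "fr a (pmap p z) \<in> carrier (stk ?X (pmap p z))" "fr a (pmap q z) \<in> carrier (stk ?X (pmap q z))"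
          using fr_in[OF pz a] fr_in[OF qz a] .
        have c: "smap p z (fr a (pmap p z)) \<in> carrier (stk P z)" "smap q z (fr a (pmap q z)) \<in> carrier (stk P z)"
          using ring_hom_closed[OF ph f(1)] ring_hom_closed[OF qh f(2)] .
        have sc: "scal P z (-1) \<in> carrier (stk P z)"
          using ring_hom_closed[OF locally_ringedD(3)[OF P z], of "-1"] by (simp add: Rg_simps)
        have wc: "w a z \<in> carrier (stk P z)" unfolding w_def using c sc by simp
        have "w a z \<in> M" using zD a wc M_eq by (simp add: D_def)
        hence 0: "\<pi> (w a z) = \<zero>\<^bsub>F\<^esub>" using \<pi>0[OF wc] by simp
        have m1: "\<pi> (scal P z (-1)) = \<ominus>\<^bsub>F\<^esub> \<one>\<^bsub>F\<^esub>"
        proof -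
          have "\<pi> (scal P z (-1)) \<oplus>\<^bsub>F\<^esub> \<one>\<^bsub>F\<^esub> = \<zero>\<^bsub>F\<^esub>"
            using ring_hom_add[OF \<pi>s, of "-1" 1] ring_hom_one[OF \<pi>s]
              ring_hom_zero[OF \<pi>s Rg.ring_axioms F.ring_axioms] by (simp add: Rg_simps)
          thus ?thesis using ring_hom_closed[OF \<pi> sc] F.minus_equality by fastforce
        qed
        have "P1 (fr a (pmap p z)) \<oplus>\<^bsub>F\<^esub> (\<ominus>\<^bsub>F\<^esub> \<one>\<^bsub>F\<^esub>) \<otimes>\<^bsub>F\<^esub> Q1 (fr a (pmap q z)) = \<zero>\<^bsub>F\<^esub>"
          using 0 unfolding w_def ring_hom_add[OF \<pi> c(1) Lz.m_closed[OF sc c(2)]] ring_hom_mult[OF \<pi> sc c(2)] m1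
          by (simp add: P1_def Q1_def)
        moreover have cc: "P1 (fr a (pmap p z)) \<in> carrier F" "Q1 (fr a (pmap q z)) \<in> carrier F"
          using ring_hom_closed[OF \<pi>] c by (auto simp: P1_def Q1_def)
        ultimately have "P1 (fr a (pmap p z)) \<ominus>\<^bsub>F\<^esub> Q1 (fr a (pmap q z)) = \<zero>\<^bsub>F\<^esub>"
          by (simp add: a_minus_def F.l_minus)
        thus ?thesis using cc F.r_right_minus_eq by simp
      qed
      have mem: "a \<in> pmap p z \<longleftrightarrow> P1 (fr a (pmap p z)) = \<zero>\<^bsub>F\<^esub>" "a \<in> pmap q z \<longleftrightarrow> Q1 (fr a (pmap q z)) = \<zero>\<^bsub>F\<^esub>"
        if a: "a \<in> carrier A" for a
      proof -
        have "a \<in> pmap f z \<longleftrightarrow> \<pi> (smap f z (fr a (pmap f z))) = \<zero>\<^bsub>F\<^esub>" if f: "kmor P ?X f" for f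
        proof -
          have fz: "primeideal (pmap f z) A" using kmorD(6)[OF f z] by (simp add: A.topspace_zariski)
          have c: "fr a (pmap f z) \<in> carrier (stk ?X (pmap f z))" by (rule fr_in[OF fz a])
          have fc: "smap f z (fr a (pmap f z)) \<in> carrier (stk P z)" by (rule ring_hom_closed[OF kmorD(2)[OF f z] c])
          have "a \<in> pmap f z \<longleftrightarrow> fr a (pmap f z) \<notin> Units (stk ?X (pmap f z))"
            using primeideal.loc_Units_iff[OF fz a primeideal.one_in_compl[OF fz]] by (simp add: fr_def)
          also have "\<dots> \<longleftrightarrow> smap f z (fr a (pmap f z)) \<notin> Units (stk P z)"
            using kmorD(3)[OF f z c] ring_hom_Units[OF kmorD(2)[OF f z]] by blast
          also have "\<dots> \<longleftrightarrow> \<pi> (smap f z (fr a (pmap f z))) = \<zero>\<^bsub>F\<^esub>" using \<pi>0[OF fc] fc M_eq by blast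
          finally show ?thesis .
        qed
        from this[OF p] this[OF q] show "a \<in> pmap p z \<longleftrightarrow> P1 (fr a (pmap p z)) = \<zero>\<^bsub>F\<^esub>"
          "a \<in> pmap q z \<longleftrightarrow> Q1 (fr a (pmap q z)) = \<zero>\<^bsub>F\<^esub>" by (simp_all add: P1_def Q1_def)
      qed
      have pq: "pmap p z = pmap q z"
      proof (intro equalityI subsetI)
        fix a assume a: "a \<in> pmap p z"
        have "a \<in> carrier A" using a ideal.Icarr[OF primeideal.axioms(1)[OF pz]] by blast
        thus "a \<in> pmap q z" using a mem agree by simp
      next
        fix a assume a: "a \<in> pmap q z"
        have "a \<in> carrier A" using a ideal.Icarr[OF primeideal.axioms(1)[OF qz]] by blast
        thus "a \<in> pmap p z" using a mem agree by simp
      qed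
      let ?x = "pmap p z"
      have x: "?x \<in> pts ?X" by (rule kmorD(6)[OF p z])
      \<comment> \<open>Agreement on germs with denominator \<open>1\<close> extends to all germs,
        because the image of a denominator \<open>s\<close> is nonzero in the field and can be
        cancelled.\<close>
      have PQ: "P1 b = Q1 b" if b: "b \<in> carrier (loc A ?x)" for b
      proof -
        from b obtain a s where as: "b = frac A ?x a s" "a \<in> carrier A" "s \<in> carrier A" "s \<in> carrier A - ?x"
          by (rule primeideal.locE[OF pz])
        note one = primeideal.one_in_compl[OF pz]
        have bc: "b \<in> carrier (loc A ?x)" "fr s ?x \<in> carrier (loc A ?x)"
          using b fr_in[OF pz as(3)] by simp_all
        have "b \<otimes>\<^bsub>loc A ?x\<^esub> fr s ?x = frac A ?x (a \<otimes>\<^bsub>A\<^esub> s) (s \<otimes>\<^bsub>A\<^esub> \<one>\<^bsub>A\<^esub>)"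
          unfolding as(1) fr_def by (rule primeideal.loc_mult[OF pz as(2,4,3) one])
        also have "\<dots> = fr a ?x"
          unfolding fr_def using as(2,3,4) one A.m_comm[OF as(3)]
          by (intro primeideal.frac_eqI'[OF pz]) auto
        finally have eq: "b \<otimes>\<^bsub>loc A ?x\<^esub> fr s ?x = fr a ?x" .
        have 1: "P1 b \<otimes>\<^bsub>F\<^esub> P1 (fr s ?x) = P1 (fr a ?x)"
          using ring_hom_mult[OF P1h bc] eq by simp
        have 2: "Q1 b \<otimes>\<^bsub>F\<^esub> Q1 (fr s ?x) = Q1 (fr a ?x)"
          using ring_hom_mult[OF Q1h[folded pq] bc] eq by simp
        have ag: "P1 (fr s ?x) = Q1 (fr s ?x)" "P1 (fr a ?x) = Q1 (fr a ?x)"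
          using agree[OF as(3)] agree[OF as(2)] unfolding pq by simp_all
        have nz: "P1 (fr s ?x) \<noteq> \<zero>\<^bsub>F\<^esub>" using mem(1)[OF as(3)] as(4) by blast
        have Fc: "P1 b \<in> carrier F" "Q1 b \<in> carrier F" "P1 (fr s ?x) \<in> carrier F"
          using ring_hom_closed[OF P1h] ring_hom_closed[OF Q1h[folded pq]] bc by auto
        have "P1 b \<otimes>\<^bsub>F\<^esub> P1 (fr s ?x) = Q1 b \<otimes>\<^bsub>F\<^esub> P1 (fr s ?x)" using 1 2 ag by simp
        thus ?thesis using F.m_rcancel[OF nz Fc(3,1,2)] by simp
      qed
      \<comment> \<open>\<open>g\<close> and \<open>d p g\<close> have the same projections to
        \<open>X\<close>, so uniqueness in the universal property identifies their image points
        \<open>z\<close> and \<open>d(p(z))\<close>.\<close>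
      let ?f1 = "kcomp p g" and ?f2 = "kcomp q g" and ?g' = "kcomp d (kcomp p g)"
      have f1: "kmor Z ?X ?f1" and f2: "kmor Z ?X ?f2" using kmor_kcomp[OF g p] kmor_kcomp[OF g q] .
      have g': "kmor Z P ?g'" by (rule kmor_kcomp[OF f1 d])
      have id1: "pmap p (pmap d ?x) = ?x" "pmap q (pmap d ?x) = ?x"
        using pd qd x by (auto simp: kmap_eq_def kcomp_def kid_def)
      have id2: "smap d ?x (smap p (pmap d ?x) b) = b" "smap d ?x (smap q (pmap d ?x) b) = b"
        if "b \<in> carrier (loc A ?x)" for b
        using pd qd x id1 that by (auto simp: kmap_eq_def kcomp_def kid_def)
      have e1: "kmap_eq Z ?X (kcomp p g) ?f1" "kmap_eq Z ?X (kcomp q g) ?f2" by (auto simp: kmap_eq_def)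
      have e2: "kmap_eq Z ?X (kcomp p ?g') ?f1"
        unfolding kmap_eq_def kcomp_def kmap.simps gs using id1 id2 by simp
      have e3: "kmap_eq Z ?X (kcomp q ?g') ?f2"
        unfolding kmap_eq_def kcomp_def kmap.simps gs using id1 id2 pq PQ by (simp add: P1_def Q1_def)
      obtain h where "kmap_eq Z P g h" "kmap_eq Z P ?g' h"
        using UP[OF Z f1 f2] g g' e1 e2 e3 by blast
      moreover have "z \<in> pts Z" by (simp add: Zs)
      ultimately have "pmap g z = pmap ?g' z" unfolding kmap_eq_def by metis
      hence "z = pmap d ?x" by (simp add: kcomp_def gs)
      thus "z \<in> pmap d ` pts ?X" using x by blast
    qed
  qed
  ultimately show "closedin (tp P) (pmap d ` pts ?X)" by simp
qed

text \<open>A vanishing power of \<open>a / s\<close> means \<open>u a^n = 0\<close> with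
  \<open>u\<close> outside a prime, hence nonzero; in a domain this forces
  \<open>a = 0\<close>.\<close>

lemma reduced_Spec:
  fixes A :: "'k::field alg ring"
  assumes A: "domain A"
  shows "reduced (Spec A \<iota> :: 'k sch)"
  unfolding reduced_def
proof (intro ballI allI impI)
  interpret A: domain A by fact
  let ?X = "Spec A \<iota> :: 'k sch"
  fix Q b and n :: nat
  assume "Q \<in> pts ?X" and b: "b \<in> carrier (stk ?X Q)" and 0: "b [^]\<^bsub>stk ?X Q\<^esub> n = \<zero>\<^bsub>stk ?X Q\<^esub>"
  hence Q: "primeideal Q A" by (simp add: A.topspace_zariski)
  interpret Q: primeideal Q A by fact
  interpret L: cring "loc A Q" by (rule Q.loc_cring)
  obtain a s where as: "b = frac A Q a s" "a \<in> carrier A" "s \<in> carrier A" "s \<in> carrier A - Q"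
    using b Q.locE[of b] by auto
  have pw: "s [^]\<^bsub>A\<^esub> k \<in> carrier A - Q \<and> b [^]\<^bsub>loc A Q\<^esub> k = frac A Q (a [^]\<^bsub>A\<^esub> k) (s [^]\<^bsub>A\<^esub> k)" for k :: nat
  proof (induction k)
    case 0
    show ?case using Q.one_in_compl by (simp add: Q.loc_one)
  next
    case (Suc k)
    thus ?case using Q.prime_compl_mult[of "s [^]\<^bsub>A\<^esub> k" s] as by (simp add: Q.loc_mult)
  qed
  have "frac A Q (a [^]\<^bsub>A\<^esub> n) (s [^]\<^bsub>A\<^esub> n) = frac A Q \<zero>\<^bsub>A\<^esub> \<one>\<^bsub>A\<^esub>"
    using 0 pw[of n] by (simp add: Q.loc_zero)
  then obtain u where u: "u \<in> carrier A - Q" "u \<otimes>\<^bsub>A\<^esub> (a [^]\<^bsub>A\<^esub> n \<otimes>\<^bsub>A\<^esub> \<one>\<^bsub>A\<^esub>) = u \<otimes>\<^bsub>A\<^esub> (\<zero>\<^bsub>A\<^esub> \<otimes>\<^bsub>A\<^esub> s [^]\<^bsub>A\<^esub> n)"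
    using Q.frac_eq_iff[of "a [^]\<^bsub>A\<^esub> n" "s [^]\<^bsub>A\<^esub> n" "\<zero>\<^bsub>A\<^esub>" "\<one>\<^bsub>A\<^esub>"] as pw[of n] Q.one_in_compl by auto
  have "u \<noteq> \<zero>\<^bsub>A\<^esub>" using u(1) additive_subgroup.zero_closed[OF Q.is_additive_subgroup] by blast
  hence "a [^]\<^bsub>A\<^esub> n = \<zero>\<^bsub>A\<^esub>" using u as by (simp add: A.integral_iff)
  hence "a = \<zero>\<^bsub>A\<^esub>"
  proof (induction n)
    case (Suc n)
    thus ?case using as(2) by (auto simp: A.integral_iff)
  qed simp
  thus "b = \<zero>\<^bsub>stk ?X Q\<^esub>"
    unfolding as(1) using as(3,4) Q.one_in_compl
    by (simp add: Q.loc_zero) (rule Q.frac_eqI', auto)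
qed

subsection \<open>Affine varieties and their rational points\<close>

lemma poly_ring_simps:
  "carrier (poly_ring n) = {p. in_vars n p}" "monoid.mult (poly_ring n) = (*)"
  "add (poly_ring n) = (+)" "one (poly_ring n) = 1" "zero (poly_ring n) = 0"
  by (auto simp: poly_ring_def ring_on_def in_vars_def)

lemma cring_poly_ring: "cring (poly_ring n :: 'k::field mp ring)"
proof (rule cringI)
  show "abelian_group (poly_ring n :: 'k mp ring)"
  proof (rule abelian_groupI)
    fix x :: "'k mp" assume "x \<in> carrier (poly_ring n)"
    thus "\<exists>y\<in>carrier (poly_ring n). y \<oplus>\<^bsub>poly_ring n\<^esub> x = \<zero>\<^bsub>poly_ring n\<^esub>"
      by (intro bexI[of _ "- x"]) (auto simp: poly_ring_simps in_vars_uminus)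
  qed (auto simp: poly_ring_simps in_vars_add add.assoc add.commute)
  show "comm_monoid (poly_ring n :: 'k mp ring)"
    by (rule comm_monoidI) (auto simp: poly_ring_simps in_vars_mult mult.assoc mult.commute)
qed (auto simp: poly_ring_simps distrib_right)

interpretation pr: cring "poly_ring n :: 'k::field mp ring" for n
  by (rule cring_poly_ring)

lemma poly_ring_uminus: "in_vars n p \<Longrightarrow> \<ominus>\<^bsub>poly_ring n\<^esub> p = - p"
proof -
  assume p: "in_vars n p"
  have "- p \<oplus>\<^bsub>poly_ring n\<^esub> p = \<zero>\<^bsub>poly_ring n\<^esub>" by (simp add: poly_ring_simps)
  from pr.minus_equality[OF this] show ?thesis using p by (simp add: poly_ring_simps in_vars_uminus)
qed

lemma poly_ring_minus: "in_vars n p \<Longrightarrow> in_vars n q \<Longrightarrow> p \<ominus>\<^bsub>poly_ring n\<^esub> q = p - q"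
  by (simp add: a_minus_def poly_ring_uminus) (simp add: poly_ring_simps)

lemma poly_ring_idealI:
  assumes "\<And>p. p \<in> I \<Longrightarrow> in_vars n p" "0 \<in> I" "\<And>p q. p \<in> I \<Longrightarrow> q \<in> I \<Longrightarrow> p + q \<in> I"
    "\<And>p q. in_vars n p \<Longrightarrow> q \<in> I \<Longrightarrow> p * q \<in> I"
  shows "ideal I (poly_ring n :: 'k::field mp ring)"
proof (rule idealI[OF pr.ring_axioms])
  show "subgroup I (add_monoid (poly_ring n))"
  proof (rule group.subgroupI[OF pr.add.is_group])
    fix p assume p: "p \<in> I"
    have "- 1 * p \<in> I" using assms(4)[OF _ p, of "-1"] by (simp add: in_vars_uminus)
    thus "inv\<^bsub>add_monoid (poly_ring n)\<^esub> p \<in> I"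
      using poly_ring_uminus[OF assms(1)[OF p]] by (simp add: a_inv_def)
  qed (use assms in \<open>auto simp: poly_ring_simps\<close>)
next
  fix p q :: "'k mp" assume "p \<in> I" "q \<in> carrier (poly_ring n)"
  thus "q \<otimes>\<^bsub>poly_ring n\<^esub> p \<in> I" "p \<otimes>\<^bsub>poly_ring n\<^esub> q \<in> I"
    using assms(4)[of q p] by (simp_all add: poly_ring_simps mult.commute)
qed

lemma poly_ring_idealD:
  assumes "ideal I (poly_ring n :: 'k::field mp ring)"
  shows "p \<in> I \<Longrightarrow> in_vars n p" "0 \<in> I" "p \<in> I \<Longrightarrow> q \<in> I \<Longrightarrow> p + q \<in> I"
    "in_vars n p \<Longrightarrow> q \<in> I \<Longrightarrow> p * q \<in> I"
proof -
  interpret I: ideal I "poly_ring n" by fact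
  show "p \<in> I \<Longrightarrow> in_vars n p" using I.Icarr[of p] by (simp add: poly_ring_simps)
  show "0 \<in> I" using additive_subgroup.zero_closed[OF I.is_additive_subgroup] by (simp add: poly_ring_simps)
  show "p \<in> I \<Longrightarrow> q \<in> I \<Longrightarrow> p + q \<in> I"
    using additive_subgroup.a_closed[OF I.is_additive_subgroup, of p q] by (simp add: poly_ring_simps)
  show "in_vars n p \<Longrightarrow> q \<in> I \<Longrightarrow> p * q \<in> I" using I.I_l_closed[of q p] by (simp add: poly_ring_simps)
qed

abbreviation cls :: "nat \<Rightarrow> 'k::field mp set \<Rightarrow> 'k mp \<Rightarrow> 'k alg" where
  "cls n I g \<equiv> I +>\<^bsub>poly_ring n\<^esub> g"

locale affine =
  fixes n :: nat and I :: "'k::field mp set"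
  assumes I: "ideal I (poly_ring n)"
begin

sublocale I: ideal I "poly_ring n" by (rule I)

lemma quot_cring: "cring (quot n I)"
  unfolding quot_def by (rule I.quotient_is_cring[OF cring_poly_ring])

lemma cls_hom: "cls n I \<in> Ring.ring_hom (poly_ring n) (quot n I)"
  unfolding quot_def by (rule I.rcos_ring_hom)

lemma cls_add: "in_vars n p \<Longrightarrow> in_vars n q \<Longrightarrow> cls n I p \<oplus>\<^bsub>quot n I\<^esub> cls n I q = cls n I (p + q)"
  and cls_mult: "in_vars n p \<Longrightarrow> in_vars n q \<Longrightarrow> cls n I p \<otimes>\<^bsub>quot n I\<^esub> cls n I q = cls n I (p * q)"
  and cls_one: "\<one>\<^bsub>quot n I\<^esub> = cls n I 1"
  and cls_in: "in_vars n p \<Longrightarrow> cls n I p \<in> carrier (quot n I)"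
  using ring_hom_add[OF cls_hom] ring_hom_mult[OF cls_hom] ring_hom_one[OF cls_hom] ring_hom_closed[OF cls_hom]
  by (auto simp: poly_ring_simps)

lemma cls_eq_iff: "in_vars n p \<Longrightarrow> in_vars n q \<Longrightarrow> cls n I p = cls n I q \<longleftrightarrow> p - q \<in> I"
  using pr.quotient_eq_iff_same_a_r_cos[OF I, of p q] by (simp add: poly_ring_simps poly_ring_minus)

lemma quot_carrier: "carrier (quot n I) = cls n I ` {p. in_vars n p}"
  unfolding quot_def FactRing_def A_RCOSETS_def' by (auto simp: poly_ring_simps)

lemma cls_zero: "\<zero>\<^bsub>quot n I\<^esub> = cls n I 0"
proof -
  have "\<zero>\<^bsub>quot n I\<^esub> = I" by (simp add: quot_def FactRing_def)
  also have "\<dots> = cls n I 0" using I.a_rcos_const[OF poly_ring_idealD(2)[OF I]] by simp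
  finally show ?thesis .
qed

lemma cls_uminus: "in_vars n p \<Longrightarrow> \<ominus>\<^bsub>quot n I\<^esub> cls n I p = cls n I (- p)"
proof -
  interpret Q: cring "quot n I" by (rule quot_cring)
  assume p: "in_vars n p"
  have "cls n I (- p) \<oplus>\<^bsub>quot n I\<^esub> cls n I p = \<zero>\<^bsub>quot n I\<^esub>"
    using p by (simp add: cls_add in_vars_uminus cls_zero)
  thus ?thesis using p by (intro Q.minus_equality) (auto simp: cls_in in_vars_uminus)
qed

lemma cls_minus: "in_vars n p \<Longrightarrow> in_vars n q \<Longrightarrow> cls n I p \<ominus>\<^bsub>quot n I\<^esub> cls n I q = cls n I (p - q)"
  by (simp add: a_minus_def cls_uminus cls_add in_vars_uminus)

lemma cls_const_hom: "(\<lambda>c. cls n I (const c)) \<in> Ring.ring_hom Rg (quot n I)"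
  by (rule ring_hom_memI)
     (auto simp: Rg_simps cls_in cls_add cls_mult cls_one const_add const_mult const_1)

lemma locally_ringed_aff: "locally_ringed (aff n I)"
  unfolding aff_def by (rule locally_ringed_Spec[OF quot_cring cls_const_hom])

lemma aff_simps: "tp (aff n I) = zariski (quot n I)" "stk (aff n I) = loc (quot n I)"
  "scal (aff n I) = (\<lambda>P c. frac (quot n I) P (cls n I (const c)) \<one>\<^bsub>quot n I\<^esub>)"
  by (simp_all add: aff_def)

lemma pts_aff: "pts (aff n I) = {P. primeideal P (quot n I)}"
  by (simp add: aff_simps cring.topspace_zariski[OF quot_cring])

end

locale affine_point = affine n I for n and I :: "'k::field mp set" +
  fixes a :: "'k list"
  assumes a: "a \<in> zeros n I"
begin

abbreviation val :: "'k mp \<Rightarrow> 'k" where "val g \<equiv> mp_eval (\<lambda>i. a ! i) g"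

lemma at_I: "g \<in> I \<Longrightarrow> val g = 0"
  using a by (simp add: zeros_def)

lemma kpoint_iff: "in_vars n g \<Longrightarrow> cls n I g \<in> kpoint n I a \<longleftrightarrow> val g = 0"
proof
  assume g: "in_vars n g" and "cls n I g \<in> kpoint n I a"
  then obtain h where h: "in_vars n h" "val h = 0" "cls n I g = cls n I h"
    by (auto simp: kpoint_def poly_ring_simps)
  have "val (g - h) = 0" using h g by (intro at_I) (simp add: cls_eq_iff)
  thus "val g = 0" using h by (simp add: mp_eval_simps)
qed (auto simp: kpoint_def poly_ring_simps)

lemma kpoint_subset: "kpoint n I a \<subseteq> carrier (quot n I)"
  by (auto simp: kpoint_def poly_ring_simps cls_in)

lemma kpointE:
  assumes "x \<in> kpoint n I a"
  obtains g where "in_vars n g" "val g = 0" "x = cls n I g"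
  using assms by (auto simp: kpoint_def poly_ring_simps)

lemma kpoint_prime: "primeideal (kpoint n I a) (quot n I)"
proof -
  interpret Q: cring "quot n I" by (rule quot_cring)
  have "ideal (kpoint n I a) (quot n I)"
  proof (rule idealI[OF Q.ring_axioms])
    show "subgroup (kpoint n I a) (add_monoid (quot n I))"
    proof (rule group.subgroupI[OF Q.add.is_group])
      show "kpoint n I a \<subseteq> carrier (add_monoid (quot n I))" using kpoint_subset by simp
      have "cls n I 0 \<in> kpoint n I a" by (subst kpoint_iff) (auto simp: mp_eval_simps)
      thus "kpoint n I a \<noteq> {}" by blast
      fix x assume "x \<in> kpoint n I a"
      then obtain g where g: "in_vars n g" "val g = 0" "x = cls n I g" by (rule kpointE)
      thus "inv\<^bsub>add_monoid (quot n I)\<^esub> x \<in> kpoint n I a"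
        using cls_uminus[OF g(1)] kpoint_iff[OF in_vars_uminus[OF g(1)]] by (simp add: a_inv_def mp_eval_simps)
      fix y assume "y \<in> kpoint n I a"
      then obtain h where h: "in_vars n h" "val h = 0" "y = cls n I h" by (rule kpointE)
      show "x \<otimes>\<^bsub>add_monoid (quot n I)\<^esub> y \<in> kpoint n I a"
        using g h kpoint_iff[OF in_vars_add[OF g(1) h(1)]] by (simp add: cls_add mp_eval_simps)
    qed
  next
    fix x y assume "x \<in> kpoint n I a" "y \<in> carrier (quot n I)"
    then obtain g h where g: "in_vars n g" "val g = 0" "x = cls n I g" and h: "in_vars n h" "y = cls n I h"
      by (auto simp: quot_carrier elim: kpointE)
    show "y \<otimes>\<^bsub>quot n I\<^esub> x \<in> kpoint n I a" "x \<otimes>\<^bsub>quot n I\<^esub> y \<in> kpoint n I a"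
      using g h kpoint_iff[OF in_vars_mult[OF g(1) h(1)]] kpoint_iff[OF in_vars_mult[OF h(1) g(1)]]
      by (simp_all add: cls_mult mp_eval_simps)
  qed
  thus ?thesis
  proof (rule primeidealI[OF _ quot_cring])
    have "cls n I 1 \<notin> kpoint n I a" by (subst kpoint_iff) (auto simp: mp_eval_simps)
    thus "carrier (quot n I) \<noteq> kpoint n I a" using cls_in[of 1] by auto
    fix x y assume "x \<in> carrier (quot n I)" "y \<in> carrier (quot n I)" and xy: "x \<otimes>\<^bsub>quot n I\<^esub> y \<in> kpoint n I a"
    then obtain g h where g: "in_vars n g" "x = cls n I g" and h: "in_vars n h" "y = cls n I h"
      by (auto simp: quot_carrier)
    show "x \<in> kpoint n I a \<or> y \<in> kpoint n I a"
      using xy g h kpoint_iff[OF g(1)] kpoint_iff[OF h(1)] kpoint_iff[OF in_vars_mult[OF g(1) h(1)]]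
      by (simp add: cls_mult mp_eval_simps)
  qed
qed

lemma kpoint_pts: "kpoint n I a \<in> pts (aff n I)"
  using kpoint_prime by (simp add: pts_aff)

text \<open>The residue of a fraction \<open>g / h\<close> is the scalar
  \<open>g(a) / h(a)\<close>.\<close>

lemma kpoint_rational: "kpoint n I a \<in> rat_points (aff n I)"
  unfolding rat_points_def
proof (intro CollectI conjI ballI kpoint_pts)
  interpret P: primeideal "kpoint n I a" "quot n I" by (rule kpoint_prime)
  fix x assume "x \<in> carrier (stk (aff n I) (kpoint n I a))"
  then obtain b s where x: "x = frac (quot n I) (kpoint n I a) b s" "b \<in> carrier (quot n I)"
    "s \<in> carrier (quot n I)" "s \<in> carrier (quot n I) - kpoint n I a"
    unfolding aff_simps using P.locE by metis
  obtain g h where g: "in_vars n g" "b = cls n I g" and h: "in_vars n h" "s = cls n I h"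
    using x(2,3) by (auto simp: quot_carrier)
  have h0: "val h \<noteq> 0" using x(4) h kpoint_iff[OF h(1)] by simp
  define c where "c = val g / val h"
  \<comment> \<open>The numerator that \<open>loc_minus\<close> produces; the factor
    \<open>1\<close> is the denominator of the scalar.\<close>
  let ?k = "g * 1 - const c * h"
  have k: "in_vars n ?k" using g h by (intro in_vars_diff in_vars_mult) auto
  have "x \<ominus>\<^bsub>loc (quot n I) (kpoint n I a)\<^esub> frac (quot n I) (kpoint n I a) (cls n I (const c)) \<one>\<^bsub>quot n I\<^esub>
    = frac (quot n I) (kpoint n I a) (cls n I ?k) (s \<otimes>\<^bsub>quot n I\<^esub> \<one>\<^bsub>quot n I\<^esub>)"
    unfolding x(1) P.loc_minus[OF x(2,4) cls_in[OF in_vars_const] P.one_in_compl]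
    using g h by (simp add: cls_one cls_mult cls_minus in_vars_mult)
  moreover have "cls n I ?k \<in> kpoint n I a"
    unfolding kpoint_iff[OF k] using h0 by (simp add: mp_eval_simps c_def)
  ultimately have "x \<ominus>\<^bsub>stk (aff n I) (kpoint n I a)\<^esub> scal (aff n I) (kpoint n I a) c
      \<notin> Units (stk (aff n I) (kpoint n I a))"
    unfolding aff_simps using P.loc_Units_iff[OF cls_in[OF k] P.prime_compl_mult[OF x(4) P.one_in_compl]] by simp
  thus "\<exists>c. x \<ominus>\<^bsub>stk (aff n I) (kpoint n I a)\<^esub> scal (aff n I) (kpoint n I a) c
      \<notin> Units (stk (aff n I) (kpoint n I a))" by blast
qed

end

text \<open>A prime that contains the classes of all \<open>x_i - c i\<close> therefore decides
  membership of \<open>g\<close> by the value of \<open>g\<close> at \<open>c\<close> alone.\<close>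

lemma mp_congruence:
  assumes "in_vars n g"
  shows "\<exists>f. (\<forall>i<n. in_vars n (f i)) \<and> g - const (mp_eval c g) = (\<Sum>i<n. f i * (mvar i - const (c i)))"
  using assms
proof (induction rule: mp_induct)
  case (const k)
  show ?case by (intro exI[of _ "\<lambda>_. 0"]) (simp add: mp_eval_simps)
next
  case (mvar j)
  have "(\<Sum>i<n. (if i = j then 1 else 0) * (mvar i - const (c i))) = (\<Sum>i<n. if i = j then mvar i - const (c i) else 0)"
    by (intro sum.cong) auto
  also have "\<dots> = mvar j - const (c j)" using mvar by simp
  finally show ?case by (intro exI[of _ "\<lambda>i. if i = j then 1 else 0"]) (simp add: mp_eval_simps)
next
  case (add p q)
  then obtain e f where e: "\<forall>i<n. in_vars n (e i)" "p - const (mp_eval c p) = (\<Sum>i<n. e i * (mvar i - const (c i)))"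
    and f: "\<forall>i<n. in_vars n (f i)" "q - const (mp_eval c q) = (\<Sum>i<n. f i * (mvar i - const (c i)))" by blast
  have "p + q - const (mp_eval c (p + q)) = (p - const (mp_eval c p)) + (q - const (mp_eval c q))"
    by (simp add: mp_eval_simps const_add)
  also have "\<dots> = (\<Sum>i<n. (e i + f i) * (mvar i - const (c i)))"
    unfolding e(2) f(2) by (simp add: sum.distrib distrib_right)
  finally show ?case using e f by (intro exI[of _ "\<lambda>i. e i + f i"]) (simp add: in_vars_add)
next
  case (mult p q)
  then obtain e f where e: "\<forall>i<n. in_vars n (e i)" "p - const (mp_eval c p) = (\<Sum>i<n. e i * (mvar i - const (c i)))"
    and f: "\<forall>i<n. in_vars n (f i)" "q - const (mp_eval c q) = (\<Sum>i<n. f i * (mvar i - const (c i)))" by blast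
  have "p * q - const (mp_eval c (p * q)) = q * (p - const (mp_eval c p)) + const (mp_eval c p) * (q - const (mp_eval c q))"
    by (simp add: mp_eval_simps const_mult algebra_simps)
  also have "\<dots> = (\<Sum>i<n. (q * e i + const (mp_eval c p) * f i) * (mvar i - const (c i)))"
    unfolding e(2) f(2) by (simp add: sum.distrib distrib_right sum_distrib_left mult.assoc)
  finally show ?case using e f mult
    by (intro exI[of _ "\<lambda>i. q * e i + const (mp_eval c p) * f i"]) (simp add: in_vars_add in_vars_mult)
qed

text \<open>Rationality assigns to each coordinate function a scalar \<open>c i\<close> with the
  class of \<open>x_i - c i\<close> in the prime; by \<open>mp_congruence\<close> the prime then
  consists of the classes of the polynomials that vanish at \<open>c\<close>.\<close>

lemma (in affine) rational_point_cases:
  assumes x: "x \<in> rat_points (aff n I)"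
  obtains a where "a \<in> zeros n I" "x = kpoint n I a"
proof -
  have P: "primeideal x (quot n I)" using x by (simp add: rat_points_def pts_aff)
  interpret P: primeideal x "quot n I" by (rule P)
  have "\<exists>c. cls n I (mvar i - const c) \<in> x" if i: "i < n" for i
  proof -
    have "frac (quot n I) x (cls n I (mvar i)) \<one>\<^bsub>quot n I\<^esub> \<in> carrier (stk (aff n I) x)"
      unfolding aff_simps using i by (intro P.frac_in_loc cls_in P.one_in_compl) simp
    then obtain c where c: "frac (quot n I) x (cls n I (mvar i)) \<one>\<^bsub>quot n I\<^esub>
        \<ominus>\<^bsub>loc (quot n I) x\<^esub> frac (quot n I) x (cls n I (const c)) \<one>\<^bsub>quot n I\<^esub> \<notin> Units (loc (quot n I) x)"
      using x unfolding rat_points_def aff_simps by blast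
    have k: "in_vars n (mvar i * 1 - const c * 1 :: 'k mp)" using i by (intro in_vars_diff in_vars_mult) auto
    have "frac (quot n I) x (cls n I (mvar i)) \<one>\<^bsub>quot n I\<^esub>
        \<ominus>\<^bsub>loc (quot n I) x\<^esub> frac (quot n I) x (cls n I (const c)) \<one>\<^bsub>quot n I\<^esub>
       = frac (quot n I) x (cls n I (mvar i * 1 - const c * 1)) (\<one>\<^bsub>quot n I\<^esub> \<otimes>\<^bsub>quot n I\<^esub> \<one>\<^bsub>quot n I\<^esub>)"
      unfolding P.loc_minus[OF cls_in[OF in_vars_mvar[OF i]] P.one_in_compl cls_in[OF in_vars_const] P.one_in_compl]
      using i by (simp add: cls_one cls_mult cls_minus)
    hence "cls n I (mvar i * 1 - const c * 1) \<in> x"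
      using c P.loc_Units_iff[OF cls_in[OF k] P.prime_compl_mult[OF P.one_in_compl P.one_in_compl]] by auto
    thus ?thesis by auto
  qed
  then obtain c where c: "\<And>i. i < n \<Longrightarrow> cls n I (mvar i - const (c i)) \<in> x" by metis
  define a where "a = map c [0..<n]"
  have an: "length a = n" "a ! i = c i" if "i < n" for i using that by (auto simp: a_def)
  have ev: "mp_eval (\<lambda>i. a ! i) g = mp_eval c g" if "in_vars n g" for g
    unfolding mp_eval_eq_ev by (rule ev_cong[OF that]) (simp add: a_def)
  have cong: "cls n I (g - const (mp_eval c g)) \<in> x" if g: "in_vars n g" for g
  proof -
    obtain f where f: "\<forall>i<n. in_vars n (f i)" "g - const (mp_eval c g) = (\<Sum>i<n. f i * (mvar i - const (c i)))"
      using mp_congruence[OF g] by blast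
    have "cls n I (\<Sum>i<k. f i * (mvar i - const (c i))) \<in> x \<and> in_vars n (\<Sum>i<k. f i * (mvar i - const (c i)))"
      if "k \<le> n" for k
      using that
    proof (induction k)
      case 0
      show ?case using additive_subgroup.zero_closed[OF P.is_additive_subgroup] by (simp add: cls_zero)
    next
      case (Suc k)
      have k: "in_vars n (f k)" "in_vars n (mvar k - const (c k))" using f Suc.prems by (auto intro: in_vars_diff)
      have "cls n I (f k * (mvar k - const (c k))) \<in> x"
        using P.I_l_closed[OF c[of k] cls_in[OF k(1)]] Suc.prems k by (simp add: cls_mult)
      hence "cls n I (\<Sum>i<k. f i * (mvar i - const (c i))) \<oplus>\<^bsub>quot n I\<^esub> cls n I (f k * (mvar k - const (c k))) \<in> x"
        using Suc by (intro additive_subgroup.a_closed[OF P.is_additive_subgroup]) auto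
      thus ?case using Suc k by (simp add: cls_add in_vars_mult in_vars_add)
    qed
    from this[of n] show ?thesis using f(2) by simp
  qed
  have mem: "cls n I g \<in> x \<longleftrightarrow> mp_eval c g = 0" if g: "in_vars n g" for g
  proof
    assume "mp_eval c g = 0"
    thus "cls n I g \<in> x" using cong[OF g] by (simp add: const_0)
  next
    assume gx: "cls n I g \<in> x"
    have "cls n I g \<ominus>\<^bsub>quot n I\<^esub> cls n I (g - const (mp_eval c g)) \<in> x"
      unfolding a_minus_def using gx cong[OF g]
      by (intro additive_subgroup.a_closed[OF P.is_additive_subgroup] additive_subgroup.a_inv_closed[OF P.is_additive_subgroup])
    hence k: "cls n I (const (mp_eval c g)) \<in> x" using g by (simp add: cls_minus in_vars_diff)
    show "mp_eval c g = 0"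
    proof (rule ccontr)
      assume "mp_eval c g \<noteq> 0"
      hence "const (inverse (mp_eval c g)) * const (mp_eval c g) = (1 :: 'k mp)"
        by (simp add: const_1 flip: const_mult)
      hence "\<one>\<^bsub>quot n I\<^esub> \<in> x"
        using P.I_l_closed[OF k cls_in[OF in_vars_const]] by (simp add: cls_mult cls_one) metis
      thus False using P.one_in_compl by blast
    qed
  qed
  have "g \<in> I \<Longrightarrow> mp_eval (\<lambda>i. a ! i) g = 0" for g
  proof -
    assume gI: "g \<in> I"
    hence g: "in_vars n g" by (rule poly_ring_idealD(1)[OF I])
    have "cls n I g = cls n I 0" using g gI by (simp add: cls_eq_iff)
    also have "\<dots> \<in> x" using additive_subgroup.zero_closed[OF P.is_additive_subgroup] by (simp add: cls_zero)
    finally show ?thesis using mem[OF g] ev[OF g] by simp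
  qed
  moreover have "length a = n" by (simp add: a_def)
  ultimately have az: "a \<in> zeros n I" by (simp add: zeros_def)
  interpret a: affine_point n I a by unfold_locales (rule az)
  have "x = kpoint n I a"
  proof (intro equalityI subsetI)
    fix y assume y: "y \<in> x"
    then obtain g where g: "in_vars n g" "y = cls n I g" using P.Icarr[OF y] by (auto simp: quot_carrier)
    thus "y \<in> kpoint n I a" using y mem ev a.kpoint_iff by simp
  next
    fix y assume "y \<in> kpoint n I a"
    then obtain g where "in_vars n g" "a.val g = 0" "y = cls n I g" by (rule a.kpointE)
    thus "y \<in> x" using mem ev by simp
  qed
  with az show thesis using that by blast
qed

subsection \<open>The coordinate ring of a plane curve\<close>

lemma ring_on_UNIV_homD:
  fixes \<psi> :: "'r::comm_ring_1 \<Rightarrow> 'b"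
  assumes "\<psi> \<in> Ring.ring_hom (ring_on UNIV) B" "ring B"
  shows "\<psi> (a + b) = \<psi> a \<oplus>\<^bsub>B\<^esub> \<psi> b" "\<psi> (a * b) = \<psi> a \<otimes>\<^bsub>B\<^esub> \<psi> b" "\<psi> 1 = \<one>\<^bsub>B\<^esub>" "\<psi> a \<in> carrier B" "\<psi> 0 = \<zero>\<^bsub>B\<^esub>"
    "\<psi> (a ^ n) = \<psi> a [^]\<^bsub>B\<^esub> n"
proof -
  interpret B: ring B by fact
  show add: "\<psi> (a + b) = \<psi> a \<oplus>\<^bsub>B\<^esub> \<psi> b" and mult: "\<psi> (a * b) = \<psi> a \<otimes>\<^bsub>B\<^esub> \<psi> b"
    and one: "\<psi> 1 = \<one>\<^bsub>B\<^esub>" and cl: "\<psi> a \<in> carrier B" for a b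
    using ring_hom_add[OF assms(1)] ring_hom_mult[OF assms(1)] ring_hom_one[OF assms(1)] ring_hom_closed[OF assms(1)]
    by (auto simp: ring_on_def)
  have "\<psi> 0 \<oplus>\<^bsub>B\<^esub> \<psi> 0 = \<psi> 0 \<oplus>\<^bsub>B\<^esub> \<zero>\<^bsub>B\<^esub>" using add[of 0 0] cl[of 0] by simp
  thus "\<psi> 0 = \<zero>\<^bsub>B\<^esub>" using B.add.l_cancel[of "\<psi> 0" "\<psi> 0" "\<zero>\<^bsub>B\<^esub>"] cl[of 0] by simp
  show "\<psi> (a ^ n) = \<psi> a [^]\<^bsub>B\<^esub> n"
  proof (induction n)
    case (Suc n)
    have "\<psi> (a ^ Suc n) = \<psi> (a ^ n * a)" by (simp add: mult.commute)
    thus ?case using Suc mult by simp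
  qed (simp add: one)
qed

text \<open>Some coefficient has nonzero image, but perhaps not the leading one;
  \<open>normalize\<close> strips leading zeros so that the relation counts as a polynomial over
  \<open>K\<close>.\<close>

lemma (in domain) algebraic_hom_image:
  fixes \<psi> :: "'r::comm_ring_1 \<Rightarrow> 'a" and m :: "'r list"
  assumes h: "\<psi> \<in> Ring.ring_hom (ring_on UNIV) R" and K: "subfield K R"
    and m: "\<psi> ` set m \<subseteq> K" "\<exists>c\<in>set m. \<psi> c \<noteq> \<zero>" and zero: "\<psi> (poly (Poly (rev m)) z) = \<zero>"
  shows "(algebraic over K) (\<psi> z)"
proof -
  note H = ring_on_UNIV_homD[OF h ring_axioms]
  have KR: "K \<subseteq> carrier R" by (rule subfieldE(3)[OF K])
  have ev: "eval (map \<psi> m) (\<psi> z) = \<psi> (poly (Poly (rev m)) z)" for m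
  proof (induction m)
    case (Cons c m)
    have "poly (Poly (rev (c # m))) z = c * z ^ length m + poly (Poly (rev m)) z"
      by (simp add: Poly_append poly_monom)
    thus ?case using Cons by (simp add: H)
  qed (simp add: H)
  define l where "l = normalize (map \<psi> m)"
  have "polynomial K l" unfolding l_def by (rule normalize_gives_polynomial) (use m in auto)
  hence "l \<in> carrier (univ_poly R K)" by (simp add: univ_poly_def)
  moreover have "eval l (\<psi> z) = \<zero>"
    unfolding l_def using eval_normalize[of "map \<psi> m" "\<psi> z"] H(4) zero ev[of m] by auto
  moreover have "l \<noteq> []"
  proof -
    have "normalize p \<noteq> []" if "\<exists>c\<in>set p. c \<noteq> \<zero>" for p using that by (induction p) auto
    thus ?thesis unfolding l_def using m(2) by auto
  qed
  ultimately show ?thesis by (intro algebraicI)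
qed

text \<open>Over the image of \<open>K\<close> the class of \<open>s\<close> is algebraic because of
  \<open>a\<close>; over the field it generates, the class of \<open>y\<close> is algebraic because
  of \<open>Q\<close>, whose reduction is not zero. These two simple extensions exhaust
  \<open>B\<close>.\<close>

lemma plane_quotient_field:
  fixes \<psi> :: "'k::field poly poly \<Rightarrow> 'b" and B :: "'b ring"
  assumes B: "domain B" and h: "\<psi> \<in> Ring.ring_hom (ring_on UNIV) B" and surj: "carrier B \<subseteq> range \<psi>"
    and a: "a \<noteq> 0" "\<psi> [:a:] = \<zero>\<^bsub>B\<^esub>" and Q: "\<psi> Q = \<zero>\<^bsub>B\<^esub>" "\<psi> [:poly.coeff Q i:] \<noteq> \<zero>\<^bsub>B\<^esub>"
    and f: "f \<in> carrier B" "f \<noteq> \<zero>\<^bsub>B\<^esub>"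
  shows "f \<in> Units B"
proof -
  interpret B: domain B by fact
  note H = ring_on_UNIV_homD[OF h B.ring_axioms]
  define c :: "'k \<Rightarrow> 'k poly poly" where "c k = [:[:k:]:]" for k
  have c: "c (k + l) = c k + c l" "c (k * l) = c k * c l" "c 1 = 1" for k l
    by (simp_all add: c_def one_pCons)
  have ch: "(\<lambda>k. \<psi> (c k)) \<in> Ring.ring_hom Rg B"
    by (rule ring_hom_memI) (simp_all add: Rg_simps H c)
  have c0: "\<psi> (c k) \<noteq> \<zero>\<^bsub>B\<^esub>" if "k \<noteq> 0" for k
  proof
    assume "\<psi> (c k) = \<zero>\<^bsub>B\<^esub>"
    hence "\<psi> (c k * c (inverse k)) = \<zero>\<^bsub>B\<^esub>" by (simp add: H)
    moreover have "c k * c (inverse k) = 1" using that by (simp add: c_def one_pCons)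
    ultimately show False using H(3) by simp
  qed
  define K where "K = (\<lambda>k. \<psi> (c k)) ` carrier Rg"
  have "ring_hom_ring Rg B (\<lambda>k. \<psi> (c k))"
    by (intro ring_hom_ring.intro ring_hom_ring_axioms.intro ch B.ring_axioms Rg.ring_axioms)
  hence K: "subfield K B" unfolding K_def
    by (rule ring_hom_ring.img_is_subfield(2)[OF _ field.carrier_is_subfield[OF field_Rg] B.one_not_zero])
  define x where "x = \<psi> [:[:0, 1:]:]"
  define y where "y = \<psi> [:0, 1:]"
  have x: "x \<in> carrier B" and y: "y \<in> carrier B" by (simp_all add: x_def y_def H)
  have "poly (map_poly c p) [:[:0, 1:]:] = [:p:]" for p
    by (induction p) (simp_all add: map_poly_pCons c_def)
  hence "\<psi> (poly (Poly (rev (rev (map c (coeffs a))))) [:[:0, 1:]:]) = \<zero>\<^bsub>B\<^esub>"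
    using a(2) by (simp add: map_poly_def)
  moreover have "\<exists>e\<in>set (rev (map c (coeffs a))). \<psi> e \<noteq> \<zero>\<^bsub>B\<^esub>"
    using a(1) c0[of "Polynomial.lead_coeff a"] by (auto intro!: bexI[of _ "Polynomial.lead_coeff a"] simp: coeffs_def)
  moreover have "\<psi> ` set (rev (map c (coeffs a))) \<subseteq> K" by (auto simp: K_def Rg_simps)
  ultimately have "(B.algebraic over K) x" unfolding x_def using B.algebraic_hom_image[OF h K] by blast
  hence F1: "subfield (B.simple_extension K x) B" using B.simple_extension_is_subfield[OF K x] by blast
  have in1: "\<psi> [:q:] \<in> B.simple_extension K x" for q
  proof (induction q)
    case 0
    show ?case using B.simple_extension.zero[of K x] by (simp add: H)
  next
    case (pCons k q)
    have "[:pCons k q:] = [:q:] * [:[:0, 1:]:] + c k" by (simp add: c_def)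
    hence "\<psi> [:pCons k q:] = \<psi> [:q:] \<otimes>\<^bsub>B\<^esub> x \<oplus>\<^bsub>B\<^esub> \<psi> (c k)" by (simp only: H x_def)
    thus ?case using B.simple_extension.lin[OF pCons(2), of "\<psi> (c k)"] by (simp add: K_def Rg_simps)
  qed
  define g :: "'k poly \<Rightarrow> 'k poly poly" where "g q = [:q:]" for q
  have "poly (map_poly g P) [:0, 1:] = P" for P
    by (induction P) (simp_all add: map_poly_pCons g_def)
  hence "\<psi> (poly (Poly (rev (rev (map g (coeffs Q))))) [:0, 1:]) = \<zero>\<^bsub>B\<^esub>"
    using Q(1) by (simp add: map_poly_def)
  moreover have "poly.coeff Q i \<noteq> 0" using Q(2) H(5) by auto
  hence "poly.coeff Q i \<in> set (coeffs Q)" by (intro coeff_in_coeffs) (auto intro: le_degree)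
  hence "\<exists>e\<in>set (rev (map g (coeffs Q))). \<psi> e \<noteq> \<zero>\<^bsub>B\<^esub>"
    using Q(2) by (auto simp: g_def)
  moreover have "\<psi> ` set (rev (map g (coeffs Q))) \<subseteq> B.simple_extension K x" using in1 by (auto simp: g_def)
  ultimately have "(B.algebraic over (B.simple_extension K x)) y"
    unfolding y_def using B.algebraic_hom_image[OF h F1] by blast
  hence F2: "subfield (B.simple_extension (B.simple_extension K x) y) B"
    using B.simple_extension_is_subfield[OF F1 y] by blast
  have in2: "\<psi> P \<in> B.simple_extension (B.simple_extension K x) y" for P
  proof (induction P)
    case 0
    show ?case using B.simple_extension.zero by (simp add: H)
  next
    case (pCons q P)
    have "pCons q P = P * [:0, 1:] + [:q:]" by simp
    hence "\<psi> (pCons q P) = \<psi> P \<otimes>\<^bsub>B\<^esub> y \<oplus>\<^bsub>B\<^esub> \<psi> [:q:]" by (simp only: H y_def)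
    thus ?case using B.simple_extension.lin[OF pCons(2) in1] by simp
  qed
  have "f \<in> B.simple_extension (B.simple_extension K x) y" using surj f(1) in2 by blast
  hence fF: "f \<in> B.simple_extension (B.simple_extension K x) y - {\<zero>\<^bsub>B\<^esub>}" using f(2) by simp
  note inv = B.subfield_m_inv[OF F2 fF]
  have "inv\<^bsub>B\<^esub> f \<in> carrier B" using inv(1) subfieldE(3)[OF F2] by blast
  thus ?thesis unfolding Units_def using f(1) inv(2,3) by (intro CollectI conjI bexI[of _ "inv\<^bsub>B\<^esub> f"])
qed

lemma irreducible_zariski_V:
  assumes A: "cring A" and M: "primeideal M A"
  shows "irreducible_in (zariski A) {P. primeideal P A \<and> M \<subseteq> P}"
proof -
  interpret A: cring A by fact
  have "{P. primeideal P A \<and> M \<subseteq> P} \<subseteq> C" if "closedin (zariski A) C" "M \<in> C" for C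
    using that unfolding A.closedin_zariski by auto
  thus ?thesis unfolding irreducible_in_def A.topspace_zariski using M by blast
qed

text \<open>If \<open>a b\<close> lies in every prime of \<open>Z\<close>, then \<open>Z\<close> is
  covered by the closed sets of \<open>a\<close> and of \<open>b\<close>, and irreducibility selects
  one of them.\<close>

lemma irreducible_zariskiD:
  assumes A: "cring A" and Z: "closedin (zariski A) Z" "irreducible_in (zariski A) Z"
  shows "primeideal (\<Inter>Z) A" "Z = {P. primeideal P A \<and> \<Inter>Z \<subseteq> P}"
proof -
  interpret A: cring A by fact
  obtain E where E: "E \<subseteq> carrier A" "Z = {P. primeideal P A \<and> E \<subseteq> P}"
    using Z(1) unfolding A.closedin_zariski by blast
  have ne: "Z \<noteq> {}" using Z(2) by (simp add: irreducible_in_def)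
  have pr: "primeideal P A" if "P \<in> Z" for P using that E(2) by blast
  have "ideal (\<Inter>Z) A" by (rule A.i_Intersect) (use ne pr primeideal.axioms(1) in blast)+
  thus "primeideal (\<Inter>Z) A"
  proof (rule primeidealI[OF _ A])
    obtain P where P: "P \<in> Z" using ne by blast
    have "\<one>\<^bsub>A\<^esub> \<notin> P" using primeideal.one_in_compl[OF pr[OF P]] by blast
    thus "carrier A \<noteq> \<Inter>Z" using P A.one_closed by blast
    fix a b assume ab: "a \<in> carrier A" "b \<in> carrier A" "a \<otimes>\<^bsub>A\<^esub> b \<in> \<Inter>Z"
    let ?V = "\<lambda>a. {P. primeideal P A \<and> {a} \<subseteq> P}"
    have "closedin (zariski A) (?V a)" "closedin (zariski A) (?V b)"
      unfolding A.closedin_zariski using ab by blast+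
    moreover have "Z \<subseteq> ?V a \<union> ?V b"
    proof
      fix P assume P: "P \<in> Z"
      hence "a \<otimes>\<^bsub>A\<^esub> b \<in> P" using ab(3) by blast
      hence "a \<in> P \<or> b \<in> P" using primeideal.I_prime[OF pr[OF P] ab(1,2)] by blast
      thus "P \<in> ?V a \<union> ?V b" using pr[OF P] by blast
    qed
    ultimately have "Z \<subseteq> ?V a \<or> Z \<subseteq> ?V b" using Z(2) unfolding irreducible_in_def by blast
    thus "a \<in> \<Inter>Z \<or> b \<in> \<Inter>Z" by blast
  qed
  show "Z = {P. primeideal P A \<and> \<Inter>Z \<subseteq> P}" unfolding E(2) by blast
qed

lemma krull_dim_one:
  assumes A: "domain A" and M: "primeideal M A" "M \<noteq> {\<zero>\<^bsub>A\<^esub>}"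
    and max: "\<And>P P'. primeideal P A \<Longrightarrow> P \<noteq> {\<zero>\<^bsub>A\<^esub>} \<Longrightarrow> primeideal P' A \<Longrightarrow> P \<subseteq> P' \<Longrightarrow> P = P'"
  shows "krull_dim (zariski A) = 1"
proof -
  interpret A: domain A by fact
  have A': "cring A" by (rule A.is_cring)
  have zp: "primeideal {\<zero>\<^bsub>A\<^esub>} A" by (rule A.zeroprimeideal)
  have M0: "\<zero>\<^bsub>A\<^esub> \<in> M"
    by (rule additive_subgroup.zero_closed[OF ideal.axioms(1)[OF primeideal.axioms(1)[OF M(1)]]])
  let ?chain = "\<lambda>n (Z :: nat \<Rightarrow> 'a set set). (\<forall>i\<le>n. closedin (zariski A) (Z i) \<and> irreducible_in (zariski A) (Z i))
      \<and> (\<forall>i<n. Z i \<subset> Z (Suc i))"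
  have "n \<le> 1" if Z: "?chain n Z" for n Z
  proof (rule ccontr)
    assume "\<not> n \<le> 1"
    hence n: "0 \<le> n" "1 \<le> n" "2 \<le> n" "0 < n" "1 < n" by auto
    note D = irreducible_zariskiD[OF A']
    have Zi: "primeideal (\<Inter>(Z i)) A" "Z i = {P. primeideal P A \<and> \<Inter>(Z i) \<subseteq> P}" if "i \<le> n" for i
      using D[of "Z i"] Z that by blast+
    have lt: "\<Inter>(Z (Suc i)) \<subset> \<Inter>(Z i)" if "Suc i \<le> n" for i
    proof -
      have "Z i \<subset> Z (Suc i)" using Z that by auto
      hence "\<Inter>(Z (Suc i)) \<subseteq> \<Inter>(Z i)" "Z i \<noteq> Z (Suc i)" by blast+
      moreover have "\<Inter>(Z (Suc i)) \<noteq> \<Inter>(Z i)" using Zi(2)[of i] Zi(2)[of "Suc i"] that \<open>Z i \<noteq> _\<close> by (metis Suc_leD)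
      ultimately show ?thesis by blast
    qed
    have "\<zero>\<^bsub>A\<^esub> \<in> \<Inter>(Z 2)"
      by (rule additive_subgroup.zero_closed[OF ideal.axioms(1)[OF primeideal.axioms(1)[OF Zi(1)[OF n(3)]]]])
    hence "\<Inter>(Z 1) \<noteq> {\<zero>\<^bsub>A\<^esub>}" using lt[of 1] n by (auto simp: numeral_2_eq_2)
    hence "\<Inter>(Z 1) = \<Inter>(Z 0)" using max[OF Zi(1)[OF n(2)] _ Zi(1)[OF n(1)]] lt[of 0] n(2) by auto
    thus False using lt[of 0] n(2) by auto
  qed
  hence "krull_dim (zariski A) \<le> 1"
    unfolding krull_dim_def by (intro Sup_least) (auto simp: one_enat_def)
  moreover have "1 \<le> krull_dim (zariski A)"
  proof -
    \<comment> \<open>Passing to closed sets reverses inclusions: the closed set of the larger prime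
      \<open>M\<close> comes first, the whole spectrum second.\<close>
    let ?Z = "\<lambda>i::nat. if i = 0 then {P. primeideal P A \<and> M \<subseteq> P} else {P. primeideal P A \<and> {\<zero>\<^bsub>A\<^esub>} \<subseteq> P}"
    have "closedin (zariski A) (?Z i)" for i
      unfolding A.closedin_zariski using ideal.Icarr[OF primeideal.axioms(1)[OF M(1)]] by auto
    moreover have "irreducible_in (zariski A) (?Z i)" for i
      using irreducible_zariski_V[OF A' M(1)] irreducible_zariski_V[OF A' zp] by simp
    moreover have "?Z 0 \<subset> ?Z (Suc 0)"
    proof -
      have "{P. primeideal P A \<and> M \<subseteq> P} \<subseteq> {P. primeideal P A \<and> {\<zero>\<^bsub>A\<^esub>} \<subseteq> P}" using M0 by blast
      moreover have "{\<zero>\<^bsub>A\<^esub>} \<in> {P. primeideal P A \<and> {\<zero>\<^bsub>A\<^esub>} \<subseteq> P}" using zp by simp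
      moreover have "{\<zero>\<^bsub>A\<^esub>} \<notin> {P. primeideal P A \<and> M \<subseteq> P}" using M(2) M0 by blast
      ultimately have "{P. primeideal P A \<and> M \<subseteq> P} \<subset> {P. primeideal P A \<and> {\<zero>\<^bsub>A\<^esub>} \<subseteq> P}"
        by (metis psubsetI)
      thus ?thesis by simp
    qed
    ultimately have "?chain 1 ?Z" by simp
    hence "\<exists>Z. ?chain 1 Z" by (rule exI[of _ ?Z])
    hence "enat 1 \<in> {enat n | n. \<exists>Z. ?chain n Z}" by (intro CollectI exI[of _ 1] conjI refl)
    thus ?thesis unfolding krull_dim_def one_enat_def by (rule Sup_upper)
  qed
  ultimately show ?thesis by simp
qed

subsection \<open>Plane curves over large fields\<close>

abbreviation mpx :: "'k::field poly \<Rightarrow> 'k mp" where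
  "mpx q \<equiv> poly (map_poly const q) (mvar 0)"

text \<open>Carries \<open>K[s][y]\<close> to the polynomials of the definitions, with
  \<open>s\<close> as variable \<open>0\<close> and \<open>y\<close> as variable
  \<open>1\<close>.\<close>

definition mp2 :: "'k::field poly poly \<Rightarrow> 'k mp" where
  "mp2 P = poly (map_poly mpx P) (mvar 1)"

lemma map_poly_const_add: "map_poly const (p + q) = map_poly const p + map_poly const q"
  by (intro poly_eqI) (simp add: coeff_map_poly const_add const_0)

lemma mpx_0: "mpx 0 = 0" and mpx_pCons: "mpx (pCons c q) = const c + mvar 0 * mpx q"
  and mpx_add: "mpx (p + q) = mpx p + mpx q"
  by (simp_all add: map_poly_pCons const_0 map_poly_const_add)

lemma mpx_smult: "mpx (smult c q) = const c * mpx q"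
  by (induction q) (simp_all add: mpx_pCons mpx_0 const_mult algebra_simps)

lemma mpx_mult: "mpx (p * q) = mpx p * mpx q"
  by (induction p) (simp_all add: mpx_pCons mpx_0 mpx_add mpx_smult const_0 algebra_simps)

lemma mp2_0: "mp2 0 = 0" and mp2_pCons: "mp2 (pCons q P) = mpx q + mvar 1 * mp2 P"
  by (simp_all add: mp2_def map_poly_pCons mpx_0)

lemma mp2_add: "mp2 (P + Q) = mp2 P + mp2 Q"
proof -
  have "map_poly mpx (P + Q) = map_poly mpx P + map_poly mpx Q"
    by (intro poly_eqI) (simp add: coeff_map_poly mpx_0 mpx_add)
  thus ?thesis by (simp add: mp2_def)
qed

lemma mp2_smult: "mp2 (smult q P) = mpx q * mp2 P"
  by (induction P) (simp_all add: mp2_pCons mp2_0 mpx_mult algebra_simps)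

lemma mp2_mult: "mp2 (P * Q) = mp2 P * mp2 Q"
  by (induction P) (simp_all add: mp2_pCons mp2_0 mp2_add mp2_smult mpx_0 algebra_simps)

lemma mp2_const: "mp2 [:[:c:]:] = const c" and mp2_x: "mp2 [:[:0, 1:]:] = mvar 0" and mp2_y: "mp2 [:0, 1:] = mvar 1"
  by (simp_all add: mp2_pCons mp2_0 mpx_pCons mpx_0 const_0 const_1 one_pCons)

lemma mp2_1: "mp2 1 = 1"
  using mp2_const[of 1] by (simp add: const_1 one_pCons)

lemma in_vars_mp2: "in_vars 2 (mp2 P)"
proof -
  have "in_vars 2 (mpx q :: 'a mp)" for q
    by (induction q) (auto simp: mpx_pCons mpx_0 intro!: in_vars_add in_vars_mult)
  thus ?thesis by (induction P) (auto simp: mp2_pCons mp2_0 intro!: in_vars_add in_vars_mult)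
qed

lemma mp2_surj: "in_vars 2 p \<Longrightarrow> \<exists>P. p = mp2 P"
proof (induction rule: mp_induct)
  case (const c)
  show ?case by (metis mp2_const)
next
  case (mvar i)
  hence "i = 0 \<or> i = 1" by auto
  thus ?case by (metis mp2_x mp2_y)
qed (metis mp2_add, metis mp2_mult)

lemma ev_mp2: "ev fps_const a (mp2 P) = ev2 (a 1) P" if "a 0 = fps_X"
proof -
  have x: "ev fps_const a (mpx q) = fps_of_poly q" for q
    by (induction q) (simp_all add: mpx_pCons mpx_0 fps_alg.ev_add fps_alg.ev_mult that fps_of_poly_pCons mult.commute)
  show ?thesis
    by (induction P) (simp_all add: mp2_pCons mp2_0 fps_alg.ev_add fps_alg.ev_mult x ev2_pCons)
qed

lemma mp_eval_mp2: "mp_eval a (mp2 P) = pt2 P (a 0) (a 1)"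
proof -
  have x: "mp_eval a (mpx q) = poly q (a 0)" for q
    by (induction q) (simp_all add: mpx_pCons mpx_0 mp_eval_simps)
  show ?thesis by (induction P) (simp_all add: mp2_pCons mp2_0 mp_eval_simps x)
qed

lemma pdiff_mp2: "pdiff 1 (mp2 P) = mp2 (pderiv P)"
proof -
  have x: "pdiff 1 (mpx q) = 0" for q
    by (induction q) (simp_all add: mpx_pCons mpx_0 pdiff_add pdiff_mult pdiff_mvar)
  show ?thesis
  proof (induction P)
    case (pCons q P)
    have "pdiff (Suc 0) (mvar (Suc 0)) = (1 :: 'a mp)" by (simp add: pdiff_mvar)
    thus ?case using pCons x
      by (simp add: mp2_pCons pdiff_add pdiff_mult pderiv_pCons mp2_add mpx_0 mp2_def[symmetric] add.commute)
  qed (simp add: mp2_0)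
qed

section \<open>The plane curve of a branch as a scheme\<close>

locale plane_curve =
  fixes u :: "'k::field fps" and Q :: "'k poly poly"
  assumes u0: "fps_nth u 0 = 0" and Q: "curve_eq u Q" and simple: "fps_nth (ev2 u (pderiv Q)) 0 \<noteq> 0"
begin

text \<open>The shapes \<open>0 + 2\<close> and \<open>{0} \<union> set [mp2 Q]\<close> are those
  that \<open>smooth_at\<close> produces over \<open>Spec_K\<close>, with no base variables and a
  single equation.\<close>

definition J where "J = genideal (poly_ring (0 + 2)) ({0} \<union> set [mp2 Q])"
definition par :: "nat \<Rightarrow> 'k fps" where "par i = (if i = 0 then fps_X else u)"

lemma ev_par: "ev fps_const par (mp2 P) = ev2 u P"
  using ev_mp2[of par P] by (simp add: par_def)

lemma kernel_ideal: "ideal {p. in_vars 2 p \<and> ev fps_const par p = 0} (poly_ring 2)"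
  by (rule poly_ring_idealI) (auto simp: fps_alg.ev_add fps_alg.ev_mult intro: in_vars_add in_vars_mult)

text \<open>By \<open>curve_eq\<close> the generated ideal is the full kernel of a map into power
  series, a domain; this yields primality at once.\<close>

lemma J_eq: "J = {p. in_vars 2 p \<and> ev fps_const par p = 0}"
proof
  have evQ: "ev2 u Q = 0" using Q by (simp add: curve_eq_def)
  have "{0} \<union> set [mp2 Q] \<subseteq> {p. in_vars 2 p \<and> ev fps_const par p = 0}"
    using evQ by (simp add: in_vars_mp2 ev_par)
  thus "J \<subseteq> {p. in_vars 2 p \<and> ev fps_const par p = 0}"
    unfolding J_def add_0 using pr.genideal_minimal[OF kernel_ideal] by simp
  have sub: "{0} \<union> set [mp2 Q] \<subseteq> carrier (poly_ring 2)" by (simp add: poly_ring_simps in_vars_mp2)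
  have J: "ideal J (poly_ring 2)" "mp2 Q \<in> J"
    unfolding J_def add_0 using pr.genideal_ideal[OF sub] pr.genideal_self[OF sub] by simp_all
  show "{p. in_vars 2 p \<and> ev fps_const par p = 0} \<subseteq> J"
  proof safe
    fix p assume p: "in_vars 2 p" "ev fps_const par p = 0"
    then obtain P where P: "p = mp2 P" using mp2_surj by blast
    hence "Q dvd P" using p(2) Q by (simp add: ev_par curve_eq_def)
    then obtain R where "P = Q * R" by (rule dvdE)
    hence "p = mp2 R * mp2 Q" by (simp add: P mp2_mult mult.commute)
    thus "p \<in> J" using poly_ring_idealD(4)[OF J(1) in_vars_mp2 J(2)] by simp
  qed
qed

sublocale J: affine 2 J
  by (rule affine.intro) (unfold J_eq, rule kernel_ideal)

abbreviation A where "A \<equiv> quot 2 J"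

lemma J_prime: "primeideal J (poly_ring 2)"
proof (rule primeidealI[OF J.I cring_poly_ring])
  have "1 \<notin> J" by (simp add: J_eq)
  moreover have "1 \<in> carrier (poly_ring 2 :: 'k mp ring)" by (simp add: poly_ring_simps)
  ultimately show "carrier (poly_ring 2) \<noteq> J" by metis
  fix a b assume "a \<in> carrier (poly_ring 2)" "b \<in> carrier (poly_ring 2)" "a \<otimes>\<^bsub>poly_ring 2\<^esub> b \<in> J"
  thus "a \<in> J \<or> b \<in> J" by (auto simp: poly_ring_simps J_eq fps_alg.ev_mult)
qed

lemma A_domain: "domain A"
  unfolding quot_def by (rule primeideal.quotient_is_domain[OF J_prime])

definition pi :: "'k poly poly \<Rightarrow> 'k alg" where "pi P = cls 2 J (mp2 P)"

lemma pi_hom: "pi \<in> Ring.ring_hom (ring_on UNIV) A"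
  by (rule ring_hom_memI)
     (auto simp: ring_on_def pi_def J.cls_in J.cls_add J.cls_mult J.cls_one in_vars_mp2 mp2_add mp2_mult mp2_1)

lemma pi_surj: "carrier A = range pi"
  unfolding J.quot_carrier pi_def using mp2_surj in_vars_mp2 by blast

lemma pi_eq_0_iff: "pi P = \<zero>\<^bsub>A\<^esub> \<longleftrightarrow> ev2 u P = 0"
  unfolding pi_def J.cls_zero
  by (subst J.cls_eq_iff) (auto simp: in_vars_mp2 J_eq ev_par)

text \<open>By elimination a nonzero prime \<open>P\<close> contains a nonzero element of
  \<open>K[s]\<close>, and \<open>Q\<close> does not reduce to zero modulo \<open>P\<close> for lack
  of a vertical component. So the quotient by \<open>P\<close> is a field.\<close>

lemma primes_maximal:
  assumes P: "primeideal P A" "P \<noteq> {\<zero>\<^bsub>A\<^esub>}" and P': "primeideal P' A" "P \<subseteq> P'"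
  shows "P = P'"
proof (rule ccontr)
  assume "P \<noteq> P'"
  interpret A: domain A by (rule A_domain)
  interpret P: primeideal P A by fact
  interpret P': primeideal P' A by fact
  note H = ring_on_UNIV_homD[OF pi_hom A.ring_axioms]
  define B where "B = A Quot P"
  have B: "domain B" unfolding B_def by (rule P.quotient_is_domain)
  interpret B: domain B by (rule B)
  define \<psi> where "\<psi> R = P +>\<^bsub>A\<^esub> pi R" for R
  have \<psi>: "\<psi> \<in> Ring.ring_hom (ring_on UNIV) B"
    using ring_hom_trans[OF pi_hom P.rcos_ring_hom] by (simp add: \<psi>_def[abs_def] comp_def B_def)
  have carB: "carrier B = (\<lambda>f. P +>\<^bsub>A\<^esub> f) ` carrier A"
    unfolding B_def FactRing_def A_RCOSETS_def' by auto
  have surj: "carrier B \<subseteq> range \<psi>" unfolding carB pi_surj \<psi>_def by blast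
  have zero_iff: "P +>\<^bsub>A\<^esub> f = \<zero>\<^bsub>B\<^esub> \<longleftrightarrow> f \<in> P" if f: "f \<in> carrier A" for f
  proof -
    have "\<zero>\<^bsub>B\<^esub> = P +>\<^bsub>A\<^esub> \<zero>\<^bsub>A\<^esub>"
      using P.a_rcos_const[OF additive_subgroup.zero_closed[OF P.is_additive_subgroup]] by (simp add: B_def FactRing_def)
    thus ?thesis using A.quotient_eq_iff_same_a_r_cos[OF P.ideal_axioms f A.zero_closed] f by (simp add: a_minus_def)
  qed
  have \<psi>0: "\<psi> R = \<zero>\<^bsub>B\<^esub> \<longleftrightarrow> pi R \<in> P" for R unfolding \<psi>_def by (rule zero_iff[OF H(4)])
  have zeroP: "\<zero>\<^bsub>A\<^esub> \<in> P" by (rule additive_subgroup.zero_closed[OF P.is_additive_subgroup])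
  then obtain g where g: "g \<in> P" "g \<noteq> \<zero>\<^bsub>A\<^esub>" using P(2) by blast
  then obtain G where G: "g = pi G" using P.Icarr[OF g(1)] pi_surj by blast
  have "ev2 u G \<noteq> 0" using g(2) pi_eq_0_iff G by blast
  then obtain a C where a: "a \<noteq> 0" "Q dvd [:a:] - C * G" using curve_eq_elimination[OF Q] by blast
  have piQ: "pi R = \<zero>\<^bsub>A\<^esub>" if "Q dvd R" for R using that Q pi_eq_0_iff by (simp add: curve_eq_def)
  have "pi [:a:] = pi (([:a:] - C * G) + C * G)" by simp
  also have "\<dots> = pi C \<otimes>\<^bsub>A\<^esub> g" unfolding H(1,2) piQ[OF a(2)] G using H(4) by simp
  finally have "pi [:a:] \<in> P" using P.I_l_closed[OF g(1) H(4)] by simp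
  define I where "I = {b. pi [:b:] \<in> P}"
  have "\<exists>b. b \<noteq> 0 \<and> pi [:b:] \<in> P" using a(1) \<open>pi [:a:] \<in> P\<close> by blast
  \<comment> \<open>\<open>b\<close> generates the intersection of \<open>P\<close> with
    \<open>K[s]\<close>; division with remainder shows this in \<open>bdvd\<close>.\<close>
  then obtain b where b: "b \<noteq> 0" "pi [:b:] \<in> P" "\<And>c. c \<noteq> 0 \<Longrightarrow> pi [:c:] \<in> P \<Longrightarrow> Polynomial.degree b \<le> Polynomial.degree c"
    using ex_has_least_nat[of "\<lambda>b. b \<noteq> 0 \<and> pi [:b:] \<in> P" _ Polynomial.degree] by blast
  have deg: "Polynomial.degree b > 0"
  proof (rule ccontr)
    assume "\<not> Polynomial.degree b > 0"
    then obtain k where k: "b = [:k:]" "k \<noteq> 0" using b(1) by (auto elim: degree_eq_zeroE)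
    have "pi ([:[:inverse k:]:] * [:b:]) \<in> P" unfolding H(2) using P.I_l_closed[OF b(2) H(4)] .
    moreover have "[:[:inverse k:]:] * [:b:] = 1" using k by (simp add: one_pCons)
    ultimately show False using H(3) P.one_in_compl by auto
  qed
  have bdvd: "b dvd c" if c: "pi [:c:] \<in> P" for c
  proof -
    have "[:c mod b:] = [:c:] + [:- (c div b):] * [:b:]"
      by (simp add: minus_div_mult_eq_mod[symmetric])
    hence "pi [:c mod b:] = pi [:c:] \<oplus>\<^bsub>A\<^esub> pi [:- (c div b):] \<otimes>\<^bsub>A\<^esub> pi [:b:]" by (simp only: H(1,2))
    hence "pi [:c mod b:] \<in> P"
      using additive_subgroup.a_closed[OF P.is_additive_subgroup c P.I_l_closed[OF b(2) H(4)]] by simp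
    hence "c mod b = 0" using b(3)[of "c mod b"] degree_mod_less[OF b(1), of c] by linarith
    thus ?thesis by (simp add: dvd_eq_mod_eq_0)
  qed
  have "\<exists>i. \<psi> [:poly.coeff Q i:] \<noteq> \<zero>\<^bsub>B\<^esub>"
  proof (rule ccontr)
    assume "\<not> ?thesis"
    hence "[:b:] dvd Q" using \<psi>0 bdvd by (simp add: const_poly_dvd_iff)
    thus False using curve_eq_not_dvd_vertical[OF Q deg] by blast
  qed
  then obtain i where i: "\<psi> [:poly.coeff Q i:] \<noteq> \<zero>\<^bsub>B\<^esub>" by blast
  have Q0: "\<psi> Q = \<zero>\<^bsub>B\<^esub>" unfolding \<psi>0 using piQ[of Q] zeroP by simp
  have b0: "\<psi> [:b:] = \<zero>\<^bsub>B\<^esub>" unfolding \<psi>0 by (rule b(2))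
  obtain f where f: "f \<in> P'" "f \<notin> P" using \<open>P \<noteq> P'\<close> P'(2) by blast
  have fA: "f \<in> carrier A" by (rule P'.Icarr[OF f(1)])
  have "P +>\<^bsub>A\<^esub> f \<in> Units B"
    by (rule plane_quotient_field[OF B \<psi> surj b(1) b0 Q0 i]) (use fA f(2) zero_iff[OF fA] carB in auto)
  then obtain y where y: "y \<in> carrier B" "y \<otimes>\<^bsub>B\<^esub> (P +>\<^bsub>A\<^esub> f) = \<one>\<^bsub>B\<^esub>"
    unfolding Units_def by blast
  then obtain h where h: "h \<in> carrier A" "(P +>\<^bsub>A\<^esub> h) \<otimes>\<^bsub>B\<^esub> (P +>\<^bsub>A\<^esub> f) = \<one>\<^bsub>B\<^esub>"
    unfolding carB by (elim imageE) simp
  have "P +>\<^bsub>A\<^esub> (h \<otimes>\<^bsub>A\<^esub> f) = P +>\<^bsub>A\<^esub> \<one>\<^bsub>A\<^esub>"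
    using h(2) ring_hom_mult[OF P.rcos_ring_hom h(1) fA] ring_hom_one[OF P.rcos_ring_hom] by (simp add: B_def)
  hence "h \<otimes>\<^bsub>A\<^esub> f \<ominus>\<^bsub>A\<^esub> \<one>\<^bsub>A\<^esub> \<in> P"
    using A.quotient_eq_iff_same_a_r_cos[OF P.ideal_axioms A.m_closed[OF h(1) fA] A.one_closed] by simp
  hence 1: "h \<otimes>\<^bsub>A\<^esub> f \<ominus>\<^bsub>A\<^esub> \<one>\<^bsub>A\<^esub> \<in> P'" using P'(2) by blast
  have 2: "h \<otimes>\<^bsub>A\<^esub> f \<in> P'" by (rule P'.I_l_closed[OF f(1) h(1)])
  \<comment> \<open>An element \<open>f\<close> of \<open>P'\<close> outside \<open>P\<close> is
    invertible modulo \<open>P\<close>, so \<open>1 = h f - (h f - 1)\<close> lies in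
    \<open>P'\<close>.\<close>
  have "h \<otimes>\<^bsub>A\<^esub> f \<ominus>\<^bsub>A\<^esub> (h \<otimes>\<^bsub>A\<^esub> f \<ominus>\<^bsub>A\<^esub> \<one>\<^bsub>A\<^esub>) \<in> P'"
    unfolding a_minus_def[of A "h \<otimes>\<^bsub>A\<^esub> f" "h \<otimes>\<^bsub>A\<^esub> f \<ominus>\<^bsub>A\<^esub> \<one>\<^bsub>A\<^esub>"]
    by (rule additive_subgroup.a_closed[OF P'.is_additive_subgroup 2 additive_subgroup.a_inv_closed[OF P'.is_additive_subgroup 1]])
  moreover have "h \<otimes>\<^bsub>A\<^esub> f \<ominus>\<^bsub>A\<^esub> (h \<otimes>\<^bsub>A\<^esub> f \<ominus>\<^bsub>A\<^esub> \<one>\<^bsub>A\<^esub>) = \<one>\<^bsub>A\<^esub>"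
    using A.m_closed[OF h(1) fA] A.one_closed by algebra
  ultimately show False using P'.one_in_compl by simp
qed

abbreviation origin :: "'k list" where "origin \<equiv> [0, 0]"

lemma zeros_J: "a \<in> zeros 2 J \<longleftrightarrow> length a = 2 \<and> pt2 Q (a ! 0) (a ! 1) = 0"
proof -
  have "(\<forall>g\<in>J. mp_eval (\<lambda>i. a ! i) g = 0) \<longleftrightarrow> pt2 Q (a ! 0) (a ! 1) = 0"
  proof
    have "mp2 Q \<in> J" using Q by (simp add: J_eq in_vars_mp2 ev_par curve_eq_def)
    moreover assume "\<forall>g\<in>J. mp_eval (\<lambda>i. a ! i) g = 0"
    ultimately show "pt2 Q (a ! 0) (a ! 1) = 0" using mp_eval_mp2[of "\<lambda>i. a ! i" Q] by simp
  next
    assume 0: "pt2 Q (a ! 0) (a ! 1) = 0"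
    show "\<forall>g\<in>J. mp_eval (\<lambda>i. a ! i) g = 0"
    proof
      fix g assume g: "g \<in> J"
      then obtain P where P: "g = mp2 P" using mp2_surj J_eq by blast
      hence "Q dvd P" using g Q by (simp add: J_eq ev_par curve_eq_def)
      thus "mp_eval (\<lambda>i. a ! i) g = 0" using curve_eq_dvd_pt2 0 by (simp add: P mp_eval_mp2)
    qed
  qed
  thus ?thesis by (simp add: zeros_def)
qed

lemma origin_zeros: "origin \<in> zeros 2 J"
proof -
  have "ev2 u Q = 0" using Q by (simp add: curve_eq_def)
  hence "pt2 Q 0 0 = 0" using ev2_nth_0[where u=u and P=Q] u0 by simp
  thus ?thesis by (simp add: zeros_J)
qed

sublocale O: affine_point 2 J origin
  by unfold_locales (rule origin_zeros)

text \<open>The function \<open>s\<close> vanishes at the origin, but on the branch it is the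
  nonzero series \<open>X\<close>.\<close>

lemma A_nonzero_prime: "kpoint 2 J origin \<noteq> {\<zero>\<^bsub>A\<^esub>}"
proof -
  have "pi [:[:0, 1:]:] \<in> kpoint 2 J origin"
    unfolding pi_def by (subst O.kpoint_iff) (simp_all add: in_vars_mp2 mp_eval_mp2)
  moreover have "pi [:[:0, 1:]:] \<noteq> \<zero>\<^bsub>A\<^esub>" by (simp add: pi_eq_0_iff ev2_pCons)
  ultimately show ?thesis by blast
qed

lemma curve_aff: "curve (aff 2 J)"
  unfolding curve_def variety_def
proof (intro conjI)
  let ?X = "aff 2 J"
  show "finite_type ?X"
    unfolding finite_type_def
  proof (intro conjI J.locally_ringed_aff exI[of _ "{pts ?X}"] ballI)
    fix U assume "U \<in> {pts ?X}"
    hence U: "U = pts ?X" by simp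
    show "openin (tp ?X) U" unfolding U by (rule openin_topspace)
    show "\<exists>n I f. ideal I (poly_ring n) \<and> kiso (open_sub ?X U) (aff n I) f"
      unfolding U open_sub_pts using J.I kiso_kid[OF J.locally_ringed_aff] by blast
  qed auto
  show "separated ?X" unfolding aff_def by (rule separated_Spec[OF J.quot_cring J.cls_const_hom])
  show "reduced ?X" unfolding aff_def by (rule reduced_Spec[OF A_domain])
  interpret A: domain A by (rule A_domain)
  have "pts ?X = {P. primeideal P A \<and> {\<zero>\<^bsub>A\<^esub>} \<subseteq> P}"
    unfolding J.pts_aff using additive_subgroup.zero_closed ideal.axioms(1) primeideal.axioms(1) by blast
  thus "irreducible_in (tp ?X) (pts ?X)"
    using irreducible_zariski_V[OF J.quot_cring A.zeroprimeideal] by (simp add: J.aff_simps)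
  show "krull_dim (tp ?X) = 1"
    unfolding J.aff_simps by (rule krull_dim_one[OF A_domain O.kpoint_prime A_nonzero_prime primes_maximal])
qed

text \<open>One equation in two variables over a point. The minor for the variable \<open>y\<close>
  is the derivative of \<open>Q\<close>, and its value at the origin is the constant term of
  \<open>ev2 u (pderiv Q)\<close>.\<close>

lemma smooth_origin: "smooth_point (aff 2 J) (kpoint 2 J origin)"
proof -
  let ?X = "aff 2 J"
  interpret Z: affine 0 "{0 :: 'k mp}"
    by (rule affine.intro, rule poly_ring_idealI) auto
  define h where "h z = (\<Union>g\<in>z. J +>\<^bsub>poly_ring 2\<^esub> g)" for z
  have single: "cls 0 {0} p = {p}" for p :: "'k mp"
    unfolding a_r_coset_def' by (simp add: poly_ring_simps)
  have h_cls: "h (cls 0 {0} p) = cls 2 J p" for p by (simp add: h_def single)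
  have v: "in_vars 2 p" if "in_vars 0 p" for p :: "'k mp" using in_vars_mono[OF that] by simp
  have hh: "h \<in> Ring.ring_hom (quot 0 {0}) A"
    by (rule ring_hom_memI)
       (auto simp: Z.quot_carrier h_cls Z.cls_add Z.cls_mult Z.cls_one J.cls_add J.cls_mult J.cls_one J.cls_in v)
  define \<phi> where "\<phi> = proj 0 {0} 2 J"
  have \<phi>: "kmor ?X Spec_K \<phi>"
    unfolding \<phi>_def proj_def Spec_K_def aff_def h_def[symmetric]
    by (rule kmor_Spec_map[OF Z.quot_cring J.quot_cring hh]) (auto simp: Z.cls_in h_cls)
  have "smooth_at 1 ?X Spec_K \<phi> (kpoint 2 J origin)"
    unfolding smooth_at_def
  proof (intro exI conjI)
    show "openin (tp ?X) (pts ?X)" "openin (tp (Spec_K :: 'k sch)) (pts Spec_K)" by (rule openin_topspace)+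
    show "kpoint 2 J origin \<in> pts ?X" by (rule O.kpoint_pts)
    show "pmap \<phi> ` pts ?X \<subseteq> pts Spec_K" using kmorD(6)[OF \<phi>] by blast
    show "ideal {0 :: 'k mp} (poly_ring 0)" by (rule Z.I)
    show "set [mp2 Q] \<subseteq> carrier (poly_ring (0 + 2))" unfolding add_0 by (simp add: poly_ring_simps in_vars_mp2)
    show "2 = length [mp2 Q] + 1" by simp
    show "J = genideal (poly_ring (0 + 2)) ({0} \<union> set [mp2 Q])" by (rule J_def)
    show "kiso (open_sub Spec_K (pts Spec_K)) (aff 0 {0 :: 'k mp}) kid"
      unfolding open_sub_pts Spec_K_def by (rule kiso_kid[OF Z.locally_ringed_aff])
    show "open_immersion (open_sub ?X (pts ?X)) (aff (0 + 2) J) kid"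
      using kiso_kid[OF J.locally_ringed_aff] unfolding open_sub_pts kiso_def add_0 by (rule conjunct1)
    show "kmap_eq (open_sub ?X (pts ?X)) (aff 0 {0}) (kcomp kid \<phi>) (kcomp (proj 0 {0} (0 + 2) J) kid)"
      unfolding open_sub_pts \<phi>_def add_0 by (simp add: kmap_eq_def kcomp_def kid_def)
    show "(\<lambda>_ :: nat. 1 :: nat) ` {..<length [mp2 Q]} \<subseteq> {0..<0 + 2}" by auto
    have "Determinant.det (mat (length [mp2 Q]) (length [mp2 Q]) (\<lambda>(i, j). pdiff ((\<lambda>_ :: nat. 1 :: nat) j) ([mp2 Q] ! i))) = mp2 (pderiv Q)"
      by (simp add: det_single pdiff_mp2[simplified])
    moreover have "cls 2 J (mp2 (pderiv Q)) \<notin> kpoint 2 J origin"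
      unfolding O.kpoint_iff[OF in_vars_mp2] using simple ev2_nth_0[where u=u and P="pderiv Q"] u0 by (simp add: mp_eval_mp2)
    ultimately show "J +>\<^bsub>poly_ring (0 + 2)\<^esub> Determinant.det (mat (length [mp2 Q]) (length [mp2 Q])
        (\<lambda>(i, j). pdiff ((\<lambda>_ :: nat. 1 :: nat) j) ([mp2 Q] ! i))) \<notin> pmap kid (kpoint 2 J origin)"
      unfolding add_0 by (simp add: kid_def)
  qed
  thus ?thesis unfolding smooth_point_def using \<phi> O.kpoint_pts by blast
qed

lemma infinite_points:
  assumes "large TYPE('k)"
  shows "infinite {(t, c). pt2 Q t c = 0}"
proof
  assume fin: "finite {(t, c). pt2 Q t c = 0}"
  have "rat_points (aff 2 J) \<subseteq> (\<lambda>(t, c). kpoint 2 J [t, c]) ` {(t, c). pt2 Q t c = 0}"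
  proof
    fix x assume "x \<in> rat_points (aff 2 J)"
    then obtain a where a: "a \<in> zeros 2 J" "x = kpoint 2 J a" by (rule J.rational_point_cases)
    obtain t c where "a = [t, c]" using a(1) unfolding zeros_J
      by (metis length_0_conv length_Suc_conv numeral_2_eq_2)
    thus "x \<in> (\<lambda>(t, c). kpoint 2 J [t, c]) ` {(t, c). pt2 Q t c = 0}" using a by (force simp: zeros_J)
  qed
  hence "finite (rat_points (aff 2 J))" using fin finite_subset by blast
  thus False using assms curve_aff smooth_origin O.kpoint_rational unfolding large_def by blast
qed

end

theorem large_imp_plane_large:
  assumes "large TYPE('k::field)"
  shows "plane_large TYPE('k)"
  unfolding plane_large_def
proof (intro allI impI, elim conjE)
  fix u :: "'k fps" and Q
  assume "fps_nth u 0 = 0" "curve_eq u Q" "fps_nth (ev2 u (pderiv Q)) 0 \<noteq> 0"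
  then interpret plane_curve u Q by unfold_locales
  show "infinite {(t, c). pt2 Q t c = 0}" by (rule infinite_points[OF assms])
qed

subsection \<open>Equations for an etale neighbourhood\<close>

lemma ring_hom_minus:
  assumes "cring A" "cring B" "h \<in> Ring.ring_hom A B" "a \<in> carrier A" "b \<in> carrier A"
  shows "h (a \<ominus>\<^bsub>A\<^esub> b) = h a \<ominus>\<^bsub>B\<^esub> h b"
proof -
  interpret ring_hom_cring A B h
    using assms by (intro ring_hom_cring.intro ring_hom_cring_axioms.intro) auto
  show ?thesis using assms(4,5) by (simp add: a_minus_def)
qed

text \<open>If the image of \<open>a - c\<close> is not a unit, neither is \<open>a - c\<close>,
  because ring homomorphisms preserve units.\<close>

lemma kmor_rational:
  assumes f: "kmor X Y f" and x: "x \<in> rat_points X" and R: "cring (stk X x)" "cring (stk Y (pmap f x))"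
    and sc: "\<And>c. scal Y (pmap f x) c \<in> carrier (stk Y (pmap f x))"
  shows "pmap f x \<in> rat_points Y"
  unfolding rat_points_def
proof (intro CollectI conjI ballI)
  have xX: "x \<in> pts X" using x by (simp add: rat_points_def)
  show "pmap f x \<in> pts Y" by (rule kmorD(6)[OF f xX])
  fix a assume a: "a \<in> carrier (stk Y (pmap f x))"
  note h = kmorD(2)[OF f xX]
  obtain c where c: "smap f x a \<ominus>\<^bsub>stk X x\<^esub> scal X x c \<notin> Units (stk X x)"
    using x ring_hom_closed[OF h a] unfolding rat_points_def by blast
  have "smap f x (a \<ominus>\<^bsub>stk Y (pmap f x)\<^esub> scal Y (pmap f x) c) = smap f x a \<ominus>\<^bsub>stk X x\<^esub> scal X x c"
    unfolding ring_hom_minus[OF R(2,1) h a sc] kmorD(4)[OF f xX] ..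
  hence "a \<ominus>\<^bsub>stk Y (pmap f x)\<^esub> scal Y (pmap f x) c \<notin> Units (stk Y (pmap f x))"
    using c ring_hom_Units[OF h] by metis
  thus "\<exists>c. a \<ominus>\<^bsub>stk Y (pmap f x)\<^esub> scal Y (pmap f x) c \<notin> Units (stk Y (pmap f x))" by blast
qed

text \<open>Every germ at \<open>x\<close> comes from a germ \<open>b\<close> at the image, and a
  non-unit \<open>b - c\<close> stays a non-unit because the stalk map reflects units.\<close>

lemma open_immersion_rational:
  assumes f: "open_immersion X Y f" and x: "x \<in> pts X" "pmap f x \<in> rat_points Y"
    and R: "cring (stk X x)" "cring (stk Y (pmap f x))"
    and sc: "\<And>c. scal Y (pmap f x) c \<in> carrier (stk Y (pmap f x))"
  shows "x \<in> rat_points X"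
  unfolding rat_points_def
proof (intro CollectI conjI ballI x(1))
  have m: "kmor X Y f" and bij: "bij_betw (smap f x) (carrier (stk Y (pmap f x))) (carrier (stk X x))"
    using f x(1) by (auto simp: open_immersion_def)
  note h = kmorD(2)[OF m x(1)]
  fix a assume "a \<in> carrier (stk X x)"
  then obtain b where b: "b \<in> carrier (stk Y (pmap f x))" "a = smap f x b"
    using bij unfolding bij_betw_def by blast
  obtain c where c: "b \<ominus>\<^bsub>stk Y (pmap f x)\<^esub> scal Y (pmap f x) c \<notin> Units (stk Y (pmap f x))"
    using x(2) b(1) unfolding rat_points_def by blast
  interpret cring "stk Y (pmap f x)" by (rule R(2))
  have "smap f x (b \<ominus>\<^bsub>stk Y (pmap f x)\<^esub> scal Y (pmap f x) c) = a \<ominus>\<^bsub>stk X x\<^esub> scal X x c"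
    unfolding ring_hom_minus[OF R(2,1) h b(1) sc] kmorD(4)[OF m x(1)] b(2) ..
  hence "a \<ominus>\<^bsub>stk X x\<^esub> scal X x c \<notin> Units (stk X x)"
    using c kmorD(3)[OF m x(1) minus_closed[OF b(1) sc]] by metis
  thus "\<exists>c. a \<ominus>\<^bsub>stk X x\<^esub> scal X x c \<notin> Units (stk X x)" by blast
qed

lemma open_sub_simps: "stk (open_sub X U) = stk X" "scal (open_sub X U) = scal X" "sec (open_sub X U) = sec X"
  "tp (open_sub X U) = subtopology (tp X) U"
  by (simp_all add: open_sub_def)

lemma pts_open_sub: "openin (tp X) U \<Longrightarrow> pts (open_sub X U) = U"
  using openin_subset by (fastforce simp: open_sub_simps)

lemma rat_points_open_sub: "openin (tp X) U \<Longrightarrow> rat_points (open_sub X U) = rat_points X \<inter> U"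
  using openin_subset[of "tp X" U] by (auto simp: rat_points_def pts_open_sub open_sub_simps(1,2))

lemma (in affine) aff_stalk:
  assumes "P \<in> pts (aff n I)"
  shows "cring (stk (aff n I) P)" "scal (aff n I) P c \<in> carrier (stk (aff n I) P)"
  using locally_ringedD(1)[OF locally_ringed_aff assms]
    ring_hom_closed[OF locally_ringedD(3)[OF locally_ringed_aff assms], of c] by (auto simp: ring_on_def)

lemma in_vars_det:
  assumes "\<And>i j. i < k \<Longrightarrow> j < k \<Longrightarrow> in_vars n (f i j)"
  shows "in_vars n (Determinant.det (mat k k (\<lambda>(i, j). f i j)))"
proof -
  have "in_vars n (signof p :: 'a mp)" for p
    by (cases p rule: sign_cases) (auto simp: sign_def in_vars_uminus)
  thus ?thesis
    unfolding Determinant.det_def using assms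
    by (auto intro!: in_vars_sum in_vars_mult in_vars_prod simp: permutes_def)
qed

lemma mp_eval_det: "mp_eval a (Determinant.det (mat k k (\<lambda>(i, j). f i j))) = Determinant.det (mat k k (\<lambda>(i, j). mp_eval a (f i j)))"
proof -
  have "comm_ring_hom (mp_eval a)" by unfold_locales (simp_all add: mp_eval_simps)
  from comm_ring_hom.hom_det[OF this, of "mat k k (\<lambda>(i, j). f i j)"]
  have "mp_eval a (Determinant.det (mat k k (\<lambda>(i, j). f i j))) = Determinant.det (map_mat (mp_eval a) (mat k k (\<lambda>(i, j). f i j)))"
    by simp
  also have "map_mat (mp_eval a) (mat k k (\<lambda>(i, j). f i j)) = mat k k (\<lambda>(i, j). mp_eval a (f i j))"
    by (rule eq_matI) auto
  finally show ?thesis .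
qed

text \<open>The union in \<open>proj\<close> runs over the representatives of one coset, which all
  have the same class modulo the larger ideal.\<close>

lemma proj_cls:
  assumes I: "ideal I (poly_ring m)" and J: "ideal J (poly_ring n)" and IJ: "I \<subseteq> J" "m \<le> n" and g: "in_vars m g"
  shows "(\<Union>f\<in>cls m I g. cls n J f) = cls n J g"
proof -
  interpret I: affine m I by (rule affine.intro[OF I])
  interpret J: affine n J by (rule affine.intro[OF J])
  have "cls n J f = cls n J g" if f: "f \<in> cls m I g" for f
  proof -
    obtain i where i: "i \<in> I" "f = i + g" using f unfolding a_r_coset_def' by (auto simp: poly_ring_simps)
    have "in_vars m f" unfolding i(2) using poly_ring_idealD(1)[OF I i(1)] g by (rule in_vars_add)
    thus ?thesis using i IJ g in_vars_mono[OF _ IJ(2)] by (subst J.cls_eq_iff) auto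
  qed
  moreover have "g \<in> cls m I g" using I.I.a_rcos_self[of g] g by (simp add: poly_ring_simps)
  ultimately show ?thesis by blast
qed

lemma affine_pointI: "ideal I (poly_ring n) \<Longrightarrow> a \<in> zeros n I \<Longrightarrow> affine_point n I a"
  by (intro affine_point.intro affine.intro affine_point_axioms.intro)

lemma mp_eval_cong: "in_vars n p \<Longrightarrow> (\<And>i. i < n \<Longrightarrow> a i = b i) \<Longrightarrow> mp_eval a p = mp_eval b p"
  unfolding mp_eval_eq_ev by (rule ev_cong)

lemma kpoint_coordinate:
  assumes I: "ideal I (poly_ring n)" and a: "a \<in> zeros n I" and i: "i < n"
    and mem: "cls n I (mvar i - const c) \<in> kpoint n I a"
  shows "a ! i = c"
proof -
  interpret affine_point n I a by (rule affine_pointI[OF I a])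
  have "in_vars n (mvar i - const c)" using i by (intro in_vars_diff) auto
  from kpoint_iff[OF this] mem show ?thesis by (simp add: mp_eval_simps)
qed

text \<open>Translates an etale image into equations over \<open>K\<close>. Near \<open>a\<close>
  the base coordinates of the smooth chart are the fractions \<open>p j / q j\<close>, and a point
  \<open>b\<close> lies in the image as soon as some \<open>T\<close> solves \<open>fs\<close> over
  it. The open conditions \<open>g\<close> and \<open>h\<close> keep \<open>b\<close> in the chart
  of the target and the solution in the image of the open immersion \<open>\<beta>\<close>.\<close>

theorem etale_neighbourhood:
  fixes I0 :: "'k::field mp set"
  assumes I0: "ideal I0 (poly_ring N)" and S: "etale_image (aff N I0) S"
    and a: "a \<in> zeros N I0" "kpoint N I0 a \<in> S"
  obtains m and fs :: "'k mp list" and p q g h \<sigma> T0 where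
    "in_vars N g" "mp_eval (\<lambda>i. a ! i) g \<noteq> 0"
    "\<And>j. j < m \<Longrightarrow> in_vars N (p j)" "\<And>j. j < m \<Longrightarrow> in_vars N (q j)" "\<And>j. j < m \<Longrightarrow> mp_eval (\<lambda>i. a ! i) (q j) \<noteq> 0"
    "\<And>i. i < length fs \<Longrightarrow> in_vars (m + length fs) (fs ! i)" "in_vars (m + length fs) h"
    "\<sigma> ` {..<length fs} \<subseteq> {m..<m + length fs}"
    "\<And>i. i < length fs \<Longrightarrow> mp_eval (\<lambda>v. if v < m then mp_eval (\<lambda>i. a ! i) (p v) / mp_eval (\<lambda>i. a ! i) (q v) else T0 v) (fs ! i) = 0"
    "Determinant.det (mat (length fs) (length fs) (\<lambda>(i, j). mp_eval (\<lambda>v. if v < m then mp_eval (\<lambda>i. a ! i) (p v) / mp_eval (\<lambda>i. a ! i) (q v) else T0 v)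
       (pdiff (\<sigma> j) (fs ! i)))) \<noteq> 0"
    "mp_eval (\<lambda>v. if v < m then mp_eval (\<lambda>i. a ! i) (p v) / mp_eval (\<lambda>i. a ! i) (q v) else T0 v) h \<noteq> 0"
    "\<And>b T. b \<in> zeros N I0 \<Longrightarrow> mp_eval (\<lambda>i. b ! i) g \<noteq> 0 \<Longrightarrow>
       (\<And>i. i < length fs \<Longrightarrow> mp_eval (\<lambda>v. if v < m then mp_eval (\<lambda>i. b ! i) (p v) / mp_eval (\<lambda>i. b ! i) (q v) else T v) (fs ! i) = 0) \<Longrightarrow>
       mp_eval (\<lambda>v. if v < m then mp_eval (\<lambda>i. b ! i) (p v) / mp_eval (\<lambda>i. b ! i) (q v) else T v) h \<noteq> 0 \<Longrightarrow>
       kpoint N I0 b \<in> S"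
proof -
  interpret Y: affine N I0 by (rule affine.intro[OF I0])
  let ?Y = "aff N I0"
  obtain X \<phi> where X: "variety X" and et: "etale X ?Y \<phi>" and S_eq: "S = pmap \<phi> ` rat_points X"
    using S unfolding etale_image_def by blast
  have XL: "locally_ringed X" using X by (simp add: variety_def finite_type_def)
  obtain x where x: "x \<in> rat_points X" "pmap \<phi> x = kpoint N I0 a" using a(2) unfolding S_eq by force
  have xX: "x \<in> pts X" using x(1) by (simp add: rat_points_def)
  have \<phi>: "kmor X ?Y \<phi>" and "smooth_at 0 X ?Y \<phi> x" using et xX by (auto simp: etale_def)
  then obtain U W m n I fs J \<sigma> \<alpha> \<beta> where
    U: "openin (tp X) U" "x \<in> U" and W: "openin (tp ?Y) W" "pmap \<phi> ` U \<subseteq> W" and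
    I: "ideal I (poly_ring m)" and fs: "set fs \<subseteq> carrier (poly_ring (m + n))" and n': "n = length fs + 0" and
    J_def: "J = genideal (poly_ring (m + n)) (I \<union> set fs)" and
    \<alpha>: "kiso (open_sub ?Y W) (aff m I) \<alpha>" and
    \<beta>: "open_immersion (open_sub X U) (aff (m + n) J) \<beta>" and
    comm: "kmap_eq (open_sub X U) (aff m I) (kcomp \<alpha> \<phi>) (kcomp (proj m I (m + n) J) \<beta>)" and
    \<sigma>: "\<sigma> ` {..<length fs} \<subseteq> {m..<m + n}" and
    det: "cls (m + n) J (Determinant.det (mat (length fs) (length fs) (\<lambda>(i, j). pdiff (\<sigma> j) (fs ! i)))) \<notin> pmap \<beta> x"
    unfolding smooth_at_def by (elim exE conjE)
  have n: "n = length fs" using n' by simp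
  interpret I: affine m I by (rule affine.intro[OF I])
  have fsv: "in_vars (m + n) (fs ! i)" if "i < n" for i using subsetD[OF fs nth_mem[of i fs]] that by (simp add: poly_ring_simps n)
  have IV: "in_vars (m + n) f" if "f \<in> I" for f using in_vars_mono[OF poly_ring_idealD(1)[OF I that]] by simp
  have sub: "I \<union> set fs \<subseteq> carrier (poly_ring (m + n))" using fs IV by (auto simp: poly_ring_simps)
  have J: "ideal J (poly_ring (m + n))" "I \<union> set fs \<subseteq> J"
    unfolding J_def using pr.genideal_ideal[OF sub] pr.genideal_self[OF sub] .
  have J_min: "J \<subseteq> L" if "ideal L (poly_ring (m + n))" "I \<union> set fs \<subseteq> L" for L
    unfolding J_def by (rule pr.genideal_minimal[OF that])
  interpret J: affine "m + n" J by (rule affine.intro[OF J(1)])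
  have ptsW: "pts (open_sub ?Y W) = W" and ptsU: "pts (open_sub X U) = U"
    using pts_open_sub W(1) U(1) by blast+
  have \<alpha>m: "kmor (open_sub ?Y W) (aff m I) \<alpha>" and \<beta>m: "kmor (open_sub X U) (aff (m + n) J) \<beta>"
    using \<alpha> \<beta> by (auto simp: kiso_def open_immersion_def)
  have \<alpha>inj: "inj_on (pmap \<alpha>) W"
    using \<alpha> ptsW by (auto simp: kiso_def open_immersion_def dest!: homeomorphic_imp_injective_map)
  have \<beta>open: "openin (tp (aff (m + n) J)) (pmap \<beta> ` U)" using \<beta> ptsU by (simp add: open_immersion_def)
  have comm': "pmap \<alpha> (pmap \<phi> z) = {c \<in> carrier (quot m I). (\<Union>f\<in>c. cls (m + n) J f) \<in> pmap \<beta> z}" if "z \<in> U" for z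
    using comm that ptsU by (simp add: kmap_eq_def kcomp_def proj_def Spec_map_def)
  have W_sub: "W \<subseteq> pts ?Y" by (rule openin_subset[OF W(1)])

  \<comment> \<open>The pullback under \<open>\<alpha>\<close> of the coordinate \<open>x_j\<close>
    is a section of the structure sheaf, hence a single fraction \<open>p / q\<close> on a
    neighbourhood \<open>V\<close> of the point \<open>a\<close>.\<close>
  define R where "R j p q V \<longleftrightarrow> in_vars N p \<and> in_vars N q \<and> openin (zariski (quot N I0)) V \<and> kpoint N I0 a \<in> V \<and> V \<subseteq> W \<and>
      (\<forall>Q\<in>V. cls N I0 q \<notin> Q \<and> smap \<alpha> Q (frac (quot m I) (pmap \<alpha> Q) (cls m I (mvar j)) \<one>\<^bsub>quot m I\<^esub>)
         = frac (quot N I0) Q (cls N I0 p) (cls N I0 q))" for j p q V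
  have "\<exists>p q V. R j p q V" if j: "j < m" for j
  proof -
    let ?t = "\<lambda>Q\<in>pts (aff m I). frac (quot m I) Q (cls m I (mvar j)) \<one>\<^bsub>quot m I\<^esub>"
    have t: "?t \<in> sec (aff m I) (pts (aff m I))"
      unfolding aff_def by (rule global_section_Spec[OF I.quot_cring I.cls_in[OF in_vars_mvar[OF j]]])
    have e: "{x \<in> pts (open_sub ?Y W). pmap \<alpha> x \<in> pts (aff m I)} = W"
      using kmorD(6)[OF \<alpha>m] ptsW by blast
    let ?r = "\<lambda>x\<in>W. smap \<alpha> x (?t (pmap \<alpha> x))"
    have "?r \<in> sec ?Y W" using kmorD(5)[OF \<alpha>m openin_topspace t] unfolding e open_sub_simps(3) .
    moreover have "kpoint N I0 a \<in> W" using W(2) U(2) x(2) by auto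
    ultimately have "\<exists>V b f. openin (zariski (quot N I0)) V \<and> kpoint N I0 a \<in> V \<and> V \<subseteq> W \<and> b \<in> carrier (quot N I0) \<and>
        f \<in> carrier (quot N I0) \<and> (\<forall>Q\<in>V. f \<notin> Q \<and> ?r Q = frac (quot N I0) Q b f)"
      unfolding aff_def[of N] mem_sec_Spec by (elim conjE) (drule bspec, assumption, assumption)
    then obtain V b f where V: "openin (zariski (quot N I0)) V" "kpoint N I0 a \<in> V" "V \<subseteq> W"
      "b \<in> carrier (quot N I0)" "f \<in> carrier (quot N I0)" "\<forall>Q\<in>V. f \<notin> Q \<and> ?r Q = frac (quot N I0) Q b f"
      by (elim exE conjE)
    obtain p q where pq: "in_vars N p" "b = cls N I0 p" "in_vars N q" "f = cls N I0 q"
      using V(4,5) by (auto simp: Y.quot_carrier)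
    have r: "?r Q = smap \<alpha> Q (frac (quot m I) (pmap \<alpha> Q) (cls m I (mvar j)) \<one>\<^bsub>quot m I\<^esub>)" if "Q \<in> V" for Q
    proof -
      have QW: "Q \<in> W" using that V(3) by blast
      have "pmap \<alpha> Q \<in> pts (aff m I)" using kmorD(6)[OF \<alpha>m] ptsW QW by blast
      thus ?thesis using QW by simp
    qed
    show ?thesis unfolding R_def
    proof (intro exI conjI ballI)
      show "in_vars N p" "in_vars N q" "openin (zariski (quot N I0)) V" "kpoint N I0 a \<in> V" "V \<subseteq> W" using pq V by auto
      fix Q assume "Q \<in> V"
      from bspec[OF V(6) this] r[OF this] show "cls N I0 q \<notin> Q"
        "smap \<alpha> Q (frac (quot m I) (pmap \<alpha> Q) (cls m I (mvar j)) \<one>\<^bsub>quot m I\<^esub>)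
         = frac (quot N I0) Q (cls N I0 p) (cls N I0 q)" by (simp_all add: pq)
    qed
  qed
  then obtain p q V where pqV0: "\<And>j. j < m \<Longrightarrow> R j (p j) (q j) (V j)" by metis
  have pqV: "\<And>j. j < m \<Longrightarrow> in_vars N (p j)" "\<And>j. j < m \<Longrightarrow> in_vars N (q j)"
    "\<And>j. j < m \<Longrightarrow> openin (zariski (quot N I0)) (V j)" "\<And>j. j < m \<Longrightarrow> kpoint N I0 a \<in> V j" "\<And>j. j < m \<Longrightarrow> V j \<subseteq> W"
    "\<And>j Q. j < m \<Longrightarrow> Q \<in> V j \<Longrightarrow> cls N I0 (q j) \<notin> Q"
    "\<And>j Q. j < m \<Longrightarrow> Q \<in> V j \<Longrightarrow> smap \<alpha> Q (frac (quot m I) (pmap \<alpha> Q) (cls m I (mvar j)) \<one>\<^bsub>quot m I\<^esub>)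
         = frac (quot N I0) Q (cls N I0 (p j)) (cls N I0 (q j))" using pqV0 unfolding R_def by blast+

  define V' where "V' = W \<inter> (\<Inter>j\<in>{..<m}. V j)"
  have "openin (zariski (quot N I0)) V'"
  proof (cases "m = 0")
    case False
    have "openin (zariski (quot N I0)) (\<Inter>j\<in>{..<m}. V j)" by (rule openin_INT2) (use pqV(3) False in auto)
    thus ?thesis using W(1) unfolding V'_def by (intro openin_Int) (simp_all add: Y.aff_simps)
  qed (use W(1) in \<open>simp add: V'_def Y.aff_simps\<close>)
  moreover have "kpoint N I0 a \<in> V'" using pqV(4) W(2) U(2) x(2) by (auto simp: V'_def)
  \<comment> \<open>A basic open set inside \<open>W\<close> and all the neighbourhoods
    \<open>V j\<close>; a representative of \<open>g0\<close> becomes \<open>g\<close>.\<close>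
  ultimately obtain g0 where g0: "g0 \<in> carrier (quot N I0)" "g0 \<notin> kpoint N I0 a"
    "\<And>Q. primeideal Q (quot N I0) \<Longrightarrow> g0 \<notin> Q \<Longrightarrow> Q \<in> V'"
    using cring.zariski_basis[OF Y.quot_cring] by metis
  obtain g where g: "in_vars N g" "g0 = cls N I0 g" using g0(1) by (auto simp: Y.quot_carrier)

  text \<open>On the neighbourhood of \<open>a\<close> where \<open>g\<close> does not vanish, the coordinates of \<open>\<alpha>\<close> are the
    fractions \<open>p j / q j\<close>.\<close>

  have coord: "\<exists>y\<in>zeros m I. kpoint N I0 b \<in> W \<and> pmap \<alpha> (kpoint N I0 b) = kpoint m I y
      \<and> (\<forall>j<m. mp_eval (\<lambda>i. b ! i) (q j) \<noteq> 0 \<and> y ! j = mp_eval (\<lambda>i. b ! i) (p j) / mp_eval (\<lambda>i. b ! i) (q j))"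
    if b: "b \<in> zeros N I0" "mp_eval (\<lambda>i. b ! i) g \<noteq> 0" for b
  proof -
    interpret b: affine_point N I0 b by (rule affine_pointI[OF I0 b(1)])
    let ?w = "kpoint N I0 b"
    interpret w: primeideal ?w "quot N I0" by (rule b.kpoint_prime)
    have "g0 \<notin> ?w" unfolding g(2) b.kpoint_iff[OF g(1)] by (rule b(2))
    hence wV: "?w \<in> V'" using g0(3) b.kpoint_prime by blast
    hence wW: "?w \<in> W" and wVj: "\<And>j. j < m \<Longrightarrow> ?w \<in> V j" by (auto simp: V'_def)
    have w_sub: "?w \<in> pts (open_sub ?Y W)" using wW ptsW by simp
    have "?w \<in> rat_points (open_sub ?Y W)" using rat_points_open_sub[OF W(1)] b.kpoint_rational wW by blast
    moreover have \<alpha>w: "pmap \<alpha> ?w \<in> pts (aff m I)" by (rule kmorD(6)[OF \<alpha>m w_sub])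
    ultimately have "pmap \<alpha> ?w \<in> rat_points (aff m I)"
      using kmor_rational[OF \<alpha>m] I.aff_stalk[OF \<alpha>w] Y.aff_stalk(1)[OF b.kpoint_pts] by (simp add: open_sub_simps)
    then obtain y where y: "y \<in> zeros m I" "pmap \<alpha> ?w = kpoint m I y" by (rule I.rational_point_cases)
    interpret y: affine_point m I y by (rule affine_pointI[OF I y(1)])
    interpret yP: primeideal "kpoint m I y" "quot m I" by (rule y.kpoint_prime)
    \<comment> \<open>The residue of \<open>x_j\<close> at the image point is \<open>y ! j\<close>,
      and that of its pullback is the value of \<open>p j / q j\<close> at \<open>b\<close>; a local
      homomorphism of \<open>K\<close>-algebras preserves residues.\<close>
    have "mp_eval (\<lambda>i. b ! i) (q j) \<noteq> 0 \<and> y ! j = mp_eval (\<lambda>i. b ! i) (p j) / mp_eval (\<lambda>i. b ! i) (q j)" if j: "j < m" for j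
    proof -
      have qw: "cls N I0 (q j) \<in> carrier (quot N I0) - ?w"
        using pqV(6)[OF j wVj[OF j]] Y.cls_in[OF pqV(2)[OF j]] by blast
      hence q0: "mp_eval (\<lambda>i. b ! i) (q j) \<noteq> 0" using b.kpoint_iff[OF pqV(2)[OF j]] by blast
      let ?c = "y ! j"
      have k: "in_vars m (mvar j * 1 - const ?c * 1 :: 'k mp)" using j by (intro in_vars_diff in_vars_mult) auto
      note mj = I.cls_in[OF in_vars_mvar[OF j]] and cc = I.cls_in[OF in_vars_const[of m ?c]]
      let ?f = "frac (quot m I) (kpoint m I y) (cls m I (mvar j)) \<one>\<^bsub>quot m I\<^esub>"
      let ?s = "scal (aff m I) (kpoint m I y) ?c"
      have s: "?s = frac (quot m I) (kpoint m I y) (cls m I (const ?c)) \<one>\<^bsub>quot m I\<^esub>" by (simp add: I.aff_simps)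
      have "?f \<ominus>\<^bsub>loc (quot m I) (kpoint m I y)\<^esub> ?s
          = frac (quot m I) (kpoint m I y) (cls m I (mvar j * 1 - const ?c * 1)) (\<one>\<^bsub>quot m I\<^esub> \<otimes>\<^bsub>quot m I\<^esub> \<one>\<^bsub>quot m I\<^esub>)"
        unfolding s yP.loc_minus[OF mj yP.one_in_compl cc yP.one_in_compl] using j by (simp add: I.cls_one I.cls_mult I.cls_minus)
      moreover have "cls m I (mvar j * 1 - const ?c * 1) \<in> kpoint m I y"
        unfolding y.kpoint_iff[OF k] by (simp add: mp_eval_simps)
      ultimately have nu: "?f \<ominus>\<^bsub>loc (quot m I) (kpoint m I y)\<^esub> ?s \<notin> Units (loc (quot m I) (kpoint m I y))"
        using yP.loc_Units_iff[OF I.cls_in[OF k] yP.prime_compl_mult[OF yP.one_in_compl yP.one_in_compl]] by simp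
      have fc: "?f \<in> carrier (loc (quot m I) (kpoint m I y))" "?s \<in> carrier (loc (quot m I) (kpoint m I y))"
        unfolding s using yP.frac_in_loc[OF mj yP.one_in_compl] yP.frac_in_loc[OF cc yP.one_in_compl] .
      interpret Ly: cring "loc (quot m I) (kpoint m I y)" by (rule yP.loc_cring)
      have h: "smap \<alpha> ?w \<in> Ring.ring_hom (loc (quot m I) (kpoint m I y)) (loc (quot N I0) ?w)"
        using kmorD(2)[OF \<alpha>m w_sub] unfolding y(2) open_sub_simps I.aff_simps Y.aff_simps .
      have "smap \<alpha> ?w (?f \<ominus>\<^bsub>loc (quot m I) (kpoint m I y)\<^esub> ?s) \<notin> Units (loc (quot N I0) ?w)"
        using kmorD(3)[OF \<alpha>m w_sub, unfolded y(2) open_sub_simps I.aff_simps Y.aff_simps, OF Ly.minus_closed[OF fc]] nu by blast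
      also have "smap \<alpha> ?w (?f \<ominus>\<^bsub>loc (quot m I) (kpoint m I y)\<^esub> ?s)
          = smap \<alpha> ?w ?f \<ominus>\<^bsub>loc (quot N I0) ?w\<^esub> smap \<alpha> ?w ?s"
        by (rule ring_hom_minus[OF yP.loc_cring w.loc_cring h fc])
      also have "smap \<alpha> ?w ?f = frac (quot N I0) ?w (cls N I0 (p j)) (cls N I0 (q j))"
        using pqV(7)[OF j wVj[OF j]] unfolding y(2) .
      also have "smap \<alpha> ?w ?s = frac (quot N I0) ?w (cls N I0 (const ?c)) \<one>\<^bsub>quot N I0\<^esub>"
        using kmorD(4)[OF \<alpha>m w_sub, of ?c] unfolding y(2) open_sub_simps Y.aff_simps .
      finally have nu2: "frac (quot N I0) ?w (cls N I0 (p j)) (cls N I0 (q j)) \<ominus>\<^bsub>loc (quot N I0) ?w\<^esub>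
          frac (quot N I0) ?w (cls N I0 (const ?c)) \<one>\<^bsub>quot N I0\<^esub> \<notin> Units (loc (quot N I0) ?w)" .
      have k2: "in_vars N (p j * 1 - const ?c * q j)" using pqV(1,2)[OF j] by (intro in_vars_diff in_vars_mult) auto
      have "frac (quot N I0) ?w (cls N I0 (p j)) (cls N I0 (q j)) \<ominus>\<^bsub>loc (quot N I0) ?w\<^esub>
          frac (quot N I0) ?w (cls N I0 (const ?c)) \<one>\<^bsub>quot N I0\<^esub>
        = frac (quot N I0) ?w (cls N I0 (p j * 1 - const ?c * q j)) (cls N I0 (q j) \<otimes>\<^bsub>quot N I0\<^esub> \<one>\<^bsub>quot N I0\<^esub>)"
        unfolding w.loc_minus[OF Y.cls_in[OF pqV(1)[OF j]] qw Y.cls_in[OF in_vars_const] w.one_in_compl]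
        using pqV(1,2)[OF j] by (simp add: Y.cls_one Y.cls_mult Y.cls_minus in_vars_mult)
      hence "cls N I0 (p j * 1 - const ?c * q j) \<in> ?w"
        using nu2 w.loc_Units_iff[OF Y.cls_in[OF k2] w.prime_compl_mult[OF qw w.one_in_compl]] by metis
      hence "mp_eval (\<lambda>i. b ! i) (p j) = ?c * mp_eval (\<lambda>i. b ! i) (q j)"
        unfolding b.kpoint_iff[OF k2] by (simp add: mp_eval_simps)
      thus ?thesis using q0 by (simp add: field_simps)
    qed
    with y wW show ?thesis by blast
  qed
  have ga: "mp_eval (\<lambda>i. a ! i) g \<noteq> 0"
    using g0(2) affine_point.kpoint_iff[OF affine_pointI[OF I0 a(1)] g(1)] g(2) by simp
  from coord[OF a(1) ga] obtain y where y: "y \<in> zeros m I" "pmap \<alpha> (kpoint N I0 a) = kpoint m I y"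
    "\<And>j. j < m \<Longrightarrow> mp_eval (\<lambda>i. a ! i) (q j) \<noteq> 0"
    "\<And>j. j < m \<Longrightarrow> y ! j = mp_eval (\<lambda>i. a ! i) (p j) / mp_eval (\<lambda>i. a ! i) (q j)" by blast
  have xU: "x \<in> pts (open_sub X U)" using U(2) ptsU by simp
  have \<beta>x: "pmap \<beta> x \<in> pts (aff (m + n) J)" by (rule kmorD(6)[OF \<beta>m xU])
  have "x \<in> rat_points (open_sub X U)" using rat_points_open_sub[OF U(1)] x(1) U(2) by blast
  hence "pmap \<beta> x \<in> rat_points (aff (m + n) J)"
    using kmor_rational[OF \<beta>m] J.aff_stalk[OF \<beta>x] locally_ringedD(1)[OF XL xX] by (simp add: open_sub_simps)
  then obtain z where z: "z \<in> zeros (m + n) J" "pmap \<beta> x = kpoint (m + n) J z" by (rule J.rational_point_cases)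
  interpret z: affine_point "m + n" J z by (rule affine_pointI[OF J(1) z(1)])
  have IJ: "I \<subseteq> J" using J(2) by blast
  \<comment> \<open>The square of \<open>\<alpha>\<close>, \<open>\<phi>\<close>,
    \<open>\<beta>\<close> and \<open>proj\<close> commutes, so the base coordinates of the chart
    point \<open>z\<close> are those of the point below it.\<close>
  have zy: "z ! j = y ! j" if j: "j < m" for j
  proof (rule kpoint_coordinate[OF J(1) z(1)])
    show "j < m + n" using j by simp
    have k: "in_vars m (mvar j - const (y ! j) :: 'k mp)" using j by (intro in_vars_diff) auto
    have "cls m I (mvar j - const (y ! j)) \<in> kpoint m I y"
      unfolding affine_point.kpoint_iff[OF affine_pointI[OF I y(1)] k] by (simp add: mp_eval_simps)
    also have "kpoint m I y = {c \<in> carrier (quot m I). (\<Union>f\<in>c. cls (m + n) J f) \<in> pmap \<beta> x}"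
      using comm'[OF U(2)] x(2) y(2) by simp
    finally have "(\<Union>f\<in>cls m I (mvar j - const (y ! j)). cls (m + n) J f) \<in> pmap \<beta> x" by simp
    thus "cls (m + n) J (mvar j - const (y ! j)) \<in> kpoint (m + n) J z"
      unfolding proj_cls[OF I J(1) IJ le_add1 k] z(2) .
  qed
  define y0 where "y0 v = (if v < m then mp_eval (\<lambda>i. a ! i) (p v) / mp_eval (\<lambda>i. a ! i) (q v) else z ! v)" for v
  have y0: "y0 = (\<lambda>v. z ! v)" using zy y(4) by (auto simp: y0_def)
  have pd: "in_vars (m + n) (pdiff (\<sigma> j) (fs ! i))" if "i < n" for i j
    by (rule in_vars_pdiff[OF fsv[OF that]])
  have "in_vars (m + n) (Determinant.det (mat n n (\<lambda>(i, j). pdiff (\<sigma> j) (fs ! i))))"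
    by (rule in_vars_det) (rule pd)
  hence det0: "Determinant.det (mat n n (\<lambda>(i, j). mp_eval y0 (pdiff (\<sigma> j) (fs ! i)))) \<noteq> 0"
    using det z.kpoint_iff unfolding z(2) n[symmetric] y0 mp_eval_det[symmetric] by blast
  have "pmap \<beta> x \<in> pmap \<beta> ` U" using U(2) by blast
  \<comment> \<open>The image of \<open>\<beta>\<close> is open and so contains a basic open
    neighbourhood of the image of \<open>x\<close>; its equation \<open>h\<close> will allow
    solutions to be lifted to points of \<open>X\<close>.\<close>
  then obtain h0 where h0: "h0 \<in> carrier (quot (m + n) J)" "h0 \<notin> pmap \<beta> x"
    "\<And>Q. primeideal Q (quot (m + n) J) \<Longrightarrow> h0 \<notin> Q \<Longrightarrow> Q \<in> pmap \<beta> ` U"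
    using cring.zariski_basis[OF J.quot_cring \<beta>open[unfolded J.aff_simps]] by metis
  obtain h where h: "in_vars (m + n) h" "h0 = cls (m + n) J h" using h0(1) by (auto simp: J.quot_carrier)
  have hy0: "mp_eval y0 h \<noteq> 0" using h0(2) z.kpoint_iff[OF h(1)] unfolding h(2) z(2) y0 by blast

  have main: "kpoint N I0 b \<in> S"
    if b: "b \<in> zeros N I0" "mp_eval (\<lambda>i. b ! i) g \<noteq> 0"
      and y'0: "\<And>i. i < n \<Longrightarrow> mp_eval (\<lambda>v. if v < m then mp_eval (\<lambda>i. b ! i) (p v) / mp_eval (\<lambda>i. b ! i) (q v) else T v) (fs ! i) = 0"
      and hy': "mp_eval (\<lambda>v. if v < m then mp_eval (\<lambda>i. b ! i) (p v) / mp_eval (\<lambda>i. b ! i) (q v) else T v) h \<noteq> 0"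
    for b T
  proof -
    let ?y = "\<lambda>v. if v < m then mp_eval (\<lambda>i. b ! i) (p v) / mp_eval (\<lambda>i. b ! i) (q v) else T v"
    from coord[OF b] obtain y where y: "y \<in> zeros m I" "kpoint N I0 b \<in> W"
      "pmap \<alpha> (kpoint N I0 b) = kpoint m I y" "\<And>j. j < m \<Longrightarrow> y ! j = ?y j" by auto
    define l where "l = map ?y [0..<m + n]"
    have l: "length l = m + n" "\<And>v. v < m + n \<Longrightarrow> l ! v = ?y v" by (auto simp: l_def)
    have evl: "mp_eval (\<lambda>i. l ! i) f = mp_eval ?y f" if "in_vars (m + n) f" for f
      by (rule mp_eval_cong[OF that]) (use l(2) in simp)
    have evy: "mp_eval (\<lambda>i. l ! i) f = mp_eval (\<lambda>i. y ! i) f" if "in_vars m f" for f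
      by (rule mp_eval_cong[OF that]) (use l(2) y(4) in simp)
    \<comment> \<open>\<open>J\<close> is generated by \<open>I\<close> and \<open>fs\<close>. The
      polynomials vanishing at \<open>l\<close> contain \<open>fs\<close> by assumption and
      \<open>I\<close> because the base coordinates of \<open>l\<close> are those of the point
      \<open>y\<close>.\<close>
    have "J \<subseteq> {f. in_vars (m + n) f \<and> mp_eval (\<lambda>i. l ! i) f = 0}"
    proof (rule J_min)
      show "ideal {f. in_vars (m + n) f \<and> mp_eval (\<lambda>i. l ! i) f = 0} (poly_ring (m + n))"
        by (rule poly_ring_idealI) (auto simp: mp_eval_simps intro: in_vars_add in_vars_mult)
      show "I \<union> set fs \<subseteq> {f. in_vars (m + n) f \<and> mp_eval (\<lambda>i. l ! i) f = 0}"
      proof (intro Un_least subsetI CollectI conjI)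
        fix f assume f: "f \<in> I"
        show "in_vars (m + n) f" by (rule IV[OF f])
        show "mp_eval (\<lambda>i. l ! i) f = 0"
          using evy[OF poly_ring_idealD(1)[OF I f]] y(1) f by (simp add: zeros_def)
      next
        fix f assume "f \<in> set fs"
        then obtain i where i: "i < n" "f = fs ! i" by (auto simp: in_set_conv_nth n)
        show "in_vars (m + n) f" unfolding i(2) by (rule fsv[OF i(1)])
        show "mp_eval (\<lambda>i. l ! i) f = 0" unfolding i(2) evl[OF fsv[OF i(1)]] by (rule y'0[OF i(1)])
      qed
    qed
    hence lz: "l \<in> zeros (m + n) J" using l(1) by (auto simp: zeros_def)
    interpret l: affine_point "m + n" J l by (rule affine_pointI[OF J(1) lz])
    have "h0 \<notin> kpoint (m + n) J l" unfolding h(2) l.kpoint_iff[OF h(1)] evl[OF h(1)] by (rule hy')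
    hence "kpoint (m + n) J l \<in> pmap \<beta> ` U" using h0(3) l.kpoint_prime by blast
    then obtain x' where x': "x' \<in> U" "pmap \<beta> x' = kpoint (m + n) J l" by auto
    have x'X: "x' \<in> pts X" "x' \<in> pts (open_sub X U)" using x'(1) openin_subset[OF U(1)] ptsU by auto
    have "x' \<in> rat_points (open_sub X U)"
      by (rule open_immersion_rational[OF \<beta> x'X(2)])
         (use x'(2) l.kpoint_rational J.aff_stalk[OF l.kpoint_pts] locally_ringedD(1)[OF XL x'X(1)] in \<open>simp_all add: open_sub_simps\<close>)
    hence x'r: "x' \<in> rat_points X" using rat_points_open_sub[OF U(1)] by blast
    have "pmap \<alpha> (pmap \<phi> x') = kpoint m I y"
      unfolding comm'[OF x'(1)] x'(2)
    proof (intro equalityI subsetI)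
      interpret y: affine_point m I y by (rule affine_pointI[OF I y(1)])
      have iff: "(\<Union>f\<in>cls m I f0. cls (m + n) J f) \<in> kpoint (m + n) J l \<longleftrightarrow> cls m I f0 \<in> kpoint m I y"
        if f0: "in_vars m f0" for f0
        unfolding proj_cls[OF I J(1) IJ le_add1 f0] l.kpoint_iff[OF in_vars_mono[OF f0 le_add1]] evy[OF f0]
          y.kpoint_iff[OF f0] ..
      fix c
      show "c \<in> kpoint m I y" if c: "c \<in> {c \<in> carrier (quot m I). (\<Union>f\<in>c. cls (m + n) J f) \<in> kpoint (m + n) J l}"
      proof -
        obtain f0 where "in_vars m f0" "c = cls m I f0" using c by (auto simp: I.quot_carrier)
        thus ?thesis using c iff by simp
      qed
      show "c \<in> {c \<in> carrier (quot m I). (\<Union>f\<in>c. cls (m + n) J f) \<in> kpoint (m + n) J l}" if c: "c \<in> kpoint m I y"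
      proof -
        obtain f0 where f0: "in_vars m f0" "c = cls m I f0" using c by (rule y.kpointE)
        thus ?thesis using c iff[OF f0(1)] I.cls_in[OF f0(1)] by simp
      qed
    qed
    moreover have "pmap \<phi> x' \<in> W" using W(2) x'(1) by blast
    \<comment> \<open>The two points agree after \<open>\<alpha>\<close>, which is injective on
      \<open>W\<close>.\<close>
    ultimately have "pmap \<phi> x' = kpoint N I0 b" using inj_onD[OF \<alpha>inj] y(2,3) by metis
    thus ?thesis unfolding S_eq using x'r by force
  qed
  show thesis
  proof (rule that[of g m p q fs h \<sigma> "\<lambda>v. z ! v"])
    show "in_vars N g" "mp_eval (\<lambda>i. a ! i) g \<noteq> 0" by (fact g ga)+
    show "in_vars (m + length fs) h" using h(1) by (simp add: n)
    show "\<sigma> ` {..<length fs} \<subseteq> {m..<m + length fs}" using \<sigma> by (simp add: n)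
    fix i assume i: "i < length fs"
    show "in_vars (m + length fs) (fs ! i)" using fsv i by (simp add: n)
    have "fs ! i \<in> J" using J(2) i by auto
    thus "mp_eval (\<lambda>v. if v < m then mp_eval (\<lambda>i. a ! i) (p v) / mp_eval (\<lambda>i. a ! i) (q v) else z ! v) (fs ! i) = 0"
      using z(1) y0 by (simp add: zeros_def y0_def[abs_def])
  next
    fix b T
    assume "b \<in> zeros N I0" "mp_eval (\<lambda>i. b ! i) g \<noteq> 0"
      "\<And>i. i < length fs \<Longrightarrow> mp_eval (\<lambda>v. if v < m then mp_eval (\<lambda>i. b ! i) (p v) / mp_eval (\<lambda>i. b ! i) (q v) else T v) (fs ! i) = 0"
      "mp_eval (\<lambda>v. if v < m then mp_eval (\<lambda>i. b ! i) (p v) / mp_eval (\<lambda>i. b ! i) (q v) else T v) h \<noteq> 0"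
    thus "kpoint N I0 b \<in> S" by (rule main[unfolded n])
  qed (use pqV(1,2) y(3) det0[unfolded y0_def[abs_def]] hy0[unfolded y0_def[abs_def]] in \<open>simp_all add: n\<close>)
qed

subsection \<open>Fibres of etale open sets\<close>

lemma kpoint_inj:
  assumes I: "ideal I (poly_ring n)" and a: "a \<in> zeros n I" and b: "b \<in> zeros n I"
    and e: "kpoint n I a = kpoint n I b"
  shows "a = b"
proof (rule nth_equalityI)
  show "length a = length b" using a b by (simp add: zeros_def)
  fix i assume "i < length a"
  hence i: "i < n" using a by (simp add: zeros_def)
  have k: "in_vars n (mvar i - const (b ! i) :: 'a mp)" using i by (intro in_vars_diff) auto
  have "cls n I (mvar i - const (b ! i)) \<in> kpoint n I a"
    unfolding e affine_point.kpoint_iff[OF affine_pointI[OF I b] k] by (simp add: mp_eval_simps)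
  thus "a ! i = b ! i" by (rule kpoint_coordinate[OF I a i])
qed

interpretation pconst_alg: kalg "\<lambda>c::'k::field. [:c:]"
  by unfold_locales auto

text \<open>Exhibits specialisation at \<open>a\<close> as an evaluation, hence as compatible with
  sums and products.\<close>

lemma spec_poly_eq_ev:
  assumes f: "in_vars (m + 1) f"
  shows "spec_poly m a f = ev (\<lambda>c. [:c:]) (\<lambda>i. if i < m then [:a ! i:] else [:0, 1:]) f"
  unfolding spec_poly_def ev_def
proof (rule sum.cong[OF refl])
  fix \<mu> assume "\<mu> \<in> keys f"
  hence "keys \<mu> \<subseteq> {..<Suc m}" using f by (auto simp: in_vars_def)
  hence "mon_eval (\<lambda>i. if i < m then [:a ! i:] else [:0, 1:]) \<mu>
      = (\<Prod>i<Suc m. (if i < m then [:a ! i:] else [:0, 1:]) ^ lookup \<mu> i)"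
    by (intro mon_eval_superset) auto
  also have "\<dots> = (\<Prod>i<m. [:a ! i:] ^ lookup \<mu> i) * [:0, 1:] ^ lookup \<mu> m" by simp
  also have "(\<Prod>i<m. [:a ! i:] ^ lookup \<mu> i) = [:\<Prod>i<m. (a ! i) ^ lookup \<mu> i:]"
  proof -
    have "(\<Prod>i\<in>A. [:a ! i:] ^ lookup \<mu> i) = [:\<Prod>i\<in>A. (a ! i) ^ lookup \<mu> i:]" if "finite A" for A
      using that by (induction A) (simp_all add: poly_const_pow)
    thus ?thesis by simp
  qed
  finally show "Polynomial.monom (lookup f \<mu> * (\<Prod>i<m. (a ! i) ^ lookup \<mu> i)) (lookup \<mu> m)
      = [:lookup f \<mu>:] * mon_eval (\<lambda>i. if i < m then [:a ! i:] else [:0, 1:]) \<mu>"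
    by (simp add: monom_altdef mult.commute)
qed

lemma spec_poly_simps:
  assumes "in_vars (m + 1) f" "in_vars (m + 1) g"
  shows "spec_poly m a (f + g) = spec_poly m a f + spec_poly m a g"
    "spec_poly m a (f * g) = spec_poly m a f * spec_poly m a g"
  using assms by (simp_all add: spec_poly_eq_ev[OF in_vars_add] spec_poly_eq_ev[OF in_vars_mult]
      spec_poly_eq_ev pconst_alg.ev_add pconst_alg.ev_mult del: One_nat_def add_Suc_right Nat.add_0_right)

lemma spec_poly_0 [simp]: "spec_poly m a 0 = 0"
  by (simp add: spec_poly_def)

lemma spec_poly_1 [simp]: "spec_poly m a 1 = 1"
  by (subst spec_poly_eq_ev) (use in_vars_const[of "m + 1" 1] in \<open>simp_all add: const_1\<close>)

lemma poly_spec_poly: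
  assumes a: "length a = m" and f: "in_vars (m + 1) f"
  shows "poly (spec_poly m a f) b = mp_eval (\<lambda>i. (a @ [b]) ! i) f"
proof -
  have "poly (ev (\<lambda>c. [:c:]) (\<lambda>i. if i < m then [:a ! i:] else [:0, 1:]) f) b
      = mp_eval (\<lambda>i. if i < m then a ! i else b) f"
    using f by (induction rule: mp_induct)
       (auto simp: mp_eval_simps pconst_alg.ev_add pconst_alg.ev_mult)
  moreover have "mp_eval (\<lambda>i. if i < m then a ! i else b) f = mp_eval (\<lambda>i. (a @ [b]) ! i) f"
    by (rule mp_eval_cong[OF f]) (use a in \<open>auto simp: nth_append\<close>)
  ultimately show ?thesis by (simp add: spec_poly_eq_ev[OF f])
qed

text \<open>The hypothesis on \<open>I\<close> puts the whole line over \<open>a\<close> into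
  \<open>V(K)\<close>, so along it only the equations of the etale neighbourhood and finitely many
  exceptions matter.\<close>

theorem etale_open_fibre_infinite:
  fixes I :: "'k::field mp set"
  assumes L: "large TYPE('k)" and I: "ideal I (poly_ring (m + 1))" and S: "etale_open_in (m + 1) I S"
    and a: "length a = m" "\<And>f. f \<in> I \<Longrightarrow> spec_poly m a f = 0" and b: "a @ [b] \<in> S"
  shows "infinite {c. a @ [c] \<in> S}"
proof -
  let ?N = "m + 1"
  have pl: "plane_large TYPE('k)" by (rule large_imp_plane_large[OF L])
  have z: "a @ [c] \<in> zeros ?N I" for c
    using a poly_spec_poly[OF a(1) poly_ring_idealD(1)[OF I], of _ c] by (simp add: zeros_def)
  have SZ: "S \<subseteq> zeros ?N I" and "(arbitrary union_of etale_image (aff ?N I)) (kpoint ?N I ` S)"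
    using S by (auto simp: etale_open_in_def etale_open_def)
  \<comment> \<open>An etale open set is a union of etale images; the one that contains the point
    \<open>a @ [b]\<close> suffices.\<close>
  then obtain \<U> where U: "\<And>U. U \<in> \<U> \<Longrightarrow> etale_image (aff ?N I) U" "\<Union>\<U> = kpoint ?N I ` S"
    unfolding union_of_def by (auto simp: subset_iff)
  obtain S' where S': "S' \<in> \<U>" "kpoint ?N I (a @ [b]) \<in> S'" using U(2) b by (metis UnionE image_eqI)
  have in_S: "a @ [c] \<in> S" if "kpoint ?N I (a @ [c]) \<in> S'" for c
  proof -
    have "kpoint ?N I (a @ [c]) \<in> kpoint ?N I ` S" using that S'(1) U(2) by blast
    then obtain s where s: "s \<in> S" "kpoint ?N I (a @ [c]) = kpoint ?N I s" by blast
    thus ?thesis using kpoint_inj[OF I z subsetD[OF SZ s(1)] s(2)] by simp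
  qed
  obtain k and fs :: "'k mp list" and p q g h \<sigma> T0 where
    g: "in_vars ?N g" "mp_eval (\<lambda>i. (a @ [b]) ! i) g \<noteq> 0" and
    p: "\<And>j. j < k \<Longrightarrow> in_vars ?N (p j)" and q: "\<And>j. j < k \<Longrightarrow> in_vars ?N (q j)" and
    q0: "\<And>j. j < k \<Longrightarrow> mp_eval (\<lambda>i. (a @ [b]) ! i) (q j) \<noteq> 0" and
    fs: "\<And>i. i < length fs \<Longrightarrow> in_vars (k + length fs) (fs ! i)" and h: "in_vars (k + length fs) h" and
    \<sigma>: "\<sigma> ` {..<length fs} \<subseteq> {k..<k + length fs}" and
    f0: "\<And>i. i < length fs \<Longrightarrow> mp_eval (\<lambda>v. if v < k then mp_eval (\<lambda>i. (a @ [b]) ! i) (p v) / mp_eval (\<lambda>i. (a @ [b]) ! i) (q v) else T0 v) (fs ! i) = 0" and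
    det: "Determinant.det (mat (length fs) (length fs) (\<lambda>(i, j). mp_eval (\<lambda>v. if v < k then mp_eval (\<lambda>i. (a @ [b]) ! i) (p v) / mp_eval (\<lambda>i. (a @ [b]) ! i) (q v) else T0 v)
       (pdiff (\<sigma> j) (fs ! i)))) \<noteq> 0" and
    h0: "mp_eval (\<lambda>v. if v < k then mp_eval (\<lambda>i. (a @ [b]) ! i) (p v) / mp_eval (\<lambda>i. (a @ [b]) ! i) (q v) else T0 v) h \<noteq> 0" and
    main: "\<And>b T. b \<in> zeros ?N I \<Longrightarrow> mp_eval (\<lambda>i. b ! i) g \<noteq> 0 \<Longrightarrow>
       (\<And>i. i < length fs \<Longrightarrow> mp_eval (\<lambda>v. if v < k then mp_eval (\<lambda>i. b ! i) (p v) / mp_eval (\<lambda>i. b ! i) (q v) else T v) (fs ! i) = 0) \<Longrightarrow>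
       mp_eval (\<lambda>v. if v < k then mp_eval (\<lambda>i. b ! i) (p v) / mp_eval (\<lambda>i. b ! i) (q v) else T v) h \<noteq> 0 \<Longrightarrow>
       kpoint ?N I b \<in> S'"
    
  proof (rule etale_neighbourhood[OF I U(1)[OF S'(1)] z S'(2)], goal_cases)
    case (1 k fs p q g h \<sigma> T0)
    show thesis by (rule that) (fact 1)+
  qed
  \<comment> \<open>\<open>P f\<close> is \<open>f(a, b + t)\<close> as a polynomial in
    \<open>t\<close>: the line is recentred, since \<open>large_jacobian_system\<close> starts at
    \<open>t = 0\<close>.\<close>
  define P where "P f = pcompose (spec_poly m a f) [:b, 1:]" for f
  have P: "poly (P f) t = mp_eval (\<lambda>i. (a @ [b + t]) ! i) f" if "in_vars ?N f" for f t
    unfolding P_def by (simp add: poly_pcompose poly_spec_poly[OF a(1) that])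
  have y: "(\<lambda>v. if v < k then poly (P (p v)) t / poly (P (q v)) t else T v)
      = (\<lambda>v. if v < k then mp_eval (\<lambda>i. (a @ [b + t]) ! i) (p v) / mp_eval (\<lambda>i. (a @ [b + t]) ! i) (q v) else T v)" for t T
    using P[OF p] P[OF q] by auto
  note y0 = y[of 0, unfolded add_0_right]
  have inf: "infinite {t. (\<forall>j<k. poly (P (q j)) t \<noteq> 0) \<and> (\<exists>T.
    (\<forall>i<length fs. mp_eval (\<lambda>v. if v < k then poly (P (p v)) t / poly (P (q v)) t else T v) (fs ! i) = 0)
    \<and> mp_eval (\<lambda>v. if v < k then poly (P (p v)) t / poly (P (q v)) t else T v) h \<noteq> 0)}" (is "infinite ?A")
  proof (rule large_jacobian_system[OF pl, where ?T0.0 = T0 and \<sigma> = \<sigma>], unfold y0)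
    show "poly (P (q j)) 0 \<noteq> 0" if "j < k" for j using q0[OF that] P[OF q[OF that], of 0] by simp
  qed (fact fs f0 \<sigma> det h h0)+
  have "poly (P g) 0 \<noteq> 0" using g(2) P[OF g(1), of 0] by simp
  hence "P g \<noteq> 0" by auto
  hence "finite {t. poly (P g) t = 0}" by (rule poly_roots_finite)
  hence inf': "infinite (?A - {t. poly (P g) t = 0})" by (rule Diff_infinite_finite[OF _ inf])
  have "(\<lambda>t. b + t) ` (?A - {t. poly (P g) t = 0}) \<subseteq> {c. a @ [c] \<in> S}"
  proof (intro image_subsetI CollectI)
    fix t assume t: "t \<in> ?A - {t. poly (P g) t = 0}"
    then obtain T where T: "\<forall>i<length fs. mp_eval (\<lambda>v. if v < k then poly (P (p v)) t / poly (P (q v)) t else T v) (fs ! i) = 0"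
      "mp_eval (\<lambda>v. if v < k then poly (P (p v)) t / poly (P (q v)) t else T v) h \<noteq> 0" by blast
    have "mp_eval (\<lambda>i. (a @ [b + t]) ! i) g \<noteq> 0" using t P[OF g(1), of t] by simp
    from main[OF z this, where T = T] T show "a @ [b + t] \<in> S" unfolding y by (intro in_S) blast
  qed
  moreover have "inj_on (\<lambda>t. b + t) A" for A :: "'k set" by simp
  ultimately show ?thesis using inf' by (meson finite_imageD finite_subset)
qed

lemma ideal_finitely_generated:
  assumes I: "ideal I (poly_ring n :: 'k::field mp ring)"
  obtains G where "finite G" "G \<subseteq> I" "I \<subseteq> lspan {p. in_vars n p} G"
proof -
  have "ideal_in I {p. in_vars n p}"
    unfolding ideal_in_def using poly_ring_idealD[OF I] by auto
  thus thesis using noeth_in_vars[where 'k = 'k] that unfolding noeth_def by metis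
qed

text \<open>Whether an ideal vanishes identically on the line over \<open>a\<close> can be tested on
  generators.\<close>

lemma spec_poly_lspan_eq_0:
  assumes "\<And>g. g \<in> G \<Longrightarrow> in_vars (m + 1) g \<and> spec_poly m a g = 0"
    and "f \<in> lspan {p. in_vars (m + 1) p} G"
  shows "spec_poly m a f = 0"
proof -
  have "in_vars (m + 1) f \<and> spec_poly m a f = 0" using assms(2)
  proof induction
    case (lspan_step r g y)
    have "in_vars (m + 1) (r * g)" using lspan_step assms(1) by (intro in_vars_mult) auto
    thus ?case using lspan_step assms(1)[of g] by (auto simp only: spec_poly_simps in_vars_add mem_Collect_eq) simp_all
  qed simp
  thus ?thesis by simp
qed

theorem theoremE:
  assumes "ez_field TYPE('k::field)"
  shows "algebraically_bounded TYPE('k)"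
  unfolding algebraically_bounded_def
proof (intro allI impI)
  fix m and S :: "'k list set" assume S: "definable (m + 1) S"
  have L: "large TYPE('k)" and "ez_set (m + 1) S" using assms S by (auto simp: ez_field_def)
  then obtain \<S> where \<S>: "finite \<S>" "S = \<Union>\<S>"
    and "\<And>U. U \<in> \<S> \<Longrightarrow> \<exists>I. ideal I (poly_ring (m + 1)) \<and> etale_open_in (m + 1) I U"
    unfolding ez_set_def radical_ideal_def by metis
  then obtain I where I: "\<And>U. U \<in> \<S> \<Longrightarrow> ideal (I U) (poly_ring (m + 1))"
    "\<And>U. U \<in> \<S> \<Longrightarrow> etale_open_in (m + 1) (I U) U" by metis
  have "\<exists>G. finite G \<and> G \<subseteq> I U \<and> I U \<subseteq> lspan {p. in_vars (m + 1) p} G" if "U \<in> \<S>" for U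
    using ideal_finitely_generated[OF I(1)[OF that]] by metis
  then obtain G where G: "\<And>U. U \<in> \<S> \<Longrightarrow> finite (G U)" "\<And>U. U \<in> \<S> \<Longrightarrow> G U \<subseteq> I U"
    "\<And>U. U \<in> \<S> \<Longrightarrow> I U \<subseteq> lspan {p. in_vars (m + 1) p} (G U)" by metis
  have Gv: "in_vars (m + 1) g" if "U \<in> \<S>" "g \<in> insert 1 (G U)" for U g
    using that poly_ring_idealD(1)[OF I(1)] G(2) in_vars_const[of "m + 1" 1] by (auto simp: const_1)
  \<comment> \<open>Independent of \<open>a\<close>: which choice function is the right one depends
    on the fibre, so all of them contribute a product.\<close>
  define F where "F = (\<lambda>\<phi>. \<Prod>U\<in>\<S>. \<phi> U) ` (\<Pi>\<^sub>E U\<in>\<S>. insert 1 (G U))"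
  have "finite F" unfolding F_def using \<S>(1) G(1) by (intro finite_imageI finite_PiE) auto
  moreover have "F \<subseteq> carrier (poly_ring (m + 1))"
    unfolding F_def by (auto simp: poly_ring_simps PiE_iff intro!: in_vars_prod Gv[unfolded One_nat_def add_Suc_right Nat.add_0_right])
  moreover have "\<exists>f\<in>F. spec_poly m a f \<noteq> 0 \<and> {b. a @ [b] \<in> S} \<subseteq> {b. poly (spec_poly m a f) b = 0}"
    if a: "length a = m" "finite {b. a @ [b] \<in> S}" for a
  proof -
    have "\<exists>g\<in>insert 1 (G U). spec_poly m a g \<noteq> 0 \<and> {b. a @ [b] \<in> U} \<subseteq> {b. poly (spec_poly m a g) b = 0}"
      if U: "U \<in> \<S>" for U
    proof (cases "{b. a @ [b] \<in> U} = {}")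
      case True
      thus ?thesis by auto
    next
      case False
      then obtain b where b: "a @ [b] \<in> U" by blast
      have "finite {b. a @ [b] \<in> U}" by (rule finite_subset[OF _ a(2)]) (use U \<S>(2) in blast)
      \<comment> \<open>A nonempty finite fibre excludes that all of \<open>I U\<close> vanishes on
        the line, so some generator survives the specialisation.\<close>
      hence "\<not> (\<forall>f\<in>I U. spec_poly m a f = 0)"
        using etale_open_fibre_infinite[OF L I(1)[OF U] I(2)[OF U] a(1) _ b] by blast
      then obtain g where g: "g \<in> G U" "spec_poly m a g \<noteq> 0"
        using spec_poly_lspan_eq_0[of "G U" m a] Gv[OF U] G(3)[OF U] by (metis insertCI subsetD)
      have "poly (spec_poly m a g) c = 0" if "a @ [c] \<in> U" for c
      proof -
        have "a @ [c] \<in> zeros (m + 1) (I U)" using I(2)[OF U] that by (auto simp: etale_open_in_def)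
        thus ?thesis unfolding poly_spec_poly[OF a(1) Gv[OF U insertI2[OF g(1)]]]
          using G(2)[OF U] g(1) by (auto simp: zeros_def)
      qed
      thus ?thesis using g by blast
    qed
    then obtain \<phi> where \<phi>: "\<And>U. U \<in> \<S> \<Longrightarrow> \<phi> U \<in> insert 1 (G U) \<and> spec_poly m a (\<phi> U) \<noteq> 0
        \<and> {b. a @ [b] \<in> U} \<subseteq> {b. poly (spec_poly m a (\<phi> U)) b = 0}" by metis
    have prod: "in_vars (m + 1) (\<Prod>U\<in>\<T>. \<phi> U) \<and> spec_poly m a (\<Prod>U\<in>\<T>. \<phi> U) = (\<Prod>U\<in>\<T>. spec_poly m a (\<phi> U))"
      if "finite \<T>" "\<T> \<subseteq> \<S>" for \<T>
      using that
    proof (induction \<T>)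
      case (insert U \<T>)
      have v: "in_vars (m + 1) (\<phi> U)" using \<phi> Gv insert.prems by blast
      have IH: "in_vars (m + 1) (\<Prod>U\<in>\<T>. \<phi> U)" "spec_poly m a (\<Prod>U\<in>\<T>. \<phi> U) = (\<Prod>U\<in>\<T>. spec_poly m a (\<phi> U))"
        using insert by auto
      show ?case unfolding prod.insert[OF insert.hyps] spec_poly_simps(2)[OF v IH(1)] IH(2)
        using in_vars_mult[OF v IH(1)] by blast
    qed (use in_vars_const[of "m + 1" 1] in \<open>simp add: const_1\<close>)
    have e: "spec_poly m a (\<Prod>U\<in>\<S>. \<phi> U) = (\<Prod>U\<in>\<S>. spec_poly m a (\<phi> U))" using prod[OF \<S>(1)] by blast
    have "(\<Prod>U\<in>\<S>. \<phi> U) = (\<Prod>U\<in>\<S>. restrict \<phi> \<S> U)" by (rule prod.cong) auto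
    moreover have "restrict \<phi> \<S> \<in> (\<Pi>\<^sub>E U\<in>\<S>. insert 1 (G U))" using \<phi> by (simp add: restrict_PiE_iff)
    ultimately have "(\<Prod>U\<in>\<S>. \<phi> U) \<in> F" unfolding F_def by (metis imageI)
    moreover have "spec_poly m a (\<Prod>U\<in>\<S>. \<phi> U) \<noteq> 0" unfolding e using \<S>(1) \<phi> by (simp add: prod_zero_iff)
    moreover have "poly (spec_poly m a (\<Prod>U\<in>\<S>. \<phi> U)) b = 0" if b: "a @ [b] \<in> S" for b
    proof -
      obtain U where U: "U \<in> \<S>" "a @ [b] \<in> U" using b \<S>(2) by blast
      hence "poly (spec_poly m a (\<phi> U)) b = 0" using \<phi> by blast
      thus ?thesis unfolding e poly_prod using \<S>(1) U(1) by (meson prod_zero)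
    qed
    ultimately show ?thesis by blast
  qed
  ultimately show "\<exists>F. finite F \<and> F \<subseteq> carrier (poly_ring (m + 1)) \<and>
      (\<forall>a. length a = m \<and> finite {b. a @ [b] \<in> S} \<longrightarrow>
        (\<exists>f\<in>F. spec_poly m a f \<noteq> 0 \<and> {b. a @ [b] \<in> S} \<subseteq> {b. poly (spec_poly m a f) b = 0}))"
    by blast
qed

end
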